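(* Let $\bar\Theta_{1,n-2,n-2}$ denote the density of the axisymmetric De Silva–Jerison cone in $\mathbb R^n$, and let $\Theta_{2,m_1,m_2}$ denote the density of the Type I solution $U_{M_1}$ with isoparametric parameters $(g=2,m_1,m_2)$. Then the following limits exist and satisfy $$\lim_{m_1,m_2\to\infty}\Theta_{2,m_1,m_2}\simeq 0.77785\;<\;0.80876\simeq\lim_{n\to\infty}\bar\Theta_{1,n-2,n-2}.$$
   Context: For a homogeneous degree-one nonnegative function $U$ on $\mathbb R^n$, the density is $\Theta(U)=\mathcal H^{n-1}(\{U>0\}\cap\mathbb S^{n-1})/\mathcal H^{n-1}(\mathbb S^{n-1})$. De Silva–Jerison cone ($n\ge3$): let $F_n(t)={}_2F_1(\frac{n-1}{2},-\frac12;\frac12;t^2)$ and let $t_n\in(0,1)$ be its unique positive zero. The cone is $U(x)=c\,|x|\,F_n(x_n/|x|)$ for $|x_n|<t_n|x|$ and $U=0$ otherwise, with $c>0$ chosen so that $|\nabla U|=1$ on $\partial\{U>0\}\setminus\{0\}$. Type I solution with $g=2$: for integers $m_1,m_2\ge1$ put $n=m_1+m_2+2$ and consider the foliation of $\mathbb S^{n-1}$ by $\mathbb S^{m_1}(\sin s)\times\mathbb S^{m_2}(\cos s)\subset\mathbb R^{m_1+1}\times\mathbb R^{m_2+1}$, $s\in[0,\frac\pi2]$. Let $f_{M_1}(t)={}_2F_1(\frac{n-1}{2},-\frac12;\frac{m_1+1}{2};t^2)$ with unique zero $t_{M_1}\in(0,1)$. Then $U_{M_1}(x)=c_{M_1}|x|f_{M_1}(\sin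 s(x/|x|))$ where $\sin s(x/|x|)<t_{M_1}$ and $U_{M_1}=0$ otherwise, with $c_{M_1}>0$ chosen so that $|\nabla U_{M_1}|=1$ on $\partial\{U_{M_1}>0\}\setminus\{0\}$. The limit $m_1,m_2\to\infty$ means that both $m_1$ and $m_2$ tend to infinity (jointly, in any manner). The symbol $\simeq$ denotes the numerical value rounded to the displayed decimals. *)

theory Defs
  imports "HOL-Analysis.Analysis"
begin

subsection \<open>Euclidean spaces of variable dimension\<close>

text \<open>
  The dimension varies inside the limits, so \<open>\<real>\<^sup>n\<close> is a metric space on an explicit carrier, the
  same as that of \<^const>\<open>Euclidean_space\<close>. Coordinates are numbered from \<open>0\<close> to \<open>n - 1\<close>.
\<close>

definition vnorm :: "nat \<Rightarrow> (nat \<Rightarrow> real) \<Rightarrow> real" where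
  "vnorm n x = L2_set x {..<n}"

definition Rn :: "nat \<Rightarrow> (nat \<Rightarrow> real) metric" where
  "Rn n = metric ({x. \<forall>i\<ge>n. x i = 0}, \<lambda>x y. vnorm n (\<lambda>i. x i - y i))"

lemma Metric_space_Rn:
  "Metric_space {x. \<forall>i\<ge>n. x i = 0} (\<lambda>x y. vnorm n (\<lambda>i. x i - y i))"
proof
  fix x y z :: "nat \<Rightarrow> real"
  show "0 \<le> vnorm n (\<lambda>i. x i - y i)"
    by (simp add: vnorm_def)
  show "vnorm n (\<lambda>i. x i - y i) = vnorm n (\<lambda>i. y i - x i)"
    by (simp add: vnorm_def L2_set_def power2_commute)
  have "vnorm n (\<lambda>i. (x i - y i) + (y i - z i))
      \<le> vnorm n (\<lambda>i. x i - y i) + vnorm n (\<lambda>i. y i - z i)"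
    unfolding vnorm_def by (rule L2_set_triangle_ineq)
  then show "vnorm n (\<lambda>i. x i - z i) \<le> vnorm n (\<lambda>i. x i - y i) + vnorm n (\<lambda>i. y i - z i)"
    by simp
  assume "x \<in> {x. \<forall>i\<ge>n. x i = 0}" and "y \<in> {x. \<forall>i\<ge>n. x i = 0}"
  then show "vnorm n (\<lambda>i. x i - y i) = 0 \<longleftrightarrow> x = y"
    by (auto simp: vnorm_def L2_set_eq_0_iff fun_eq_iff) (metis lessThan_iff not_less)
qed

lemma mspace_Rn [simp]: "mspace (Rn n) = {x. \<forall>i\<ge>n. x i = 0}"
  by (simp add: Rn_def Metric_space.mspace_metric [OF Metric_space_Rn])

lemma mdist_Rn [simp]: "mdist (Rn n) = (\<lambda>x y. vnorm n (\<lambda>i. x i - y i))"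
  by (simp add: Rn_def Metric_space.mdist_metric [OF Metric_space_Rn])

definition unit_sphere :: "nat \<Rightarrow> (nat \<Rightarrow> real) set" where
  "unit_sphere n = {x \<in> mspace (Rn n). vnorm n x = 1}"

subsection \<open>Hausdorff measure\<close>

definition ediam :: "'a metric \<Rightarrow> 'a set \<Rightarrow> ennreal" where
  "ediam m A = (SUP x\<in>A. SUP y\<in>A. ennreal (mdist m x y))"

text \<open>
  Empty sets of a cover contribute \<open>0\<close>; the case distinction matters only for \<open>k = 0\<close>, where
  \<open>0 ^ 0 = 1\<close>. The constant makes the \<open>k\<close>-dimensional measure agree with Lebesgue measure on \<open>\<real>\<^sup>k\<close>.
\<close>

definition hausdorff_pre :: "'a metric \<Rightarrow> nat \<Rightarrow> real \<Rightarrow> 'a set \<Rightarrow> ennreal" where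
  "hausdorff_pre m k \<delta> A =
     (INF C \<in> {C :: nat \<Rightarrow> 'a set.
                 A \<subseteq> (\<Union>i. C i) \<and> (\<forall>i. C i \<subseteq> mspace m \<and> ediam m (C i) \<le> ennreal \<delta>)}.
        \<Sum>i. if C i = {} then 0
            else ennreal (unit_ball_vol (real k) / 2 ^ k) * ediam m (C i) ^ k)"

definition hausdorff :: "'a metric \<Rightarrow> nat \<Rightarrow> 'a set \<Rightarrow> ennreal" where
  "hausdorff m k A = (SUP \<delta>\<in>{0<..}. hausdorff_pre m k \<delta> A)"

subsection \<open>Positivity set, free boundary condition and density\<close>

definition positive_set :: "nat \<Rightarrow> ((nat \<Rightarrow> real) \<Rightarrow> real) \<Rightarrow> (nat \<Rightarrow> real) set" where
  "positive_set n U = {x \<in> mspace (Rn n). U x > 0}"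

definition sphere_density :: "nat \<Rightarrow> ((nat \<Rightarrow> real) \<Rightarrow> real) \<Rightarrow> real" where
  "sphere_density n U =
     enn2real (hausdorff (Rn n) (n - 1) (positive_set n U \<inter> unit_sphere n)) /
     enn2real (hausdorff (Rn n) (n - 1) (unit_sphere n))"

definition gradient :: "nat \<Rightarrow> ((nat \<Rightarrow> real) \<Rightarrow> real) \<Rightarrow> (nat \<Rightarrow> real) \<Rightarrow> nat \<Rightarrow> real" where
  "gradient n U x = (\<lambda>i. if i < n then deriv (\<lambda>h. U (x(i := h))) (x i) else 0)"

text \<open>
  The solutions have a kink across the free boundary, so \<open>|\<nabla>U| = 1\<close> there is read, as usual for
  the one-phase problem, as the limit of \<open>|\<nabla>U|\<close> from within \<open>{U > 0}\<close>.
\<close>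

definition unit_gradient_on_free_boundary :: "nat \<Rightarrow> ((nat \<Rightarrow> real) \<Rightarrow> real) \<Rightarrow> bool" where
  "unit_gradient_on_free_boundary n U \<longleftrightarrow>
     (\<forall>y \<in> (mtopology_of (Rn n) frontier_of positive_set n U) - {\<lambda>i. 0}.
        ((\<lambda>x. vnorm n (gradient n U x)) \<longlongrightarrow> 1)
          (atin_within (mtopology_of (Rn n)) y (positive_set n U)))"

subsection \<open>The two families of cones\<close>

definition hyp2f1 :: "real \<Rightarrow> real \<Rightarrow> real \<Rightarrow> real \<Rightarrow> real" where
  "hyp2f1 a b c z = eval_fps (fps_hypergeo [a, b] [c] 1) z"

definition DSJ_F :: "nat \<Rightarrow> real \<Rightarrow> real" where
  "DSJ_F n t = hyp2f1 ((real n - 1) / 2) (- 1 / 2) (1 / 2) (t\<^sup>2)"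

definition DSJ_zero :: "nat \<Rightarrow> real" where
  "DSJ_zero n = (THE t. 0 < t \<and> t < 1 \<and> DSJ_F n t = 0)"

text \<open>The axis is the last coordinate, which has index \<open>n - 1\<close> here.\<close>

definition DSJ_scaled :: "nat \<Rightarrow> real \<Rightarrow> (nat \<Rightarrow> real) \<Rightarrow> real" where
  "DSJ_scaled n c x =
     (if \<bar>x (n - 1)\<bar> < DSJ_zero n * vnorm n x
      then c * vnorm n x * DSJ_F n (x (n - 1) / vnorm n x) else 0)"

definition DSJ_const :: "nat \<Rightarrow> real" where
  "DSJ_const n = (THE c. c > 0 \<and> unit_gradient_on_free_boundary n (DSJ_scaled n c))"

definition DSJ_cone :: "nat \<Rightarrow> (nat \<Rightarrow> real) \<Rightarrow> real" where
  "DSJ_cone n = DSJ_scaled n (DSJ_const n)"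

text \<open>
  A point of \<open>\<real>\<^sup>n\<close>, \<open>n = m\<^sub>1 + m\<^sub>2 + 2\<close>, is split into its first \<open>m\<^sub>1 + 1\<close> and its last \<open>m\<^sub>2 + 1\<close>
  coordinates. For \<open>y\<close> on the unit sphere, \<open>leaf_param m1 m2 y\<close> is the \<open>s\<close> of the leaf
  \<open>S\<^sup>m\<^sup>1(sin s) \<times> S\<^sup>m\<^sup>2(cos s)\<close> that contains \<open>y\<close>.
\<close>

definition leaf_param :: "nat \<Rightarrow> nat \<Rightarrow> (nat \<Rightarrow> real) \<Rightarrow> real" where
  "leaf_param m1 m2 y =
     (THE s. 0 \<le> s \<and> s \<le> pi / 2 \<and>
             L2_set y {..<m1 + 1} = sin s \<and> L2_set y {m1 + 1..<m1 + m2 + 2} = cos s)"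

definition typeI_f :: "nat \<Rightarrow> nat \<Rightarrow> real \<Rightarrow> real" where
  "typeI_f m1 m2 t =
     hyp2f1 ((real (m1 + m2 + 2) - 1) / 2) (- 1 / 2) ((real m1 + 1) / 2) (t\<^sup>2)"

definition typeI_zero :: "nat \<Rightarrow> nat \<Rightarrow> real" where
  "typeI_zero m1 m2 = (THE t. 0 < t \<and> t < 1 \<and> typeI_f m1 m2 t = 0)"

text \<open>At \<open>x = 0\<close> the angle is meaningless, but both branches give the value \<open>0\<close>.\<close>

definition typeI_scaled :: "nat \<Rightarrow> nat \<Rightarrow> real \<Rightarrow> (nat \<Rightarrow> real) \<Rightarrow> real" where
  "typeI_scaled m1 m2 c x =
     (let r = vnorm (m1 + m2 + 2) x;
          s = leaf_param m1 m2 (\<lambda>i. x i / r)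
      in if sin s < typeI_zero m1 m2 then c * r * typeI_f m1 m2 (sin s) else 0)"

definition typeI_const :: "nat \<Rightarrow> nat \<Rightarrow> real" where
  "typeI_const m1 m2 =
     (THE c. c > 0 \<and> unit_gradient_on_free_boundary (m1 + m2 + 2) (typeI_scaled m1 m2 c))"

definition typeI_cone :: "nat \<Rightarrow> nat \<Rightarrow> (nat \<Rightarrow> real) \<Rightarrow> real" where
  "typeI_cone m1 m2 = typeI_scaled m1 m2 (typeI_const m1 m2)"

definition DSJ_density :: "nat \<Rightarrow> real" where
  "DSJ_density n = sphere_density n (DSJ_cone n)"

definition typeI_density :: "nat \<Rightarrow> nat \<Rightarrow> real" where
  "typeI_density m1 m2 = sphere_density (m1 + m2 + 2) (typeI_cone m1 m2)"

subsection \<open>Rounding\<close>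

definition round_decimals :: "nat \<Rightarrow> real \<Rightarrow> real" where
  "round_decimals k x = of_int (round (10 ^ k * x)) / 10 ^ k"

end

theory Submission
  imports
    Defs
    "HOL-Probability.Distributions"
    "HOL-Probability.Sinc_Integral"
    "HOL-Real_Asymp.Real_Asymp"
begin

text \<open>
  On the sphere the Hausdorff measure and the normalized Lebesgue measure of the cone over a set are
  both finite, positive and invariant under rotations; two measures that give balls of equal radius
  equal mass are proportional, so densities are ratios of Lebesgue volumes. Splitting \<open>\<real>\<^sup>n\<close> into
  blocks of sizes \<open>k\<close> and \<open>n - k\<close> and passing to the ratio of the two radii turns the density into
  a quotient of one-dimensional beta integrals, cut at the zero \<open>z\<close> of the profile.

  If both blocks grow, put \<open>p = k / n\<close> and \<open>\<sigma>\<^sup>2 = 2 p (1 - p) / n\<close>. In the variable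
  \<open>y = (z - p) / \<sigma>\<close> the hypergeometric equation converges to the Hermite equation of degree \<open>1/2\<close>,
  and Sturm comparison with shifts of the Hermite function shows that \<open>y\<close> tends to the zero
  \<open>y0\<close> of the latter, while the beta weights tend to the Gaussian weight; the limit is
  \<open>\<Phi> y0\<close>, where \<open>\<Phi>\<close> is the standard normal distribution function.
  If one block is a line, then \<open>n z\<close> tends to \<open>2 x0\<close>, where \<open>x0\<close> is the positive zero of
  \<open>1F1(-1/2; 1/2; x)\<close>, and the limit is \<open>2 \<Phi> (sqrt (2 x0)) - 1\<close>.
\<close>

section \<open>The Hausdorff measure on Borel sets\<close>

text \<open>The spherical Hausdorff measure is never evaluated: the density is a quotient, so
  finiteness, positivity and rotation invariance suffice. Two obstacles shape the asymptotic half.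
  The blocks grow in any manner, so \<open>p\<close> need not converge and may tend to 0 or 1; hence
  every error is measured by \<open>\<rho>\<close>, which depends only on
  \<open>1 / k + 1 / l\<close>. And the comparison covers the whole interval left of the zero, that
  is down to \<open>y = - p / \<sigma>\<close>, which tends to minus infinity; errors must therefore
  be small relative to \<open>psi 0\<close> on a full half-line, and \<open>psi_Suc_le\<close>
  provides this. The degree 1/2 comes from homogeneity one: in the variable \<open>y\<close> the
  hypergeometric operator is about \<open>n / 2\<close> times
  \<open>\<phi>'' - y \<phi>' + \<phi> / 2\<close>. Shifting the Hermite function by
  \<open>h\<close> changes the outcome by \<open>h * psi 0\<close>, which beats an error of
  \<open>8 * \<rho> * psi 0\<close> as soon as \<open>8 * \<rho> < h\<close>. The existence of a
  zero of the profile is itself a product of the comparison with the limit and is established for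
  large dimensions.\<close>

definition hweight :: "'a metric \<Rightarrow> nat \<Rightarrow> 'a set \<Rightarrow> ennreal" where
  "hweight m k B = (if B = {} then 0 else ennreal (unit_ball_vol (real k) / 2 ^ k) * ediam m B ^ k)"

definition hcovers :: "'a metric \<Rightarrow> real \<Rightarrow> 'a set \<Rightarrow> (nat \<Rightarrow> 'a set) set" where
  "hcovers m \<delta> A = {C. A \<subseteq> (\<Union>i. C i) \<and> (\<forall>i. C i \<subseteq> mspace m \<and> ediam m (C i) \<le> ennreal \<delta>)}"

lemma hausdorff_pre_alt: "hausdorff_pre m k \<delta> A = (INF C \<in> hcovers m \<delta> A. \<Sum>i. hweight m k (C i))"
  by (simp add: hausdorff_pre_def hweight_def hcovers_def)

lemma ediam_empty [simp]: "ediam m {} = 0"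
  by (simp add: ediam_def bot_ennreal)

lemma hweight_empty [simp]: "hweight m k {} = 0"
  by (simp add: hweight_def)

lemma mdist_le_ediam: "x \<in> B \<Longrightarrow> y \<in> B \<Longrightarrow> ennreal (mdist m x y) \<le> ediam m B"
  unfolding ediam_def by (meson SUP_upper SUP_upper2)

lemma hausdorff_pre_mono: "A \<subseteq> B \<Longrightarrow> hausdorff_pre m k \<delta> A \<le> hausdorff_pre m k \<delta> B"
  unfolding hausdorff_pre_alt hcovers_def by (intro INF_superset_mono) auto

lemma hausdorff_pre_antimono:
  assumes "\<delta> \<le> \<delta>'" shows "hausdorff_pre m k \<delta>' A \<le> hausdorff_pre m k \<delta> A"
proof -
  have "ennreal \<delta> \<le> ennreal \<delta>'" using assms by (rule ennreal_leI)
  then have "hcovers m \<delta> A \<subseteq> hcovers m \<delta>' A"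
    unfolding hcovers_def by (auto intro: order_trans)
  then show ?thesis unfolding hausdorff_pre_alt by (intro INF_superset_mono) auto
qed

lemma hausdorff_pre_empty [simp]: "hausdorff_pre m k \<delta> {} = 0"
proof -
  have "(\<lambda>_. {}) \<in> hcovers m \<delta> {}" by (simp add: hcovers_def)
  then have "hausdorff_pre m k \<delta> {} \<le> (\<Sum>i::nat. hweight m k {})"
    unfolding hausdorff_pre_alt by (rule INF_lower)
  then show ?thesis by simp
qed

text \<open>Covers of the \<open>A i\<close> that are optimal up to \<open>e / 2 ^ (i + 1)\<close>
  are merged into one sequence through \<open>prod_decode\<close>; the excesses add up to
  \<open>e\<close>.\<close>

lemma hausdorff_pre_UN_le:
  "hausdorff_pre m k \<delta> (\<Union>i::nat. A i) \<le> (\<Sum>i. hausdorff_pre m k \<delta> (A i))"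
proof (rule ennreal_le_epsilon)
  fix e :: real
  assume fin: "(\<Sum>i. hausdorff_pre m k \<delta> (A i)) < top" and e: "0 < e"
  define d where "d i = e * (1/2)^Suc i" for i
  have d: "d i > 0" for i using e by (simp add: d_def)
  have "\<exists>C\<in>hcovers m \<delta> (A i). (\<Sum>j. hweight m k (C j)) < hausdorff_pre m k \<delta> (A i) + d i" for i
  proof (rule INF_approx_ennreal)
    show "0 < d i" by (rule d)
    show "hausdorff_pre m k \<delta> (A i) \<noteq> \<infinity>"
      using fin ennreal_suminf_lessD[of "\<lambda>i. hausdorff_pre m k \<delta> (A i)" top i] by auto
  qed (simp add: hausdorff_pre_alt)
  then obtain C where C: "\<And>i. C i \<in> hcovers m \<delta> (A i)"
    and C2: "\<And>i. (\<Sum>j. hweight m k (C i j)) < hausdorff_pre m k \<delta> (A i) + d i" by metis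
  define C' where "C' p = C (fst (prod_decode p)) (snd (prod_decode p))" for p
  have "C' \<in> hcovers m \<delta> (\<Union>i. A i)"
  proof -
    have "(\<Union>i. A i) \<subseteq> (\<Union>p. C' p)"
    proof
      fix x assume "x \<in> (\<Union>i. A i)"
      then obtain i where "x \<in> A i" by auto
      then obtain j where "x \<in> C i j" using C[of i] by (auto simp: hcovers_def)
      then have "x \<in> C' (prod_encode (i,j))" by (simp add: C'_def)
      then show "x \<in> (\<Union>p. C' p)" by auto
    qed
    then show ?thesis using C by (auto simp: hcovers_def C'_def)
  qed
  then have "hausdorff_pre m k \<delta> (\<Union>i. A i) \<le> (\<Sum>p. hweight m k (C' p))"
    unfolding hausdorff_pre_alt by (rule INF_lower)
  also have "\<dots> = (\<Sum>i. \<Sum>j. hweight m k (C i j))"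
    unfolding C'_def
    by (rule suminf_ennreal_2dimen[of _ "\<lambda>p. hweight m k (C (fst p) (snd p))"]) simp
  also have "\<dots> \<le> (\<Sum>i. hausdorff_pre m k \<delta> (A i) + ennreal (d i))"
    by (intro suminf_le) (auto intro: less_imp_le C2)
  also have "\<dots> = (\<Sum>i. hausdorff_pre m k \<delta> (A i)) + (\<Sum>i. ennreal (d i))"
    by (intro suminf_add[symmetric]) auto
  also have "(\<Sum>i. ennreal (d i)) = ennreal e"
  proof -
    have "d sums (e * 1)" unfolding d_def by (intro sums_mult power_half_series)
    then show ?thesis using d by (subst suminf_ennreal2) (auto simp: sums_iff less_imp_le)
  qed
  finally show "hausdorff_pre m k \<delta> (\<Union>i. A i) \<le> (\<Sum>i. hausdorff_pre m k \<delta> (A i)) + ennreal e" .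
qed

text \<open>A set of diameter at most \<open>\<delta> < \<eta>\<close> cannot meet both
  \<open>A\<close> and \<open>B\<close>, so a cover of the union splits into two covers that use
  different members.\<close>

lemma hausdorff_pre_separated:
  assumes sep: "\<And>x y. x \<in> A \<Longrightarrow> y \<in> B \<Longrightarrow> \<eta> \<le> mdist m x y" and "0 \<le> \<delta>" "\<delta> < \<eta>"
  shows "hausdorff_pre m k \<delta> A + hausdorff_pre m k \<delta> B \<le> hausdorff_pre m k \<delta> (A \<union> B)"
  unfolding hausdorff_pre_alt[of m k \<delta> "A \<union> B"]
proof (rule INF_greatest)
  fix C assume C: "C \<in> hcovers m \<delta> (A \<union> B)"
  \<comment> \<open>Members that miss \<open>X\<close> are replaced by the empty set, whose weight
    is 0 also when \<open>k = 0\<close>.\<close>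
  define CA where "CA X i = (if C i \<inter> X = {} then {} else C i)" for X i
  have le: "hausdorff_pre m k \<delta> X \<le> (\<Sum>i. hweight m k (CA X i))" if "X \<subseteq> A \<union> B" for X
    unfolding hausdorff_pre_alt
  proof (rule INF_lower)
    show "CA X \<in> hcovers m \<delta> X"
      using C that unfolding hcovers_def CA_def by (auto split: if_splits) blast
  qed
  have "hweight m k (CA A i) + hweight m k (CA B i) \<le> hweight m k (C i)" for i
  proof (cases "C i \<inter> A = {} \<or> C i \<inter> B = {}")
    case False
    then obtain x y where xy: "x \<in> C i" "x \<in> A" "y \<in> C i" "y \<in> B" by auto
    have "ennreal (mdist m x y) \<le> ediam m (C i)" using xy by (intro mdist_le_ediam)
    also have "\<dots> \<le> ennreal \<delta>" using C by (auto simp: hcovers_def)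
    finally have "mdist m x y \<le> \<delta>" using assms(2) by (simp add: ennreal_le_iff)
    with sep[OF xy(2,4)] assms(3) show ?thesis by simp
  qed (auto simp: CA_def)
  then have "(\<Sum>i. hweight m k (CA A i) + hweight m k (CA B i)) \<le> (\<Sum>i. hweight m k (C i))"
    by (intro suminf_le) auto
  moreover have "(\<Sum>i. hweight m k (CA A i) + hweight m k (CA B i)) =
     (\<Sum>i. hweight m k (CA A i)) + (\<Sum>i. hweight m k (CA B i))"
    by (intro suminf_add[symmetric]) auto
  moreover have "hausdorff_pre m k \<delta> A + hausdorff_pre m k \<delta> B \<le>
     (\<Sum>i. hweight m k (CA A i)) + (\<Sum>i. hweight m k (CA B i))"
    by (intro add_mono le) auto
  ultimately show "hausdorff_pre m k \<delta> A + hausdorff_pre m k \<delta> B \<le> (\<Sum>i. hweight m k (C i))" by simp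
qed

section \<open>The outer measure: subadditivity, separated sets, Caratheodory's criterion\<close>

lemma hausdorff_empty [simp]: "hausdorff m k {} = 0"
  by (simp add: hausdorff_def)

lemma hausdorff_mono: "A \<subseteq> B \<Longrightarrow> hausdorff m k A \<le> hausdorff m k B"
  unfolding hausdorff_def by (intro SUP_mono) (auto intro: hausdorff_pre_mono)

lemma hausdorff_pre_le: "0 < \<delta> \<Longrightarrow> hausdorff_pre m k \<delta> A \<le> hausdorff m k A"
  unfolding hausdorff_def by (intro SUP_upper) auto

lemma hausdorff_UN_le: "hausdorff m k (\<Union>i::nat. A i) \<le> (\<Sum>i. hausdorff m k (A i))"
  unfolding hausdorff_def[of m k "\<Union>i. A i"]
proof (rule SUP_least)
  fix \<delta> :: real assume "\<delta> \<in> {0<..}"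
  then have "(\<Sum>i. hausdorff_pre m k \<delta> (A i)) \<le> (\<Sum>i. hausdorff m k (A i))"
    by (intro suminf_le hausdorff_pre_le) auto
  with hausdorff_pre_UN_le show "hausdorff_pre m k \<delta> (\<Union>i. A i) \<le> (\<Sum>i. hausdorff m k (A i))"
    by (rule order_trans)
qed

lemma hausdorff_Un_le: "hausdorff m k (A \<union> B) \<le> hausdorff m k A + hausdorff m k B"
proof -
  have "hausdorff m k (A \<union> B) \<le> (\<Sum>i. hausdorff m k (binaryset A B i))"
    using hausdorff_UN_le[of m k "binaryset A B"] by (simp add: UN_binaryset_eq)
  also have "\<dots> = hausdorff m k A + hausdorff m k B"
    by (subst suminf_finite[of "{0,1}"]) (auto simp: binaryset_def)
  finally show ?thesis .
qed

lemma hausdorff_separated: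
  assumes sep: "\<And>x y. x \<in> A \<Longrightarrow> y \<in> B \<Longrightarrow> \<eta> \<le> mdist m x y" and "0 < \<eta>"
  shows "hausdorff m k A + hausdorff m k B \<le> hausdorff m k (A \<union> B)"
proof -
  have *: "hausdorff_pre m k \<delta> A + hausdorff_pre m k \<delta>' B \<le> hausdorff m k (A \<union> B)"
    if "0 < \<delta>" "0 < \<delta>'" for \<delta> \<delta>'
  proof -
    \<comment> \<open>Premeasures grow as the scale shrinks, so both may be moved to one common
      scale below \<open>\<eta>\<close>, where additivity is available.\<close>
    define d where "d = min (min \<delta> \<delta>') (\<eta>/2)"
    have d: "0 < d" "d < \<eta>" "d \<le> \<delta>" "d \<le> \<delta>'" using that assms(2) by (auto simp: d_def min_def)
    have "hausdorff_pre m k \<delta> A + hausdorff_pre m k \<delta>' B \<le> hausdorff_pre m k d A + hausdorff_pre m k d B"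
      using d by (intro add_mono hausdorff_pre_antimono)
    also have "\<dots> \<le> hausdorff_pre m k d (A \<union> B)"
      using d by (intro hausdorff_pre_separated[OF sep]) auto
    also have "\<dots> \<le> hausdorff m k (A \<union> B)" using d by (intro hausdorff_pre_le)
    finally show ?thesis .
  qed
  have "hausdorff_pre m k \<delta> A + hausdorff m k B \<le> hausdorff m k (A \<union> B)" if "0 < \<delta>" for \<delta>
  proof -
    have "hausdorff_pre m k \<delta> A + hausdorff m k B = (SUP \<delta>'\<in>{0<..}. hausdorff_pre m k \<delta> A + hausdorff_pre m k \<delta>' B)"
      unfolding hausdorff_def by (intro ennreal_SUP_add_right) auto
    also have "\<dots> \<le> hausdorff m k (A \<union> B)" using that by (intro SUP_least *) auto
    finally show ?thesis .
  qed
  note ** = this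
  have "hausdorff m k A + hausdorff m k B = (SUP \<delta>\<in>{0<..}. hausdorff_pre m k \<delta> A + hausdorff m k B)"
    unfolding hausdorff_def[of m k A] by (intro ennreal_SUP_add_left[symmetric]) auto
  also have "\<dots> \<le> hausdorff m k (A \<union> B)" by (intro SUP_least **) auto
  finally show ?thesis .
qed

text \<open>Gaps between the value ranges of a 1-Lipschitz function keep the layers a positive
  distance apart, so additivity for separated sets iterates. The ranges increase with
  \<open>i\<close>, hence only the gap below the newest layer counts.\<close>

lemma sum_hausdorff_layers_le:
  fixes f :: "'a \<Rightarrow> real"
  assumes Lip: "\<And>x y. x \<in> E \<Longrightarrow> y \<in> E \<Longrightarrow> \<bar>f x - f y\<bar> \<le> mdist m x y"
    and layer: "\<And>i x. x \<in> D i \<Longrightarrow> x \<in> E \<and> u i < f x \<and> f x \<le> v i"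
    and gap: "\<And>i. v i < u (Suc i)" and uv: "\<And>i. u i \<le> v i"
  shows "(\<Sum>i<N. hausdorff m k (D i)) \<le> hausdorff m k (\<Union>i<N. D i)"
proof (induction N)
  case (Suc N)
  have v_mono: "v i \<le> v N" if "i \<le> N" for i N
    using lift_Suc_mono_le[of v i N] that gap uv by (meson less_imp_le order_trans)
  have "(\<Sum>i<Suc N. hausdorff m k (D i)) \<le> hausdorff m k (\<Union>i<N. D i) + hausdorff m k (D N)"
    using Suc by (simp add: add_right_mono)
  also have "\<dots> \<le> hausdorff m k ((\<Union>i<N. D i) \<union> D N)"
  proof (cases N)
    case (Suc N')
    show ?thesis
    proof (rule hausdorff_separated)
      fix x y assume "x \<in> (\<Union>i<N. D i)" and y: "y \<in> D N"
      then obtain i where i: "i < N" "x \<in> D i" by auto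
      have "f x \<le> v N'" using layer[OF i(2)] v_mono[of i N'] i Suc by auto
      moreover have "u N < f y" using layer[OF y] by auto
      ultimately show "u (Suc N') - v N' \<le> mdist m x y"
        using Lip[of x y] layer[OF i(2)] layer[OF y] Suc by auto
    qed (use gap in auto)
  qed auto
  also have "(\<Union>i<N. D i) \<union> D N = (\<Union>i<Suc N. D i)" by (auto simp: less_Suc_eq)
  finally show ?case .
qed simp

text \<open>Caratheodory's criterion for a metric outer measure: the sublevel set is exhausted by
  the sets where \<open>f \<le> a - 1 / (j + 1)\<close>, which have positive distance from the
  complement, and what they miss is covered by layers of finite total measure.\<close>

lemma hausdorff_caratheodory_less:
  fixes f :: "'a \<Rightarrow> real"
  assumes Lip: "\<And>x y. x \<in> E \<Longrightarrow> y \<in> E \<Longrightarrow> \<bar>f x - f y\<bar> \<le> mdist m x y"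
  shows "hausdorff m k (E \<inter> {x. f x < a}) + hausdorff m k (E - {x. f x < a}) \<le> hausdorff m k E"
proof (cases "hausdorff m k E = \<infinity>")
  case False
  define P where "P = E \<inter> {x. f x < a}"
  define Q where "Q = E - {x. f x < a}"
  define e where "e j = a - 1 / (real j + 1)" for j :: nat
  define D where "D j = {x \<in> P. e j < f x \<and> f x \<le> e (Suc j)}" for j
  have e_less: "e j < e (Suc j)" for j by (simp add: e_def field_simps)
  have e_mono: "i \<le> j \<Longrightarrow> e i \<le> e j" for i j using lift_Suc_mono_le[of e] e_less less_imp_le by blast
  \<comment> \<open>Consecutive layers touch, but layers whose indices have the same parity are
    separated by a gap. Summing each parity on its own bounds the full sum by twice the measure of
    \<open>E\<close>.\<close>
  have "(\<Sum>i<N. hausdorff m k (D (2*i + c))) \<le> hausdorff m k E" for N c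
  proof -
    have "(\<Sum>i<N. hausdorff m k (D (2*i + c))) \<le> hausdorff m k (\<Union>i<N. D (2*i+c))"
      by (rule sum_hausdorff_layers_le[OF Lip, where u = "\<lambda>i. e (2*i+c)" and v = "\<lambda>i. e (Suc (2*i+c))"])
         (auto simp: D_def P_def e_less less_imp_le)
    also have "\<dots> \<le> hausdorff m k E" by (intro hausdorff_mono) (auto simp: D_def P_def)
    finally show ?thesis .
  qed
  note even_odd = this
  have fin: "(\<Sum>i. hausdorff m k (D i)) \<noteq> \<infinity>"
  proof -
    have "(\<Sum>i<N. hausdorff m k (D i)) \<le> hausdorff m k E + hausdorff m k E" for N
    proof -
      have "(\<Sum>i<N. hausdorff m k (D i)) \<le> (\<Sum>i<2*N. hausdorff m k (D i))"
        by (intro sum_mono2) auto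
      also have "\<dots> = (\<Sum>i<N. hausdorff m k (D (2*i+0))) + (\<Sum>i<N. hausdorff m k (D (2*i+1)))"
        by (induction N) (simp_all add: algebra_simps)
      also have "\<dots> \<le> hausdorff m k E + hausdorff m k E" by (intro add_mono even_odd)
      finally show ?thesis .
    qed
    then have "(\<Sum>i. hausdorff m k (D i)) \<le> hausdorff m k E + hausdorff m k E"
      by (intro suminf_le_const) auto
    with False show ?thesis by (auto simp: top_unique)
  qed
  \<comment> \<open>The initial layers are added on the left, so that the tail after
    \<open>j\<close> is completed to the full sum without any subtraction in
    \<open>ennreal\<close>.\<close>
  have step: "hausdorff m k P + hausdorff m k Q + (\<Sum>i<j. hausdorff m k (D i))
      \<le> hausdorff m k E + (\<Sum>i. hausdorff m k (D i))" for j
  proof -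
    define Ej where "Ej = {x \<in> P. f x \<le> e j}"
    have "hausdorff m k Ej + hausdorff m k Q \<le> hausdorff m k (Ej \<union> Q)"
    proof (rule hausdorff_separated)
      fix x y assume "x \<in> Ej" "y \<in> Q"
      then show "1 / (real j + 1) \<le> mdist m x y"
        using Lip[of x y] by (auto simp: Ej_def Q_def P_def e_def)
    qed simp
    also have "\<dots> \<le> hausdorff m k E" by (intro hausdorff_mono) (auto simp: Ej_def Q_def P_def)
    finally have 1: "hausdorff m k Ej + hausdorff m k Q \<le> hausdorff m k E" .
    have "P \<subseteq> Ej \<union> (\<Union>i. D (i + j))"
    proof
      fix x assume x: "x \<in> P"
      show "x \<in> Ej \<union> (\<Union>i. D (i + j))"
      proof (cases "f x \<le> e j")
        case False
        obtain N where N: "1 / (real N + 1) < a - f x"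
          using reals_Archimedean[of "a - f x"] x by (auto simp: P_def inverse_eq_divide add.commute)
        then have ex: "f x \<le> e N" by (auto simp: e_def)
        define M where "M = (LEAST N. f x \<le> e N)"
        have M: "f x \<le> e M" unfolding M_def using ex by (rule LeastI)
        have "j < M" using False M e_mono[of M j] by (meson leI order_trans)
        then obtain M' where M': "M = Suc M'" "j \<le> M'" by (cases M) auto
        have "e M' < f x" using not_less_Least[of M' "\<lambda>N. f x \<le> e N"] M' by (auto simp: M_def)
        then have "x \<in> D (M' - j + j)" using M M' x by (auto simp: D_def)
        then show ?thesis by blast
      qed (use x in \<open>auto simp: Ej_def\<close>)
    qed
    then have "hausdorff m k P \<le> hausdorff m k (Ej \<union> (\<Union>i. D (i + j)))" by (rule hausdorff_mono)
    also have "\<dots> \<le> hausdorff m k Ej + hausdorff m k (\<Union>i. D (i + j))" by (rule hausdorff_Un_le)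
    also have "\<dots> \<le> hausdorff m k Ej + (\<Sum>i. hausdorff m k (D (i + j)))"
      by (intro add_left_mono hausdorff_UN_le)
    finally have "hausdorff m k P + hausdorff m k Q + (\<Sum>i<j. hausdorff m k (D i))
      \<le> (hausdorff m k Ej + hausdorff m k Q) + ((\<Sum>i. hausdorff m k (D (i + j))) + (\<Sum>i<j. hausdorff m k (D i)))"
      by (simp add: add_ac add_left_mono)
    also have "(\<Sum>i. hausdorff m k (D (i + j))) + (\<Sum>i<j. hausdorff m k (D i)) = (\<Sum>i. hausdorff m k (D i))"
      by (rule suminf_offset[symmetric]) auto
    finally show ?thesis using 1 by (meson add_right_mono order_trans)
  qed
  \<comment> \<open>As \<open>j\<close> tends to infinity the full sum appears on both sides; being
    finite, it cancels.\<close>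
  have "hausdorff m k P + hausdorff m k Q + (\<Sum>i. hausdorff m k (D i))
      \<le> hausdorff m k E + (\<Sum>i. hausdorff m k (D i))"
  proof (rule LIMSEQ_le_const2)
    show "(\<lambda>j. hausdorff m k P + hausdorff m k Q + (\<Sum>i<j. hausdorff m k (D i))) \<longlonglongrightarrow>
        hausdorff m k P + hausdorff m k Q + (\<Sum>i. hausdorff m k (D i))"
      by (intro tendsto_add tendsto_const summable_LIMSEQ) auto
  qed (use step in auto)
  then have "hausdorff m k P + hausdorff m k Q \<le> hausdorff m k E"
    using fin by (simp add: ennreal_add_left_cancel_le add.commute[of _ "\<Sum>i. hausdorff m k (D i)"])
  then show ?thesis by (simp add: P_def Q_def)
qed simp

lemma abs_component_le_vnorm: "i < n \<Longrightarrow> \<bar>x i\<bar> \<le> vnorm n x"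
  unfolding vnorm_def using member_le_L2_set[of "{..<n}" i "\<lambda>i. \<bar>x i\<bar>"] by (simp add: L2_set_def)

text \<open>The Caratheodory sets of the outer measure on \<open>\<Omega>\<close> form a
  sigma-algebra. Coordinates are 1-Lipschitz, so the inclusion of \<open>\<Omega>\<close> is Borel
  measurable, and the measure sought is the image measure under it.\<close>

lemma hausdorff_borel_measure_exists:
  assumes \<Omega>: "\<Omega> \<subseteq> mspace (Rn n)"
  shows "\<exists>M :: (nat \<Rightarrow> real) measure. sets M = sets borel \<and>
     (\<forall>B\<in>sets borel. emeasure M B = hausdorff (Rn n) k (B \<inter> \<Omega>))"
proof -
  let ?H = "hausdorff (Rn n) k"
  interpret sigma_algebra \<Omega> "Pow \<Omega>" by (rule sigma_algebra_Pow)
  have oms: "outer_measure_space (Pow \<Omega>) ?H"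
    unfolding outer_measure_space_def
    by (auto simp: positive_def increasing_def countably_subadditive_def hausdorff_mono hausdorff_UN_le)
  define L where "L = lambda_system \<Omega> (Pow \<Omega>) ?H"
  have ms: "measure_space \<Omega> L ?H"
    unfolding L_def using oms by (rule caratheodory_lemma)
  define N where "N = measure_of \<Omega> L ?H"
  have sa: "sigma_algebra \<Omega> L" using ms by (simp add: measure_space_def)
  then have LP: "L \<subseteq> Pow \<Omega>" by (simp add: sigma_algebra_iff2)
  have sets_N [simp]: "sets N = L" and space_N [simp]: "space N = \<Omega>"
    using sa LP by (auto simp: N_def sigma_algebra.sets_measure_of_eq sigma_algebra.sigma_sets_eq)
  have em_N: "emeasure N A = ?H A" if "A \<in> L" for A
    unfolding N_def using ms that sa
    by (intro emeasure_measure_of_sigma) (auto simp: measure_space_def)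
  have meas: "(\<lambda>x. x) \<in> borel_measurable N"
  proof (rule measurable_coordinatewise_then_product)
    fix i :: nat
    show "(\<lambda>x. x i) \<in> borel_measurable N"
      unfolding borel_measurable_iff_less
    proof
      fix a :: real
      have "?H (X \<inter> {w \<in> \<Omega>. w i < a}) + ?H (X - {w \<in> \<Omega>. w i < a}) = ?H X" if X: "X \<subseteq> \<Omega>" for X
      proof (rule antisym)
        have "?H (X \<inter> {w. w i < a}) + ?H (X - {w. w i < a}) \<le> ?H X"
        proof (rule hausdorff_caratheodory_less)
          fix x y :: "nat \<Rightarrow> real" assume "x \<in> X" "y \<in> X"
          then have "x \<in> mspace (Rn n)" "y \<in> mspace (Rn n)" using X \<Omega> by blast+
          then have "\<forall>i\<ge>n. x i = 0" "\<forall>i\<ge>n. y i = 0" by auto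
          then show "\<bar>x i - y i\<bar> \<le> mdist (Rn n) x y"
            using abs_component_le_vnorm[of i n "\<lambda>i. x i - y i"]
            by (cases "i < n") (auto simp: vnorm_def)
        qed
        moreover have "X \<inter> {w \<in> \<Omega>. w i < a} = X \<inter> {w. w i < a}" "X - {w \<in> \<Omega>. w i < a} = X - {w. w i < a}"
          using X by auto
        ultimately show "?H (X \<inter> {w \<in> \<Omega>. w i < a}) + ?H (X - {w \<in> \<Omega>. w i < a}) \<le> ?H X" by simp
        show "?H X \<le> ?H (X \<inter> {w \<in> \<Omega>. w i < a}) + ?H (X - {w \<in> \<Omega>. w i < a})"
          using hausdorff_Un_le[of "Rn n" k "X \<inter> {w \<in> \<Omega>. w i < a}" "X - {w \<in> \<Omega>. w i < a}"]
          unfolding Int_Diff_Un .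
      qed
      then show "{w \<in> space N. w i < a} \<in> sets N"
        by (auto simp: L_def lambda_system_eq)
    qed
  qed
  show ?thesis
  proof (intro exI conjI ballI)
    fix B :: "(nat \<Rightarrow> real) set" assume B: "B \<in> sets borel"
    have "(\<lambda>x. x) -` B \<inter> space N \<in> sets N" using meas B by (rule measurable_sets)
    then show "emeasure (distr N borel (\<lambda>x. x)) B = ?H (B \<inter> \<Omega>)"
      using B meas by (simp add: emeasure_distr em_N)
  qed simp
qed

text \<open>Used for the pairs \<open>(A, S)\<close> and \<open>(S, A)\<close>, this yields
  proportionality. The quotient \<open>g / h\<close> may behave in any way as the radius shrinks;
  the estimate for \<open>A\<close> carries \<open>g / h\<close>, the one for \<open>B\<close>
  carries \<open>h / g\<close>, and the factors cancel in the product. Relative openness makes the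
  relative mass in small balls equal to 1 eventually at each point of the set.\<close>

lemma uniform_measures_le:
  fixes M N :: "'a measure" and d :: "'a \<Rightarrow> 'a \<Rightarrow> real" and g h :: "real \<Rightarrow> real"
  assumes fin: "finite_measure M" "finite_measure N" and sets_eq [measurable_cong]: "sets N = sets M"
    and d: "(\<lambda>(x, y). d x y) \<in> borel_measurable (M \<Otimes>\<^sub>M M)" and sym: "\<And>x y. d x y = d y x"
    and S: "S \<in> sets M" and A: "A \<in> sets M" "A \<subseteq> S" and B: "B \<in> sets M" "B \<subseteq> S"
    and opA: "\<And>x. x \<in> A \<Longrightarrow> \<exists>r>0. \<forall>y\<in>S. d x y < r \<longrightarrow> y \<in> A"
    and opB: "\<And>x. x \<in> B \<Longrightarrow> \<exists>r>0. \<forall>y\<in>S. d x y < r \<longrightarrow> y \<in> B"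
    and g: "\<And>x r. x \<in> S \<Longrightarrow> 0 < r \<Longrightarrow> measure M {y\<in>S. d x y < r} = g r" "\<And>r. 0 < r \<Longrightarrow> 0 < g r"
    and h: "\<And>x r. x \<in> S \<Longrightarrow> 0 < r \<Longrightarrow> measure N {y\<in>S. d x y < r} = h r" "\<And>r. 0 < r \<Longrightarrow> 0 < h r"
  shows "measure M A * measure N B \<le> measure N A * measure M B"
proof -
  interpret M: finite_measure M by (rule fin)
  interpret N: finite_measure N by (rule fin)
  define r where "r n = 1 / (real n + 1)" for n :: nat
  have r: "0 < r n" for n by (simp add: r_def)
  have r_lim: "r \<longlonglongrightarrow> 0" unfolding r_def by real_asymp
  have SM: "S \<subseteq> space M" "A \<subseteq> space M" "B \<subseteq> space M" using S A B sets.sets_into_space by blast+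
  have space_eq: "space N = space M" using sets_eq by (rule sets_eq_imp_space_eq)
  text \<open>
    By Fubini, the average over \<open>K\<close> of the relative mass of \<open>C\<close> in small balls is at most
    a constant times \<open>\<mu> C\<close>, whereas it converges to \<open>\<nu> C\<close>.
  \<close>
  have key: "\<exists>a. a \<longlonglongrightarrow> measure K C \<and> (\<forall>n. 0 \<le> a n \<and> a n \<le> p (r n) / q (r n) * measure L C)"
    if K: "finite_measure K" "sets K = sets M" and L: "finite_measure L" "sets L = sets M"
      and C: "C \<in> sets M" "C \<subseteq> S" and opC: "\<And>x. x \<in> C \<Longrightarrow> \<exists>r>0. \<forall>y\<in>S. d x y < r \<longrightarrow> y \<in> C"
      and p: "\<And>x r. x \<in> S \<Longrightarrow> 0 < r \<Longrightarrow> measure K {y\<in>S. d x y < r} = p r" "\<And>r. 0 < r \<Longrightarrow> 0 < p r"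
      and q: "\<And>x r. x \<in> S \<Longrightarrow> 0 < r \<Longrightarrow> measure L {y\<in>S. d x y < r} = q r" "\<And>r. 0 < r \<Longrightarrow> 0 < q r"
    for K L :: "'a measure" and C and p q :: "real \<Rightarrow> real"
  proof -
    interpret K: finite_measure K by (rule K)
    interpret L: finite_measure L by (rule L)
    interpret KL: pair_sigma_finite K L ..
    note [measurable_cong] = K(2) L(2)
    note [measurable] = C(1) S
    have dKL [measurable]: "(\<lambda>(x, y). d x y) \<in> borel_measurable (K \<Otimes>\<^sub>M L)"
      using d by (simp cong: measurable_cong_sets add: sets_pair_measure_cong[OF K(2) L(2)])
    have dK: "(\<lambda>y. d x y) \<in> borel_measurable L" if "x \<in> space M" for x
      using that measurable_Pair2[OF dKL] sets_eq_imp_space_eq[OF K(2)] by simp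
    define Cn where "Cn n x = {y\<in>C. d x y < r n}" for n x
    have Cn_sets: "Cn n x \<in> sets M" if "x \<in> C" for n x
    proof -
      have "x \<in> space M" using that C sets.sets_into_space by blast
      then have [measurable]: "(\<lambda>y. d x y) \<in> borel_measurable L" by (rule dK)
      have "{y \<in> space L. y \<in> C \<and> d x y < r n} \<in> sets L" by measurable
      also have "{y \<in> space L. y \<in> C \<and> d x y < r n} = Cn n x"
        using C(2) SM(1) sets_eq_imp_space_eq[OF L(2)] by (auto simp: Cn_def)
      finally show ?thesis using L by simp
    qed
    have ball_sets: "{y\<in>S. d x y < r n} \<in> sets M" if "x \<in> S" for n x
    proof -
      have "x \<in> space M" using that SM by auto
      then have [measurable]: "(\<lambda>y. d x y) \<in> borel_measurable L" by (rule dK)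
      have "{y \<in> space L. y \<in> S \<and> d x y < r n} \<in> sets L" by measurable
      also have "{y \<in> space L. y \<in> S \<and> d x y < r n} = {y\<in>S. d x y < r n}"
        using SM sets_eq_imp_space_eq[OF L(2)] by auto
      finally show ?thesis using L by simp
    qed
    define F where "F n x = (\<integral>\<^sup>+y. indicator {p\<in>space (K \<Otimes>\<^sub>M L). fst p \<in> C \<and> snd p \<in> C \<and> d (fst p) (snd p) < r n} (x, y) \<partial>L)" for n x
    have FE: "F n x = indicator C x * emeasure L (Cn n x)" if "x \<in> space K" for n x
    proof (cases "x \<in> C")
      case True
      have "F n x = (\<integral>\<^sup>+y. indicator (Cn n x) y \<partial>L)"
        unfolding F_def using True that
        by (intro nn_integral_cong) (auto simp: indicator_def Cn_def space_pair_measure)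
      also have "\<dots> = emeasure L (Cn n x)" using Cn_sets[OF True] L by (intro nn_integral_indicator) simp
      finally show ?thesis using True by simp
    qed (auto simp: F_def indicator_def)
    have F_meas [measurable]: "F n \<in> borel_measurable K" for n
      unfolding F_def by measurable
    define u where "u n x = enn2real (F n x) / q (r n)" for n x
    have u_meas [measurable]: "u n \<in> borel_measurable K" for n unfolding u_def by measurable
    have u_eq: "u n x = indicator C x * measure L (Cn n x) / q (r n)" if "x \<in> space K" for n x
      unfolding u_def FE[OF that] measure_def by (auto simp: indicator_def)
    have Cn_sub: "measure L (Cn n x) \<le> q (r n)" if "x \<in> C" for n x
    proof -
      have xS: "x \<in> S" using that C by auto
      have "measure L (Cn n x) \<le> measure L {y\<in>S. d x y < r n}"
        using ball_sets[OF xS] L C by (intro L.finite_measure_mono) (auto simp: Cn_def)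
      then show ?thesis using q(1)[OF xS r] by simp
    qed
    have u01: "0 \<le> u n x" "u n x \<le> indicator C x" if "x \<in> space K" for n x
      using Cn_sub[of x n] q(2)[OF r[of n]] that by (auto simp: u_eq indicator_def)
    have u_lim: "(\<lambda>n. u n x) \<longlonglongrightarrow> indicator C x" if x: "x \<in> space K" for x
    proof (cases "x \<in> C")
      case True
      obtain e where e: "e > 0" "\<And>y. y \<in> S \<Longrightarrow> d x y < e \<Longrightarrow> y \<in> C" using opC[OF True] by blast
      have "eventually (\<lambda>n. r n < e) sequentially" using r_lim e(1) by (rule order_tendstoD)
      then have "eventually (\<lambda>n. u n x = indicator C x) sequentially"
      proof eventually_elim
        case (elim n)
        then have "Cn n x = {y\<in>S. d x y < r n}" using e(2) C by (fastforce simp: Cn_def)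
        then have "measure L (Cn n x) = q (r n)" using q(1)[of x "r n"] r True C by auto
        then show ?case using True q(2)[OF r[of n]] x by (simp add: u_eq)
      qed
      then show ?thesis by (rule tendsto_eventually)
    qed (use x in \<open>simp add: u_eq\<close>)
    have int_C: "integrable K (indicator C :: 'a \<Rightarrow> real)" using C K by (intro integrable_real_indicator) (auto simp: K.emeasure_eq_measure)
    have "(\<lambda>n. \<integral>x. u n x \<partial>K) \<longlonglongrightarrow> (\<integral>x. indicator C x \<partial>K)"
      using u_lim u01 by (intro integral_dominated_convergence[OF _ _ int_C]) auto
    moreover have "(\<integral>x. indicator C x \<partial>K) = measure K C"
      using C K sets.sets_into_space[of C K] by (simp add: Int_absorb2)
    moreover have "(\<integral>x. u n x \<partial>K) \<le> p (r n) / q (r n) * measure L C" for n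
    proof -
      have qp: "q (r n) > 0" by (intro q r)
      have "(\<integral>\<^sup>+x. F n x \<partial>K) = (\<integral>\<^sup>+y. \<integral>\<^sup>+x. indicator {p\<in>space (K \<Otimes>\<^sub>M L). fst p \<in> C \<and> snd p \<in> C \<and> d (fst p) (snd p) < r n} (x, y) \<partial>K \<partial>L)"
        unfolding F_def by (rule KL.Fubini'[symmetric]) measurable
      also have "\<dots> \<le> (\<integral>\<^sup>+y. ennreal (p (r n)) * indicator C y \<partial>L)"
      proof (rule nn_integral_mono)
        fix y assume y: "y \<in> space L"
        show "(\<integral>\<^sup>+x. indicator {p\<in>space (K \<Otimes>\<^sub>M L). fst p \<in> C \<and> snd p \<in> C \<and> d (fst p) (snd p) < r n} (x, y) \<partial>K)
            \<le> ennreal (p (r n)) * indicator C y"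
        proof (cases "y \<in> C")
          case True
          then have yS: "y \<in> S" using C by auto
          have "(\<integral>\<^sup>+x. indicator {p\<in>space (K \<Otimes>\<^sub>M L). fst p \<in> C \<and> snd p \<in> C \<and> d (fst p) (snd p) < r n} (x, y) \<partial>K)
            \<le> (\<integral>\<^sup>+x. indicator {x\<in>S. d y x < r n} x \<partial>K)"
            using C by (intro nn_integral_mono) (auto simp: indicator_def sym)
          also have "\<dots> = emeasure K {x\<in>S. d y x < r n}"
            using ball_sets[OF yS] K by (intro nn_integral_indicator) simp
          also have "\<dots> = ennreal (p (r n))" using p(1)[OF yS r[of n]] by (simp add: K.emeasure_eq_measure)
          finally show ?thesis using True by simp
        next
          case False
          then have "(\<integral>\<^sup>+x. indicator {p\<in>space (K \<Otimes>\<^sub>M L). fst p \<in> C \<and> snd p \<in> C \<and> d (fst p) (snd p) < r n} (x, y) \<partial>K) = (\<integral>\<^sup>+x. 0 \<partial>K)"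
            by (intro nn_integral_cong) (auto simp: indicator_def)
          then show ?thesis by simp
        qed
      qed
      also have "\<dots> = ennreal (p (r n) * measure L C)"
        using C L p(2)[OF r[of n]] by (simp add: nn_integral_cmult_indicator L.emeasure_eq_measure ennreal_mult')
      finally have F_le: "(\<integral>\<^sup>+x. F n x \<partial>K) \<le> ennreal (p (r n) * measure L C)" .
      have F_fin: "F n x < \<infinity>" if "x \<in> space K" for x
        unfolding FE[OF that] by (auto simp: indicator_def L.emeasure_eq_measure)
      have "(\<integral>x. u n x \<partial>K) = enn2real (\<integral>\<^sup>+x. ennreal (u n x) \<partial>K)"
        by (rule integral_eq_nn_integral) (use u01 in auto)
      also have "(\<integral>\<^sup>+x. ennreal (u n x) \<partial>K) = (\<integral>\<^sup>+x. ennreal (1 / q (r n)) * F n x \<partial>K)"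
      proof (rule nn_integral_cong)
        fix x assume x: "x \<in> space K"
        have "ennreal (u n x) = ennreal (1 / q (r n)) * ennreal (enn2real (F n x))"
          unfolding u_def using qp by (subst ennreal_mult[symmetric]) auto
        then show "ennreal (u n x) = ennreal (1 / q (r n)) * F n x" using F_fin[OF x] by simp
      qed
      also have "\<dots> = ennreal (1 / q (r n)) * (\<integral>\<^sup>+x. F n x \<partial>K)" by (rule nn_integral_cmult) simp
      also have "enn2real \<dots> \<le> enn2real (ennreal (1 / q (r n)) * ennreal (p (r n) * measure L C))"
        using F_le by (intro enn2real_mono mult_left_mono) (auto simp: ennreal_mult_less_top)
      also have "\<dots> = p (r n) / q (r n) * measure L C"
        using qp p(2)[OF r[of n]] by (simp add: enn2real_mult)
      finally show ?thesis .
    qed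
    moreover have "0 \<le> (\<integral>x. u n x \<partial>K)" for n by (rule Bochner_Integration.integral_nonneg) (use u01 in auto)
    ultimately show ?thesis by (intro exI[of _ "\<lambda>n. \<integral>x. u n x \<partial>K"]) auto
  qed
  obtain a where a: "a \<longlonglongrightarrow> measure M A" "\<And>n. 0 \<le> a n" "\<And>n. a n \<le> g (r n) / h (r n) * measure N A"
    using key[of M N A g h] fin sets_eq A opA g h by auto
  obtain b where b: "b \<longlonglongrightarrow> measure N B" "\<And>n. 0 \<le> b n" "\<And>n. b n \<le> h (r n) / g (r n) * measure M B"
    using key[of N M B h g] fin sets_eq B opB g h by auto
  have "a n * b n \<le> measure N A * measure M B" for n
  proof -
    have "a n * b n \<le> (g (r n) / h (r n) * measure N A) * (h (r n) / g (r n) * measure M B)"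
      using a b g(2)[OF r[of n]] h(2)[OF r[of n]] by (intro mult_mono) auto
    also have "\<dots> = measure N A * measure M B"
      using g(2)[OF r[of n]] h(2)[OF r[of n]] by (simp add: field_simps)
    finally show ?thesis .
  qed
  then show ?thesis
    using tendsto_mult[OF a(1) b(1)] by (intro LIMSEQ_le_const2) auto
qed

section \<open>Finiteness of the Hausdorff measure of the sphere\<close>

lemma vnorm_nonneg [simp]: "0 \<le> vnorm n x"
  by (simp add: vnorm_def)

lemma vnorm_cmult: "vnorm n (\<lambda>i. c * x i) = \<bar>c\<bar> * vnorm n x"
  unfolding vnorm_def using L2_set_right_distrib[of "\<bar>c\<bar>" x "{..<n}"]
  by (simp add: L2_set_def power_mult_distrib)

lemma vnorm_add_le: "vnorm n (\<lambda>i. x i + y i) \<le> vnorm n x + vnorm n y"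
  unfolding vnorm_def by (rule L2_set_triangle_ineq)

lemma vnorm_minus_commute: "vnorm n (\<lambda>i. x i - y i) = vnorm n (\<lambda>i. y i - x i)"
  by (simp add: vnorm_def L2_set_def power2_commute)

lemma vnorm_diff_le: "\<bar>vnorm n x - vnorm n y\<bar> \<le> vnorm n (\<lambda>i. x i - y i)"
  using vnorm_add_le[of n "\<lambda>i. x i - y i" y] vnorm_add_le[of n "\<lambda>i. y i - x i" x]
  by (simp add: vnorm_minus_commute[of n y x])

lemma hausdorff_pre_finite_cover_le:
  assumes "finite K" "A \<subseteq> (\<Union>f\<in>K. C f)" "\<And>f. f \<in> K \<Longrightarrow> C f \<subseteq> mspace m" "0 \<le> \<delta>"
    and diam: "\<And>f x y. f \<in> K \<Longrightarrow> x \<in> C f \<Longrightarrow> y \<in> C f \<Longrightarrow> mdist m x y \<le> \<delta>"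
  shows "hausdorff_pre m k \<delta> A \<le> ennreal (real (card K) * (unit_ball_vol (real k) / 2 ^ k * \<delta> ^ k))"
proof -
  obtain b where b: "bij_betw b {..<card K} K"
    using ex_bij_betw_nat_finite[OF assms(1)] by (auto simp: atLeast0LessThan)
  define D where "D i = (if i < card K then C (b i) else {})" for i
  have bK: "i < card K \<Longrightarrow> b i \<in> K" for i using b by (auto simp: bij_betw_def)
  have diam': "ediam m (D i) \<le> ennreal \<delta>" for i
    unfolding ediam_def D_def using diam[OF bK] by (auto intro!: SUP_least ennreal_leI)
  have "D \<in> hcovers m \<delta> A"
  proof -
    have "A \<subseteq> (\<Union>i. D i)"
    proof
      fix x assume "x \<in> A"
      then obtain f where f: "f \<in> K" "x \<in> C f" using assms(2) by auto
      then obtain i where "i < card K" "f = b i" using b by (auto simp: bij_betw_def)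
      then have "x \<in> D i" using f by (simp add: D_def)
      then show "x \<in> (\<Union>i. D i)" by auto
    qed
    then show ?thesis using diam' assms(3)[OF bK] by (auto simp: hcovers_def D_def split: if_splits)
  qed
  then have "hausdorff_pre m k \<delta> A \<le> (\<Sum>i. hweight m k (D i))"
    unfolding hausdorff_pre_alt by (rule INF_lower)
  also have "\<dots> = (\<Sum>i<card K. hweight m k (D i))"
    by (rule suminf_finite) (auto simp: D_def)
  also have "\<dots> \<le> (\<Sum>i<card K. ennreal (unit_ball_vol (real k) / 2 ^ k * \<delta> ^ k))"
  proof (rule sum_mono)
    fix i
    have "hweight m k (D i) \<le> ennreal (unit_ball_vol (real k) / 2 ^ k) * ennreal \<delta> ^ k"
      unfolding hweight_def using diam'[of i] by (auto intro!: mult_left_mono power_mono)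
    then show "hweight m k (D i) \<le> ennreal (unit_ball_vol (real k) / 2 ^ k * \<delta> ^ k)"
      using assms(4) by (subst ennreal_mult) (simp_all add: ennreal_power)
  qed
  also have "\<dots> = ennreal (real (card K) * (unit_ball_vol (real k) / 2 ^ k * \<delta> ^ k))"
    using assms(4) by (subst (2) ennreal_mult) (simp_all add: ennreal_of_nat_eq_real_of_nat)
  finally show ?thesis .
qed

text \<open>Points of the sphere are projected to the surface of the cube by dividing by the largest
  modulus of a coordinate. A grid of mesh \<open>1 / m\<close> on the \<open>2 * n\<close> faces
  needs at most \<open>2 * n * (2 * m + 1) ^ (n - 1)\<close> cells, each of spherical diameter at
  most \<open>2 * sqrt n / m\<close>, so the cost of the cover is bounded independently of
  \<open>m\<close>.\<close>

lemma hausdorff_unit_sphere_finite: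
  assumes "1 \<le> n"
  shows "hausdorff (Rn n) (n - 1) (unit_sphere n) < \<infinity>"
proof -
  define c where "c = unit_ball_vol (real (n-1)) / 2 ^ (n-1)"
  have c0: "0 \<le> c" by (simp add: c_def)
  define K where "K = 2 * real n * (c * (6 * sqrt n) ^ (n-1))"
  define mx where "mx x = Max ((\<lambda>i. \<bar>x i\<bar>) ` {..<n})" for x :: "nat \<Rightarrow> real"
  have ne: "{..<n} \<noteq> {}" using assms by (simp add: lessThan_empty_iff)
  have mx_ge: "\<bar>x i\<bar> \<le> mx x" if "i < n" for x i using that by (auto simp: mx_def)
  have mx_ex: "\<exists>i<n. mx x = \<bar>x i\<bar>" for x
  proof -
    have "mx x \<in> (\<lambda>i. \<bar>x i\<bar>) ` {..<n}" unfolding mx_def using ne by (intro Max_in) auto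
    then show ?thesis by auto
  qed
  have mx_le: "mx x \<le> vnorm n x" for x
    using mx_ex[of x] abs_component_le_vnorm[of _ n x] by auto
  have mx_pos: "0 < mx x" if "vnorm n x = 1" for x
  proof (rule ccontr)
    assume "\<not> 0 < mx x"
    then have "\<forall>i<n. x i = 0" using mx_ge[of _ x] by (metis abs_le_zero_iff linorder_not_less order_trans)
    then have "vnorm n x = 0" by (simp add: vnorm_def L2_set_def)
    with that show False by simp
  qed
  have grid: "hausdorff_pre (Rn n) (n-1) (2 * sqrt n / real m) (unit_sphere n) \<le> ennreal K"
    if m: "0 < m" for m :: nat
  proof -
    \<comment> \<open>Cells are labelled by integer parts. On the face where coordinate
      \<open>i\<close> has the largest modulus its label is exactly \<open>m\<close> or
      \<open>- m\<close>, which leaves \<open>n - 1\<close> free labels.\<close>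
    let ?F = "\<lambda>i s j. if j = i then {s} else {- int m .. int m}"
    let ?K = "(\<Union>p\<in>{..<n}\<times>{- int m, int m}. PiE {..<n} (?F (fst p) (snd p)))"
    let ?C = "\<lambda>f :: nat \<Rightarrow> int. {x \<in> unit_sphere n. \<forall>j<n. \<lfloor>real m * (x j / mx x)\<rfloor> = f j}"
    have finK: "finite ?K" by (auto intro!: finite_PiE)
    have "card ?K \<le> (\<Sum>p\<in>{..<n}\<times>{- int m, int m}. card (PiE {..<n} (?F (fst p) (snd p))))"
      by (rule card_UN_le) simp
    also have "\<dots> \<le> (\<Sum>p\<in>{..<n}\<times>{- int m, int m}. (2*m+1) ^ (n-1))"
    proof (rule sum_mono)
      fix p assume "p \<in> {..<n}\<times>{- int m, int m}"
      then have p: "fst p \<in> {..<n}" by auto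
      have "card (PiE {..<n} (?F (fst p) (snd p))) = (\<Prod>j<n. card (?F (fst p) (snd p) j))"
        by (simp add: card_PiE)
      also have "\<dots> = (\<Prod>j\<in>{..<n}-{fst p}. card (?F (fst p) (snd p) j))"
        using p by (subst prod.remove[of _ "fst p"]) auto
      also have "\<dots> = (\<Prod>j\<in>{..<n}-{fst p}. 2*m+1)" by (intro prod.cong) auto
      also have "\<dots> = (2*m+1) ^ (n-1)" using p by (simp only: prod_constant) simp
      finally show "card (PiE {..<n} (?F (fst p) (snd p))) \<le> (2*m+1) ^ (n-1)" by simp
    qed
    also have "\<dots> = 2 * n * (2*m+1) ^ (n-1)" using m by (simp add: card_cartesian_product)
    finally have card_le: "real (card ?K) \<le> 2 * real n * (3 * real m) ^ (n-1)"
    proof -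
      assume "card ?K \<le> 2 * n * (2*m+1) ^ (n-1)"
      then have "real (card ?K) \<le> real (2 * n * (2*m+1) ^ (n-1))" by (simp only: of_nat_le_iff)
      also have "\<dots> = 2 * real n * (2 * real m + 1) ^ (n-1)" by (simp add: add.commute)
      also have "\<dots> \<le> 2 * real n * (3 * real m) ^ (n-1)"
        using m by (intro mult_left_mono power_mono) auto
      finally show ?thesis .
    qed
    have "hausdorff_pre (Rn n) (n-1) (2 * sqrt n / real m) (unit_sphere n)
        \<le> ennreal (real (card ?K) * (c * (2 * sqrt n / real m) ^ (n-1)))"
      unfolding c_def
    proof (rule hausdorff_pre_finite_cover_le[OF finK, where C = ?C])
      show "unit_sphere n \<subseteq> (\<Union>f\<in>?K. ?C f)"
      proof
        fix x assume x: "x \<in> unit_sphere n"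
        then have mp: "0 < mx x" by (intro mx_pos) (simp add: unit_sphere_def)
        define f where "f = restrict (\<lambda>j. \<lfloor>real m * (x j / mx x)\<rfloor>) {..<n}"
        obtain i where i: "i < n" "mx x = \<bar>x i\<bar>" using mx_ex by blast
        define s where "s = (if x i < 0 then - int m else int m)"
        have "x i / mx x = (if x i < 0 then -1 else 1)" using i mp by (auto simp: abs_if split: if_splits)
        then have fi: "f i = s"
          using i by (auto simp: f_def s_def floor_eq_iff)
        have "f j \<in> {- int m .. int m}" if "j < n" for j
        proof -
          have "\<bar>x j / mx x\<bar> \<le> 1" using mx_ge[OF that, of x] mp by simp
          then have "\<bar>real m * (x j / mx x)\<bar> \<le> real m * 1"
            unfolding abs_mult by (intro mult_mono) auto
          then have "\<lfloor>real m * (x j / mx x)\<rfloor> \<in> {- int m .. int m}"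
            unfolding atLeastAtMost_iff abs_le_iff by linarith
          then show ?thesis using that by (simp add: f_def)
        qed
        then have "f \<in> PiE {..<n} (?F i s)" using fi by (auto simp: PiE_iff f_def)
        moreover have "(i, s) \<in> {..<n}\<times>{- int m, int m}" using i by (auto simp: s_def)
        ultimately have "f \<in> ?K" by (intro UN_I[of "(i, s)"]) (simp_all only: fst_conv snd_conv)
        moreover have "x \<in> ?C f" using x by (auto simp: f_def)
        ultimately show "x \<in> (\<Union>f\<in>?K. ?C f)" by blast
      qed
      show "?C f \<subseteq> mspace (Rn n)" for f by (auto simp: unit_sphere_def)
      show "0 \<le> 2 * sqrt n / real m" by simp
      fix f x y assume "x \<in> ?C f" "y \<in> ?C f"
      then have x: "vnorm n x = 1" "\<And>j. j < n \<Longrightarrow> \<lfloor>real m * (x j / mx x)\<rfloor> = f j"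
        and y: "vnorm n y = 1" "\<And>j. j < n \<Longrightarrow> \<lfloor>real m * (y j / mx y)\<rfloor> = f j"
        by (auto simp: unit_sphere_def)
      define a b where "a = mx x" and "b = mx y"
      have a: "0 < a" "a \<le> 1" and b: "0 < b" using x y mx_pos mx_le[of x] by (auto simp: a_def b_def)
      define w where "w = (\<lambda>i. (1/a) * x i - (1/b) * y i)"
      have w: "\<bar>w i\<bar> \<le> 1 / real m" if "i < n" for i
      proof -
        have "\<bar>real m * (x i / a) - real m * (y i / b)\<bar> \<le> 1"
          using x(2)[OF that] y(2)[OF that] unfolding a_def b_def by linarith
        also have "real m * (x i / a) - real m * (y i / b) = real m * w i" by (simp add: w_def algebra_simps)
        finally show ?thesis using m by (simp add: abs_mult field_simps)
      qed
      have "vnorm n w \<le> sqrt (\<Sum>i<n. (1 / real m)\<^sup>2)"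
        unfolding vnorm_def L2_set_def using w by (intro real_sqrt_le_mono sum_mono) (metis abs_le_square_iff abs_of_nonneg lessThan_iff of_nat_0_le_iff zero_le_divide_1_iff)
      also have "\<dots> = sqrt n / real m" using m by (simp add: real_sqrt_divide power_divide)
      finally have wn: "vnorm n w \<le> sqrt n / real m" .
      \<comment> \<open>\<open>x / a\<close> and \<open>y / b\<close> have norms
        \<open>1 / a\<close> and \<open>1 / b\<close>, so the difference of the scales is controlled
        by the distance of the projected points.\<close>
      have inv: "\<bar>1/a - 1/b\<bar> \<le> vnorm n w"
        using vnorm_diff_le[of n "\<lambda>i. (1/a) * x i" "\<lambda>i. (1/b) * y i"] a b x y
        by (simp only: vnorm_cmult w_def) simp
      have "vnorm n (\<lambda>i. x i - y i) = vnorm n (\<lambda>i. a * w i + (a - b) / b * y i)"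
        using a b by (intro arg_cong[where f = "vnorm n"]) (auto simp: w_def field_simps)
      also have "\<dots> \<le> vnorm n (\<lambda>i. a * w i) + vnorm n (\<lambda>i. (a - b) / b * y i)" by (rule vnorm_add_le)
      also have "\<dots> = a * vnorm n w + \<bar>(a - b) / b\<bar>" using a(1) by (simp only: vnorm_cmult y(1) abs_of_pos mult_1_right)
      also have "(a - b) / b = - (a * (1/a - 1/b))" using a b by (simp add: field_simps)
      also have "\<bar>- (a * (1/a - 1/b))\<bar> = a * \<bar>1/a - 1/b\<bar>" using a by (simp add: abs_mult)
      also have "a * vnorm n w + a * \<bar>1/a - 1/b\<bar> \<le> 1 * vnorm n w + 1 * vnorm n w"
        using a inv by (intro add_mono mult_mono) auto
      also have "\<dots> \<le> 2 * sqrt n / real m" using wn by simp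
      finally show "mdist (Rn n) x y \<le> 2 * sqrt n / real m" by simp
    qed
    also have "\<dots> \<le> ennreal K"
    proof (rule ennreal_leI)
      have "real (card ?K) * (c * (2 * sqrt n / real m) ^ (n-1))
          \<le> (2 * real n * (3 * real m) ^ (n-1)) * (c * (2 * sqrt n / real m) ^ (n-1))"
        using card_le c0 by (intro mult_right_mono) auto
      also have "\<dots> = 2 * real n * (c * ((3 * real m) * (2 * sqrt n / real m)) ^ (n-1))"
        by (simp only: power_mult_distrib mult_ac)
      also have "(3 * real m) * (2 * sqrt n / real m) = 6 * sqrt n" using m by simp
      finally show "real (card ?K) * (c * (2 * sqrt n / real m) ^ (n-1)) \<le> K" by (simp add: K_def)
    qed
    finally show ?thesis .
  qed
  have "hausdorff (Rn n) (n - 1) (unit_sphere n) \<le> ennreal K"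
    unfolding hausdorff_def
  proof (rule SUP_least)
    fix \<delta> :: real assume "\<delta> \<in> {0<..}"
    moreover have "(\<lambda>m. 2 * sqrt n / real (Suc m)) \<longlonglongrightarrow> 0" by real_asymp
    ultimately have "eventually (\<lambda>m. 2 * sqrt n / real (Suc m) < \<delta>) sequentially"
      by (intro order_tendstoD) auto
    then obtain m where "2 * sqrt n / real (Suc m) < \<delta>" by (auto simp: eventually_sequentially)
    then have "hausdorff_pre (Rn n) (n-1) \<delta> (unit_sphere n)
        \<le> hausdorff_pre (Rn n) (n-1) (2 * sqrt n / real (Suc m)) (unit_sphere n)"
      by (intro hausdorff_pre_antimono) auto
    also have "\<dots> \<le> ennreal K" by (rule grid) simp
    finally show "hausdorff_pre (Rn n) (n-1) \<delta> (unit_sphere n) \<le> ennreal K" .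
  qed
  then show ?thesis by (metis ennreal_less_top infinity_ennreal_def le_less_trans)
qed

section \<open>Rotations and the cone measure\<close>

definition lebn :: "nat \<Rightarrow> (nat \<Rightarrow> real) measure" where
  "lebn n = PiM {..<n} (\<lambda>_. lborel)"

definition shear :: "nat \<Rightarrow> nat \<Rightarrow> real \<Rightarrow> (nat \<Rightarrow> real) \<Rightarrow> nat \<Rightarrow> real" where
  "shear i j a x = x(i := x i + a * x j)"

lemma component_measurable_lebn [measurable]: "i < n \<Longrightarrow> (\<lambda>x. x i) \<in> borel_measurable (lebn n)"
  unfolding lebn_def by measurable

lemma measurable_lebnI:
  assumes "\<And>i. i < n \<Longrightarrow> (\<lambda>x. f x i) \<in> borel_measurable M"
    and "\<And>x i. x \<in> space M \<Longrightarrow> n \<le> i \<Longrightarrow> f x i = undefined"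
  shows "f \<in> measurable M (lebn n)"
  unfolding lebn_def using assms
  by (intro measurable_PiM_single') (auto simp: PiE_iff extensional_def)

lemma space_lebn_undefined: "x \<in> space (lebn n) \<Longrightarrow> n \<le> i \<Longrightarrow> x i = undefined"
  by (auto simp: lebn_def space_PiM PiE_iff extensional_def)

lemma shear_measurable: "i < n \<Longrightarrow> j < n \<Longrightarrow> shear i j a \<in> measurable (lebn n) (lebn n)"
  unfolding shear_def
  by (rule measurable_lebnI) (auto simp: space_lebn_undefined fun_upd_def)

text \<open>When \<open>x i\<close> is integrated first, the shear is a translation of that
  coordinate by a constant.\<close>

lemma distr_shear:
  assumes ij: "i < n" "j < n" "i \<noteq> j"
  shows "distr (lebn n) (lebn n) (shear i j a) = lebn n"
proof (rule measure_eqI)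
  fix B assume "B \<in> sets (distr (lebn n) (lebn n) (shear i j a))"
  then have B [measurable]: "B \<in> sets (lebn n)" by simp
  interpret product_sigma_finite "\<lambda>_::nat. lborel :: real measure" by standard
  have ins: "{..<n} = insert i ({..<n} - {i})" using ij by auto
  have [measurable]: "shear i j a \<in> measurable (lebn n) (lebn n)" using ij by (intro shear_measurable)
  have expand: "(\<integral>\<^sup>+x. f x \<partial>lebn n) = (\<integral>\<^sup>+ x. \<integral>\<^sup>+ y. f (x(i := y)) \<partial>lborel \<partial>PiM ({..<n} - {i}) (\<lambda>_. lborel))"
    if "f \<in> borel_measurable (lebn n)" for f
    using that unfolding lebn_def
    by (subst (1) ins, subst product_nn_integral_insert) (auto simp: insert_absorb ij)
  have "emeasure (distr (lebn n) (lebn n) (shear i j a)) B = (\<integral>\<^sup>+x. indicator B (shear i j a x) \<partial>lebn n)"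
    using nn_integral_distr[of "shear i j a" "lebn n" "lebn n" "indicator B"] by simp
  also have "\<dots> = (\<integral>\<^sup>+ x. \<integral>\<^sup>+ y. indicator B (shear i j a (x(i := y))) \<partial>lborel \<partial>PiM ({..<n} - {i}) (\<lambda>_. lborel))"
    by (rule expand) measurable
  also have "\<dots> = (\<integral>\<^sup>+ x. \<integral>\<^sup>+ y. indicator B (x(i := y)) \<partial>lborel \<partial>PiM ({..<n} - {i}) (\<lambda>_. lborel))"
  proof (rule nn_integral_cong)
    fix x assume x: "x \<in> space (PiM ({..<n} - {i}) (\<lambda>_. lborel :: real measure))"
    have upd: "(\<lambda>y. x(i := y)) \<in> measurable borel (lebn n)"
      using x ij by (intro measurable_lebnI) (auto simp: fun_upd_def space_PiM PiE_iff extensional_def)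
    then have [measurable]: "(\<lambda>y. indicator B (x(i := y)) :: ennreal) \<in> borel_measurable borel" by measurable
    have "(\<integral>\<^sup>+ y. indicator B (x(i := y)) \<partial>lborel) = (\<integral>\<^sup>+ y. indicator B (x(i := a * x j + 1 * y)) \<partial>lborel)"
      by (subst nn_integral_real_affine[where c = 1 and t = "a * x j"]) auto
    then show "(\<integral>\<^sup>+ y. indicator B (shear i j a (x(i := y))) \<partial>lborel) = (\<integral>\<^sup>+ y. indicator B (x(i := y)) \<partial>lborel)"
      using ij by (simp add: shear_def add.commute)
  qed
  also have "\<dots> = (\<integral>\<^sup>+x. indicator B x \<partial>lebn n)" by (rule expand[symmetric]) measurable
  finally show "emeasure (distr (lebn n) (lebn n) (shear i j a)) B = emeasure (lebn n) B" by simp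
qed simp

definition givens :: "nat \<Rightarrow> nat \<Rightarrow> real \<Rightarrow> real \<Rightarrow> (nat \<Rightarrow> real) \<Rightarrow> nat \<Rightarrow> real" where
  "givens i j c s x = x(i := c * x i - s * x j, j := s * x i + c * x j)"

text \<open>All that is used of an orthogonal map, listed in a form inherited by compositions.
  Homogeneity compares only the first \<open>n\<close> coordinates, since points of
  \<open>lebn n\<close> are \<open>undefined\<close> beyond them and points of \<open>Rn n\<close>
  are 0 there.\<close>

definition rotation :: "nat \<Rightarrow> ((nat \<Rightarrow> real) \<Rightarrow> nat \<Rightarrow> real) \<Rightarrow> bool" where
  "rotation n T \<longleftrightarrow> bij T \<and> (\<forall>x i. n \<le> i \<longrightarrow> T x i = x i) \<and>
     (\<forall>x z c. (\<forall>j<n. z j = c * x j) \<longrightarrow> (\<forall>j<n. T z j = c * T x j)) \<and>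
     (\<forall>x y. vnorm n (\<lambda>i. T x i - T y i) = vnorm n (\<lambda>i. x i - y i)) \<and>
     T \<in> borel_measurable borel \<and> T \<in> measurable (lebn n) (lebn n) \<and>
     distr (lebn n) (lebn n) T = lebn n"

lemma rotation_id: "rotation n (\<lambda>x. x)"
  by (auto simp: rotation_def bij_def distr_id2)

lemma rotation_comp:
  assumes S: "rotation n S" and T: "rotation n T"
  shows "rotation n (S \<circ> T)"
proof -
  have "bij (S \<circ> T)" using S T by (auto simp: rotation_def intro: bij_comp)
  moreover have "S \<circ> T \<in> borel_measurable borel" "S \<circ> T \<in> measurable (lebn n) (lebn n)"
    using S T unfolding rotation_def by (auto intro: measurable_comp)
  moreover have "distr (lebn n) (lebn n) (S \<circ> T) = lebn n"
    using S T distr_distr[of S "lebn n" "lebn n" T "lebn n"] unfolding rotation_def by auto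
  ultimately show ?thesis using S T unfolding rotation_def by auto
qed

lemma vnorm_sq: "(vnorm n x)\<^sup>2 = (\<Sum>i<n. (x i)\<^sup>2)"
  by (simp add: vnorm_def L2_set_def sum_nonneg)

text \<open>A plane rotation is a product of three shears, hence preserves Lebesgue measure. The
  outer shears have the coefficient \<open>- s / (1 + c)\<close>, minus the tangent of half the
  angle, which excludes the half turn \<open>c = -1\<close>.\<close>

lemma rotation_givens:
  assumes ij: "i < n" "j < n" "i \<noteq> j" and cs: "c\<^sup>2 + s\<^sup>2 = 1" "c \<noteq> -1"
  shows "rotation n (givens i j c s)"
proof -
  have inv: "givens i j c (- t) (givens i j c t x) = x" if "c\<^sup>2 + t\<^sup>2 = 1" for t x
  proof
    fix k
    have "c * (c * x i - t * x j) + t * (t * x i + c * x j) = (c\<^sup>2 + t\<^sup>2) * x i"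
      "- t * (c * x i - t * x j) + c * (t * x i + c * x j) = (c\<^sup>2 + t\<^sup>2) * x j"
      by (simp_all add: power2_eq_square algebra_simps)
    then show "givens i j c (- t) (givens i j c t x) k = x k"
      using that ij by (auto simp: givens_def)
  qed
  have "bij (givens i j c s)"
    using inv[OF cs(1)] inv[of "- s"] cs(1) by (intro o_bij[of "givens i j c (- s)"]) (auto simp: fun_eq_iff)
  moreover have norm: "vnorm n (givens i j c s x) = vnorm n x" for x
  proof -
    have "(\<Sum>k<n. (givens i j c s x k)\<^sup>2) = (\<Sum>k<n. (x k)\<^sup>2)"
    proof -
      have split: "(\<Sum>k<n. f k) = f i + (f j + (\<Sum>k\<in>{..<n}-{i}-{j}. f k))" for f :: "nat \<Rightarrow> real"
        using ij by (simp add: sum.remove[of "{..<n}" i] sum.remove[of "{..<n}-{i}" j])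
      have "(c * x i - s * x j)\<^sup>2 + (s * x i + c * x j)\<^sup>2 = (c\<^sup>2 + s\<^sup>2) * ((x i)\<^sup>2 + (x j)\<^sup>2)"
        by (simp add: power2_eq_square algebra_simps)
      moreover have "(\<Sum>k\<in>{..<n}-{i}-{j}. (givens i j c s x k)\<^sup>2) = (\<Sum>k\<in>{..<n}-{i}-{j}. (x k)\<^sup>2)"
        by (intro sum.cong) (auto simp: givens_def)
      ultimately show ?thesis using ij cs(1) by (simp add: split givens_def)
    qed
    then show ?thesis by (simp add: vnorm_def L2_set_def)
  qed
  moreover have "(\<lambda>k. givens i j c s x k - givens i j c s y k) = givens i j c s (\<lambda>k. x k - y k)" for x y
    by (auto simp: givens_def fun_eq_iff algebra_simps)
  moreover have "givens i j c s \<in> borel_measurable borel"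
  proof (rule measurable_coordinatewise_then_product)
    fix k
    have [measurable]: "(\<lambda>x::nat\<Rightarrow>real. x l) \<in> borel_measurable borel" for l
      by (intro borel_measurable_continuous_onI continuous_on_product_coordinates)
    show "(\<lambda>x. givens i j c s x k) \<in> borel_measurable borel"
      unfolding givens_def fun_upd_def by measurable
  qed
  moreover have comp: "givens i j c s = shear i j (- s / (1 + c)) \<circ> (shear j i s \<circ> shear i j (- s / (1 + c)))"
  proof
    fix x
    have c1: "1 + c \<noteq> 0" using cs(2) by (simp add: add_eq_0_iff)
    define a where "a = - s / (1 + c)"
    have a: "a * (1 + c) = - s" using c1 by (simp add: a_def)
    have "s\<^sup>2 = (1 + c) * (1 - c)" using cs(1) by (simp add: power2_eq_square algebra_simps)
    then have "s * a = c - 1" using c1 by (simp add: a_def power2_eq_square field_simps)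
    have e: "s * a = c - 1" by fact
    have "x j + s * (x i + a * x j) = s * x i + (1 + s * a) * x j" by (simp add: algebra_simps)
    then have 1: "x j + s * (x i + a * x j) = s * x i + c * x j" using e by simp
    have "x i + a * x j + a * (s * x i + c * x j) = (1 + s * a) * x i + (a * (1 + c)) * x j"
      by (simp add: algebra_simps)
    then have 2: "x i + a * x j + a * (s * x i + c * x j) = c * x i - s * x j" using e a by simp
    show "givens i j c s x = (shear i j (- s / (1 + c)) \<circ> (shear j i s \<circ> shear i j (- s / (1 + c)))) x"
      unfolding a_def[symmetric] using ij 1 2 by (auto simp: givens_def shear_def fun_eq_iff)
  qed
  moreover have sm: "shear i j a \<in> measurable (lebn n) (lebn n)" "shear j i a \<in> measurable (lebn n) (lebn n)" for a
    using ij by (auto intro: shear_measurable)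
  then have "givens i j c s \<in> measurable (lebn n) (lebn n)"
    unfolding comp by (intro measurable_comp[OF _ sm(1)] measurable_comp[OF sm(1) sm(2)])
  moreover have "distr (lebn n) (lebn n) (givens i j c s) = lebn n"
    unfolding comp distr_distr[OF sm(1) measurable_comp[OF sm(1) sm(2)], symmetric]
      distr_distr[OF sm(2) sm(1), symmetric]
    using ij by (simp add: distr_shear)
  moreover have "givens i j c s z k = d * givens i j c s x k" if "\<forall>k<n. z k = d * x k" "k < n" for x z d k
  proof -
    have "z i = d * x i" "z j = d * x j" "z k = d * x k" using that ij by auto
    then show ?thesis by (simp add: givens_def algebra_simps)
  qed
  moreover have "givens i j c s x k = x k" if "n \<le> k" for x k
    using ij that by (auto simp: givens_def)
  ultimately show ?thesis
    unfolding rotation_def by (intro conjI allI impI) (simp_all only:)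
qed

lemma rotation_norm: "rotation n T \<Longrightarrow> vnorm n (T x) = vnorm n x"
proof -
  assume T: "rotation n T"
  have hom: "\<And>x z c. \<forall>j<n. z j = c * x j \<Longrightarrow> \<forall>j<n. T z j = c * T x j"
    and iso: "\<And>x y. vnorm n (\<lambda>i. T x i - T y i) = vnorm n (\<lambda>i. x i - y i)"
    using T unfolding rotation_def by blast+
  have "T (\<lambda>_. 0) j = 0" if "j < n" for j
    using hom[where x = "\<lambda>_. 0" and z = "\<lambda>_. 0" and c = 0] that by simp
  then have "vnorm n (\<lambda>i. T x i - T (\<lambda>_. 0) i) = vnorm n (T x)"
    by (simp add: vnorm_def L2_set_def)
  then show ?thesis using iso[of x "\<lambda>_. 0"] by simp
qed

definition pole :: "nat \<Rightarrow> real" where "pole = (\<lambda>i. if i = 0 then 1 else 0)"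

text \<open>Coordinates 1, 2, ... are annihilated one after another by a plane rotation against
  coordinate 0, which leaves plus or minus the pole.\<close>

lemma rotation_to_pole:
  assumes n: "2 \<le> n" and x: "x \<in> unit_sphere n"
  shows "\<exists>T. rotation n T \<and> T x = pole"
proof -
  have "\<exists>T. rotation n T \<and> (\<forall>j. 0 < j \<and> j < m \<longrightarrow> T x j = 0)" if "m \<le> n" for m
    using that
  proof (induction m)
    case 0 then show ?case using rotation_id by blast
  next
    case (Suc m)
    then obtain T where T: "rotation n T" "\<And>j. 0 < j \<Longrightarrow> j < m \<Longrightarrow> T x j = 0" by auto
    show ?case
    proof (cases "m = 0 \<or> T x m = 0")
      case True
      then show ?thesis using T by (intro exI[of _ T]) (auto simp: less_Suc_eq)
    next
      case False
      define y where "y = T x"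
      define r where "r = sqrt ((y 0)\<^sup>2 + (y m)\<^sup>2)"
      have r: "0 < r" "r\<^sup>2 = (y 0)\<^sup>2 + (y m)\<^sup>2"
        using False by (auto simp: r_def y_def sum_power2_gt_zero_iff)
      have cs: "(y 0 / r)\<^sup>2 + (- y m / r)\<^sup>2 = 1"
        using r(1) by (simp add: power_divide add_divide_distrib[symmetric] flip: r(2))
      have "y 0 / r \<noteq> -1"
      proof
        assume "y 0 / r = - 1"
        with cs have "(- y m / r)\<^sup>2 = 0" by simp
        with False r show False by (simp add: y_def)
      qed
      with cs have R: "rotation n (givens 0 m (y 0 / r) (- y m / r))"
        using False Suc.prems by (intro rotation_givens) auto
      show ?thesis
      proof (intro exI conjI allI impI)
        show "rotation n (givens 0 m (y 0 / r) (- y m / r) \<circ> T)" using R T(1) by (rule rotation_comp)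
        fix j assume "0 < j \<and> j < Suc m"
        then show "(givens 0 m (y 0 / r) (- y m / r) \<circ> T) x j = 0"
          using T(2)[of j] False by (auto simp: givens_def y_def less_Suc_eq)
      qed
    qed
  qed
  then obtain T where T: "rotation n T" "\<And>j. 0 < j \<Longrightarrow> j < n \<Longrightarrow> T x j = 0" by blast
  have "(vnorm n (T x))\<^sup>2 = 1" using x rotation_norm[OF T(1)] by (simp add: unit_sphere_def)
  moreover have "(\<Sum>i<n. (T x i)\<^sup>2) = (T x 0)\<^sup>2"
    using n T(2) by (subst sum.remove[of _ 0]) auto
  ultimately have sq: "(T x 0)\<^sup>2 = 1" by (simp add: vnorm_sq)
  have hi: "T x i = 0" if "n \<le> i" for i using T(1) x that by (auto simp: rotation_def unit_sphere_def)
  show ?thesis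
  proof (cases "T x 0 = 1")
    case True
    then have "T x = pole" using T(2) hi by (auto simp: pole_def fun_eq_iff) (metis leI)
    then show ?thesis using T(1) by blast
  next
    case False
    then have m1: "T x 0 = -1" using sq by (simp add: power2_eq_1_iff)
    \<comment> \<open>The half turn is excluded from \<open>rotation_givens\<close>, so the sign is
      corrected by two quarter turns.\<close>
    let ?Q = "givens 0 1 0 1"
    have Q: "rotation n ?Q" using n by (intro rotation_givens) auto
    have "?Q (?Q (T x)) = pole"
      using T(2) hi m1 n by (auto simp: pole_def fun_eq_iff givens_def) (metis leI)
    then show ?thesis using rotation_comp[OF Q rotation_comp[OF Q T(1)]] by (intro exI[of _ "?Q \<circ> (?Q \<circ> T)"]) auto
  qed
qed

section \<open>The cone measure on the sphere\<close>

lemma borel_measurable_component [measurable]: "(\<lambda>x::nat\<Rightarrow>real. x i) \<in> borel_measurable borel"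
  by (intro borel_measurable_continuous_onI continuous_on_product_coordinates)

lemma borel_measurable_vnorm [measurable]: "vnorm n \<in> borel_measurable borel"
  unfolding vnorm_def L2_set_def by measurable

lemma lebn_measurable_vnorm [measurable]: "vnorm n \<in> borel_measurable (lebn n)"
  unfolding vnorm_def L2_set_def by measurable

lemma unit_sphere_borel [measurable]: "unit_sphere n \<in> sets borel"
proof -
  have "unit_sphere n = {x \<in> space borel. (\<forall>i. n \<le> i \<longrightarrow> x i = 0) \<and> vnorm n x = 1}"
    by (auto simp: unit_sphere_def)
  also have "\<dots> \<in> sets borel" by measurable
  finally show ?thesis .
qed

text \<open>The value 0 beyond the first \<open>n\<close> coordinates moves points of
  \<open>lebn n\<close>, which are \<open>undefined\<close> there, into the carrier of
  \<open>Rn n\<close>.\<close>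

definition sphere_proj :: "nat \<Rightarrow> (nat \<Rightarrow> real) \<Rightarrow> nat \<Rightarrow> real" where
  "sphere_proj n x = (\<lambda>i. if i < n then x i / vnorm n x else 0)"

lemma sphere_proj_measurable [measurable]: "sphere_proj n \<in> borel_measurable (lebn n)"
proof (rule measurable_coordinatewise_then_product)
  fix i show "(\<lambda>x. sphere_proj n x i) \<in> borel_measurable (lebn n)"
    unfolding sphere_proj_def by (cases "i < n") simp_all
qed

text \<open>The volume of the part of the unit ball that lies over a set of directions. Being an
  image measure, it is a Borel measure by construction; the origin is removed because it has no
  direction.\<close>

definition cone_measure :: "nat \<Rightarrow> (nat \<Rightarrow> real) measure" where
  "cone_measure n = distr (density (lebn n) (indicator {x \<in> space (lebn n). 0 < vnorm n x \<and> vnorm n x \<le> 1}))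
     borel (sphere_proj n)"

lemma sets_cone_measure [simp, measurable_cong]: "sets (cone_measure n) = sets borel"
  by (simp add: cone_measure_def)

lemma emeasure_cone_measure:
  assumes [measurable]: "B \<in> sets borel"
  shows "emeasure (cone_measure n) B =
     emeasure (lebn n) {x \<in> space (lebn n). 0 < vnorm n x \<and> vnorm n x \<le> 1 \<and> sphere_proj n x \<in> B}"
proof -
  have "emeasure (cone_measure n) B =
      emeasure (density (lebn n) (indicator {x \<in> space (lebn n). 0 < vnorm n x \<and> vnorm n x \<le> 1}))
        {x \<in> space (lebn n). sphere_proj n x \<in> B}"
    unfolding cone_measure_def by (subst emeasure_distr) (auto intro!: arg_cong[where f = "emeasure _"])
  also have "\<dots> = (\<integral>\<^sup>+x. indicator {x \<in> space (lebn n). 0 < vnorm n x \<and> vnorm n x \<le> 1} x *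
      indicator {x \<in> space (lebn n). sphere_proj n x \<in> B} x \<partial>lebn n)"
    by (rule emeasure_density) measurable
  also have "\<dots> = (\<integral>\<^sup>+x. indicator {x \<in> space (lebn n). 0 < vnorm n x \<and> vnorm n x \<le> 1 \<and> sphere_proj n x \<in> B} x \<partial>lebn n)"
    by (intro nn_integral_cong) (auto simp: indicator_def)
  also have "\<dots> = emeasure (lebn n) {x \<in> space (lebn n). 0 < vnorm n x \<and> vnorm n x \<le> 1 \<and> sphere_proj n x \<in> B}"
    by (rule nn_integral_indicator) measurable
  finally show ?thesis .
qed

lemma emeasure_cone_measure_rotation:
  assumes T: "rotation n T" and [measurable]: "B \<in> sets borel"
  shows "emeasure (cone_measure n) (T -` B) = emeasure (cone_measure n) B"
proof -
  have [measurable]: "T \<in> borel_measurable borel" "T \<in> measurable (lebn n) (lebn n)"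
    and hom: "\<And>x z c. \<forall>j<n. z j = c * x j \<Longrightarrow> \<forall>j<n. T z j = c * T x j"
    and hi: "\<And>x i. n \<le> i \<Longrightarrow> T x i = x i"
    and dist: "distr (lebn n) (lebn n) T = lebn n"
    using T unfolding rotation_def by blast+
  have proj: "sphere_proj n (T x) = T (sphere_proj n x)" for x
  proof
    fix i
    have "\<forall>j<n. T (sphere_proj n x) j = (1 / vnorm n x) * T x j"
      by (rule hom) (simp add: sphere_proj_def)
    then show "sphere_proj n (T x) i = T (sphere_proj n x) i"
      using hi[of i "sphere_proj n x"] rotation_norm[OF T, of x]
      by (cases "i < n") (auto simp: sphere_proj_def)
  qed
  let ?A = "{x \<in> space (lebn n). 0 < vnorm n x \<and> vnorm n x \<le> 1 \<and> sphere_proj n x \<in> B}"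
  have TB: "T -` B \<in> sets borel" using measurable_sets[of T borel borel B] by simp
  have "emeasure (cone_measure n) B = emeasure (distr (lebn n) (lebn n) T) ?A"
    by (simp add: emeasure_cone_measure dist)
  also have "\<dots> = emeasure (lebn n) (T -` ?A \<inter> space (lebn n))" by (rule emeasure_distr) measurable
  also have "T -` ?A \<inter> space (lebn n) =
      {x \<in> space (lebn n). 0 < vnorm n x \<and> vnorm n x \<le> 1 \<and> sphere_proj n x \<in> T -` B}"
    using measurable_space[of T "lebn n" "lebn n"] by (auto simp: rotation_norm[OF T] proj)
  finally show ?thesis using TB by (simp add: emeasure_cone_measure)
qed

lemma rotation_sphere: "rotation n T \<Longrightarrow> T x \<in> unit_sphere n \<longleftrightarrow> x \<in> unit_sphere n"
  using rotation_norm[of n T x] by (auto simp: unit_sphere_def rotation_def)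

text \<open>With the centre rotated to the pole, the cone over the ball lies in a box with side
  \<open>[-1, 1]\<close> along the axis and sides \<open>[-d, d]\<close> otherwise. The order
  \<open>d ^ (n - 1)\<close> is the one required by the mass distribution principle.\<close>

lemma emeasure_cone_ball_le:
  assumes n: "2 \<le> n" and x: "x \<in> unit_sphere n" and d: "0 \<le> d"
  shows "emeasure (cone_measure n) {y \<in> unit_sphere n. vnorm n (\<lambda>i. x i - y i) \<le> d} \<le> ennreal (2 ^ n * d ^ (n - 1))"
proof -
  obtain T where T: "rotation n T" "T x = pole" using rotation_to_pole[OF n x] by blast
  let ?B = "{y \<in> unit_sphere n. vnorm n (\<lambda>i. pole i - y i) \<le> d}"
  have B [measurable]: "?B \<in> sets borel"
  proof -
    have "(\<lambda>y. vnorm n (\<lambda>i. pole i - y i)) \<in> borel_measurable borel"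
      unfolding vnorm_def L2_set_def by measurable
    then have "{y \<in> space borel. y \<in> unit_sphere n \<and> vnorm n (\<lambda>i. pole i - y i) \<le> d} \<in> sets borel" by measurable
    then show ?thesis by simp
  qed
  have "vnorm n (\<lambda>i. T x i - T y i) = vnorm n (\<lambda>i. x i - y i)" for y
    using T(1) unfolding rotation_def by blast
  then have "{y \<in> unit_sphere n. vnorm n (\<lambda>i. x i - y i) \<le> d} = T -` ?B"
    using T rotation_sphere[OF T(1)] by auto
  then have "emeasure (cone_measure n) {y \<in> unit_sphere n. vnorm n (\<lambda>i. x i - y i) \<le> d} = emeasure (cone_measure n) ?B"
    using emeasure_cone_measure_rotation[OF T(1) B] by simp
  also have "\<dots> \<le> emeasure (lebn n) (PiE {..<n} (\<lambda>i. if i = 0 then {-1..1} else {-d..d}))"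
    unfolding emeasure_cone_measure[OF B]
  proof (rule emeasure_mono)
    show "PiE {..<n} (\<lambda>i. if i = 0 then {-1..1} else {-d..d}) \<in> sets (lebn n)"
      unfolding lebn_def by (rule sets_PiM_I_finite) auto
    show "{z \<in> space (lebn n). 0 < vnorm n z \<and> vnorm n z \<le> 1 \<and> sphere_proj n z \<in> ?B}
       \<subseteq> PiE {..<n} (\<lambda>i. if i = 0 then {-1..1} else {-d..d})"
    proof
      fix z assume "z \<in> {z \<in> space (lebn n). 0 < vnorm n z \<and> vnorm n z \<le> 1 \<and> sphere_proj n z \<in> ?B}"
      then have z: "z \<in> space (lebn n)" "0 < vnorm n z" "vnorm n z \<le> 1"
        "vnorm n (\<lambda>i. pole i - sphere_proj n z i) \<le> d" by auto
      show "z \<in> PiE {..<n} (\<lambda>i. if i = 0 then {-1..1} else {-d..d})"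
      proof (rule PiE_I)
        fix i assume i: "i \<in> {..<n}"
        show "z i \<in> (if i = 0 then {-1..1} else {-d..d})"
        proof (cases "i = 0")
          case True
          then show ?thesis using abs_component_le_vnorm[of i n z] i z by auto
        next
          case False
          have "\<bar>pole i - sphere_proj n z i\<bar> \<le> d"
            using abs_component_le_vnorm[of i n "\<lambda>i. pole i - sphere_proj n z i"] i z by auto
          then have "\<bar>z i\<bar> / vnorm n z \<le> d" using False i z by (simp add: pole_def sphere_proj_def abs_divide)
          then have "\<bar>z i\<bar> \<le> d * vnorm n z" using z by (simp add: field_simps)
          also have "\<dots> \<le> d" using z d by (simp add: mult_left_le)
          finally show ?thesis using False by auto
        qed
      next
        fix i assume "i \<notin> {..<n}"
        then show "z i = undefined" using z by (simp add: space_lebn_undefined)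
      qed
    qed
  qed
  also have "\<dots> = ennreal (2 ^ n * d ^ (n - 1))"
  proof -
    interpret product_sigma_finite "\<lambda>_::nat. lborel :: real measure" by standard
    have "emeasure (lebn n) (PiE {..<n} (\<lambda>i. if i = 0 then {-1..1} else {-d..d}))
       = (\<Prod>i<n. emeasure lborel (if i = 0 then {-1..1} else {-d..d}))"
      unfolding lebn_def by (rule emeasure_PiM) auto
    also have "\<dots> = 2 * (\<Prod>i\<in>{..<n}-{0}. ennreal (2 * d))"
      using n d by (subst prod.remove[of _ 0]) (auto intro!: arg_cong2[where f = "(*)"] prod.cong)
    also have "(\<Prod>i\<in>{..<n}-{0}. ennreal (2 * d)) = ennreal ((2 * d) ^ (n - 1))"
      using n d by (subst prod_constant, subst ennreal_power) auto
    also have "2 * ennreal ((2 * d) ^ (n - 1)) = ennreal (2 * (2 * d) ^ (n - 1))"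
      using d by (subst ennreal_mult[of 2]) auto
    also have "2 * (2 * d) ^ (n - 1) = 2 ^ n * d ^ (n - 1)"
      using n by (cases n) (auto simp: power_mult_distrib)
    finally show ?thesis .
  qed
  finally show ?thesis .
qed

lemma emeasure_cone_sphere:
  assumes "1 \<le> n"
  shows "emeasure (cone_measure n) (unit_sphere n) = emeasure (lebn n) {x \<in> space (lebn n). 0 < vnorm n x \<and> vnorm n x \<le> 1}"
proof -
  have "sphere_proj n x \<in> unit_sphere n" if "0 < vnorm n x" for x
  proof -
    have "vnorm n (sphere_proj n x) = vnorm n (\<lambda>i. (1 / vnorm n x) * x i)"
      by (simp add: vnorm_def sphere_proj_def L2_set_def)
    also have "\<dots> = 1" using that by (subst vnorm_cmult) simp
    finally show ?thesis by (auto simp: unit_sphere_def sphere_proj_def)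
  qed
  then show ?thesis
    by (subst emeasure_cone_measure) (auto intro!: arg_cong[where f = "emeasure _"])
qed

lemma emeasure_cone_sphere_bounds:
  assumes n: "1 \<le> n"
  shows "0 < emeasure (cone_measure n) (unit_sphere n)" "emeasure (cone_measure n) (unit_sphere n) < \<infinity>"
proof -
  interpret product_sigma_finite "\<lambda>_::nat. lborel :: real measure" by standard
  let ?A = "{x \<in> space (lebn n). 0 < vnorm n x \<and> vnorm n x \<le> 1}"
  let ?B = "{x \<in> space (lebn n). vnorm n x \<le> 1}"
  let ?Z = "{x \<in> space (lebn n). vnorm n x \<le> 0}"
  have ball: "emeasure (lebn n) ?B = ennreal (unit_ball_vol (real n))"
  proof -
    have "?B = {f. sqrt (\<Sum>i\<in>{..<n}. (f i)\<^sup>2) \<le> 1} \<inter> space (lebn n)"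
      by (auto simp: vnorm_def L2_set_def)
    then show ?thesis using emeasure_cball_aux[of "{..<n}" 1] by (simp add: lebn_def)
  qed
  have "?Z \<subseteq> PiE {..<n} (\<lambda>_. {0})"
  proof
    fix x assume "x \<in> ?Z"
    then have x: "x \<in> space (lebn n)" "vnorm n x \<le> 0" by auto
    have "x i = 0" if "i < n" for i using abs_component_le_vnorm[OF that, of x] x(2) by linarith
    then show "x \<in> PiE {..<n} (\<lambda>_. {0})" using x(1) by (auto simp: PiE_iff extensional_def space_lebn_undefined)
  qed
  then have "emeasure (lebn n) ?Z \<le> emeasure (lebn n) (PiE {..<n} (\<lambda>_. {0}))"
    unfolding lebn_def by (intro emeasure_mono sets_PiM_I_finite) auto
  also have "\<dots> = (\<Prod>i<n. emeasure lborel {0::real})"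
    unfolding lebn_def by (rule emeasure_PiM) auto
  also have "\<dots> = 0" using n by (simp add: power_0_left)
  finally have Z: "emeasure (lebn n) ?Z = 0" by simp
  have "emeasure (lebn n) ?B \<le> emeasure (lebn n) ?A + emeasure (lebn n) ?Z"
  proof -
    have "?B = ?A \<union> ?Z" by auto
    moreover have "?A \<in> sets (lebn n)" "?Z \<in> sets (lebn n)" by measurable
    ultimately show ?thesis using emeasure_subadditive[of ?A "lebn n" ?Z] by simp
  qed
  then have "ennreal (unit_ball_vol (real n)) \<le> emeasure (lebn n) ?A" using Z ball by simp
  moreover have "unit_ball_vol (real n) > 0" by simp
  ultimately show "0 < emeasure (cone_measure n) (unit_sphere n)"
    using n by (simp add: emeasure_cone_sphere less_le_trans[of 0 "ennreal (unit_ball_vol (real n))"] ennreal_less_zero_iff)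
  have "emeasure (lebn n) ?A \<le> emeasure (lebn n) ?B" by (intro emeasure_mono) auto
  also have "\<dots> < \<infinity>" using ball by simp
  finally show "emeasure (cone_measure n) (unit_sphere n) < \<infinity>" using n by (simp add: emeasure_cone_sphere)
qed

section \<open>Comparison of the Hausdorff measure with the cone measure\<close>

lemma unit_sphere_subset: "unit_sphere n \<subseteq> mspace (Rn n)"
  by (auto simp: unit_sphere_def)

text \<open>Mass distribution principle: the trace on the sphere of a member of a cover lies in a
  ball around one of its points with the diameter of the member as radius. Its cone measure is thus
  at most \<open>K\<close> times the weight, and the weights add up to at least the cone measure of
  the sphere divided by \<open>K\<close>.\<close>

lemma hausdorff_unit_sphere_pos:
  assumes n: "2 \<le> n"
  shows "0 < hausdorff (Rn n) (n - 1) (unit_sphere n)"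
proof -
  let ?S = "unit_sphere n" and ?\<nu> = "cone_measure n"
  define c where "c = unit_ball_vol (real (n-1)) / 2 ^ (n-1)"
  have c: "0 < c" unfolding c_def by simp
  define K where "K = 2 ^ n / c"
  have K: "0 < K" using c by (simp add: K_def)
  define v where "v = measure ?\<nu> ?S"
  have nu: "emeasure ?\<nu> ?S = ennreal v"
    unfolding v_def using emeasure_cone_sphere_bounds(2)[of n] n by (intro emeasure_eq_ennreal_measure) auto
  have v: "0 < v" using emeasure_cone_sphere_bounds(1)[of n] n unfolding nu by (simp add: ennreal_less_zero_iff)
  have "ennreal (v / K) \<le> hausdorff_pre (Rn n) (n-1) 1 ?S"
    unfolding hausdorff_pre_alt
  proof (rule INF_greatest)
    fix C assume C: "C \<in> hcovers (Rn n) 1 ?S"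
    define x where "x i = (SOME x. x \<in> C i \<inter> ?S)" for i
    have x: "x i \<in> C i \<inter> ?S" if "C i \<inter> ?S \<noteq> {}" for i
      unfolding x_def using that by (metis some_in_eq)
    define d where "d i = enn2real (ediam (Rn n) (C i))" for i
    have fin: "ediam (Rn n) (C i) = ennreal (d i)" for i
    proof -
      have "ediam (Rn n) (C i) \<le> ennreal 1" using C by (auto simp: hcovers_def)
      then have "ediam (Rn n) (C i) < top" by (metis ennreal_less_top le_less_trans)
      then show ?thesis by (simp add: d_def)
    qed
    have d0: "0 \<le> d i" for i by (simp add: d_def)
    define B where "B i = (if C i \<inter> ?S = {} then {} else {y \<in> ?S. vnorm n (\<lambda>j. x i j - y j) \<le> d i})" for i
    have B_sets: "B i \<in> sets borel" for i
    proof -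
      have "(\<lambda>y. vnorm n (\<lambda>j. x i j - y j)) \<in> borel_measurable borel"
        unfolding vnorm_def L2_set_def by measurable
      then have "{y \<in> space borel. y \<in> ?S \<and> vnorm n (\<lambda>j. x i j - y j) \<le> d i} \<in> sets borel" by measurable
      then show ?thesis by (simp add: B_def)
    qed
    have "?S \<subseteq> (\<Union>i. B i)"
    proof
      fix y assume y: "y \<in> ?S"
      then obtain i where i: "y \<in> C i" using C by (auto simp: hcovers_def)
      then have ne: "C i \<inter> ?S \<noteq> {}" using y by auto
      have "ennreal (mdist (Rn n) (x i) y) \<le> ennreal (d i)"
        unfolding fin[symmetric] using x[OF ne] i by (intro mdist_le_ediam) auto
      then have "y \<in> B i" using ne y d0 by (auto simp: B_def ennreal_le_iff)
      then show "y \<in> (\<Union>i. B i)" by auto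
    qed
    then have "ennreal v \<le> emeasure ?\<nu> (\<Union>i. B i)"
      unfolding nu[symmetric] using B_sets by (intro emeasure_mono) auto
    also have "\<dots> \<le> (\<Sum>i. emeasure ?\<nu> (B i))"
      using B_sets by (intro emeasure_subadditive_countably) auto
    also have "\<dots> \<le> (\<Sum>i. ennreal K * hweight (Rn n) (n-1) (C i))"
    proof (intro suminf_le)
      fix i
      show "emeasure ?\<nu> (B i) \<le> ennreal K * hweight (Rn n) (n-1) (C i)"
      proof (cases "C i \<inter> ?S = {}")
        case False
        then have "emeasure ?\<nu> (B i) \<le> ennreal (2 ^ n * d i ^ (n - 1))"
          using x[OF False] emeasure_cone_ball_le[OF n _ d0, of "x i"] unfolding B_def by simp
        also have "2 ^ n * d i ^ (n - 1) = K * (c * d i ^ (n - 1))" using c by (simp add: K_def)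
        also have "ennreal (K * (c * d i ^ (n - 1))) = ennreal K * (ennreal c * ennreal (d i) ^ (n - 1))"
          using K c d0 by (simp add: ennreal_mult ennreal_power)
        also have "ennreal c * ennreal (d i) ^ (n - 1) = hweight (Rn n) (n-1) (C i)"
          using False unfolding hweight_def fin c_def by auto
        finally show ?thesis .
      qed (simp add: B_def)
    qed auto
    also have "\<dots> = ennreal K * (\<Sum>i. hweight (Rn n) (n-1) (C i))" by simp
    finally have "ennreal (1/K) * ennreal v \<le> ennreal (1/K) * (ennreal K * (\<Sum>i. hweight (Rn n) (n-1) (C i)))"
      by (intro mult_left_mono) auto
    also have "\<dots> = ennreal (1/K * K) * (\<Sum>i. hweight (Rn n) (n-1) (C i))"
      unfolding mult.assoc[symmetric] using K by (subst ennreal_mult[symmetric]) auto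
    also have "1/K * K = 1" using K by simp
    also have "ennreal (1/K) * ennreal v = ennreal (v / K)" using K v by (simp flip: ennreal_mult)
    finally show "ennreal (v / K) \<le> (\<Sum>i. hweight (Rn n) (n-1) (C i))" by simp
  qed
  also have "\<dots> \<le> hausdorff (Rn n) (n - 1) ?S" by (intro hausdorff_pre_le) simp
  finally show ?thesis using v K by (auto intro: less_le_trans[rotated])
qed

lemma hausdorff_isometry_image_le:
  assumes T: "\<And>x. x \<in> mspace m \<Longrightarrow> T x \<in> mspace m"
    and iso: "\<And>x y. x \<in> mspace m \<Longrightarrow> y \<in> mspace m \<Longrightarrow> mdist m (T x) (T y) = mdist m x y"
  shows "hausdorff m k (T ` A) \<le> hausdorff m k A"
  unfolding hausdorff_def
proof (rule SUP_mono)
  fix \<delta> :: real assume \<delta>: "\<delta> \<in> {0<..}"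
  have "hausdorff_pre m k \<delta> (T ` A) \<le> hausdorff_pre m k \<delta> A"
    unfolding hausdorff_pre_alt
  proof (rule INF_mono)
    fix C assume C: "C \<in> hcovers m \<delta> A"
    have diam: "ediam m (T ` C i) = ediam m (C i)" for i
    proof -
      have "C i \<subseteq> mspace m" using C by (auto simp: hcovers_def)
      then have "(SUP x\<in>C i. SUP y\<in>C i. ennreal (mdist m (T x) (T y))) = (SUP x\<in>C i. SUP y\<in>C i. ennreal (mdist m x y))"
        by (intro SUP_cong refl) (auto simp: iso subset_iff)
      then show ?thesis by (simp add: ediam_def image_image)
    qed
    have "(\<lambda>i. T ` C i) \<in> hcovers m \<delta> (T ` A)"
    proof -
      have C': "A \<subseteq> (\<Union>i. C i)" "\<And>i. C i \<subseteq> mspace m" "\<And>i. ediam m (C i) \<le> ennreal \<delta>"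
        using C by (auto simp: hcovers_def)
      have "T ` A \<subseteq> (\<Union>i. T ` C i)" using C'(1) by blast
      moreover have "T ` C i \<subseteq> mspace m" for i using C'(2)[of i] T by blast
      ultimately show ?thesis using C'(3) unfolding hcovers_def by (simp add: diam)
    qed
    moreover have "(\<Sum>i. hweight m k (T ` C i)) \<le> (\<Sum>i. hweight m k (C i))"
    proof -
      have "hweight m k (T ` C i) = hweight m k (C i)" for i by (auto simp: hweight_def diam)
      then show ?thesis by simp
    qed
    ultimately show "\<exists>D\<in>hcovers m \<delta> (T ` A). (\<Sum>i. hweight m k (D i)) \<le> (\<Sum>i. hweight m k (C i))"
      by (intro bexI[of _ "\<lambda>i. T ` C i"])
  qed
  with \<delta> show "\<exists>\<delta>'\<in>{0<..}. hausdorff_pre m k \<delta> (T ` A) \<le> hausdorff_pre m k \<delta>' A" by blast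
qed

lemma hausdorff_rotation_image:
  assumes T: "rotation n T" and A: "A \<subseteq> mspace (Rn n)"
  shows "hausdorff (Rn n) k (T ` A) = hausdorff (Rn n) k A"
proof (rule antisym)
  have bij: "bij T" and hi: "\<And>x i. n \<le> i \<Longrightarrow> T x i = x i"
    and iso: "\<And>x y. vnorm n (\<lambda>i. T x i - T y i) = vnorm n (\<lambda>i. x i - y i)"
    using T unfolding rotation_def by blast+
  show "hausdorff (Rn n) k (T ` A) \<le> hausdorff (Rn n) k A"
    by (rule hausdorff_isometry_image_le) (auto simp: hi iso)
  have inv: "T (inv T x) = x" "inv T (T x) = x" for x
    using bij by (simp_all add: bij_is_surj surj_f_inv_f bij_is_inj)
  have "hausdorff (Rn n) k (inv T ` (T ` A)) \<le> hausdorff (Rn n) k (T ` A)"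
  proof (rule hausdorff_isometry_image_le)
    show "mdist (Rn n) (inv T x) (inv T y) = mdist (Rn n) x y" for x y
      using iso[of "inv T x" "inv T y"] by (simp add: inv)
    show "inv T x \<in> mspace (Rn n)" if "x \<in> mspace (Rn n)" for x
      using that hi[of _ "inv T x"] by (simp add: inv)
  qed
  then show "hausdorff (Rn n) k A \<le> hausdorff (Rn n) k (T ` A)" by (simp add: image_image inv)
qed

text \<open>Rotations carry every point to the pole, so under both measures the mass of a ball
  depends on its radius only, and \<open>uniform_measures_le\<close> applies.\<close>

lemma hausdorff_sphere_ratio:
  assumes n: "2 \<le> n" and A: "A \<in> sets borel" "A \<subseteq> unit_sphere n"
    and opn: "\<And>x. x \<in> A \<Longrightarrow> \<exists>r>0. \<forall>y\<in>unit_sphere n. vnorm n (\<lambda>i. x i - y i) < r \<longrightarrow> y \<in> A"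
  shows "enn2real (hausdorff (Rn n) (n - 1) A) / enn2real (hausdorff (Rn n) (n - 1) (unit_sphere n)) =
     measure (cone_measure n) A / measure (cone_measure n) (unit_sphere n)"
proof -
  let ?S = "unit_sphere n" and ?\<nu> = "cone_measure n" and ?H = "hausdorff (Rn n) (n - 1)"
  let ?d = "\<lambda>x y. vnorm n (\<lambda>i. x i - y i)"
  obtain M :: "(nat \<Rightarrow> real) measure" where sets_M [simp, measurable_cong]: "sets M = sets borel"
    and em: "\<And>B. B \<in> sets borel \<Longrightarrow> emeasure M B = ?H (B \<inter> ?S)"
    using hausdorff_borel_measure_exists[OF unit_sphere_subset, of n "n - 1"] by metis
  have space_M [simp]: "space M = UNIV" using sets_M by (metis sets_eq_imp_space_eq space_borel)
  have MA: "measure M B = enn2real (?H B)" if "B \<in> sets borel" "B \<subseteq> ?S" for B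
    using em[OF that(1)] that(2) by (simp add: measure_def Int_absorb2)
  have HS: "0 < ?H ?S" "?H ?S < \<infinity>"
    using hausdorff_unit_sphere_pos hausdorff_unit_sphere_finite n by auto
  have finM: "finite_measure M" by (rule finite_measureI) (use HS em[of UNIV] in simp)
  have finN: "finite_measure ?\<nu>"
  proof (rule finite_measureI)
    have "emeasure ?\<nu> (space ?\<nu>) = emeasure (lebn n) {x \<in> space (lebn n). 0 < vnorm n x \<and> vnorm n x \<le> 1}"
      using emeasure_cone_measure[of UNIV n] sets_eq_imp_space_eq[OF sets_cone_measure, of n] by simp
    also have "\<dots> = emeasure ?\<nu> ?S" using emeasure_cone_sphere[of n] n by simp
    finally show "emeasure ?\<nu> (space ?\<nu>) \<noteq> \<infinity>" using emeasure_cone_sphere_bounds[of n] n by simp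
  qed
  have d_pair: "(\<lambda>(x, y). ?d x y) \<in> borel_measurable (M \<Otimes>\<^sub>M M)"
    unfolding vnorm_def L2_set_def by measurable
  have d_meas: "(\<lambda>y. ?d x y) \<in> borel_measurable borel" for x
    unfolding vnorm_def L2_set_def by measurable
  have ball_sets: "{y \<in> ?S. ?d x y < r} \<in> sets borel" for x r
  proof -
    note [measurable] = d_meas[of x]
    have "{y \<in> space borel. y \<in> ?S \<and> ?d x y < r} \<in> sets borel" by measurable
    then show ?thesis by simp
  qed
  have H_ball: "?H {y \<in> ?S. ?d x y < r} = ?H {y \<in> ?S. ?d pole y < r}"
    and nu_ball: "emeasure ?\<nu> {y \<in> ?S. ?d x y < r} = emeasure ?\<nu> {y \<in> ?S. ?d pole y < r}"
    if x: "x \<in> ?S" for x r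
  proof -
    obtain T where T: "rotation n T" "T x = pole" using rotation_to_pole[OF n x] by blast
    have iso: "?d (T x) (T y) = ?d x y" for y using T(1) unfolding rotation_def by blast
    have eq: "{y \<in> ?S. ?d x y < r} = T -` {y \<in> ?S. ?d pole y < r}"
      using rotation_sphere[OF T(1)] iso T(2) by auto
    show "emeasure ?\<nu> {y \<in> ?S. ?d x y < r} = emeasure ?\<nu> {y \<in> ?S. ?d pole y < r}"
      unfolding eq by (rule emeasure_cone_measure_rotation[OF T(1) ball_sets])
    have "surj T" using T(1) unfolding rotation_def bij_def by blast
    then have "T ` {y \<in> ?S. ?d x y < r} = {y \<in> ?S. ?d pole y < r}"
      unfolding eq by (rule surj_image_vimage_eq)
    then show "?H {y \<in> ?S. ?d x y < r} = ?H {y \<in> ?S. ?d pole y < r}"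
      using hausdorff_rotation_image[OF T(1), of "{y \<in> ?S. ?d x y < r}" "n - 1"] unit_sphere_subset by fastforce
  qed
  \<comment> \<open>If the ball around the pole were null, so would be every ball of radius
    \<open>r\<close>. A countable cover by sets of diameter at most \<open>r / 2\<close> exists
    because the premeasure is finite, and it puts the sphere into a countable union of null
    balls.\<close>
  have pos: "0 < measure L {y \<in> ?S. ?d pole y < r}"
    if L: "finite_measure L" "sets L = sets borel" "0 < emeasure L ?S"
      and ball: "\<And>x. x \<in> ?S \<Longrightarrow> emeasure L {y \<in> ?S. ?d x y < r} = emeasure L {y \<in> ?S. ?d pole y < r}"
      and r: "0 < r" for L r
  proof (rule ccontr)
    interpret finite_measure L by fact
    assume "\<not> 0 < measure L {y \<in> ?S. ?d pole y < r}"
    then have "measure L {y \<in> ?S. ?d pole y < r} = 0" using measure_nonneg[of L] by (meson antisym not_le)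
    then have zero: "emeasure L {y \<in> ?S. ?d pole y < r} = 0" by (simp add: emeasure_eq_measure)
    have "hausdorff_pre (Rn n) (n-1) (r/2) ?S < \<infinity>"
      using hausdorff_pre_le[of "r/2" "Rn n" "n-1" ?S] HS(2) r by (meson half_gt_zero le_less_trans)
    then have "hcovers (Rn n) (r/2) ?S \<noteq> {}" by (auto simp: hausdorff_pre_alt)
    then obtain C where C: "C \<in> hcovers (Rn n) (r/2) ?S" by blast
    define x where "x i = (SOME x. x \<in> C i \<inter> ?S)" for i
    have x: "x i \<in> C i \<inter> ?S" if "C i \<inter> ?S \<noteq> {}" for i
      unfolding x_def using that by (metis some_in_eq)
    define B where "B i = (if C i \<inter> ?S = {} then {} else {y \<in> ?S. ?d (x i) y < r})" for i
    have B_sets: "B i \<in> sets L" for i using ball_sets L(2) by (auto simp: B_def)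
    have B0: "emeasure L (B i) = 0" for i
      using ball[of "x i"] x[of i] zero by (auto simp: B_def)
    have "?S \<subseteq> (\<Union>i. B i)"
    proof
      fix y assume y: "y \<in> ?S"
      then obtain i where i: "y \<in> C i" using C by (auto simp: hcovers_def)
      then have ne: "C i \<inter> ?S \<noteq> {}" using y by auto
      have "ennreal (mdist (Rn n) (x i) y) \<le> ediam (Rn n) (C i)" using x[OF ne] i by (intro mdist_le_ediam) auto
      also have "\<dots> \<le> ennreal (r/2)" using C by (auto simp: hcovers_def)
      finally have "?d (x i) y \<le> r/2" using r by (simp add: ennreal_le_iff)
      then have "y \<in> B i" using ne y r by (auto simp: B_def)
      then show "y \<in> (\<Union>i. B i)" by auto
    qed
    then have "emeasure L ?S \<le> emeasure L (\<Union>i. B i)" using B_sets by (intro emeasure_mono) auto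
    also have "\<dots> \<le> (\<Sum>i. emeasure L (B i))" using B_sets by (intro emeasure_subadditive_countably) auto
    also have "\<dots> = 0" by (simp add: B0)
    finally show False using L(3) by simp
  qed
  have nuS: "0 < emeasure ?\<nu> ?S" using emeasure_cone_sphere_bounds n by auto
  have MS: "0 < emeasure M ?S" using em[of ?S] HS(1) by simp
  have M_ball: "emeasure M {y \<in> ?S. ?d x y < r} = emeasure M {y \<in> ?S. ?d pole y < r}" if "x \<in> ?S" for x r
  proof -
    have "{y \<in> ?S. ?d x y < r} \<inter> ?S = {y \<in> ?S. ?d x y < r}" for x by auto
    then show ?thesis using H_ball[OF that] ball_sets by (simp add: em)
  qed
  have sym: "?d x y = ?d y x" for x y by (rule vnorm_minus_commute)
  have ball_eq: "measure M {y \<in> ?S. ?d x y < r} = measure M {y \<in> ?S. ?d pole y < r}"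
    "measure ?\<nu> {y \<in> ?S. ?d x y < r} = measure ?\<nu> {y \<in> ?S. ?d pole y < r}" if "x \<in> ?S" for x r
    using M_ball[OF that] nu_ball[OF that] by (simp_all add: measure_def)
  have posM: "0 < measure M {y \<in> ?S. ?d pole y < r}" if "0 < r" for r
    by (rule pos[OF finM sets_M MS M_ball that])
  have posN: "0 < measure ?\<nu> {y \<in> ?S. ?d pole y < r}" if "0 < r" for r
    by (rule pos[OF finN sets_cone_measure nuS nu_ball that])
  have opS: "\<exists>r>0. \<forall>y\<in>?S. ?d x y < r \<longrightarrow> y \<in> ?S" for x by (intro exI[of _ 1]) auto
  \<comment> \<open>The comparison is made for \<open>(A, S)\<close> and then for
    \<open>(S, A)\<close>; together the two inequalities are the proportion.\<close>
  have "measure M A * measure ?\<nu> ?S \<le> measure ?\<nu> A * measure M ?S"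
    by (rule uniform_measures_le[OF finM finN _ d_pair sym, where S = ?S
          and g = "\<lambda>r. measure M {y \<in> ?S. ?d pole y < r}" and h = "\<lambda>r. measure ?\<nu> {y \<in> ?S. ?d pole y < r}"])
       (use A opn opS ball_eq posM posN in auto)
  moreover have "measure M ?S * measure ?\<nu> A \<le> measure ?\<nu> ?S * measure M A"
    by (rule uniform_measures_le[OF finM finN _ d_pair sym, where S = ?S
          and g = "\<lambda>r. measure M {y \<in> ?S. ?d pole y < r}" and h = "\<lambda>r. measure ?\<nu> {y \<in> ?S. ?d pole y < r}"])
       (use A opn opS ball_eq posM posN in auto)
  ultimately have "measure M A * measure ?\<nu> ?S = measure ?\<nu> A * measure M ?S" by (simp add: mult.commute)
  moreover have "measure M ?S \<noteq> 0" "measure ?\<nu> ?S \<noteq> 0"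
    using MS nuS finite_measure.emeasure_eq_measure[OF finM] finite_measure.emeasure_eq_measure[OF finN] by auto
  ultimately have "measure M A / measure M ?S = measure ?\<nu> A / measure ?\<nu> ?S" by (simp add: field_simps)
  then show ?thesis using MA A by simp
qed

declare component_measurable_lebn [measurable del] borel_measurable_component [measurable del]

section \<open>Splitting the coordinates into two blocks\<close>

lemma L2_set_measurable_PiM:
  assumes "finite I"
  shows "(\<lambda>x. L2_set x I) \<in> borel_measurable (PiM I (\<lambda>_. lborel))"
proof -
  have "(\<lambda>x. x i) \<in> borel_measurable (PiM I (\<lambda>_. lborel :: real measure))" if "i \<in> I" for i
    using measurable_component_singleton[OF that, of "\<lambda>_. lborel :: real measure"] by simp
  then have "(\<lambda>x. (x i)\<^sup>2) \<in> borel_measurable (PiM I (\<lambda>_. lborel :: real measure))" if "i \<in> I" for i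
    using that by (intro borel_measurable_power)
  then show ?thesis unfolding L2_set_def by measurable
qed

text \<open>Both measures are finite on the half-lines \<open>{..a}\<close> and agree there, by the
  volume of a ball.\<close>

lemma distr_L2_set_lborel:
  assumes I: "finite I" "I \<noteq> {}"
  shows "distr (PiM I (\<lambda>_. lborel)) borel (\<lambda>x. L2_set x I) =
     density lborel (\<lambda>r. ennreal (unit_ball_vol (real (card I)) * (real (card I) * r ^ (card I - 1))) * indicator {0..} r)"
    (is "?D = ?E")
proof (rule measure_eqI_generator_eq[where \<Omega> = UNIV and E = "range (\<lambda>a::real. {..a})" and A = "\<lambda>i. {..real i}"])
  let ?P = "PiM I (\<lambda>_. lborel :: real measure)"
  define k where "k = card I"
  have k: "1 \<le> k" using I by (simp add: k_def Suc_leI card_gt_0_iff)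
  define w where "w = unit_ball_vol (real k)"
  have w: "0 \<le> w" by (simp add: w_def)
  have meas [measurable]: "(\<lambda>x. L2_set x I) \<in> borel_measurable ?P"
    by (rule L2_set_measurable_PiM[OF I(1)])
  have D: "emeasure ?D {..a} = (if a < 0 then 0 else ennreal (w * a ^ k))" for a :: real
  proof -
    have 1: "emeasure ?D {..a} = emeasure ?P ({x. L2_set x I \<le> a} \<inter> space ?P)"
      by (subst emeasure_distr) (auto intro!: arg_cong[where f = "emeasure _"])
    consider "a < 0" | "a = 0" | "a > 0" by linarith
    then show ?thesis
    proof cases
      case 1
      have "\<not> L2_set x I \<le> a" for x :: "'a \<Rightarrow> real" using L2_set_nonneg[of x I] 1 by linarith
      then have "{x. L2_set x I \<le> a} \<inter> space ?P = {}" by auto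
      then show ?thesis using \<open>a < 0\<close> by (simp add: \<open>emeasure ?D {..a} = _\<close>)
    next
      case 2
      have ball: "emeasure ?P ({x. L2_set x I \<le> r} \<inter> space ?P) = ennreal (w * r ^ k)" if "0 < r" for r
        using emeasure_cball_aux[OF I(1) that] by (simp add: L2_set_def k_def w_def)
      \<comment> \<open>The volume formula covers positive radii; radius 0 is reached as the limit
        of the radii \<open>1 / (m + 1)\<close>.\<close>
      have "emeasure ?P ({x. L2_set x I \<le> 0} \<inter> space ?P) \<le> ennreal (w * (1 / real (Suc m)) ^ k)" for m
        unfolding ball[of "1 / real (Suc m)", simplified, symmetric]
        by (subst ball[symmetric]) (auto intro!: emeasure_mono intro: order_trans)
      moreover have "(\<lambda>m. ennreal (w * (1 / real (Suc m)) ^ k)) \<longlonglongrightarrow> ennreal (w * 0 ^ k)"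
        using LIMSEQ_inverse_real_of_nat by (intro tendsto_intros) (simp add: inverse_eq_divide)
      ultimately have "emeasure ?P ({x. L2_set x I \<le> 0} \<inter> space ?P) \<le> ennreal (w * 0 ^ k)"
        by (intro LIMSEQ_le_const) auto
      then show ?thesis using 2 1 k by (simp add: power_0_left)
    next
      case 3
      then show ?thesis using 1 emeasure_cball_aux[OF I(1) 3] by (simp add: L2_set_def k_def w_def)
    qed
  qed
  have E: "emeasure ?E {..a} = (if a < 0 then 0 else ennreal (w * a ^ k))" for a :: real
  proof -
    have "emeasure ?E {..a} = (\<integral>\<^sup>+r. ennreal (w * (real k * r ^ (k - 1))) * indicator {0..a} r \<partial>lborel)"
      by (subst emeasure_density) (auto simp: w_def k_def indicator_def intro!: nn_integral_cong)
    also have "\<dots> = (if a < 0 then 0 else ennreal (w * a ^ k))"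
    proof (cases "a < 0")
      case False
      have "((\<lambda>r. w * r ^ k) has_real_derivative w * (real k * r ^ (k - 1))) (at r)" for r
        by (auto intro!: derivative_eq_intros)
      then show ?thesis using False w k
        by (subst nn_integral_FTC_Icc[where F = "\<lambda>r. w * r ^ k"]) (auto simp: power_0_left)
    qed simp
    finally show ?thesis .
  qed
  show "emeasure ?D X = emeasure ?E X" if "X \<in> range (\<lambda>a::real. {..a})" for X
    using that D E by auto
  show "emeasure ?D {..real i} \<noteq> \<infinity>" for i using D[of "real i"] by simp
  show "sets ?D = sigma_sets UNIV (range (\<lambda>a::real. {..a}))" "sets ?E = sigma_sets UNIV (range (\<lambda>a::real. {..a}))"
    by (simp_all add: borel_eq_atMost)
  show "Int_stable (range (\<lambda>a::real. {..a}))"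
    by (auto simp: Int_stable_def intro!: exI[of _ "min _ _"])
  show "(\<Union>i. {..real i}) = UNIV" by (auto simp: real_arch_simple)
qed auto

text \<open>
  The law of the pair of radii has a homogeneous density, so after the substitution
  \<open>a = b s\<close> the variables \<open>s\<close> and \<open>b\<close> separate.
\<close>
lemma emeasure_lebn_two_radii:
  assumes IJ: "I \<union> J = {..<n}" "I \<inter> J = {}" "I \<noteq> {}" "J \<noteq> {}" and W [measurable]: "W \<in> sets borel"
  shows "emeasure (lebn n) {x \<in> space (lebn n). (L2_set x I)\<^sup>2 + (L2_set x J)\<^sup>2 \<le> 1 \<and>
       0 < L2_set x I \<and> 0 < L2_set x J \<and> L2_set x I / L2_set x J \<in> W} =
     ennreal (unit_ball_vol (real (card I)) * real (card I) * (unit_ball_vol (real (card J)) * real (card J)) / real n) *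
     (\<integral>\<^sup>+s. ennreal (s ^ (card I - 1) * (1 + s\<^sup>2) powr (- real n / 2)) * indicator (W \<inter> {0<..}) s \<partial>lborel)"
proof -
  interpret product_sigma_finite "\<lambda>_::nat. lborel :: real measure" by standard
  have fin: "finite I" "finite J" using IJ(1) by (metis finite_Un finite_lessThan)+
  define k l where "k = card I" and "l = card J"
  have kl: "1 \<le> k" "1 \<le> l" "k + l = n"
    using fin IJ card_Un_disjoint[of I J] by (auto simp: k_def l_def Suc_leI card_gt_0_iff)
  let ?I = "PiM I (\<lambda>_. lborel :: real measure)" and ?J = "PiM J (\<lambda>_. lborel :: real measure)"
  interpret I: finite_product_sigma_finite "\<lambda>_. lborel :: real measure" I by standard (rule fin)
  interpret J: finite_product_sigma_finite "\<lambda>_. lborel :: real measure" J by standard (rule fin)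
  interpret pair_sigma_finite ?I ?J by standard
  have mI [measurable]: "(\<lambda>x. L2_set x I) \<in> borel_measurable ?I"
    and mJ [measurable]: "(\<lambda>x. L2_set x J) \<in> borel_measurable ?J"
    using fin by (simp_all add: L2_set_measurable_PiM)
  have mIn [measurable]: "(\<lambda>x. L2_set x I) \<in> borel_measurable (lebn n)"
  proof -
    have "(\<lambda>x. (x i)\<^sup>2) \<in> borel_measurable (lebn n)" if "i \<in> I" for i
      using that IJ(1) by (intro borel_measurable_power component_measurable_lebn) auto
    then show ?thesis unfolding L2_set_def by measurable
  qed
  have mJn [measurable]: "(\<lambda>x. L2_set x J) \<in> borel_measurable (lebn n)"
  proof -
    have "(\<lambda>x. (x i)\<^sup>2) \<in> borel_measurable (lebn n)" if "i \<in> J" for i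
      using that IJ(1) by (intro borel_measurable_power component_measurable_lebn) auto
    then show ?thesis unfolding L2_set_def by measurable
  qed
  define Q where "Q a b \<longleftrightarrow> a\<^sup>2 + b\<^sup>2 \<le> 1 \<and> 0 < a \<and> 0 < b \<and> a / b \<in> W" for a b :: real
  define q where "q a b = (indicator {p. Q (fst p) (snd p)} (a, b) :: ennreal)" for a b :: real
  have Q_sets: "{p. Q (fst p) (snd p)} \<in> sets (borel \<Otimes>\<^sub>M borel)"
  proof -
    have "{p \<in> space (borel \<Otimes>\<^sub>M borel). Q (fst p) (snd p)} \<in> sets (borel \<Otimes>\<^sub>M borel)"
      unfolding Q_def by measurable
    then show ?thesis by (simp add: space_pair_measure)
  qed
  have q_meas [measurable]: "(\<lambda>p. q (fst p) (snd p)) \<in> borel_measurable (borel \<Otimes>\<^sub>M borel)"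
    unfolding q_def using Q_sets by simp
  have q_meas' [measurable]: "(\<lambda>x. q (f x) (g x)) \<in> borel_measurable N"
    if [measurable]: "f \<in> borel_measurable N" "g \<in> borel_measurable N" for f g and N :: "'b measure"
    using measurable_compose[of "\<lambda>x. (f x, g x)" N "borel \<Otimes>\<^sub>M borel", OF _ q_meas] by simp
  define u v where "u = unit_ball_vol (real k) * real k" and "v = unit_ball_vol (real l) * real l"
  have uv: "0 \<le> u" "0 \<le> v" by (auto simp: u_def v_def)
  let ?fI = "\<lambda>a. ennreal (u * a ^ (k - 1)) * indicator {0..} a" and ?fJ = "\<lambda>b. ennreal (v * b ^ (l - 1)) * indicator {0..} b"
  have lawI: "(\<integral>\<^sup>+x. f (L2_set x I) \<partial>?I) = (\<integral>\<^sup>+a. ?fI a * f a \<partial>lborel)"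
    if [measurable]: "f \<in> borel_measurable borel" for f
  proof -
    have "(\<integral>\<^sup>+x. f (L2_set x I) \<partial>?I) = (\<integral>\<^sup>+a. f a \<partial>distr ?I borel (\<lambda>x. L2_set x I))"
      by (subst nn_integral_distr) auto
    then show ?thesis
      unfolding distr_L2_set_lborel[OF fin(1) IJ(3)] k_def u_def
      by (simp add: nn_integral_density mult.assoc)
  qed
  have lawJ: "(\<integral>\<^sup>+x. f (L2_set x J) \<partial>?J) = (\<integral>\<^sup>+a. ?fJ a * f a \<partial>lborel)"
    if [measurable]: "f \<in> borel_measurable borel" for f
  proof -
    have "(\<integral>\<^sup>+x. f (L2_set x J) \<partial>?J) = (\<integral>\<^sup>+a. f a \<partial>distr ?J borel (\<lambda>x. L2_set x J))"
      by (subst nn_integral_distr) auto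
    then show ?thesis
      unfolding distr_L2_set_lborel[OF fin(2) IJ(4)] l_def v_def
      by (simp add: nn_integral_density mult.assoc)
  qed
  have "emeasure (lebn n) {x \<in> space (lebn n). (L2_set x I)\<^sup>2 + (L2_set x J)\<^sup>2 \<le> 1 \<and>
       0 < L2_set x I \<and> 0 < L2_set x J \<and> L2_set x I / L2_set x J \<in> W} = (\<integral>\<^sup>+x. q (L2_set x I) (L2_set x J) \<partial>lebn n)"
  proof -
    let ?R = "{x \<in> space (lebn n). (L2_set x I)\<^sup>2 + (L2_set x J)\<^sup>2 \<le> 1 \<and>
       0 < L2_set x I \<and> 0 < L2_set x J \<and> L2_set x I / L2_set x J \<in> W}"
    have "(\<integral>\<^sup>+x. q (L2_set x I) (L2_set x J) \<partial>lebn n) = (\<integral>\<^sup>+x. indicator ?R x \<partial>lebn n)"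
      by (intro nn_integral_cong) (auto simp: q_def Q_def indicator_def)
    also have "\<dots> = emeasure (lebn n) ?R" by (rule nn_integral_indicator) measurable
    finally show ?thesis by simp
  qed
  also have "\<dots> = (\<integral>\<^sup>+x. \<integral>\<^sup>+y. q (L2_set x I) (L2_set y J) \<partial>?J \<partial>?I)"
  proof -
    have "(\<integral>\<^sup>+x. q (L2_set x I) (L2_set x J) \<partial>lebn n) =
        (\<integral>\<^sup>+x. \<integral>\<^sup>+y. q (L2_set (merge I J (x, y)) I) (L2_set (merge I J (x, y)) J) \<partial>?J \<partial>?I)"
      unfolding lebn_def IJ(1)[symmetric]
      by (rule product_nn_integral_fold[OF IJ(2) fin]) (use lebn_def IJ(1) mIn mJn q_meas' in metis)
    moreover have "L2_set (merge I J (x, y)) I = L2_set x I" "L2_set (merge I J (x, y)) J = L2_set y J" for x y :: "nat \<Rightarrow> real"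
      using IJ(2) by (auto intro!: L2_set_cong simp: merge_def)
    ultimately show ?thesis by simp
  qed
  also have "\<dots> = (\<integral>\<^sup>+a. ?fI a * (\<integral>\<^sup>+b. ?fJ b * q a b \<partial>lborel) \<partial>lborel)"
  proof -
    have "(\<integral>\<^sup>+x. \<integral>\<^sup>+y. q (L2_set x I) (L2_set y J) \<partial>?J \<partial>?I) =
        (\<integral>\<^sup>+x. (\<integral>\<^sup>+b. ?fJ b * q (L2_set x I) b \<partial>lborel) \<partial>?I)"
      by (subst lawJ) auto
    also have "\<dots> = (\<integral>\<^sup>+a. ?fI a * (\<integral>\<^sup>+b. ?fJ b * q a b \<partial>lborel) \<partial>lborel)"
      by (rule lawI) measurable
    finally show ?thesis .
  qed
  also have "\<dots> = (\<integral>\<^sup>+a. \<integral>\<^sup>+b. ?fI a * (?fJ b * q a b) \<partial>lborel \<partial>lborel)"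
    by (subst nn_integral_cmult) auto
  also have "\<dots> = (\<integral>\<^sup>+b. \<integral>\<^sup>+a. ?fI a * (?fJ b * q a b) \<partial>lborel \<partial>lborel)"
    by (rule lborel_pair.Fubini') measurable
  also have "\<dots> = (\<integral>\<^sup>+b. \<integral>\<^sup>+s. ennreal (u * v * s ^ (k - 1)) * indicator (W \<inter> {0<..}) s *
       (ennreal (b ^ (n - 1)) * indicator {0<..(1 + s\<^sup>2) powr (-1/2)} b) \<partial>lborel \<partial>lborel)"
  proof (rule nn_integral_cong)
    fix b :: real
    show "(\<integral>\<^sup>+a. ?fI a * (?fJ b * q a b) \<partial>lborel) = (\<integral>\<^sup>+s. ennreal (u * v * s ^ (k - 1)) * indicator (W \<inter> {0<..}) s *
       (ennreal (b ^ (n - 1)) * indicator {0<..(1 + s\<^sup>2) powr (-1/2)} b) \<partial>lborel)"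
    proof (cases "0 < b")
      case False
      then show ?thesis by (simp add: q_def Q_def indicator_def)
    next
      case True
      have "(\<integral>\<^sup>+a. ?fI a * (?fJ b * q a b) \<partial>lborel) = ennreal b * (\<integral>\<^sup>+s. ?fI (b * s) * (?fJ b * q (b * s) b) \<partial>lborel)"
        using True nn_integral_real_affine[of "\<lambda>a. ?fI a * (?fJ b * q a b)" b 0] by simp
      also have "\<dots> = (\<integral>\<^sup>+s. ennreal b * (?fI (b * s) * (?fJ b * q (b * s) b)) \<partial>lborel)"
      proof (rule nn_integral_cmult[symmetric])
        have "(\<lambda>a. ?fI a * (?fJ b * q a b)) \<in> borel_measurable borel" by measurable
        from measurable_compose[OF _ this, of "\<lambda>s. b * s" lborel]
        show "(\<lambda>s. ?fI (b * s) * (?fJ b * q (b * s) b)) \<in> borel_measurable lborel" by simp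
      qed
      also have "\<dots> = (\<integral>\<^sup>+s. ennreal (u * v * s ^ (k - 1)) * indicator (W \<inter> {0<..}) s *
       (ennreal (b ^ (n - 1)) * indicator {0<..(1 + s\<^sup>2) powr (-1/2)} b) \<partial>lborel)"
      proof (rule nn_integral_cong)
        fix s :: real
        have le: "(b * s)\<^sup>2 + b\<^sup>2 \<le> 1 \<longleftrightarrow> b \<le> (1 + s\<^sup>2) powr (-1/2)"
        proof -
          have pos: "0 < 1 + s\<^sup>2" by (simp add: add_pos_nonneg)
          have "(b * s)\<^sup>2 + b\<^sup>2 \<le> 1 \<longleftrightarrow> b\<^sup>2 * (1 + s\<^sup>2) \<le> 1" by (simp add: power_mult_distrib algebra_simps)
          also have "\<dots> \<longleftrightarrow> sqrt (b\<^sup>2 * (1 + s\<^sup>2)) \<le> 1" by simp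
          also have "sqrt (b\<^sup>2 * (1 + s\<^sup>2)) = b * sqrt (1 + s\<^sup>2)" using True by (simp add: real_sqrt_mult)
          also have "b * sqrt (1 + s\<^sup>2) \<le> 1 \<longleftrightarrow> b \<le> 1 / sqrt (1 + s\<^sup>2)" using pos by (simp add: field_simps)
          also have "1 / sqrt (1 + s\<^sup>2) = (1 + s\<^sup>2) powr (-1/2)"
            using pos by (simp add: powr_minus powr_half_sqrt inverse_eq_divide)
          finally show ?thesis .
        qed
        show "ennreal b * (?fI (b * s) * (?fJ b * q (b * s) b)) = ennreal (u * v * s ^ (k - 1)) * indicator (W \<inter> {0<..}) s *
          (ennreal (b ^ (n - 1)) * indicator {0<..(1 + s\<^sup>2) powr (-1/2)} b)"
        proof (cases "0 < s \<and> s \<in> W \<and> b \<le> (1 + s\<^sup>2) powr (-1/2)")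
          case T: True
          \<comment> \<open>The factor \<open>b\<close> is the Jacobian of \<open>a = b s\<close>;
            with it the powers of \<open>b\<close> combine to the exponent
            \<open>n - 1\<close>.\<close>
          have e: "b * ((u * (b * s) ^ (k - 1)) * (v * b ^ (l - 1))) = (u * v * s ^ (k - 1)) * b ^ (n - 1)"
          proof -
            have "b ^ (n - 1) = b * b ^ (k - 1) * b ^ (l - 1)"
            proof -
              have "n - 1 = Suc ((k - 1) + (l - 1))" using kl by simp
              then show ?thesis by (simp only: power_add power_Suc mult.assoc)
            qed
            then show ?thesis by (simp add: power_mult_distrib mult_ac)
          qed
          have q1: "q (b * s) b = 1" using T True le by (simp add: q_def Q_def)
          have "ennreal b * (?fI (b * s) * (?fJ b * q (b * s) b)) = ennreal (b * ((u * (b * s) ^ (k - 1)) * (v * b ^ (l - 1))))"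
            using T True uv q1 by (simp add: ennreal_mult)
          also have "\<dots> = ennreal (u * v * s ^ (k - 1)) * ennreal (b ^ (n - 1))"
            unfolding e using T True uv by (intro ennreal_mult) auto
          finally show ?thesis using T True by simp
        next
          case F: False
          then have "q (b * s) b = 0"
            using True le by (auto simp: q_def Q_def indicator_def zero_less_mult_iff)
          then show ?thesis using F by (auto simp: indicator_def)
        qed
      qed
      finally show ?thesis .
    qed
  qed
  also have "\<dots> = (\<integral>\<^sup>+s. \<integral>\<^sup>+b. ennreal (u * v * s ^ (k - 1)) * indicator (W \<inter> {0<..}) s *
       (ennreal (b ^ (n - 1)) * indicator {0<..(1 + s\<^sup>2) powr (-1/2)} b) \<partial>lborel \<partial>lborel)"
  proof -
    have "(\<lambda>(b, s). ennreal (u * v * s ^ (k - 1)) * indicator (W \<inter> {0<..}) s *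
       (ennreal (b ^ (n - 1)) * indicator {p. 0 < fst p \<and> fst p \<le> (1 + (snd p)\<^sup>2) powr (-1/2)} (b, s))) \<in> borel_measurable (lborel \<Otimes>\<^sub>M lborel)"
      by measurable
    also have "(\<lambda>(b, s). ennreal (u * v * s ^ (k - 1)) * indicator (W \<inter> {0<..}) s *
       (ennreal (b ^ (n - 1)) * indicator {p. 0 < fst p \<and> fst p \<le> (1 + (snd p)\<^sup>2) powr (-1/2)} (b, s))) =
       (\<lambda>(b, s). ennreal (u * v * s ^ (k - 1)) * indicator (W \<inter> {0<..}) s *
       (ennreal (b ^ (n - 1)) * indicator {0<..(1 + s\<^sup>2) powr (-1/2)} b))"
      by (auto simp: indicator_def)
    finally show ?thesis by (intro lborel_pair.Fubini') simp
  qed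
  also have "\<dots> = (\<integral>\<^sup>+s. ennreal (u * v / n) * (ennreal (s ^ (k - 1) * (1 + s\<^sup>2) powr (- real n / 2)) * indicator (W \<inter> {0<..}) s) \<partial>lborel)"
  proof (rule nn_integral_cong)
    fix s :: real
    \<comment> \<open>The largest \<open>b\<close> that stays in the unit ball for this
      \<open>s\<close>; integrating \<open>b ^ (n - 1)\<close> up to it gives
      \<open>c ^ n / n\<close>, the origin of the exponent \<open>- n / 2\<close>.\<close>
    define c where "c = (1 + s\<^sup>2) powr (-1/2)"
    have c: "0 \<le> c" by (simp add: c_def)
    have n: "0 < n" using kl by simp
    have "(\<integral>\<^sup>+b. ennreal (b ^ (n - 1)) * indicator {0<..c} b \<partial>lborel) = (\<integral>\<^sup>+b. ennreal (b ^ (n - 1)) * indicator {0..c} b \<partial>lborel)"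
      by (intro nn_integral_cong_AE AE_I[of _ _ "{0}"]) (auto simp: indicator_def)
    also have "\<dots> = ennreal (c ^ n / n - 0 ^ n / n)"
      using n c by (intro nn_integral_FTC_Icc) (auto intro!: derivative_eq_intros)
    also have "c ^ n / n - 0 ^ n / n = c ^ n / n" using n by (simp add: power_0_left)
    finally have b: "(\<integral>\<^sup>+b. ennreal (b ^ (n - 1)) * indicator {0<..c} b \<partial>lborel) = ennreal (c ^ n / n)" .
    have cn: "c ^ n = (1 + s\<^sup>2) powr (- real n / 2)"
    proof -
      have "0 < 1 + s\<^sup>2" by (simp add: add_pos_nonneg)
      then have "0 < c" by (simp add: c_def)
      then have "c ^ n = c powr real n" by (simp add: powr_realpow)
      also have "\<dots> = (1 + s\<^sup>2) powr (- real n / 2)" by (simp add: c_def powr_powr)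
      finally show ?thesis .
    qed
    have "(\<integral>\<^sup>+b. ennreal (u * v * s ^ (k - 1)) * indicator (W \<inter> {0<..}) s * (ennreal (b ^ (n - 1)) * indicator {0<..c} b) \<partial>lborel)
        = ennreal (u * v * s ^ (k - 1)) * indicator (W \<inter> {0<..}) s * ennreal (c ^ n / n)"
      by (subst nn_integral_cmult, measurable) (simp only: b)
    also have "\<dots> = ennreal (u * v / n) * (ennreal (s ^ (k - 1) * c ^ n) * indicator (W \<inter> {0<..}) s)"
    proof (cases "s \<in> W \<inter> {0<..}")
      case True
      then have "ennreal (u * v * s ^ (k - 1)) * ennreal (c ^ n / n) = ennreal ((u * v * s ^ (k - 1)) * (c ^ n / n))"
        using uv c by (intro ennreal_mult[symmetric]) auto
      also have "(u * v * s ^ (k - 1)) * (c ^ n / n) = (u * v / n) * (s ^ (k - 1) * c ^ n)" by simp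
      also have "ennreal \<dots> = ennreal (u * v / n) * ennreal (s ^ (k - 1) * c ^ n)"
        using uv c True by (intro ennreal_mult) auto
      finally show ?thesis using True by simp
    qed simp
    finally show "(\<integral>\<^sup>+b. ennreal (u * v * s ^ (k - 1)) * indicator (W \<inter> {0<..}) s *
       (ennreal (b ^ (n - 1)) * indicator {0<..(1 + s\<^sup>2) powr (-1/2)} b) \<partial>lborel) =
       ennreal (u * v / n) * (ennreal (s ^ (k - 1) * (1 + s\<^sup>2) powr (- real n / 2)) * indicator (W \<inter> {0<..}) s)"
      unfolding c_def[symmetric] cn[symmetric] .
  qed
  also have "\<dots> = ennreal (u * v / n) * (\<integral>\<^sup>+s. ennreal (s ^ (k - 1) * (1 + s\<^sup>2) powr (- real n / 2)) * indicator (W \<inter> {0<..}) s \<partial>lborel)"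
    by (rule nn_integral_cmult) measurable
  finally show ?thesis by (simp add: u_def v_def k_def l_def)
qed

text \<open>Where the block vanishes one of its coordinates vanishes, so the exceptional set lies in
  a null hyperplane.\<close>

lemma AE_lebn_L2_set_pos:
  assumes I: "I \<noteq> {}" "I \<subseteq> {..<n}"
  shows "AE x in lebn n. 0 < L2_set x I"
proof -
  interpret product_sigma_finite "\<lambda>_::nat. lborel :: real measure" by standard
  obtain i where i: "i \<in> I" "i < n" using I by auto
  have fin: "finite I" using I finite_subset by blast
  let ?Z = "PiE {..<n} (\<lambda>j. if j = i then {0::real} else UNIV)"
  have "emeasure (lebn n) ?Z = (\<Prod>j<n. emeasure lborel (if j = i then {0::real} else UNIV))"
    unfolding lebn_def by (rule emeasure_PiM) auto
  also have "\<dots> = 0" using i by (intro prod_zero) auto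
  finally have Z: "emeasure (lebn n) ?Z = 0" .
  have Z_sets: "?Z \<in> sets (lebn n)" unfolding lebn_def by (rule sets_PiM_I_finite) auto
  show ?thesis
  proof (rule AE_I[OF _ Z Z_sets])
    show "{x \<in> space (lebn n). \<not> 0 < L2_set x I} \<subseteq> ?Z"
    proof
      fix x assume x: "x \<in> {x \<in> space (lebn n). \<not> 0 < L2_set x I}"
      then have "L2_set x I = 0" using L2_set_nonneg[of x I] by auto
      then have "x i = 0" using i fin by (simp add: L2_set_eq_0_iff)
      then show "x \<in> ?Z" using x by (auto simp: PiE_iff extensional_def space_lebn_undefined)
    qed
  qed
qed

text \<open>The law of the ratio of two radii, up to a factor independent of \<open>W\<close> that
  drops out of quotients; in the variable \<open>s\<^sup>2 / (1 + s\<^sup>2)\<close> it is a beta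
  integral.\<close>

definition ratio_mass :: "nat \<Rightarrow> nat \<Rightarrow> real set \<Rightarrow> real" where
  "ratio_mass n k W = enn2real (\<integral>\<^sup>+s. ennreal (s ^ (k - 1) * (1 + s\<^sup>2) powr (- real n / 2)) * indicator (W \<inter> {0<..}) s \<partial>lborel)"

text \<open>A bound \<open>z\<close> on the share of the block in the squared norm is the bound
  \<open>sqrt (z / (1 - z))\<close> on the ratio of the radii. Both volumes carry the same constant,
  and points with a vanishing radius are null.\<close>

lemma cone_measure_ratio:
  assumes I: "I \<noteq> {}" "I \<subset> {..<n}" and z: "0 < z" "z < 1"
  shows "measure (cone_measure n) {y \<in> unit_sphere n. (L2_set y I)\<^sup>2 < z} / measure (cone_measure n) (unit_sphere n)
     = ratio_mass n (card I) {..<sqrt (z / (1 - z))} / ratio_mass n (card I) UNIV"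
proof -
  define J where "J = {..<n} - I"
  have IJ: "I \<union> J = {..<n}" "I \<inter> J = {}" "I \<noteq> {}" "J \<noteq> {}" and J: "J \<subseteq> {..<n}" and I': "I \<subseteq> {..<n}"
    using I by (auto simp: J_def)
  have fin: "finite I" "finite J" using IJ(1) by (metis finite_Un finite_lessThan)+
  have n: "1 \<le> n" using I by (cases n) auto
  define c where "c = unit_ball_vol (real (card I)) * real (card I) * (unit_ball_vol (real (card J)) * real (card J)) / real n"
  have c: "0 < c" using fin IJ n by (simp add: c_def card_gt_0_iff)
  have split: "(vnorm n x)\<^sup>2 = (L2_set x I)\<^sup>2 + (L2_set x J)\<^sup>2" for x
    using fin IJ by (simp add: vnorm_sq L2_set_def sum_nonneg flip: IJ(1)) (simp add: sum.union_disjoint)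
  have mI [measurable]: "(\<lambda>x. L2_set x I) \<in> borel_measurable (lebn n)"
  proof -
    have "(\<lambda>x. (x i)\<^sup>2) \<in> borel_measurable (lebn n)" if "i \<in> I" for i
      using that IJ(1) by (intro borel_measurable_power component_measurable_lebn) auto
    then show ?thesis unfolding L2_set_def by measurable
  qed
  have mJ [measurable]: "(\<lambda>x. L2_set x J) \<in> borel_measurable (lebn n)"
  proof -
    have "(\<lambda>x. (x i)\<^sup>2) \<in> borel_measurable (lebn n)" if "i \<in> J" for i
      using that IJ(1) by (intro borel_measurable_power component_measurable_lebn) auto
    then show ?thesis unfolding L2_set_def by measurable
  qed
  have mB: "(\<lambda>x :: nat \<Rightarrow> real. L2_set x I) \<in> borel_measurable borel"
    unfolding L2_set_def using borel_measurable_component by measurable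
  have key: "emeasure (cone_measure n) {y \<in> unit_sphere n. L2_set y I \<in> V} = ennreal c *
      (\<integral>\<^sup>+s. ennreal (s ^ (card I - 1) * (1 + s\<^sup>2) powr (- real n / 2)) * indicator (W \<inter> {0<..}) s \<partial>lborel)"
    if V: "V \<in> sets borel" and W: "W \<in> sets borel"
      and VW: "\<And>a b. 0 < a \<Longrightarrow> 0 < b \<Longrightarrow> a / sqrt (a\<^sup>2 + b\<^sup>2) \<in> V \<longleftrightarrow> a / b \<in> W" for V W
  proof -
    note [measurable] = V W mB
    have [measurable]: "{y \<in> unit_sphere n. L2_set y I \<in> V} \<in> sets borel"
    proof -
      have "{y \<in> space borel. y \<in> unit_sphere n \<and> L2_set y I \<in> V} \<in> sets borel" by measurable
      then show ?thesis by simp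
    qed
    have proj: "L2_set (sphere_proj n x) I = L2_set x I / vnorm n x" for x
    proof -
      have "L2_set (sphere_proj n x) I = L2_set (\<lambda>i. (1 / vnorm n x) * x i) I"
        using I' by (intro L2_set_cong) (auto simp: sphere_proj_def)
      also have "\<dots> = (1 / vnorm n x) * L2_set x I" by (rule L2_set_right_distrib[symmetric]) simp
      finally show ?thesis by simp
    qed
    have in_sphere: "sphere_proj n x \<in> unit_sphere n" if "0 < vnorm n x" for x
    proof -
      have "vnorm n (sphere_proj n x) = vnorm n (\<lambda>i. (1 / vnorm n x) * x i)"
        by (simp add: vnorm_def sphere_proj_def L2_set_def)
      also have "\<dots> = 1" using that by (subst vnorm_cmult) simp
      finally show ?thesis by (auto simp: unit_sphere_def sphere_proj_def)
    qed
    have "emeasure (cone_measure n) {y \<in> unit_sphere n. L2_set y I \<in> V} =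
       emeasure (lebn n) {x \<in> space (lebn n). 0 < vnorm n x \<and> vnorm n x \<le> 1 \<and> sphere_proj n x \<in> {y \<in> unit_sphere n. L2_set y I \<in> V}}"
      by (rule emeasure_cone_measure) measurable
    also have "\<dots> = emeasure (lebn n) {x \<in> space (lebn n). (L2_set x I)\<^sup>2 + (L2_set x J)\<^sup>2 \<le> 1 \<and>
       0 < L2_set x I \<and> 0 < L2_set x J \<and> L2_set x I / L2_set x J \<in> W}"
    proof (rule emeasure_eq_AE)
      show "AE x in lebn n. (x \<in> {x \<in> space (lebn n). 0 < vnorm n x \<and> vnorm n x \<le> 1 \<and> sphere_proj n x \<in> {y \<in> unit_sphere n. L2_set y I \<in> V}}) =
        (x \<in> {x \<in> space (lebn n). (L2_set x I)\<^sup>2 + (L2_set x J)\<^sup>2 \<le> 1 \<and>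
       0 < L2_set x I \<and> 0 < L2_set x J \<and> L2_set x I / L2_set x J \<in> W})"
        using AE_lebn_L2_set_pos[OF IJ(3) I'] AE_lebn_L2_set_pos[OF IJ(4) J]
      proof eventually_elim
        case (elim x)
        have v: "vnorm n x = sqrt ((L2_set x I)\<^sup>2 + (L2_set x J)\<^sup>2)"
          unfolding split[symmetric] by simp
        have "0 < vnorm n x" unfolding v using elim by (simp add: add_pos_pos)
        moreover have "vnorm n x \<le> 1 \<longleftrightarrow> (L2_set x I)\<^sup>2 + (L2_set x J)\<^sup>2 \<le> 1" unfolding v by simp
        moreover have "sphere_proj n x \<in> {y \<in> unit_sphere n. L2_set y I \<in> V} \<longleftrightarrow> L2_set x I / L2_set x J \<in> W"
          using VW[OF elim] in_sphere[OF \<open>0 < vnorm n x\<close>] by (simp add: proj v)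
        ultimately show ?case using elim by simp
      qed
    qed measurable
    finally show ?thesis unfolding emeasure_lebn_two_radii[OF IJ W] c_def .
  qed
  have "a / sqrt (a\<^sup>2 + b\<^sup>2) \<in> {t. t\<^sup>2 < z} \<longleftrightarrow> a / b \<in> {..<sqrt (z / (1 - z))}" if ab: "0 < a" "0 < b" for a b :: real
  proof -
    have "a / sqrt (a\<^sup>2 + b\<^sup>2) \<in> {t. t\<^sup>2 < z} \<longleftrightarrow> a\<^sup>2 < z * (a\<^sup>2 + b\<^sup>2)"
      using ab by (simp add: power_divide add_pos_pos pos_divide_less_eq)
    also have "\<dots> \<longleftrightarrow> a\<^sup>2 * (1 - z) < z * b\<^sup>2" by (simp add: algebra_simps)
    also have "\<dots> \<longleftrightarrow> (a / b)\<^sup>2 < z / (1 - z)" using ab z by (simp add: power_divide field_simps)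
    also have "\<dots> \<longleftrightarrow> sqrt ((a / b)\<^sup>2) < sqrt (z / (1 - z))" by (simp only: real_sqrt_less_iff)
    also have "\<dots> \<longleftrightarrow> a / b < sqrt (z / (1 - z))" using ab by simp
    finally show ?thesis by simp
  qed
  moreover have "{t::real. t\<^sup>2 < z} \<in> sets borel" by measurable
  ultimately have 1: "measure (cone_measure n) {y \<in> unit_sphere n. (L2_set y I)\<^sup>2 < z} = c * ratio_mass n (card I) {..<sqrt (z / (1 - z))}"
    using key[of "{t. t\<^sup>2 < z}" "{..<sqrt (z / (1 - z))}"] c by (simp add: measure_def ratio_mass_def enn2real_mult)
  have 2: "measure (cone_measure n) (unit_sphere n) = c * ratio_mass n (card I) UNIV"
    using key[of UNIV UNIV] c by (simp add: measure_def ratio_mass_def enn2real_mult)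
  show ?thesis unfolding 1 2 using c by simp
qed

section \<open>The gradient of a homogeneous cone\<close>

lemma mtopology_Rn_component:
  "continuous_map (mtopology_of (Rn n)) euclideanreal (\<lambda>x. x i)"
proof -
  interpret Metric_space "mspace (Rn n)" "mdist (Rn n)" by (rule Metric_space_mspace_mdist)
  show ?thesis
    unfolding mtopology_of_def mtopology_is_euclidean[symmetric]
  proof (subst metric_continuous_map[OF Met_TC.Metric_space_axioms], intro conjI ballI allI impI)
    fix a :: "nat \<Rightarrow> real" and \<epsilon> :: real
    assume a: "a \<in> mspace (Rn n)" and \<epsilon>: "0 < \<epsilon>"
    show "\<exists>\<delta>>0. \<forall>x. x \<in> mspace (Rn n) \<and> mdist (Rn n) a x < \<delta> \<longrightarrow> dist (a i) (x i) < \<epsilon>"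
    proof (intro exI conjI allI impI, rule \<epsilon>)
      fix x assume x: "x \<in> mspace (Rn n) \<and> mdist (Rn n) a x < \<epsilon>"
      show "dist (a i) (x i) < \<epsilon>"
      proof (cases "i < n")
        case True
        have "\<bar>a i - x i\<bar> \<le> vnorm n (\<lambda>i. a i - x i)" by (rule abs_component_le_vnorm[OF True])
        then show ?thesis using x by (simp add: dist_real_def)
      next
        case False
        then show ?thesis using a x \<epsilon> by simp
      qed
    qed
  qed auto
qed

lemma topspace_mtopology_Rn [simp]: "topspace (mtopology_of (Rn n)) = mspace (Rn n)"
  by (simp only: mtopology_of_def Metric_space.topspace_mtopology[OF Metric_space_mspace_mdist])

text \<open>Covers both families: \<open>I\<close> is the axis or the first block, and the profile
  is a function of the share of the block in the squared norm, which avoids angles. Written as a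
  product, the positivity condition fails at the origin by itself.\<close>

locale homogeneous_cone =
  fixes n :: nat and I :: "nat set" and z :: real and G G' :: "real \<Rightarrow> real" and U :: "real \<Rightarrow> (nat \<Rightarrow> real) \<Rightarrow> real"
  assumes I: "I \<noteq> {}" "I \<subset> {..<n}" and z: "0 < z" "z < 1"
    and G_zero: "G z = 0" and G_pos: "\<And>x. 0 \<le> x \<Longrightarrow> x < z \<Longrightarrow> 0 < G x"
    and DERIV_G: "\<And>x. 0 \<le> x \<Longrightarrow> x < 1 \<Longrightarrow> (G has_real_derivative G' x) (at x)"
    and G'_cont: "isCont G' z" and G'_neg: "G' z < 0"
    and U: "\<And>c x. x \<in> mspace (Rn n) \<Longrightarrow> U c x =
      (if (L2_set x I)\<^sup>2 < z * (vnorm n x)\<^sup>2 then c * vnorm n x * G ((L2_set x I)\<^sup>2 / (vnorm n x)\<^sup>2) else 0)"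
begin

definition A :: "(nat \<Rightarrow> real) \<Rightarrow> real" where "A x = (\<Sum>i\<in>I. (x i)\<^sup>2)"
definition B :: "(nat \<Rightarrow> real) \<Rightarrow> real" where "B x = (\<Sum>i<n. (x i)\<^sup>2)"
definition P :: "(nat \<Rightarrow> real) set" where "P = {x \<in> mspace (Rn n). A x < z * B x}"

lemma finI: "finite I" and IN: "i \<in> I \<Longrightarrow> i < n"
  using I finite_subset[of I "{..<n}"] by auto

lemma A_eq: "(L2_set x I)\<^sup>2 = A x" and B_eq: "(vnorm n x)\<^sup>2 = B x"
  by (simp_all add: A_def B_def L2_set_def vnorm_def sum_nonneg)

lemma A_nonneg: "0 \<le> A x" and B_nonneg: "0 \<le> B x" and A_le_B: "A x \<le> B x"
  using I by (auto simp: A_def B_def sum_nonneg intro!: sum_mono2)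

lemma vnorm_sqrt: "vnorm n x = sqrt (B x)"
  by (simp add: vnorm_def L2_set_def B_def)

lemma U_alt: "x \<in> mspace (Rn n) \<Longrightarrow> U c x = (if x \<in> P then c * sqrt (B x) * G (A x / B x) else 0)"
  unfolding U A_eq B_eq by (simp add: P_def vnorm_sqrt)

lemma P_bounds: "x \<in> P \<Longrightarrow> 0 < B x \<and> 0 \<le> A x / B x \<and> A x / B x < z"
  using A_nonneg[of x] B_nonneg[of x] z unfolding P_def
  by (cases "B x = 0") (auto simp: divide_less_eq)

lemma positive_set_U: "0 < c \<Longrightarrow> positive_set n (U c) = P"
  unfolding positive_set_def using P_bounds G_pos
  by (auto simp: U_alt P_def[THEN eqset_imp_iff] simp del: mspace_Rn intro!: mult_pos_pos split: if_splits)

lemma continuous_map_A: "continuous_map (mtopology_of (Rn n)) euclideanreal A"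
  unfolding A_def by (intro continuous_map_sum continuous_map_real_pow mtopology_Rn_component finI)

lemma continuous_map_B: "continuous_map (mtopology_of (Rn n)) euclideanreal B"
  unfolding B_def by (intro continuous_map_sum continuous_map_real_pow mtopology_Rn_component) auto

lemma continuous_map_AB: "continuous_map (mtopology_of (Rn n)) euclideanreal (\<lambda>x. A x - z * B x)"
  by (intro continuous_map_diff continuous_map_real_mult_left continuous_map_A continuous_map_B)

lemma openin_P: "openin (mtopology_of (Rn n)) P"
proof -
  have "openin (mtopology_of (Rn n)) {x \<in> topspace (mtopology_of (Rn n)). A x - z * B x \<in> {..<0}}"
    using continuous_map_AB by (rule openin_continuous_map_preimage) (simp flip: open_openin)
  then show ?thesis by (simp add: P_def del: mspace_Rn)
qed

lemma frontier_P:
  assumes "y \<in> mtopology_of (Rn n) frontier_of P"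
  shows "y \<in> mspace (Rn n)" "A y = z * B y"
proof -
  have cl: "y \<in> mtopology_of (Rn n) closure_of P" and nP: "y \<notin> P"
    using assms openin_P by (auto simp: frontier_of_def interior_of_openin)
  have "closedin (mtopology_of (Rn n)) {x \<in> topspace (mtopology_of (Rn n)). A x - z * B x \<in> {..0}}"
    using continuous_map_AB by (rule closedin_continuous_map_preimage) (simp flip: closed_closedin)
  then have "mtopology_of (Rn n) closure_of P \<subseteq> {x \<in> topspace (mtopology_of (Rn n)). A x - z * B x \<in> {..0}}"
    by (rule closure_of_minimal[rotated]) (auto simp: P_def)
  with cl nP show "y \<in> mspace (Rn n)" "A y = z * B y" by (auto simp: P_def simp del: mspace_Rn)
qed

lemma DERIV_sum_squares:
  assumes "finite S"
  shows "((\<lambda>h. \<Sum>j\<in>S. ((x(i := h)) j)\<^sup>2) has_real_derivative (if i \<in> S then 2 * t else 0)) (at t)"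
proof -
  have "((\<lambda>h. ((x(i := h)) j)\<^sup>2) has_real_derivative (if j = i then 2 * t else 0)) (at t)" for j
    by (auto intro!: derivative_eq_intros)
  then have "((\<lambda>h. \<Sum>j\<in>S. ((x(i := h)) j)\<^sup>2) has_real_derivative (\<Sum>j\<in>S. if j = i then 2 * t else 0)) (at t)"
    by (intro DERIV_sum)
  then show ?thesis using assms by (simp add: sum.delta)
qed

lemma gradient_U:
  assumes x: "x \<in> P" and i: "i < n"
  defines "r \<equiv> sqrt (B x)" and "q \<equiv> A x / B x"
  shows "gradient n (U c) x i = c * ((x i / r) * (G q + 2 * ((if i \<in> I then 1 else 0) - q) * G' q))"
proof -
  have b: "0 < B x" "0 \<le> q" "q < z" using P_bounds[OF x] by (auto simp: q_def)
  have r: "0 < r" "r\<^sup>2 = B x" using b by (simp_all add: r_def)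
  have xm: "x \<in> mspace (Rn n)" using x by (simp add: P_def)
  define ch where "ch = (if i \<in> I then 1 else (0 :: real))"
  define a where "a h = A (x(i := h))" for h
  define b' where "b' h = B (x(i := h))" for h
  have da: "(a has_real_derivative ch * (2 * x i)) (at (x i))"
    unfolding a_def A_def ch_def using DERIV_sum_squares[OF finI, of x i "x i"] by (simp split: if_splits)
  have db: "(b' has_real_derivative 2 * x i) (at (x i))"
    unfolding b'_def B_def using DERIV_sum_squares[of "{..<n}" x i "x i"] i by simp
  have ab: "a (x i) = A x" "b' (x i) = B x" by (simp_all add: a_def b'_def)
  \<comment> \<open>\<open>P\<close> is open, so along a coordinate line the function agrees near
    the point with its smooth branch, and the kink across the free boundary is not seen.\<close>
  have ev: "\<forall>\<^sub>F h in nhds (x i). U c (x(i := h)) = c * sqrt (b' h) * G (a h / b' h)"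
  proof -
    have "isCont (\<lambda>h. a h - z * b' h) (x i)"
      using DERIV_isCont[OF da] DERIV_isCont[OF db] by (intro continuous_intros)
    moreover have "a (x i) - z * b' (x i) < 0" using x by (simp add: ab P_def)
    ultimately have "\<forall>\<^sub>F h in at (x i). a h - z * b' h < 0"
      unfolding isCont_def by (intro order_tendstoD)
    then have "\<forall>\<^sub>F h in nhds (x i). a h - z * b' h < 0"
      using \<open>a (x i) - z * b' (x i) < 0\<close> by (simp add: eventually_nhds_conv_at)
    then show ?thesis
    proof eventually_elim
      case (elim h)
      have "x(i := h) \<in> mspace (Rn n)" using xm i by auto
      then show ?case using elim by (simp add: U_alt P_def a_def b'_def del: mspace_Rn)
    qed
  qed
  have q1: "q < 1" using b z by simp
  have dG: "(G has_real_derivative G' q) (at (a (x i) / b' (x i)))"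
    using DERIV_G[OF b(2) q1] by (simp add: ab q_def)
  have d1: "((\<lambda>h. a h / b' h) has_real_derivative (ch * (2 * x i) * B x - A x * (2 * x i)) / (B x * B x)) (at (x i))"
    using DERIV_divide[OF da db] b by (simp add: ab)
  have d2: "((\<lambda>h. sqrt (b' h)) has_real_derivative inverse (sqrt (B x)) / 2 * (2 * x i)) (at (x i))"
    using DERIV_chain2[OF DERIV_real_sqrt db] b by (simp add: ab)
  have d3: "((\<lambda>h. c * (sqrt (b' h) * G (a h / b' h))) has_real_derivative
     c * (inverse (sqrt (B x)) / 2 * (2 * x i) * G q + G' q * ((ch * (2 * x i) * B x - A x * (2 * x i)) / (B x * B x)) * sqrt (B x))) (at (x i))"
    using DERIV_cmult[OF DERIV_mult[OF d2 DERIV_chain2[OF dG d1]], of c] by (simp add: ab q_def)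
  have "((\<lambda>h. U c (x(i := h))) has_real_derivative
     c * (inverse (sqrt (B x)) / 2 * (2 * x i) * G q + G' q * ((ch * (2 * x i) * B x - A x * (2 * x i)) / (B x * B x)) * sqrt (B x))) (at (x i))"
    using d3 ev by (subst DERIV_cong_ev[OF refl _ refl]) (auto simp: mult.assoc)
  then have "gradient n (U c) x i = c * (inverse (sqrt (B x)) / 2 * (2 * x i) * G q + G' q * ((ch * (2 * x i) * B x - A x * (2 * x i)) / (B x * B x)) * sqrt (B x))"
    using i by (simp add: gradient_def DERIV_imp_deriv)
  also have "inverse (sqrt (B x)) / 2 * (2 * x i) * G q = (x i / r) * G q" by (simp add: r_def field_simps)
  also have "G' q * ((ch * (2 * x i) * B x - A x * (2 * x i)) / (B x * B x)) * sqrt (B x) = (x i / r) * (2 * (ch - q) * G' q)"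
  proof -
    have A: "A x = q * r\<^sup>2" using b r by (simp add: q_def)
    show ?thesis unfolding r_def[symmetric] A r(2)[symmetric] using r(1) by (simp add: field_simps power2_eq_square)
  qed
  finally show ?thesis by (simp add: ch_def distrib_left mult.assoc)
qed

text \<open>For \<open>q\<close> the squared sine of an angle this is the orthogonal splitting of
  the gradient: \<open>G q\<close> is the radial part, and \<open>4 * q * (1 - q)\<close> is the
  squared derivative of \<open>q\<close> in the angle, so the second summand is the tangential
  part.\<close>

lemma vnorm_gradient_U:
  assumes x: "x \<in> P"
  defines "q \<equiv> A x / B x"
  shows "vnorm n (gradient n (U c) x) = \<bar>c\<bar> * sqrt ((G q)\<^sup>2 + 4 * q * (1 - q) * (G' q)\<^sup>2)"
proof -
  have b: "0 < B x" using P_bounds[OF x] by auto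
  define r where "r = sqrt (B x)"
  have r: "0 < r" "r\<^sup>2 = B x" using b by (simp_all add: r_def)
  have "(\<Sum>i<n. (gradient n (U c) x i)\<^sup>2) = (\<Sum>i<n. c\<^sup>2 / B x * ((x i)\<^sup>2 * (G q - 2 * q * G' q)\<^sup>2
      + (if i \<in> I then (x i)\<^sup>2 * (4 * G q * G' q + 4 * (1 - 2 * q) * (G' q)\<^sup>2) else 0)))"
  proof (rule sum.cong[OF refl])
    fix i assume "i \<in> {..<n}"
    then have "gradient n (U c) x i = c * ((x i / r) * (G q + 2 * ((if i \<in> I then 1 else 0) - q) * G' q))"
      using gradient_U[OF x, of i c] by (simp add: q_def r_def)
    then have "(gradient n (U c) x i)\<^sup>2 = c\<^sup>2 * ((x i)\<^sup>2 / B x * (G q + 2 * ((if i \<in> I then 1 else 0) - q) * G' q)\<^sup>2)"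
      by (simp only: power_mult_distrib power_divide r(2))
    also have "(G q + 2 * ((if i \<in> I then 1 else 0) - q) * G' q)\<^sup>2 =
      (G q - 2 * q * G' q)\<^sup>2 + (if i \<in> I then 4 * G q * G' q + 4 * (1 - 2 * q) * (G' q)\<^sup>2 else 0)"
      by (simp add: power2_eq_square algebra_simps)
    finally show "(gradient n (U c) x i)\<^sup>2 = c\<^sup>2 / B x * ((x i)\<^sup>2 * (G q - 2 * q * G' q)\<^sup>2
      + (if i \<in> I then (x i)\<^sup>2 * (4 * G q * G' q + 4 * (1 - 2 * q) * (G' q)\<^sup>2) else 0))"
      by (simp add: distrib_left)
  qed
  also have "\<dots> = c\<^sup>2 / B x * (B x * (G q - 2 * q * G' q)\<^sup>2 + A x * (4 * G q * G' q + 4 * (1 - 2 * q) * (G' q)\<^sup>2))"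
  proof -
    have "{i. i < n \<and> i \<in> I} = I" using IN by auto
    then have "(\<Sum>i<n. if i \<in> I then (x i)\<^sup>2 * e else 0) = A x * e" for e
      using I by (simp add: sum.If_cases A_def sum_distrib_right Int_absorb1 psubset_imp_subset)
    moreover have "(\<Sum>i<n. (x i)\<^sup>2 * e) = B x * e" for e by (simp only: B_def sum_distrib_right)
    ultimately show ?thesis by (simp only: sum.distrib sum_distrib_left[symmetric])
  qed
  also have "A x = q * B x" using b by (simp add: q_def)
  also have "c\<^sup>2 / B x * (B x * (G q - 2 * q * G' q)\<^sup>2 + q * B x * (4 * G q * G' q + 4 * (1 - 2 * q) * (G' q)\<^sup>2))
    = c\<^sup>2 * ((G q)\<^sup>2 + 4 * q * (1 - q) * (G' q)\<^sup>2)"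
    using b by (simp add: field_simps power2_eq_square)
  finally show ?thesis by (simp add: vnorm_def L2_set_def real_sqrt_mult)
qed

text \<open>At the free boundary \<open>G\<close> vanishes and the radial part with it. What remains
  depends on \<open>c\<close> and \<open>z\<close> only, so the limit is the same at every boundary
  point.\<close>

lemma gradient_limit:
  assumes y: "y \<in> mtopology_of (Rn n) frontier_of P" "y \<noteq> (\<lambda>i. 0)"
  shows "((\<lambda>x. vnorm n (gradient n (U c) x)) \<longlongrightarrow> \<bar>c\<bar> * (2 * sqrt (z * (1 - z)) * - G' z)) (atin_within (mtopology_of (Rn n)) y P)"
proof -
  let ?F = "atin_within (mtopology_of (Rn n)) y P"
  have ym: "y \<in> mspace (Rn n)" and yz: "A y = z * B y" using frontier_P[OF y(1)] by auto
  have By: "B y \<noteq> 0"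
  proof
    assume "B y = 0"
    then have "\<forall>i<n. y i = 0" by (auto simp: B_def sum_nonneg_eq_0_iff)
    then have "y = (\<lambda>i. 0)" using ym by (auto simp: fun_eq_iff) (metis leI)
    with y show False by simp
  qed
  have lim: "(f \<longlongrightarrow> f y) ?F" if "continuous_map (mtopology_of (Rn n)) euclideanreal f" for f
  proof -
    have "limitin euclideanreal f (f y) (atin (mtopology_of (Rn n)) y)"
      using that ym by (simp add: continuous_map_atin del: mspace_Rn)
    then have "(f \<longlongrightarrow> f y) (atin (mtopology_of (Rn n)) y)" by simp
    moreover have "?F \<le> atin (mtopology_of (Rn n)) y"
      by (rule filter_leI) (auto simp: eventually_atin eventually_atin_within)
    ultimately show ?thesis by (rule tendsto_mono[rotated])
  qed
  have q: "((\<lambda>x. A x / B x) \<longlongrightarrow> z) ?F"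
    using tendsto_divide[OF lim[OF continuous_map_A] lim[OF continuous_map_B] By] By by (simp add: yz)
  have "isCont G z" using DERIV_G[of z] z by (intro DERIV_isCont) auto
  then have Gq: "((\<lambda>x. G (A x / B x)) \<longlongrightarrow> 0) ?F" using isCont_tendsto_compose[OF _ q, of G] G_zero by simp
  have G'q: "((\<lambda>x. G' (A x / B x)) \<longlongrightarrow> G' z) ?F" by (rule isCont_tendsto_compose[OF G'_cont q])
  have "((\<lambda>x. \<bar>c\<bar> * sqrt ((G (A x / B x))\<^sup>2 + 4 * (A x / B x) * (1 - A x / B x) * (G' (A x / B x))\<^sup>2)) \<longlongrightarrow>
      \<bar>c\<bar> * sqrt (0\<^sup>2 + 4 * z * (1 - z) * (G' z)\<^sup>2)) ?F"
    by (intro tendsto_intros q Gq G'q)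
  moreover have "sqrt (0\<^sup>2 + 4 * z * (1 - z) * (G' z)\<^sup>2) = 2 * sqrt (z * (1 - z)) * - G' z"
    using G'_neg by (simp add: real_sqrt_mult mult.assoc)
  moreover have "\<forall>\<^sub>F x in ?F. \<bar>c\<bar> * sqrt ((G (A x / B x))\<^sup>2 + 4 * (A x / B x) * (1 - A x / B x) * (G' (A x / B x))\<^sup>2)
      = vnorm n (gradient n (U c) x)"
  proof -
    have "\<forall>\<^sub>F x in ?F. x \<in> P"
      unfolding eventually_atin_within using openin_topspace[of "mtopology_of (Rn n)"] ym
      by (intro disjI2 exI[of _ "topspace (mtopology_of (Rn n))"]) (auto simp del: mspace_Rn)
    then show ?thesis by eventually_elim (simp add: vnorm_gradient_U)
  qed
  ultimately show ?thesis by (simp add: Lim_transform_eventually)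
qed

text \<open>Without a boundary point at which the filter is proper, the gradient condition would
  hold for every \<open>c\<close> and the normalizing constant would not be unique.\<close>

lemma frontier_point_exists:
  "\<exists>y \<in> mtopology_of (Rn n) frontier_of P - {\<lambda>i. 0}. atin_within (mtopology_of (Rn n)) y P \<noteq> bot"
proof -
  obtain i where i: "i \<in> I" "i < n" using I IN by auto
  obtain j where j: "j \<notin> I" "j < n" using I by auto
  \<comment> \<open>\<open>w 1\<close> is a unit vector whose share in the block is exactly
    \<open>z\<close>; multiplying its block coordinate by some \<open>s < 1\<close> moves it into
    \<open>P\<close>.\<close>
  define w where "w s = (\<lambda>l. if l = i then s * sqrt z else if l = j then sqrt (1 - z) else 0)" for s
  have wm: "w s \<in> mspace (Rn n)" for s using i j by (auto simp: w_def)
  have ij: "i \<noteq> j" using i j by auto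
  have Aw: "A (w s) = s\<^sup>2 * z" for s
  proof -
    have "A (w s) = (\<Sum>l\<in>I. if l = i then s\<^sup>2 * z else 0)"
      unfolding A_def using j z by (intro sum.cong) (auto simp: w_def power_mult_distrib)
    then show ?thesis using i finI by (simp add: sum.delta)
  qed
  have Bw: "B (w s) = s\<^sup>2 * z + (1 - z)" for s
  proof -
    have "B (w s) = (\<Sum>l<n. (if l = i then s\<^sup>2 * z else 0) + (if l = j then 1 - z else 0))"
      unfolding B_def using ij z by (intro sum.cong) (auto simp: w_def power_mult_distrib)
    then show ?thesis using i j by (simp add: sum.distrib sum.delta)
  qed
  have wP: "w s \<in> P" if "0 \<le> s" "s < 1" for s
  proof -
    have "s\<^sup>2 < 1" using that by (simp add: power_less_one_iff)
    then have "0 < z * (1 - z) * (1 - s\<^sup>2)" using z by simp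
    then have "A (w s) < z * B (w s)" unfolding Aw Bw by (simp add: algebra_simps)
    then show ?thesis using wm by (simp add: P_def)
  qed
  have nP: "w 1 \<notin> P" by (simp add: P_def Aw Bw)
  have near: "\<exists>x. x \<in> P \<and> x \<in> V" if V: "openin (mtopology_of (Rn n)) V" "w 1 \<in> V" for V
  proof -
    interpret Metric_space "mspace (Rn n)" "mdist (Rn n)" by (rule Metric_space_mspace_mdist)
    obtain r where r: "0 < r" "mball (w 1) r \<subseteq> V"
      using V unfolding mtopology_of_def openin_mtopology by blast
    define s where "s = 1 - min 1 (r / 2)"
    have s: "0 \<le> s" "s < 1" "1 - s < r" using r by (auto simp: s_def min_def)
    have "w 1 i - w s i = (1 - s) * sqrt z" by (simp add: w_def algebra_simps)
    then have wi: "(w 1 i - w s i)\<^sup>2 = (1 - s)\<^sup>2 * z" using z by (simp add: power_mult_distrib)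
    have "vnorm n (\<lambda>l. w 1 l - w s l) = sqrt (\<Sum>l<n. if l = i then (1 - s)\<^sup>2 * z else 0)"
      unfolding vnorm_def L2_set_def
      using wi by (intro arg_cong[where f = sqrt] sum.cong) (auto simp: w_def)
    also have "\<dots> = (1 - s) * sqrt z" using i s by (simp add: sum.delta real_sqrt_mult)
    also have "\<dots> \<le> (1 - s) * 1" using s z by (intro mult_left_mono) auto
    also have "\<dots> < r" using s by simp
    finally have "mdist (Rn n) (w 1) (w s) < r" by simp
    then have "w s \<in> mball (w 1) r" using wm by (simp only: in_mball)
    then show ?thesis using r wP[OF s(1,2)] by blast
  qed
  show ?thesis
  proof (rule bexI)
    show "w 1 \<in> mtopology_of (Rn n) frontier_of P - {\<lambda>i. 0}"
    proof -
      have "w 1 \<in> mtopology_of (Rn n) closure_of P"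
        using near wm by (auto simp: in_closure_of simp del: mspace_Rn)
      then have "w 1 \<in> mtopology_of (Rn n) frontier_of P"
        using nP openin_P by (simp add: frontier_of_def interior_of_openin)
      moreover have "w 1 j \<noteq> 0" using ij z by (simp add: w_def)
      then have "w 1 \<noteq> (\<lambda>i. 0)" by metis
      ultimately show ?thesis by simp
    qed
    show "atin_within (mtopology_of (Rn n)) (w 1) P \<noteq> bot"
    proof
      assume "atin_within (mtopology_of (Rn n)) (w 1) P = bot"
      then have "eventually (\<lambda>_. False) (atin_within (mtopology_of (Rn n)) (w 1) P)" by simp
      then obtain V where V: "openin (mtopology_of (Rn n)) V" "w 1 \<in> V" "\<forall>x\<in>V. x \<in> P \<and> x \<noteq> w 1 \<longrightarrow> False"
        using wm unfolding eventually_atin_within by (auto simp del: mspace_Rn)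
      then show False using near[OF V(1,2)] nP by metis
    qed
  qed
qed

text \<open>The limit is \<open>c * K\<close> on the whole free boundary, so the condition is one
  linear equation for \<open>c\<close>. This gives the definite descriptions in the two cones a
  value, of which the density uses only positivity.\<close>

lemma ex1_unit_gradient: "\<exists>!c. 0 < c \<and> unit_gradient_on_free_boundary n (U c)"
proof -
  define K where "K = 2 * sqrt (z * (1 - z)) * - G' z"
  have K: "0 < K" using z G'_neg by (simp add: K_def mult_less_0_iff)
  have iff: "unit_gradient_on_free_boundary n (U c) \<longleftrightarrow> c * K = 1" if c: "0 < c" for c
  proof
    assume "c * K = 1"
    then show "unit_gradient_on_free_boundary n (U c)"
      unfolding unit_gradient_on_free_boundary_def positive_set_U[OF c]
      using gradient_limit[of _ c] c by (auto simp: K_def)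
  next
    assume ug: "unit_gradient_on_free_boundary n (U c)"
    obtain y where y: "y \<in> mtopology_of (Rn n) frontier_of P - {\<lambda>i. 0}" "atin_within (mtopology_of (Rn n)) y P \<noteq> bot"
      using frontier_point_exists by blast
    have "((\<lambda>x. vnorm n (gradient n (U c) x)) \<longlongrightarrow> c * K) (atin_within (mtopology_of (Rn n)) y P)"
      using gradient_limit[of y c] y c by (simp add: K_def)
    moreover have "((\<lambda>x. vnorm n (gradient n (U c) x)) \<longlongrightarrow> 1) (atin_within (mtopology_of (Rn n)) y P)"
      using ug y unfolding unit_gradient_on_free_boundary_def positive_set_U[OF c] by blast
    ultimately show "c * K = 1" using tendsto_unique[OF y(2)] by blast
  qed
  show ?thesis
  proof (rule ex1I[of _ "1 / K"])
    show "0 < 1 / K \<and> unit_gradient_on_free_boundary n (U (1 / K))" using K iff[of "1 / K"] by simp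
    show "c = 1 / K" if "0 < c \<and> unit_gradient_on_free_boundary n (U c)" for c
      using that iff[of c] K by (simp add: field_simps)
  qed
qed

end

section \<open>The hypergeometric profiles\<close>

text \<open>\<open>k\<close> is the dimension of the block: 1 for the axisymmetric cone and
  \<open>m1 + 1\<close> for the second family. The argument of the series is the squared variable
  \<open>t\<^sup>2\<close> of the original profiles.\<close>

definition hyp_fps :: "nat \<Rightarrow> nat \<Rightarrow> real fps" where
  "hyp_fps n k = fps_hypergeo [(real n - 1) / 2, - 1 / 2] [real k / 2] 1"

definition hypG :: "nat \<Rightarrow> nat \<Rightarrow> real \<Rightarrow> real" where
  "hypG n k z = eval_fps (hyp_fps n k) z"

definition hypG' :: "nat \<Rightarrow> nat \<Rightarrow> real \<Rightarrow> real" where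
  "hypG' n k z = eval_fps (fps_deriv (hyp_fps n k)) z"

definition hypG'' :: "nat \<Rightarrow> nat \<Rightarrow> real \<Rightarrow> real" where
  "hypG'' n k z = eval_fps (fps_deriv (fps_deriv (hyp_fps n k))) z"

lemma hyp_fps_Suc:
  assumes "1 \<le> k"
  shows "(real j + 1) * (real k / 2 + real j) * fps_nth (hyp_fps n k) (Suc j) =
    ((real n - 1) / 2 + real j) * (real j - 1 / 2) * fps_nth (hyp_fps n k) j"
proof -
  have "fps_nth (hyp_fps n k) (Suc j) = ((real n - 1) / 2 + real j) * (real j - 1 / 2) /
      ((real j + 1) * (real k / 2 + real j)) * fps_nth (hyp_fps n k) j"
    using fps_hypergeo_rec[of "[(real n - 1) / 2, - 1 / 2]" "[real k / 2]" 1 j, folded hyp_fps_def]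
    by (simp only: foldl_Cons foldl_Nil mult_1 of_nat_Suc) (simp add: add.commute)
  moreover have "(real j + 1) * (real k / 2 + real j) \<noteq> 0" using assms by (simp add: add_nonneg_eq_0_iff)
  ultimately show ?thesis by (simp add: field_simps)
qed

lemma hyp_fps_0 [simp]: "fps_nth (hyp_fps n k) 0 = 1"
  by (simp add: hyp_fps_def)

text \<open>In the recursion the factor \<open>j - 1/2\<close> is negative for \<open>j = 0\<close>
  only, so the sign changes once, after the constant term 1. The profile is therefore strictly
  decreasing on \<open>[0, 1)\<close> and has at most one zero there.\<close>

lemma hyp_fps_neg:
  assumes "2 \<le> n" "1 \<le> k" "1 \<le> j"
  shows "fps_nth (hyp_fps n k) j < 0"
  using assms(3)
proof (induction j rule: dec_induct)
  case base
  have "real k / 2 * fps_nth (hyp_fps n k) 1 = (real n - 1) / 2 * (- 1 / 2)"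
    using hyp_fps_Suc[OF assms(2), of 0 n] by simp
  moreover have "(real n - 1) / 2 * (- 1 / 2) < 0" using assms by simp
  ultimately have "real k / 2 * fps_nth (hyp_fps n k) 1 < 0" by linarith
  then show ?case using assms by (simp add: mult_less_0_iff)
next
  case (step j)
  have "0 < (real n - 1) / 2 + real j" "0 < real j - 1 / 2" using step assms by (auto intro: add_nonneg_pos)
  then have "((real n - 1) / 2 + real j) * (real j - 1 / 2) * fps_nth (hyp_fps n k) j < 0"
    using step by (intro mult_pos_neg mult_pos_pos) auto
  then have "(real j + 1) * (real k / 2 + real j) * fps_nth (hyp_fps n k) (Suc j) < 0"
    using hyp_fps_Suc[OF assms(2), of j n] by simp
  moreover have "0 < (real j + 1) * (real k / 2 + real j)" using assms by (intro mult_pos_pos) auto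
  ultimately show ?case by (simp add: mult_less_0_iff)
qed

lemma hyp_fps_radius:
  assumes "2 \<le> n" "1 \<le> k"
  shows "fps_conv_radius (hyp_fps n k) = 1"
proof -
  have nz: "fps_nth (hyp_fps n k) j \<noteq> 0" for j
    using hyp_fps_neg[OF assms, of j] by (cases j) auto
  have "norm (fps_nth (hyp_fps n k) j) / norm (fps_nth (hyp_fps n k) (Suc j))
      = (real j + 1) * (real k / 2 + real j) / (((real n - 1) / 2 + real j) * (real j - 1 / 2))" if "1 \<le> j" for j
  proof -
    have p: "0 < ((real n - 1) / 2 + real j) * (real j - 1 / 2)" "0 < (real j + 1) * (real k / 2 + real j)"
      using assms that by (auto intro!: mult_pos_pos intro: add_nonneg_pos)
    have "fps_nth (hyp_fps n k) j / fps_nth (hyp_fps n k) (Suc j)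
      = (real j + 1) * (real k / 2 + real j) / (((real n - 1) / 2 + real j) * (real j - 1 / 2))"
    proof (subst frac_eq_eq)
      show "fps_nth (hyp_fps n k) (Suc j) \<noteq> 0" by (rule nz)
      show "((real n - 1) / 2 + real j) * (real j - 1 / 2) \<noteq> 0" by (rule less_imp_neq[OF p(1), symmetric])
      show "fps_nth (hyp_fps n k) j * (((real n - 1) / 2 + real j) * (real j - 1 / 2)) =
          (real j + 1) * (real k / 2 + real j) * fps_nth (hyp_fps n k) (Suc j)"
        unfolding hyp_fps_Suc[OF assms(2)] by (simp only: mult_ac)
    qed
    moreover have "0 < fps_nth (hyp_fps n k) j / fps_nth (hyp_fps n k) (Suc j)"
      using hyp_fps_neg[OF assms, of j] hyp_fps_neg[OF assms, of "Suc j"] that by (simp add: divide_neg_neg)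
    ultimately show ?thesis by (simp flip: abs_divide)
  qed
  then have "\<forall>\<^sub>F j in sequentially. (real j + 1) * (real k / 2 + real j) / (((real n - 1) / 2 + real j) * (real j - 1 / 2))
      = norm (fps_nth (hyp_fps n k) j) / norm (fps_nth (hyp_fps n k) (Suc j))"
    by (intro eventually_sequentiallyI[of 1]) simp
  moreover have "(\<lambda>j. (real j + 1) * (real k / 2 + real j) / (((real n - 1) / 2 + real j) * (real j - 1 / 2))) \<longlonglongrightarrow> 1"
    by real_asymp
  ultimately have "(\<lambda>j. norm (fps_nth (hyp_fps n k) j) / norm (fps_nth (hyp_fps n k) (Suc j))) \<longlonglongrightarrow> 1"
    by (rule Lim_transform_eventually[rotated])
  then show ?thesis
    unfolding fps_conv_radius_def by (intro conv_radius_ratio_limit_nonzero[of _ 1]) (simp_all add: one_ereal_def)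
qed

context
  fixes n k :: nat
  assumes nk: "2 \<le> n" "1 \<le> k"
begin

lemma hyp_fps_deriv_radius:
  "1 \<le> fps_conv_radius (fps_deriv (hyp_fps n k))" "1 \<le> fps_conv_radius (fps_deriv (fps_deriv (hyp_fps n k)))"
  using fps_conv_radius_deriv[of "hyp_fps n k"] fps_conv_radius_deriv[of "fps_deriv (hyp_fps n k)"]
    hyp_fps_radius[OF nk] by auto

lemma hyp_fps_in_radius:
  fixes z :: real assumes "\<bar>z\<bar> < 1"
  shows "ereal (norm z) < fps_conv_radius (hyp_fps n k)"
    "ereal (norm z) < fps_conv_radius (fps_deriv (hyp_fps n k))"
    "ereal (norm z) < fps_conv_radius (fps_deriv (fps_deriv (hyp_fps n k)))"
  using assms hyp_fps_radius[OF nk] hyp_fps_deriv_radius by (auto intro: less_le_trans[of _ 1])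

lemma DERIV_hypG: "\<bar>z\<bar> < 1 \<Longrightarrow> (hypG n k has_real_derivative hypG' n k z) (at z)"
  unfolding hypG_def[abs_def] hypG'_def by (intro has_field_derivative_eval_fps hyp_fps_in_radius)

lemma DERIV_hypG': "\<bar>z\<bar> < 1 \<Longrightarrow> (hypG' n k has_real_derivative hypG'' n k z) (at z)"
  unfolding hypG'_def[abs_def] hypG''_def by (intro has_field_derivative_eval_fps hyp_fps_in_radius)

lemma hypG_0: "hypG n k 0 = 1"
  by (simp add: hypG_def eval_fps_at_0)

lemma hypG'_neg:
  assumes "0 \<le> z" "z < 1"
  shows "hypG' n k z < 0"
proof -
  let ?d = "fps_deriv (hyp_fps n k)"
  have s: "(\<lambda>j. fps_nth ?d j * z ^ j) sums hypG' n k z"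
    unfolding hypG'_def using assms by (intro sums_eval_fps hyp_fps_in_radius) auto
  have "(\<lambda>j. if j = 0 then fps_nth ?d 0 else 0) sums fps_nth ?d 0"
    using sums_single[of 0 "\<lambda>_. fps_nth ?d 0"] by (simp add: eq_commute)
  then have "hypG' n k z \<le> fps_nth ?d 0"
    using sums_le[OF _ s] hyp_fps_neg[OF nk] assms
    by (intro sums_le[OF _ s]) (auto simp: mult_le_0_iff intro: less_imp_le)
  also have "\<dots> < 0" using hyp_fps_neg[OF nk, of 1] by simp
  finally show ?thesis .
qed

lemma hypG_strict_antimono:
  assumes "0 \<le> x" "x < y" "y < 1"
  shows "hypG n k y < hypG n k x"
  using assms(2)
proof (rule DERIV_neg_imp_decreasing)
  fix t assume "x \<le> t" "t \<le> y"
  then have "0 \<le> t" "t < 1" using assms by auto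
  then show "\<exists>d. (hypG n k has_real_derivative d) (at t) \<and> d < 0"
    using DERIV_hypG[of t] hypG'_neg[of t] by auto
qed

text \<open>The coefficient recursion in another form: the hypergeometric equation with
  \<open>a = (n - 1) / 2\<close> and \<open>b = - 1 / 2\<close>, so that
  \<open>a + b + 1 = n / 2\<close> and \<open>a * b = - (n - 1) / 4\<close>.\<close>

lemma hypG_ode:
  assumes "\<bar>z\<bar> < 1"
  shows "z * (1 - z) * hypG'' n k z + (real k / 2 - real n * z / 2) * hypG' n k z + (real n - 1) / 4 * hypG n k z = 0"
proof -
  let ?F = "hyp_fps n k"
  let ?A = "fps_X * (fps_deriv (fps_deriv ?F) - fps_X * fps_deriv (fps_deriv ?F))"
  let ?B = "fps_const (real k / 2) * fps_deriv ?F - fps_const (real n / 2) * (fps_X * fps_deriv ?F)"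
  let ?C = "fps_const ((real n - 1) / 4) * ?F"
  have "?A + ?B + ?C = 0"
  proof (rule fps_ext)
    fix j
    show "fps_nth (?A + ?B + ?C) j = fps_nth 0 j"
    proof (cases j)
      case 0
      then show ?thesis using hyp_fps_Suc[OF nk(2), of 0 n] by (simp add: field_simps)
    next
      case (Suc i)
      have "fps_nth (?A + ?B + ?C) j = (real j + 1) * (real k / 2 + real j) * fps_nth ?F (Suc j)
          - ((real n - 1) / 2 + real j) * (real j - 1 / 2) * fps_nth ?F j"
        unfolding Suc by (cases i) (simp_all add: field_simps)
      then show ?thesis using hyp_fps_Suc[OF nk(2), of j n] by simp
    qed
  qed
  then have "eval_fps (?A + ?B + ?C) z = 0" by simp
  moreover have r: "ereal (norm z) < fps_conv_radius ?F" "ereal (norm z) < fps_conv_radius (fps_deriv ?F)"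
    "ereal (norm z) < fps_conv_radius (fps_deriv (fps_deriv ?F))"
    by (rule hyp_fps_in_radius[OF assms])+
  have XF: "ereal (norm z) < fps_conv_radius (fps_X * g)" "eval_fps (fps_X * g) z = z * eval_fps g z"
    if "ereal (norm z) < fps_conv_radius g" for g :: "real fps"
    using that less_le_trans[OF _ fps_conv_radius_mult[of fps_X g]] by (auto simp: eval_fps_mult)
  have CF: "ereal (norm z) < fps_conv_radius (fps_const c * g)" "eval_fps (fps_const c * g) z = c * eval_fps g z"
    if "ereal (norm z) < fps_conv_radius g" for g :: "real fps" and c
    using that less_le_trans[OF _ fps_conv_radius_mult[of "fps_const c" g]] by (auto simp: eval_fps_mult)
  have DF: "ereal (norm z) < fps_conv_radius (g - h)" "eval_fps (g - h) z = eval_fps g z - eval_fps h z"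
    if "ereal (norm z) < fps_conv_radius g" "ereal (norm z) < fps_conv_radius h" for g h :: "real fps"
    using that less_le_trans[OF _ fps_conv_radius_diff[of g h]] by (auto simp: eval_fps_diff)
  have AF: "ereal (norm z) < fps_conv_radius (g + h)" "eval_fps (g + h) z = eval_fps g z + eval_fps h z"
    if "ereal (norm z) < fps_conv_radius g" "ereal (norm z) < fps_conv_radius h" for g h :: "real fps"
    using that less_le_trans[OF _ fps_conv_radius_add[of g h]] by (auto simp: eval_fps_add)
  have "eval_fps (?A + ?B + ?C) z = z * (hypG'' n k z - z * hypG'' n k z) +
      (real k / 2 * hypG' n k z - real n / 2 * (z * hypG' n k z)) + (real n - 1) / 4 * hypG n k z"
    unfolding hypG_def hypG'_def hypG''_def by (simp only: XF CF DF AF r)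
  ultimately show ?thesis by (simp add: algebra_simps)
qed

text \<open>Existence is conditional on a nonpositive value. Such a point is supplied by Sturm
  comparison when both blocks grow and by the confluent limit when one block is a line.\<close>

lemma hypG_unique_zero:
  assumes z1: "0 < z1" "z1 < 1" "hypG n k z1 \<le> 0"
  shows "\<exists>z. 0 < z \<and> z \<le> z1 \<and> hypG n k z = 0 \<and> (\<forall>x. 0 \<le> x \<and> x < z \<longrightarrow> 0 < hypG n k x) \<and>
     (\<forall>x. 0 < x \<and> x < 1 \<and> hypG n k x = 0 \<longrightarrow> x = z)"
proof -
  have "\<exists>z. 0 \<le> z \<and> z \<le> z1 \<and> hypG n k z = 0"
  proof (rule IVT2)
    show "\<forall>x. 0 \<le> x \<and> x \<le> z1 \<longrightarrow> isCont (hypG n k) x"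
      using z1 by (auto intro!: DERIV_isCont[OF DERIV_hypG])
  qed (use z1 hypG_0 in auto)
  then obtain z where z: "0 \<le> z" "z \<le> z1" "hypG n k z = 0" by blast
  have "z \<noteq> 0" using z hypG_0 by auto
  moreover have "0 < hypG n k x" if "0 \<le> x" "x < z" for x
    using hypG_strict_antimono[of x z] that z z1 by auto
  moreover have "x = z" if "0 < x" "x < 1" "hypG n k x = 0" for x
    using hypG_strict_antimono[of x z] hypG_strict_antimono[of z x] that z z1 by (cases x z rule: linorder_cases) auto
  ultimately show ?thesis using z by (intro exI[of _ z]) auto
qed

text \<open>
  Sturm comparison: \<open>p = z\<^sup>k\<^sup>/\<^sup>2 (1 - z)\<^sup>l\<^sup>/\<^sup>2\<close> is the integrating factor of the hypergeometric operator,
  so the monotonicity of \<open>p\<close> times the Wronskian of \<open>G\<close> and a test function \<open>\<phi>\<close> is governed by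
  the sign of the operator on \<open>\<phi>\<close>.
\<close>
lemma wronskian_sign:
  fixes \<phi> \<phi>' \<phi>'' :: "real \<Rightarrow> real" and \<epsilon> :: real
  assumes k: "k < n" and z: "0 < z" "z < 1"
    and d: "\<And>x. (\<phi> has_real_derivative \<phi>' x) (at x)" "\<And>x. (\<phi>' has_real_derivative \<phi>'' x) (at x)"
    and L: "\<And>x. 0 < x \<Longrightarrow> x < z \<Longrightarrow>
      0 \<le> \<epsilon> * hypG n k x * (x * (1 - x) * \<phi>'' x + (real k / 2 - real n * x / 2) * \<phi>' x + (real n - 1) / 4 * \<phi> x)"
  shows "0 \<le> \<epsilon> * (hypG n k z * \<phi>' z - \<phi> z * hypG' n k z)"
proof -
  define l where "l = real n - real k"
  have l: "0 < l" using k by (simp add: l_def)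
  have kp: "0 < real k" using nk by simp
  define p where "p x = x powr (real k / 2) * (1 - x) powr (l / 2)" for x :: real
  define W where "W x = hypG n k x * \<phi>' x - \<phi> x * hypG' n k x" for x
  \<comment> \<open>\<open>\<epsilon>\<close> is taken as 1 and as -1 later, so that one statement
    serves both directions of the comparison.\<close>
  define f where "f x = \<epsilon> * (p x * W x)" for x
  have "f 0 \<le> f z"
  proof (rule DERIV_nonneg_imp_increasing_open[OF less_imp_le[OF z(1)]])
    fix x assume x: "0 < x" "x < z"
    then have x1: "x < 1" "\<bar>x\<bar> < 1" using z by auto
    have dp: "(p has_real_derivative p x / (x * (1 - x)) * (real k / 2 - real n * x / 2)) (at x)"
    proof -
      have "(p has_real_derivative (real k / 2 * x powr (real k / 2 - 1)) * (1 - x) powr (l / 2)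
          + x powr (real k / 2) * (- (l / 2 * (1 - x) powr (l / 2 - 1)))) (at x)"
        unfolding p_def using x x1 by (auto intro!: derivative_eq_intros)
      moreover have "x powr (real k / 2 - 1) = x powr (real k / 2) / x"
        "(1 - x) powr (l / 2 - 1) = (1 - x) powr (l / 2) / (1 - x)"
        using x x1 by (simp_all add: powr_diff)
      ultimately have *: "(p has_real_derivative (real k / 2 * (x powr (real k / 2) / x)) * (1 - x) powr (l / 2)
          + x powr (real k / 2) * (- (l / 2 * ((1 - x) powr (l / 2) / (1 - x))))) (at x)" by simp
      have "(real k / 2 * (x powr (real k / 2) / x)) * (1 - x) powr (l / 2)
          + x powr (real k / 2) * (- (l / 2 * ((1 - x) powr (l / 2) / (1 - x))))
         = p x * (real k / 2 / x - l / 2 / (1 - x))" by (simp add: p_def algebra_simps)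
      also have "real k / 2 / x - l / 2 / (1 - x) = (real k / 2 - real n * x / 2) / (x * (1 - x))"
        using x x1 by (simp add: l_def field_simps)
      finally show ?thesis using * by simp
    qed
    have dW: "(W has_real_derivative hypG n k x * \<phi>'' x - \<phi> x * hypG'' n k x) (at x)"
      unfolding W_def
      by (rule derivative_eq_intros DERIV_hypG[OF x1(2)] DERIV_hypG'[OF x1(2)] d refl | simp)+
    have "(f has_real_derivative \<epsilon> * (p x / (x * (1 - x)) * (real k / 2 - real n * x / 2) * W x +
        (hypG n k x * \<phi>'' x - \<phi> x * hypG'' n k x) * p x)) (at x)"
      unfolding f_def by (intro DERIV_cmult DERIV_mult dp dW)
    moreover have "\<epsilon> * (p x / (x * (1 - x)) * (real k / 2 - real n * x / 2) * W x +
        (hypG n k x * \<phi>'' x - \<phi> x * hypG'' n k x) * p x) =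
      p x / (x * (1 - x)) * (\<epsilon> * hypG n k x * (x * (1 - x) * \<phi>'' x + (real k / 2 - real n * x / 2) * \<phi>' x + (real n - 1) / 4 * \<phi> x))"
    proof -
      have ode: "x * (1 - x) * hypG'' n k x = - (real k / 2 - real n * x / 2) * hypG' n k x - (real n - 1) / 4 * hypG n k x"
        using hypG_ode[OF x1(2)] by linarith
      define q where "q = p x / (x * (1 - x))"
      have px: "p x = q * (x * (1 - x))" using x x1 by (simp add: q_def)
      have "\<epsilon> * (q * (real k / 2 - real n * x / 2) * W x + (hypG n k x * \<phi>'' x - \<phi> x * hypG'' n k x) * p x)
         = \<epsilon> * q * ((real k / 2 - real n * x / 2) * W x + hypG n k x * (x * (1 - x) * \<phi>'' x) - \<phi> x * (x * (1 - x) * hypG'' n k x))"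
        unfolding px by (simp add: algebra_simps)
      also have "\<dots> = q * (\<epsilon> * hypG n k x * (x * (1 - x) * \<phi>'' x + (real k / 2 - real n * x / 2) * \<phi>' x + (real n - 1) / 4 * \<phi> x))"
        unfolding ode W_def by (simp add: algebra_simps)
      finally show ?thesis unfolding q_def .
    qed
    moreover have "0 \<le> p x / (x * (1 - x))" using x x1 by (simp add: p_def)
    ultimately show "\<exists>y. (f has_real_derivative y) (at x) \<and> 0 \<le> y"
      using L[OF x] by (metis mult_nonneg_nonneg)
  next
    have "continuous_on {0..z} (\<lambda>x. hypG n k x)" "continuous_on {0..z} (\<lambda>x. hypG' n k x)"
      "continuous_on {0..z} \<phi>" "continuous_on {0..z} \<phi>'"
      using z by (auto intro!: continuous_at_imp_continuous_on DERIV_isCont[OF DERIV_hypG] DERIV_isCont[OF DERIV_hypG'] DERIV_isCont[OF d(1)] DERIV_isCont[OF d(2)])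
    moreover have "continuous_on {0..z} p"
      unfolding p_def using z kp l by (intro continuous_intros continuous_on_powr') auto
    ultimately show "continuous_on {0..z} f" unfolding f_def W_def by (intro continuous_intros)
  qed
  \<comment> \<open>The integrating factor vanishes at 0, so the comparison starts from 0 whatever
    the test function does there.\<close>
  moreover have "f 0 = 0" using kp by (simp add: f_def p_def)
  moreover have "f z = p z * (\<epsilon> * W z)" by (simp add: f_def)
  moreover have "0 < p z" using z by (simp add: p_def)
  ultimately have "0 \<le> \<epsilon> * W z" by (simp add: zero_le_mult_iff)
  then show ?thesis by (simp add: W_def)
qed

end

section \<open>The Hermite function of degree one half\<close>

text \<open>With \<open>t = s\<^sup>2\<close> this is the integral over positive \<open>t\<close> of
  \<open>t powr (j - 1/2) * exp (- t\<^sup>2 / 2 + y * t)\<close>, a positive multiple of the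
  Hermite function of degree \<open>- j - 1/2\<close> at \<open>- y\<close>. The variable
  \<open>s\<close> removes the singularity at 0 for \<open>j = 0\<close>.\<close>

definition psi :: "nat \<Rightarrow> real \<Rightarrow> real" where
  "psi j y = (\<integral>s. s ^ (2 * j) * exp (- (s ^ 4) / 2 + y * s\<^sup>2) \<partial>lborel)"

lemma psi_exponent_le: "- (s ^ 4) / 2 + y * s\<^sup>2 \<le> (y + 1)\<^sup>2 / 2 - (s::real)\<^sup>2"
proof -
  have "0 \<le> (s\<^sup>2 - (y + 1))\<^sup>2" by simp
  also have "\<dots> = s ^ 4 - 2 * (y + 1) * s\<^sup>2 + (y + 1)\<^sup>2" by (simp add: power2_eq_square power4_eq_xxxx algebra_simps)
  finally show ?thesis by (simp add: algebra_simps)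
qed

lemma integrable_power_gauss: "integrable lborel (\<lambda>s::real. s ^ (2 * j) * exp (- s\<^sup>2))"
proof (rule Bochner_Integration.integrable_bound)
  show "integrable lborel (\<lambda>s. sqrt (2 * pi) * (std_normal_density s * s ^ (2 * j)))"
    using integrable_std_normal_moment[of "2 * j"] by simp
  show "AE s in lborel. norm (s ^ (2 * j) * exp (- s\<^sup>2)) \<le> norm (sqrt (2 * pi) * (std_normal_density s * s ^ (2 * j)))"
  proof (rule AE_I2)
    fix s :: real
    have "exp (- s\<^sup>2) \<le> exp (- s\<^sup>2 / 2)" by simp
    then have "s ^ (2 * j) * exp (- s\<^sup>2) \<le> s ^ (2 * j) * exp (- s\<^sup>2 / 2)" by (intro mult_left_mono) auto
    also have "\<dots> = sqrt (2 * pi) * (std_normal_density s * s ^ (2 * j))" by (simp add: std_normal_density_def)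
    finally show "norm (s ^ (2 * j) * exp (- s\<^sup>2)) \<le> norm (sqrt (2 * pi) * (std_normal_density s * s ^ (2 * j)))"
      by (simp add: abs_mult)
  qed
qed simp

lemma integrable_psi: "integrable lborel (\<lambda>s::real. s ^ (2 * j) * exp (- (s ^ 4) / 2 + y * s\<^sup>2))"
proof (rule Bochner_Integration.integrable_bound)
  show "integrable lborel (\<lambda>s::real. exp ((y + 1)\<^sup>2 / 2) * (s ^ (2 * j) * exp (- s\<^sup>2)))"
    using integrable_power_gauss[of j] by simp
  show "AE s in lborel. norm (s ^ (2 * j) * exp (- (s ^ 4) / 2 + y * s\<^sup>2)) \<le> norm (exp ((y + 1)\<^sup>2 / 2) * (s ^ (2 * j) * exp (- s\<^sup>2)))"
  proof (rule AE_I2)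
    fix s :: real
    have "exp (- (s ^ 4) / 2 + y * s\<^sup>2) \<le> exp ((y + 1)\<^sup>2 / 2 - s\<^sup>2)" using psi_exponent_le by simp
    also have "\<dots> = exp ((y + 1)\<^sup>2 / 2) * exp (- s\<^sup>2)" by (simp flip: exp_add)
    finally have "s ^ (2 * j) * exp (- (s ^ 4) / 2 + y * s\<^sup>2) \<le> s ^ (2 * j) * (exp ((y + 1)\<^sup>2 / 2) * exp (- s\<^sup>2))"
      by (intro mult_left_mono) auto
    also have "\<dots> = exp ((y + 1)\<^sup>2 / 2) * (s ^ (2 * j) * exp (- s\<^sup>2))" by (simp only: mult_ac)
    finally have "s ^ (2 * j) * exp (- (s ^ 4) / 2 + y * s\<^sup>2) \<le> exp ((y + 1)\<^sup>2 / 2) * (s ^ (2 * j) * exp (- s\<^sup>2))" .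
    then show "norm (s ^ (2 * j) * exp (- (s ^ 4) / 2 + y * s\<^sup>2)) \<le> norm (exp ((y + 1)\<^sup>2 / 2) * (s ^ (2 * j) * exp (- s\<^sup>2)))"
      by (simp add: abs_mult)
  qed
qed simp

lemma psi_pos: "0 < psi j y"
proof -
  define c where "c = exp (- 8 - 4 * \<bar>y\<bar>)"
  have "(\<integral>s. indicator {1..2::real} s * c \<partial>lborel) \<le> psi j y"
    unfolding psi_def
  proof (rule integral_mono[OF _ integrable_psi])
    show "integrable lborel (\<lambda>s. indicator {1..2::real} s * c)" by simp
    fix s :: real
    show "indicator {1..2} s * c \<le> s ^ (2 * j) * exp (- (s ^ 4) / 2 + y * s\<^sup>2)"
    proof (cases "s \<in> {1..2}")
      case True
      then have s2: "s\<^sup>2 \<le> 4" "0 \<le> s\<^sup>2" using power_mono[of s 2 2] by auto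
      have "s ^ 4 = (s\<^sup>2)\<^sup>2" by simp
      also have "\<dots> \<le> 4\<^sup>2" using s2 by (intro power_mono)
      finally have s4: "s ^ 4 \<le> 16" by simp
      have "- (\<bar>y\<bar> * s\<^sup>2) \<le> y * s\<^sup>2" using s2 by (metis abs_ge_minus_self abs_mult abs_of_nonneg minus_le_iff)
      moreover have "\<bar>y\<bar> * s\<^sup>2 \<le> \<bar>y\<bar> * 4" using s2 by (intro mult_left_mono) auto
      ultimately have "c \<le> exp (- (s ^ 4) / 2 + y * s\<^sup>2)" unfolding c_def using s4 by simp
      moreover have "1 \<le> s ^ (2 * j)" using True by (intro one_le_power) auto
      ultimately have "1 * c \<le> s ^ (2 * j) * exp (- (s ^ 4) / 2 + y * s\<^sup>2)"
        by (intro mult_mono) (auto simp: c_def)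
      then show ?thesis using True by simp
    qed simp
  qed
  moreover have "(\<integral>s. indicator {1..2::real} s * c \<partial>lborel) = c" by simp
  moreover have "0 < c" by (simp add: c_def)
  ultimately show ?thesis by simp
qed

lemma abs_exp_minus_one_minus_le: "\<bar>exp x - 1 - x\<bar> \<le> x\<^sup>2 * exp \<bar>x\<bar>" for x :: real
proof -
  have 1: "1 + x \<le> exp x" by (rule exp_ge_add_one_self)
  have "1 - x \<le> exp (- x)" using exp_ge_add_one_self[of "- x"] by simp
  then have "(1 - x) * exp x \<le> exp (- x) * exp x" by (intro mult_right_mono) auto
  then have 2: "exp x - 1 \<le> x * exp x" by (simp add: algebra_simps flip: exp_add)
  have "exp x - 1 - x \<le> x * (exp x - 1)" using 2 by (simp add: algebra_simps)
  also have "\<dots> \<le> x\<^sup>2 * exp \<bar>x\<bar>"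
  proof (cases "0 \<le> x")
    case True
    then have "x * (exp x - 1) \<le> x * (x * exp x)" using 2 by (intro mult_left_mono)
    then show ?thesis using True by (simp add: power2_eq_square)
  next
    case False
    have "x * (exp x - 1) \<le> x * x" by (intro mult_left_mono_neg) (use 1 False in linarith)+
    also have "\<dots> \<le> x * x * exp \<bar>x\<bar>" using mult_left_mono[of 1 "exp \<bar>x\<bar>" "x * x"] by simp
    finally show ?thesis by (simp add: power2_eq_square)
  qed
  finally show ?thesis using 1 by linarith
qed

lemma has_real_derivative_quadratic_bound:
  fixes f :: "real \<Rightarrow> real"
  assumes "\<And>h. \<bar>h\<bar> \<le> 1 \<Longrightarrow> \<bar>f (y + h) - f y - h * D\<bar> \<le> K * h\<^sup>2"
  shows "(f has_real_derivative D) (at y)"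
proof -
  have "((\<lambda>h. (f (y + h) - f y) / h - D) \<longlongrightarrow> 0) (at 0)"
  proof (rule Lim_null_comparison)
    show "\<forall>\<^sub>F h in at 0. norm ((f (y + h) - f y) / h - D) \<le> K * \<bar>h\<bar>"
      unfolding eventually_at
    proof (intro exI[of _ 1] conjI ballI impI)
      fix h :: real assume h: "h \<noteq> 0 \<and> dist h 0 < 1"
      have "h * ((f (y + h) - f y) / h - D) = f (y + h) - f y - h * D"
        using h by (simp add: field_simps)
      then have "\<bar>h\<bar> * \<bar>(f (y + h) - f y) / h - D\<bar> = \<bar>f (y + h) - f y - h * D\<bar>"
        by (simp only: abs_mult[symmetric])
      also have "\<dots> \<le> K * h\<^sup>2" using h by (intro assms) auto
      also have "\<dots> = \<bar>h\<bar> * (K * \<bar>h\<bar>)" by (simp add: power2_eq_square)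
      finally show "norm ((f (y + h) - f y) / h - D) \<le> K * \<bar>h\<bar>" using h by simp
    qed auto
    show "((\<lambda>h. K * \<bar>h\<bar>) \<longlongrightarrow> 0) (at 0)" by (auto intro!: tendsto_eq_intros)
  qed
  then show ?thesis unfolding DERIV_def by (simp add: LIM_zero_iff)
qed

text \<open>Differentiation under the integral sign with the quadratic remainder of
  \<open>abs_exp_minus_one_minus_le\<close>; for steps of length at most 1 the majorant is the
  moment of order \<open>j + 2\<close> at \<open>y + 1\<close>.\<close>

lemma DERIV_psi: "(psi j has_real_derivative psi (Suc j) y) (at y)"
proof (rule has_real_derivative_quadratic_bound)
  fix h :: real assume h: "\<bar>h\<bar> \<le> 1"
  let ?e = "\<lambda>y (s::real). exp (- (s ^ 4) / 2 + y * s\<^sup>2)"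
  have i: "integrable lborel (\<lambda>s. s ^ (2 * j) * ?e (y + h) s)" "integrable lborel (\<lambda>s. s ^ (2 * j) * ?e y s)"
    "integrable lborel (\<lambda>s. s ^ (2 * Suc j) * ?e y s)" "integrable lborel (\<lambda>s. s ^ (2 * Suc (Suc j)) * ?e (y + 1) s)"
    by (rule integrable_psi)+
  have i': "integrable lborel (\<lambda>s. s ^ (2 * j) * ?e (y + h) s - s ^ (2 * j) * ?e y s - h * (s ^ (2 * Suc j) * ?e y s))"
    using i by (intro Bochner_Integration.integrable_diff integrable_mult_right) auto
  have eq: "psi j (y + h) - psi j y - h * psi (Suc j) y
      = (\<integral>s. s ^ (2 * j) * ?e (y + h) s - s ^ (2 * j) * ?e y s - h * (s ^ (2 * Suc j) * ?e y s) \<partial>lborel)"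
    unfolding psi_def using i by simp
  have "\<bar>psi j (y + h) - psi j y - h * psi (Suc j) y\<bar> \<le> (\<integral>s. h\<^sup>2 * (s ^ (2 * Suc (Suc j)) * ?e (y + 1) s) \<partial>lborel)"
    unfolding eq
  proof (rule integral_abs_bound_integral[OF i'])
    show "integrable lborel (\<lambda>s. h\<^sup>2 * (s ^ (2 * Suc (Suc j)) * ?e (y + 1) s))" using i(4) by simp
    fix s :: real
    have e: "?e (y + h) s = ?e y s * exp (h * s\<^sup>2)" by (simp add: algebra_simps flip: exp_add)
    have eqs: "s ^ (2 * j) * ?e (y + h) s - s ^ (2 * j) * ?e y s - h * (s ^ (2 * Suc j) * ?e y s)
        = s ^ (2 * j) * ?e y s * (exp (h * s\<^sup>2) - 1 - h * s\<^sup>2)"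
      unfolding e by (simp add: algebra_simps power_add power2_eq_square)
    have "\<bar>s ^ (2 * j) * ?e (y + h) s - s ^ (2 * j) * ?e y s - h * (s ^ (2 * Suc j) * ?e y s)\<bar> = s ^ (2 * j) * ?e y s * \<bar>exp (h * s\<^sup>2) - 1 - h * s\<^sup>2\<bar>" unfolding eqs by (simp add: abs_mult)
    also have "\<dots> \<le> s ^ (2 * j) * ?e y s * ((h * s\<^sup>2)\<^sup>2 * exp (s\<^sup>2))"
    proof (intro mult_left_mono order_trans[OF abs_exp_minus_one_minus_le] mult_left_mono)
      show "exp \<bar>h * s\<^sup>2\<bar> \<le> exp (s\<^sup>2)" using h mult_right_mono[of "\<bar>h\<bar>" 1 "s\<^sup>2"] by (simp add: abs_mult)
    qed auto
    also have "\<dots> = h\<^sup>2 * (s ^ (2 * Suc (Suc j)) * (?e y s * exp (s\<^sup>2)))"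
      by (simp add: power_mult_distrib power2_eq_square algebra_simps)
    also have "?e y s * exp (s\<^sup>2) = ?e (y + 1) s" by (simp add: algebra_simps flip: exp_add)
    finally show "\<bar>s ^ (2 * j) * ?e (y + h) s - s ^ (2 * j) * ?e y s - h * (s ^ (2 * Suc j) * ?e y s)\<bar>
      \<le> h\<^sup>2 * (s ^ (2 * Suc (Suc j)) * ?e (y + 1) s)" .
  qed
  also have "\<dots> = psi (Suc (Suc j)) (y + 1) * h\<^sup>2" unfolding psi_def by simp
  finally show "\<bar>psi j (y + h) - psi j y - h * psi (Suc j) y\<bar> \<le> psi (Suc (Suc j)) (y + 1) * h\<^sup>2" .
qed

text \<open>The integrand of the right side minus that of the left is half the derivative of
  \<open>F\<close>, which vanishes at both ends of the line. As each \<open>psi (Suc j)\<close> is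
  the derivative of \<open>psi j\<close>, this is the differential equation of
  \<open>psi j\<close>.\<close>

lemma psi_recurrence: "psi (Suc (Suc j)) y = y * psi (Suc j) y + (real j + 1/2) * psi j y"
proof -
  define F where "F s = s ^ (2 * j + 1) * exp (- (s ^ 4) / 2 + y * s\<^sup>2)" for s :: real
  define f where "f s = 2 * ((real j + 1/2) * (s ^ (2 * j) * exp (- (s ^ 4) / 2 + y * s\<^sup>2))
      + y * (s ^ (2 * Suc j) * exp (- (s ^ 4) / 2 + y * s\<^sup>2))
      - s ^ (2 * Suc (Suc j)) * exp (- (s ^ 4) / 2 + y * s\<^sup>2))" for s :: real
  have int: "integrable lborel f"
    unfolding f_def by (intro integrable_mult_right Bochner_Integration.integrable_add Bochner_Integration.integrable_diff integrable_psi)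
  have lim_top: "(F \<longlongrightarrow> 0) at_top"
  proof (rule Lim_null_comparison)
    show "\<forall>\<^sub>F s in at_top. norm (F s) \<le> exp ((y + 1)\<^sup>2 / 2) * (s ^ (2 * j + 1) / exp s)"
      using eventually_ge_at_top[of "1::real"]
    proof eventually_elim
      case (elim s)
      have "s \<le> s\<^sup>2" using elim by (simp add: power2_eq_square)
      then have "exp (- (s ^ 4) / 2 + y * s\<^sup>2) \<le> exp ((y + 1)\<^sup>2 / 2 - s)"
        using psi_exponent_le[of s y] by simp
      then have "s ^ (2 * j + 1) * exp (- (s ^ 4) / 2 + y * s\<^sup>2) \<le> s ^ (2 * j + 1) * exp ((y + 1)\<^sup>2 / 2 - s)"
        using elim by (intro mult_left_mono) auto
      then show ?case using elim by (simp add: F_def exp_diff abs_mult mult_ac)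
    qed
    show "((\<lambda>s. exp ((y + 1)\<^sup>2 / 2) * (s ^ (2 * j + 1) / exp s)) \<longlongrightarrow> 0) at_top"
      by (rule tendsto_mult_right_zero[OF tendsto_power_div_exp_0])
  qed
  have odd: "F (- s) = - F s" for s by (simp add: F_def power_minus_odd)
  have lim_bot: "(F \<longlongrightarrow> 0) at_bot"
    unfolding filterlim_at_bot_mirror odd using tendsto_minus[OF lim_top] by simp
  have "(LBINT s=-\<infinity>..\<infinity>. f s) = 0 - 0"
  proof (rule interval_integral_FTC_integrable)
    show "(F has_vector_derivative f s) (at s)" for s
    proof -
      have "(F has_real_derivative f s) (at s)"
      proof -
        have 1: "((\<lambda>s. s ^ (2 * j + 1)) has_real_derivative real (2 * j + 1) * s ^ (2 * j)) (at s)"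
          using DERIV_pow[of "2 * j + 1" s] by simp
        have 2: "((\<lambda>s. exp (- (s ^ 4) / 2 + y * s\<^sup>2)) has_real_derivative
            exp (- (s ^ 4) / 2 + y * s\<^sup>2) * (2 * y * s - 2 * s ^ 3)) (at s)"
          by (auto intro!: derivative_eq_intros)
        have "s ^ (2 * Suc j) = s ^ (2 * j) * s\<^sup>2" "s ^ (2 * Suc (Suc j)) = s ^ (2 * j) * s ^ 4"
          by (simp_all add: power2_eq_square power4_eq_xxxx mult_ac)
        then have "real (2 * j + 1) * s ^ (2 * j) * exp (- (s ^ 4) / 2 + y * s\<^sup>2)
            + exp (- (s ^ 4) / 2 + y * s\<^sup>2) * (2 * y * s - 2 * s ^ 3) * s ^ (2 * j + 1) = f s"
          by (simp add: f_def algebra_simps power2_eq_square power3_eq_cube power4_eq_xxxx)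
        then show ?thesis using DERIV_mult[OF 1 2] unfolding F_def by simp
      qed
      then show ?thesis by (simp add: has_real_derivative_iff_has_vector_derivative)
    qed
    show "isCont f s" for s unfolding f_def by (intro continuous_intros) simp_all
    show "set_integrable lborel (einterval (-\<infinity>) \<infinity>) f" using int by (simp add: set_integrable_def)
    show "((F \<circ> real_of_ereal) \<longlongrightarrow> 0) (at_right (-\<infinity>))" "((F \<circ> real_of_ereal) \<longlongrightarrow> 0) (at_left \<infinity>)"
      using lim_bot lim_top by (simp_all add: ereal_tendsto_simps1)
  qed simp
  then have "(\<integral>s. f s \<partial>lborel) = 0"
    by (simp add: interval_lebesgue_integral_def set_lebesgue_integral_def)
  moreover have "(\<integral>s. f s \<partial>lborel) = 2 * ((real j + 1/2) * psi j y + y * psi (Suc j) y - psi (Suc (Suc j)) y)"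
    unfolding f_def psi_def
    by (simp add: integrable_psi[simplified] integrable_psi[of "Suc j", simplified] integrable_psi[of "Suc (Suc j)", simplified])
  ultimately show ?thesis by simp
qed

text \<open>The weight times \<open>(s\<^sup>2 - t)\<^sup>2\<close> is nonnegative; suitable values
  of \<open>t\<close> turn this into bounds for quotients of consecutive moments.\<close>

lemma psi_square_nonneg: "0 \<le> psi (Suc (Suc j)) y - 2 * t * psi (Suc j) y + t\<^sup>2 * psi j y"
proof -
  let ?e = "\<lambda>s::real. exp (- (s ^ 4) / 2 + y * s\<^sup>2)"
  have i: "integrable lborel (\<lambda>s. s ^ (2 * j) * ?e s)" "integrable lborel (\<lambda>s. s ^ (2 * Suc j) * ?e s)"
    "integrable lborel (\<lambda>s. s ^ (2 * Suc (Suc j)) * ?e s)"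
    by (rule integrable_psi)+
  have "psi (Suc (Suc j)) y - 2 * t * psi (Suc j) y + t\<^sup>2 * psi j y
      = (\<integral>s. s ^ (2 * Suc (Suc j)) * ?e s - 2 * t * (s ^ (2 * Suc j) * ?e s) + t\<^sup>2 * (s ^ (2 * j) * ?e s) \<partial>lborel)"
    unfolding psi_def using i by (simp add: Bochner_Integration.integral_add Bochner_Integration.integral_diff)
  also have "(\<lambda>s. s ^ (2 * Suc (Suc j)) * ?e s - 2 * t * (s ^ (2 * Suc j) * ?e s) + t\<^sup>2 * (s ^ (2 * j) * ?e s))
      = (\<lambda>s. s ^ (2 * j) * ?e s * (s\<^sup>2 - t)\<^sup>2)"
    by (auto simp: fun_eq_iff power2_eq_square algebra_simps)
  also have "0 \<le> (\<integral>s. s ^ (2 * j) * ?e s * (s\<^sup>2 - t)\<^sup>2 \<partial>lborel)"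
    by (rule Bochner_Integration.integral_nonneg) auto
  finally show ?thesis .
qed

text \<open>The square with \<open>t = 1\<close> and the recurrence give the first bound; for
  negative \<open>y\<close> the second follows from the recurrence and the positivity of
  \<open>psi 2\<close>. Valid on the whole half-line, they make the errors of the comparison small
  relative to \<open>psi 0\<close>.\<close>

lemma psi_Suc_le:
  assumes "y \<le> 1"
  shows "psi 1 y \<le> 3/2 * psi 0 y" "\<bar>y\<bar> * psi 1 y \<le> 3/2 * psi 0 y"
proof -
  have rec: "psi 2 y = y * psi 1 y + 1/2 * psi 0 y"
    using psi_recurrence[of 0 y] by (simp add: numeral_2_eq_2)
  have pos: "0 < psi 0 y" "0 < psi 1 y" "0 < psi 2 y" by (rule psi_pos)+
  have "0 \<le> psi 2 y - 2 * psi 1 y + psi 0 y" using psi_square_nonneg[of 0 y 1] by (simp add: numeral_2_eq_2)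
  then have "(2 - y) * psi 1 y \<le> 3/2 * psi 0 y" unfolding rec by (simp add: algebra_simps)
  moreover have "1 * psi 1 y \<le> (2 - y) * psi 1 y" using assms pos by (intro mult_right_mono) auto
  ultimately show 1: "psi 1 y \<le> 3/2 * psi 0 y" by simp
  show "\<bar>y\<bar> * psi 1 y \<le> 3/2 * psi 0 y"
  proof (cases "0 \<le> y")
    case True
    then have "\<bar>y\<bar> * psi 1 y \<le> 1 * psi 1 y" using assms pos by (intro mult_right_mono) auto
    then show ?thesis using 1 by simp
  next
    case False
    then show ?thesis using rec pos by (simp add: algebra_simps)
  qed
qed

text \<open>A positive multiple of the Hermite function of degree 1/2 at \<open>- y\<close>: with
  derivative \<open>- psi 0\<close> and second derivative \<open>- psi 1\<close> it satisfies
  \<open>u'' - y u' + u / 2 = 0\<close> identically.\<close>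

definition hermite_half :: "real \<Rightarrow> real" where
  "hermite_half y = 2 * (psi 1 y - y * psi 0 y)"

lemma DERIV_hermite_half: "(hermite_half has_real_derivative - psi 0 y) (at y)"
proof -
  have rec: "psi 2 y = y * psi 1 y + 1/2 * psi 0 y"
    using psi_recurrence[of 0 y] by (simp add: numeral_2_eq_2)
  have "(hermite_half has_real_derivative 2 * (psi 2 y - (psi 0 y + y * psi 1 y))) (at y)"
    unfolding hermite_half_def
    by (auto intro!: derivative_eq_intros DERIV_psi[THEN DERIV_chain2] simp: numeral_2_eq_2 algebra_simps)
  then show ?thesis unfolding rec by (simp add: algebra_simps)
qed

lemma hermite_half_strict_antimono: "x < y \<Longrightarrow> hermite_half y < hermite_half x"
  by (rule DERIV_neg_imp_decreasing) (auto intro: DERIV_hermite_half simp: psi_pos)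

section \<open>The zero of the profile when both blocks grow\<close>

text \<open>The Hermite equation holds at the argument \<open>u\<close>, but the drift sees
  \<open>y = u + h\<close>; the mismatch is the main term \<open>h * psi 0 u\<close>. The error
  collects the deviation of \<open>z * (1 - z)\<close> from its value at \<open>p\<close> and of
  \<open>n - 1\<close> from \<open>n\<close>; its parts contribute
  \<open>3 + 3 + 2 = 8\<close>.\<close>

lemma hypergeo_operator_shifted_hermite:
  fixes k l :: nat and z h :: real
  assumes kl: "1 \<le> k" "1 \<le> l" and n: "n = k + l" and z: "0 < z" "z < 1" and h: "\<bar>h\<bar> \<le> 1"
  defines "p \<equiv> real k / real n" and "\<rho> \<equiv> sqrt (2 * (1 / real k + 1 / real l))"
  defines "\<sigma> \<equiv> sqrt (2 * p * (1 - p) / real n)"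
  defines "u \<equiv> (z - p) / \<sigma> - h"
  assumes u: "u \<le> 1" and \<rho>: "\<rho> \<le> 1"
  shows "\<bar>(z * (1 - z) * (- psi 1 u / \<sigma>\<^sup>2) + (real k / 2 - real n * z / 2) * (- psi 0 u / \<sigma>) + (real n - 1) / 4 * hermite_half u)
     - real n / 2 * (h * psi 0 u)\<bar> \<le> real n / 2 * (8 * \<rho> * psi 0 u)"
proof -
  define q where "q = 1 - p"
  have n0: "0 < real n" using kl n by simp
  have q: "q = real l / real n" using n0 by (simp add: q_def p_def n field_simps)
  have pq: "0 < p" "0 < q" "p \<le> 1" "q \<le> 1" using kl n0 by (simp_all add: p_def q n)
  have \<sigma>2: "\<sigma>\<^sup>2 = 2 * p * q / n" using pq n0 by (simp add: \<sigma>_def q_def[symmetric])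
  have \<sigma>: "0 < \<sigma>" using pq n0 by (simp add: \<sigma>_def q_def[symmetric])
  have \<rho>2: "\<rho>\<^sup>2 = 2 * (1 / real k + 1 / real l)" by (simp add: \<rho>_def add_nonneg_nonneg)
  have \<rho>0: "0 \<le> \<rho>" by (simp add: \<rho>_def)
  have r: "1 / real k + 1 / real l = 1 / (n * p * q)"
    using kl n0 by (simp add: p_def q) (simp add: n field_simps)
  define y where "y = (z - p) / \<sigma>"
  \<comment> \<open>The relative slope of \<open>z * (1 - z)\<close> at \<open>p\<close> in the
    variable \<open>y\<close>; the curvature contributes \<open>- 2 / n * y\<^sup>2\<close>.\<close>
  define \<epsilon> where "\<epsilon> = \<sigma> * (q - p) / (p * q)"
  have zy: "z = p + \<sigma> * y" using \<sigma> by (simp add: y_def)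
  have uy: "u = y - h" by (simp add: u_def y_def)
  have pos: "0 < psi 0 u" "0 < psi 1 u" by (rule psi_pos)+
  have \<epsilon>: "\<bar>\<epsilon>\<bar> \<le> \<rho>"
  proof -
    have "\<bar>q - p\<bar> \<le> 1" using pq by (simp add: q_def)
    then have "(q - p)\<^sup>2 \<le> 1" by (simp add: abs_square_le_1)
    then have "\<epsilon>\<^sup>2 \<le> \<sigma>\<^sup>2 / (p * q)\<^sup>2"
      unfolding \<epsilon>_def power_divide power_mult_distrib using pq by (intro divide_right_mono mult_left_le) auto
    also have "\<dots> = \<rho>\<^sup>2" unfolding \<sigma>2 \<rho>2 r using pq n0 by (simp add: power2_eq_square)
    finally show ?thesis using \<rho>0 abs_le_square_iff[of \<epsilon> \<rho>] by simp
  qed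
  \<comment> \<open>This turns the crude bound \<open>\<bar>y\<bar> \<le> 1 / \<sigma>\<close> into
    \<open>\<bar>y\<bar> / n \<le> \<rho> / 2\<close>, however small \<open>p\<close> or
    \<open>q\<close> is.\<close>
  have n\<sigma>: "real n * \<sigma> * \<rho> = 2"
  proof -
    have "(real n * \<sigma> * \<rho>)\<^sup>2 = 2\<^sup>2"
      unfolding power_mult_distrib \<sigma>2 \<rho>2 r using pq n0 by (simp add: power2_eq_square)
    moreover have "0 \<le> real n * \<sigma> * \<rho>" using \<sigma> \<rho>0 by simp
    ultimately show ?thesis by (rule power2_eq_imp_eq) simp
  qed
  have yn: "\<bar>y\<bar> / n \<le> \<rho> / 2"
  proof -
    have "\<bar>z - p\<bar> \<le> 1" using z pq by (simp add: abs_le_iff)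
    then have "\<bar>y\<bar> \<le> 1 / \<sigma>" using \<sigma> by (simp add: y_def abs_divide divide_right_mono)
    also have "1 / \<sigma> = n * \<rho> / 2" using n\<sigma> \<sigma> by (simp add: field_simps)
    finally show ?thesis using n0 by (simp add: field_simps)
  qed
  have n1: "1 / n \<le> \<rho> / 2"
  proof -
    have "1 / real n \<le> 1 / real k" using kl n by (simp add: frac_le)
    also have "\<dots> \<le> 1 / real k + 1 / real l" by simp
    also have "\<dots> = \<rho>\<^sup>2 / 2" using \<rho>2 by simp
    also have "\<dots> \<le> \<rho> / 2" using \<rho> \<rho>0 by (simp add: power2_eq_square mult_left_le)
    finally show ?thesis .
  qed
  have c: "psi 1 u \<le> 3/2 * psi 0 u" "\<bar>u\<bar> * psi 1 u \<le> 3/2 * psi 0 u" using psi_Suc_le[OF u] by auto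
  have "\<bar>y\<bar> \<le> \<bar>u\<bar> + 1" using uy h by linarith
  then have "\<bar>y\<bar> * psi 1 u \<le> (\<bar>u\<bar> + 1) * psi 1 u" using pos by (intro mult_right_mono) auto
  also have "\<dots> \<le> 3 * psi 0 u" using c by (simp add: distrib_right)
  finally have yp: "\<bar>y\<bar> * psi 1 u \<le> 3 * psi 0 u" .
  have uy': "\<bar>u\<bar> \<le> \<bar>y\<bar> + 1" using uy h by linarith
  define R where "R = (\<epsilon> * y - 2 / n * y\<^sup>2) * psi 1 u + (psi 1 u - u * psi 0 u) / n"
  have "(z * (1 - z) * (- psi 1 u / \<sigma>\<^sup>2) + (real k / 2 - real n * z / 2) * (- psi 0 u / \<sigma>) + (real n - 1) / 4 * hermite_half u)
     = real n / 2 * (h * psi 0 u) - real n / 2 * R"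
  proof -
    define T where "T = 1 + \<epsilon> * y - 2 / n * y\<^sup>2"
    have zT: "z * (1 - z) = p * q * T"
    proof -
      have "p * q * (\<epsilon> * y) = \<sigma> * (q - p) * y" unfolding \<epsilon>_def using pq by simp
      moreover have "p * q * (2 / n * y\<^sup>2) = \<sigma>\<^sup>2 * y\<^sup>2" unfolding \<sigma>2 by simp
      moreover have "1 - z = q - \<sigma> * y" using zy by (simp add: q_def)
      ultimately have "p * q * (1 + \<epsilon> * y - 2 / n * y\<^sup>2) = p * q + \<sigma> * (q - p) * y - \<sigma>\<^sup>2 * y\<^sup>2"
        by (simp only: distrib_left right_diff_distrib mult_1_right)
      also have "\<dots> = (p + \<sigma> * y) * (q - \<sigma> * y)" by (simp add: algebra_simps power2_eq_square)
      also have "\<dots> = z * (1 - z)" using zy by (simp add: q_def)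
      finally show ?thesis by (simp add: T_def)
    qed
    have 1: "z * (1 - z) * (- psi 1 u / \<sigma>\<^sup>2) = - (n / 2) * (T * psi 1 u)"
      unfolding zT \<sigma>2 using pq n0 by (simp add: field_simps)
    have "real k / 2 - real n * z / 2 = - (n / 2) * (\<sigma> * y)"
      unfolding zy p_def using n0 by (simp add: field_simps)
    then have 2: "(real k / 2 - real n * z / 2) * (- psi 0 u / \<sigma>) = n / 2 * (y * psi 0 u)"
      using \<sigma> by simp
    have 3: "(real n - 1) / 4 * hermite_half u = n / 2 * ((1 - 1 / n) * (psi 1 u - u * psi 0 u))"
      unfolding hermite_half_def using n0 by (simp add: field_simps)
    show ?thesis unfolding 1 2 3 R_def T_def unfolding uy using n0 by (simp add: field_simps)
  qed
  moreover have "\<bar>R\<bar> \<le> 8 * \<rho> * psi 0 u"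
  proof -
    have a: "\<bar>\<epsilon> * y * psi 1 u\<bar> \<le> \<rho> * (3 * psi 0 u)"
      using mult_mono[OF \<epsilon> yp] \<rho>0 pos by (simp add: abs_mult mult.assoc)
    have b: "\<bar>2 / n * y\<^sup>2 * psi 1 u\<bar> \<le> \<rho> * (3 * psi 0 u)"
    proof -
      have "\<bar>2 / n * y\<^sup>2 * psi 1 u\<bar> = 2 * (\<bar>y\<bar> / n) * (\<bar>y\<bar> * psi 1 u)"
        using pos n0 by (simp add: abs_mult power2_eq_square)
      also have "\<dots> \<le> \<rho> * (3 * psi 0 u)"
        by (rule mult_mono[OF _ yp]) (use yn pos \<rho>0 in \<open>auto simp: mult.commute\<close>)
      finally show ?thesis .
    qed
    have d: "\<bar>(psi 1 u - u * psi 0 u) / n\<bar> \<le> 2 * \<rho> * psi 0 u"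
    proof -
      have "\<bar>psi 1 u - u * psi 0 u\<bar> \<le> \<bar>psi 1 u\<bar> + \<bar>u * psi 0 u\<bar>" by (rule abs_triangle_ineq4)
      also have "\<dots> = psi 1 u + \<bar>u\<bar> * psi 0 u" using pos by (simp add: abs_mult)
      also have "\<dots> \<le> 3/2 * psi 0 u + (\<bar>y\<bar> + 1) * psi 0 u"
        using c(1) uy' pos by (intro add_mono mult_right_mono) auto
      also have "\<dots> = (5/2 + \<bar>y\<bar>) * psi 0 u" by (simp add: algebra_simps)
      finally have "\<bar>(psi 1 u - u * psi 0 u) / n\<bar> \<le> (5/2 + \<bar>y\<bar>) * psi 0 u / n"
        using n0 by (simp add: abs_divide divide_right_mono)
      also have "\<dots> = (5/2 * (1 / n) + \<bar>y\<bar> / n) * psi 0 u" using n0 by (simp add: field_simps)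
      also have "\<dots> \<le> (5/2 * (\<rho> / 2) + \<rho> / 2) * psi 0 u"
        using yn n1 pos by (intro mult_right_mono add_mono) auto
      also have "\<dots> \<le> 2 * \<rho> * psi 0 u" using \<rho>0 pos by (intro mult_right_mono) auto
      finally show ?thesis .
    qed
    have R: "R = \<epsilon> * y * psi 1 u - 2 / n * y\<^sup>2 * psi 1 u + (psi 1 u - u * psi 0 u) / n"
      by (simp add: R_def left_diff_distrib)
    show ?thesis using a b d unfolding R by linarith
  qed
  then have "\<bar>real n / 2 * R\<bar> \<le> real n / 2 * (8 * \<rho> * psi 0 u)"
    unfolding abs_mult using n0 by (intro mult_mono) auto
  ultimately show ?thesis by simp
qed

text \<open>Upper bound: were the profile positive up to \<open>p + \<sigma> * (y0 + h)\<close>, its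
  Wronskian with the Hermite function shifted to the right would be nonnegative there, although that
  function vanishes at the point with negative slope. Lower bound: at a zero too far to the left the
  function shifted to the left is still positive while the profile decreases, which gives the
  Wronskian the wrong sign.\<close>

lemma hypG_zero_location:
  fixes k l :: nat and h y0 :: real
  assumes kl: "1 \<le> k" "1 \<le> l" and n: "n = k + l"
    and y0: "hermite_half y0 = 0" "0 \<le> y0" "y0 \<le> 1" and h: "0 < h" "h \<le> 1"
  defines "p \<equiv> real k / real n" and "\<rho> \<equiv> sqrt (2 * (1 / real k + 1 / real l))"
  defines "\<sigma> \<equiv> sqrt (2 * p * (1 - p) / real n)"
  assumes \<rho>: "8 * \<rho> < h"
  shows "0 < p + \<sigma> * (y0 - h)" "p + \<sigma> * (y0 + h) < 1"
    "\<exists>z. 0 < z \<and> z \<le> p + \<sigma> * (y0 + h) \<and> hypG n k z \<le> 0"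
    "\<And>z. 0 < z \<Longrightarrow> z < 1 \<Longrightarrow> hypG n k z = 0 \<Longrightarrow> (\<And>x. 0 \<le> x \<Longrightarrow> x < z \<Longrightarrow> 0 < hypG n k x) \<Longrightarrow> p + \<sigma> * (y0 - h) \<le> z"
proof -
  define q where "q = 1 - p"
  have n0: "0 < real n" using kl n by simp
  have q: "q = real l / real n" using n0 by (simp add: q_def p_def n field_simps)
  have pq: "0 < p" "0 < q" "p \<le> 1" "q \<le> 1" using kl n0 by (simp_all add: p_def q n)
  have \<sigma>2: "\<sigma>\<^sup>2 = 2 * p * q / n" using pq n0 by (simp add: \<sigma>_def q_def[symmetric])
  have \<sigma>: "0 < \<sigma>" using pq n0 by (simp add: \<sigma>_def q_def[symmetric])
  have \<rho>2: "\<rho>\<^sup>2 = 2 * (1 / real k + 1 / real l)" by (simp add: \<rho>_def add_nonneg_nonneg)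
  have \<rho>0: "0 \<le> \<rho>" by (simp add: \<rho>_def)
  have \<rho>1: "\<rho> \<le> 1" "2 * \<rho> < 1" using \<rho> h by auto
  have n2: "2 \<le> n" "k < n" using kl n by auto
  \<comment> \<open>Together with its counterpart for \<open>q\<close> and
    \<open>2 * \<rho> < 1\<close>, this keeps the test points inside the unit interval even if
    \<open>p\<close> is close to 0 or 1.\<close>
  have \<sigma>p: "\<sigma> \<le> p * \<rho>"
  proof -
    have "\<sigma>\<^sup>2 = p\<^sup>2 * (2 * (q / p) / n)" unfolding \<sigma>2 using pq by (simp add: power2_eq_square)
    also have "q / p / n = (1 / real k) * q" using kl n0 by (simp add: p_def)
    then have "2 * (q / p) / n = 2 * ((1 / real k) * q)" by simp
    also have "p\<^sup>2 * (2 * ((1 / real k) * q)) \<le> p\<^sup>2 * \<rho>\<^sup>2"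
    proof (rule mult_left_mono)
      have "(1 / real k) * q \<le> 1 / real k" using pq by (intro mult_left_le) auto
      also have "\<dots> \<le> 1 / real k + 1 / real l" by simp
      finally show "2 * ((1 / real k) * q) \<le> \<rho>\<^sup>2" unfolding \<rho>2 by (intro mult_left_mono) auto
    qed simp
    finally have "\<sigma>\<^sup>2 \<le> (p * \<rho>)\<^sup>2" by (simp add: power_mult_distrib)
    then show ?thesis by (rule power2_le_imp_le) (use pq \<rho>0 in simp)
  qed
  have \<sigma>q: "\<sigma> \<le> q * \<rho>"
  proof -
    have "\<sigma>\<^sup>2 = q\<^sup>2 * (2 * (p / q) / n)" unfolding \<sigma>2 using pq by (simp add: power2_eq_square)
    also have "p / q / n = (1 / real l) * p" using kl n0 by (simp add: q)
    then have "2 * (p / q) / n = 2 * ((1 / real l) * p)" by simp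
    also have "q\<^sup>2 * (2 * ((1 / real l) * p)) \<le> q\<^sup>2 * \<rho>\<^sup>2"
    proof (rule mult_left_mono)
      have "(1 / real l) * p \<le> 1 / real l" using pq by (intro mult_left_le) auto
      also have "\<dots> \<le> 1 / real k + 1 / real l" by simp
      finally show "2 * ((1 / real l) * p) \<le> \<rho>\<^sup>2" unfolding \<rho>2 by (intro mult_left_mono) auto
    qed simp
    finally have "\<sigma>\<^sup>2 \<le> (q * \<rho>)\<^sup>2" by (simp add: power_mult_distrib)
    then show ?thesis by (rule power2_le_imp_le) (use pq \<rho>0 in simp)
  qed
  show lo: "0 < p + \<sigma> * (y0 - h)"
  proof -
    have "\<sigma> * (h - y0) \<le> \<sigma> * 1" using \<sigma> y0 h by (intro mult_left_mono) auto
    also have "\<dots> \<le> p * \<rho>" using \<sigma>p by simp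
    also have "\<dots> < p * 1" using pq \<rho>1 by (intro mult_strict_left_mono) auto
    finally show ?thesis by (simp add: algebra_simps)
  qed
  show hi: "p + \<sigma> * (y0 + h) < 1"
  proof -
    have "\<sigma> * (y0 + h) \<le> \<sigma> * 2" using \<sigma> y0 h by (intro mult_left_mono) auto
    also have "\<dots> \<le> q * \<rho> * 2" using \<sigma>q by simp
    also have "\<dots> < q * 1" using pq \<rho>1 by (simp add: mult.assoc)
    finally show ?thesis by (simp add: q_def)
  qed
  have DER: "((\<lambda>z. hermite_half ((z - p) / \<sigma> - g)) has_real_derivative - psi 0 ((z - p) / \<sigma> - g) / \<sigma>) (at z)"
    "((\<lambda>z. - psi 0 ((z - p) / \<sigma> - g) / \<sigma>) has_real_derivative - psi 1 ((z - p) / \<sigma> - g) / \<sigma>\<^sup>2) (at z)" for g z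
  proof -
    have "((\<lambda>z. (z - p) / \<sigma> - g) has_real_derivative 1 / \<sigma>) (at z)"
      using \<sigma> by (auto intro!: derivative_eq_intros)
    from DERIV_chain2[OF DERIV_hermite_half this] DERIV_cdivide[OF DERIV_minus[OF DERIV_chain2[OF DERIV_psi[of 0] this]], of \<sigma>]
    show "((\<lambda>z. hermite_half ((z - p) / \<sigma> - g)) has_real_derivative - psi 0 ((z - p) / \<sigma> - g) / \<sigma>) (at z)"
      "((\<lambda>z. - psi 0 ((z - p) / \<sigma> - g) / \<sigma>) has_real_derivative - psi 1 ((z - p) / \<sigma> - g) / \<sigma>\<^sup>2) (at z)"
      by (simp_all add: power2_eq_square)
  qed
  note op = hypergeo_operator_shifted_hermite[OF kl n, folded p_def \<rho>_def, folded \<sigma>_def, OF _ _ _ _ \<rho>1(1)]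
  have small: "8 * \<rho> * psi 0 u < h * psi 0 u" for u using \<rho> psi_pos[of 0 u] by simp
  have n20: "0 < real n / 2" using n0 by simp
  show "\<exists>z. 0 < z \<and> z \<le> p + \<sigma> * (y0 + h) \<and> hypG n k z \<le> 0"
  proof (rule ccontr)
    define z1 where "z1 = p + \<sigma> * (y0 + h)"
    have z1: "0 < z1" "z1 < 1" using hi lo \<sigma> h y0 pq by (auto simp: z1_def intro!: add_pos_nonneg)
    assume "\<not> ?thesis"
    then have G: "0 < hypG n k z" if "0 < z" "z \<le> z1" for z using that by (force simp: z1_def)
    have "0 \<le> 1 * (hypG n k z1 * (- psi 0 ((z1 - p) / \<sigma> - h) / \<sigma>) - hermite_half ((z1 - p) / \<sigma> - h) * hypG' n k z1)"
    proof (rule wronskian_sign[OF n2(1) kl(1) n2(2) z1 DER])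
      fix x assume x: "0 < x" "x < z1"
      define u where "u = (x - p) / \<sigma> - h"
      have "x - p \<le> \<sigma> * (y0 + h)" using x by (simp add: z1_def)
      then have "(x - p) / \<sigma> \<le> y0 + h" using \<sigma> by (simp add: field_simps)
      then have u1: "u \<le> 1" using y0 by (simp add: u_def)
      have "real n / 2 * (8 * \<rho> * psi 0 u) < real n / 2 * (h * psi 0 u)"
        using small n20 by (intro mult_strict_left_mono)
      then have "0 < x * (1 - x) * (- psi 1 u / \<sigma>\<^sup>2) + (real k / 2 - real n * x / 2) * (- psi 0 u / \<sigma>) + (real n - 1) / 4 * hermite_half u"
        using op[of x h] x z1 u1 h unfolding u_def by (simp add: abs_le_iff)
      then show "0 \<le> 1 * hypG n k x * (x * (1 - x) * (- psi 1 ((x - p) / \<sigma> - h) / \<sigma>\<^sup>2) +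
          (real k / 2 - real n * x / 2) * (- psi 0 ((x - p) / \<sigma> - h) / \<sigma>) + (real n - 1) / 4 * hermite_half ((x - p) / \<sigma> - h))"
        using G[of x] x unfolding u_def by simp
    qed
    moreover have "(z1 - p) / \<sigma> - h = y0" using \<sigma> by (simp add: z1_def)
    ultimately have "0 \<le> - (hypG n k z1 * (psi 0 y0 / \<sigma>))" using y0 by simp
    moreover have "0 < hypG n k z1 * (psi 0 y0 / \<sigma>)" using G[of z1] z1 \<sigma> psi_pos[of 0 y0] by simp
    ultimately show False by linarith
  qed
  show "p + \<sigma> * (y0 - h) \<le> z"
    if z: "0 < z" "z < 1" and Gz: "hypG n k z = 0" and G: "\<And>x. 0 \<le> x \<Longrightarrow> x < z \<Longrightarrow> 0 < hypG n k x" for z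
  proof (rule ccontr)
    assume "\<not> p + \<sigma> * (y0 - h) \<le> z"
    then have lt: "(z - p) / \<sigma> - (- h) < y0" using \<sigma> by (simp add: field_simps)
    have "0 \<le> - 1 * (hypG n k z * (- psi 0 ((z - p) / \<sigma> - (- h)) / \<sigma>) - hermite_half ((z - p) / \<sigma> - (- h)) * hypG' n k z)"
    proof (rule wronskian_sign[OF n2(1) kl(1) n2(2) z DER])
      fix x assume x: "0 < x" "x < z"
      define u where "u = (x - p) / \<sigma> - (- h)"
      have "(x - p) / \<sigma> \<le> (z - p) / \<sigma>" using x \<sigma> by (simp add: divide_right_mono)
      then have u1: "u \<le> 1" using y0 lt by (simp add: u_def)
      have "real n / 2 * (8 * \<rho> * psi 0 u) < real n / 2 * (h * psi 0 u)"
        using small n20 by (intro mult_strict_left_mono)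
      then have "x * (1 - x) * (- psi 1 u / \<sigma>\<^sup>2) + (real k / 2 - real n * x / 2) * (- psi 0 u / \<sigma>) + (real n - 1) / 4 * hermite_half u < 0"
        using op[of x "- h"] x z u1 h unfolding u_def by (simp add: abs_le_iff)
      then show "0 \<le> - 1 * hypG n k x * (x * (1 - x) * (- psi 1 ((x - p) / \<sigma> - (- h)) / \<sigma>\<^sup>2) +
          (real k / 2 - real n * x / 2) * (- psi 0 ((x - p) / \<sigma> - (- h)) / \<sigma>) + (real n - 1) / 4 * hermite_half ((x - p) / \<sigma> - (- h)))"
        using G[of x] x unfolding u_def by (simp add: mult_nonneg_nonpos)
    qed
    then have "0 \<le> hermite_half ((z - p) / \<sigma> - (- h)) * hypG' n k z" using Gz by simp
    moreover have "0 < hermite_half ((z - p) / \<sigma> - (- h))" using hermite_half_strict_antimono[OF lt] y0 by simp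
    moreover have "hypG' n k z < 0" using hypG'_neg[OF n2(1) kl(1)] z by simp
    ultimately show False by (simp add: zero_le_mult_iff)
  qed
qed

section \<open>Gaussian limits of the mass ratios\<close>

text \<open>The substitution is made on compact intervals and extended to the half-line by monotone
  convergence.\<close>

lemma nn_integral_exp_substitution:
  fixes f :: "real \<Rightarrow> real"
  assumes [measurable]: "f \<in> borel_measurable borel"
  shows "(\<integral>\<^sup>+s. ennreal (f s) * indicator {0<..} s \<partial>lborel) = (\<integral>\<^sup>+t. ennreal (f (exp t) * exp t) \<partial>lborel)"
proof (rule LIMSEQ_unique)
  show "(\<lambda>N. \<integral>\<^sup>+s. ennreal (f s) * indicator {exp (- real N)..exp (real N)} s \<partial>lborel) \<longlonglongrightarrow>
      (\<integral>\<^sup>+s. ennreal (f s) * indicator {0<..} s \<partial>lborel)"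
  proof (rule nn_integral_LIMSEQ)
    show "incseq (\<lambda>N s. ennreal (f s) * indicator {exp (- real N)..exp (real N)} s)"
      by (auto simp: incseq_def le_fun_def indicator_def intro!: mult_left_mono)
         (meson exp_le_cancel_iff neg_le_iff_le of_nat_le_iff order_trans)+
    fix s :: real
    show "(\<lambda>N. ennreal (f s) * indicator {exp (- real N)..exp (real N)} s) \<longlonglongrightarrow> ennreal (f s) * indicator {0<..} s"
    proof (cases "0 < s")
      case True
      obtain M :: nat where M: "\<bar>ln s\<bar> \<le> real M" using real_arch_simple by blast
      have "ennreal (f s) * indicator {exp (- real N)..exp (real N)} s = ennreal (f s) * indicator {0<..} s" if "M \<le> N" for N
      proof -
        have "- real N \<le> ln s" "ln s \<le> real N" using M that by linarith+
        then have "exp (- real N) \<le> s" "s \<le> exp (real N)"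
          using True by (metis exp_le_cancel_iff exp_ln)+
        then show ?thesis using True by simp
      qed
      then show ?thesis by (intro tendsto_eventually eventually_sequentiallyI)
    next
      case False
      then have "\<not> exp (- real N) \<le> s" for N using exp_gt_zero[of "- real N"] by linarith
      then show ?thesis using False by simp
    qed
  qed measurable
  have "(\<integral>\<^sup>+s. ennreal (f s) * indicator {exp (- real N)..exp (real N)} s \<partial>lborel) =
      (\<integral>\<^sup>+t. ennreal (f (exp t) * exp t) * indicator {- real N..real N} t \<partial>lborel)" for N
  proof -
    have "(\<integral>\<^sup>+s. ennreal (f s * indicator {exp (- real N)..exp (real N)} s) \<partial>lborel) =
      (\<integral>\<^sup>+t. ennreal (f (exp t) * exp t * indicator {- real N..real N} t) \<partial>lborel)"
      by (rule nn_integral_substitution)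
         (auto intro!: derivative_eq_intros continuous_intros simp: set_borel_measurable_def)
    moreover have "ennreal a * indicator S x = ennreal (a * indicator S x)" for a x :: real and S
      by (simp add: indicator_def)
    ultimately show ?thesis by simp
  qed
  moreover have "(\<lambda>N. \<integral>\<^sup>+t. ennreal (f (exp t) * exp t) * indicator {- real N..real N} t \<partial>lborel) \<longlonglongrightarrow>
      (\<integral>\<^sup>+t. ennreal (f (exp t) * exp t) \<partial>lborel)"
  proof (rule nn_integral_LIMSEQ)
    show "incseq (\<lambda>N t. ennreal (f (exp t) * exp t) * indicator {- real N..real N} t)"
      by (auto simp: incseq_def le_fun_def indicator_def)
    fix t :: real
    obtain M :: nat where M: "\<bar>t\<bar> \<le> real M" using real_arch_simple by blast
    have "ennreal (f (exp t) * exp t) * indicator {- real N..real N} t = ennreal (f (exp t) * exp t)" if "M \<le> N" for N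
    proof -
      have "- real N \<le> t" "t \<le> real N" using M that by linarith+
      then show ?thesis by simp
    qed
    then show "(\<lambda>N. ennreal (f (exp t) * exp t) * indicator {- real N..real N} t) \<longlonglongrightarrow> ennreal (f (exp t) * exp t)"
      by (intro tendsto_eventually eventually_sequentiallyI)
  qed measurable
  ultimately show "(\<lambda>N. \<integral>\<^sup>+s. ennreal (f s) * indicator {exp (- real N)..exp (real N)} s \<partial>lborel) \<longlonglongrightarrow>
      (\<integral>\<^sup>+t. ennreal (f (exp t) * exp t) \<partial>lborel)" by simp
qed

lemma taylor_second_order:
  fixes f :: "real \<Rightarrow> real"
  assumes d: "\<And>t. (f has_real_derivative f' t) (at t)" "\<And>t. (f' has_real_derivative f'' t) (at t)"
  shows "\<exists>t. \<bar>t\<bar> \<le> \<bar>x\<bar> \<and> f x = f 0 + f' 0 * x + f'' t / 2 * x\<^sup>2"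
proof (cases "x = 0")
  case False
  define diff where "diff m = (if m = 0 then f else if m = 1 then f' else f'')" for m :: nat
  have "\<exists>t. (if x < 0 then x < t \<and> t < 0 else 0 < t \<and> t < x) \<and>
      f x = (\<Sum>m<2. (diff m 0 / fact m) * (x - 0) ^ m) + (diff 2 t / fact 2) * (x - 0) ^ 2"
    by (rule Taylor[where a = "- \<bar>x\<bar>" and b = "\<bar>x\<bar>"]) (use False d in \<open>auto simp: diff_def less_Suc_eq numeral_2_eq_2\<close>)
  then obtain t where t: "if x < 0 then x < t \<and> t < 0 else 0 < t \<and> t < x"
    "f x = (\<Sum>m<2. (diff m 0 / fact m) * (x - 0) ^ m) + (diff 2 t / fact 2) * (x - 0) ^ 2" by blast
  have "\<bar>t\<bar> \<le> \<bar>x\<bar>" using t(1) by (auto split: if_splits)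
  moreover have "f x = f 0 + f' 0 * x + f'' t / 2 * x\<^sup>2" using t(2) by (simp add: diff_def numeral_2_eq_2)
  ultimately show ?thesis by blast
qed auto

text \<open>The cumulant generating function of a Bernoulli variable with mean
  \<open>p\<close>.\<close>

definition log_mix :: "real \<Rightarrow> real \<Rightarrow> real" where
  "log_mix p x = ln (1 - p + p * exp x)"

lemma log_mix_pos: "0 < p \<Longrightarrow> p < 1 \<Longrightarrow> 0 < 1 - p + p * exp (x::real)"
  by (intro add_pos_pos) auto

lemma DERIV_log_mix:
  assumes p: "0 < p" "p < 1"
  shows "(log_mix p has_real_derivative p * exp x / (1 - p + p * exp x)) (at x)"
    and "((\<lambda>x. p * exp x / (1 - p + p * exp x)) has_real_derivative p * (1 - p) * exp x / (1 - p + p * exp x)\<^sup>2) (at x)"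
proof -
  have nz: "1 - p + p * exp x \<noteq> 0" "0 < 1 - p + p * exp x" using log_mix_pos[OF p, of x] by auto
  show "(log_mix p has_real_derivative p * exp x / (1 - p + p * exp x)) (at x)"
    unfolding log_mix_def[abs_def] using nz by (auto intro!: derivative_eq_intros)
  show "((\<lambda>x. p * exp x / (1 - p + p * exp x)) has_real_derivative p * (1 - p) * exp x / (1 - p + p * exp x)\<^sup>2) (at x)"
    using nz by (auto intro!: derivative_eq_intros simp: power2_eq_square algebra_simps)
qed

text \<open>The second derivative at \<open>t\<close> is \<open>p * (1 - p) * g\<close>, and
  \<open>g\<close> lies between \<open>exp (- \<bar>t\<bar>)\<close> and
  \<open>exp \<bar>t\<bar>\<close> uniformly in \<open>p\<close>, because
  \<open>1 - p + p * exp t\<close> lies between 1 and \<open>exp t\<close>.\<close>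

lemma log_mix_bounds:
  assumes p: "0 < p" "p < 1"
  shows "p * (1 - p) * exp (- \<bar>x\<bar>) * x\<^sup>2 / 2 \<le> log_mix p x - p * x"
    and "log_mix p x - p * x \<le> p * (1 - p) * exp \<bar>x\<bar> * x\<^sup>2 / 2"
proof -
  obtain t where t: "\<bar>t\<bar> \<le> \<bar>x\<bar>"
    "log_mix p x = log_mix p 0 + p * exp 0 / (1 - p + p * exp 0) * x + p * (1 - p) * exp t / (1 - p + p * exp t)\<^sup>2 / 2 * x\<^sup>2"
    using taylor_second_order[OF DERIV_log_mix[OF p]] by blast
  define g where "g = exp t / (1 - p + p * exp t)\<^sup>2"
  have eq: "log_mix p x - p * x = p * (1 - p) * g * x\<^sup>2 / 2"
    using t(2) by (simp add: log_mix_def g_def)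
  have D: "0 < 1 - p + p * exp t" by (rule log_mix_pos[OF p])
  have "exp (- \<bar>t\<bar>) \<le> g \<and> g \<le> exp \<bar>t\<bar>"
  proof (cases "0 \<le> t")
    case True
    have 1: "1 \<le> 1 - p + p * exp t" using True p mult_left_mono[of 1 "exp t" p] by simp
    have "(1 - p) * 1 \<le> (1 - p) * exp t" using True p by (intro mult_left_mono) auto
    then have 2: "1 - p + p * exp t \<le> exp t" by (simp add: algebra_simps)
    have "g \<le> exp t / 1\<^sup>2" unfolding g_def using 1 by (intro divide_left_mono power_mono) auto
    moreover have "exp t / (exp t)\<^sup>2 \<le> g" unfolding g_def using 2 D by (intro divide_left_mono power_mono) auto
    moreover have "exp t / (exp t)\<^sup>2 = exp (- t)" by (simp add: power2_eq_square exp_minus field_simps)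
    ultimately show ?thesis using True by simp
  next
    case False
    have 1: "1 - p + p * exp t \<le> 1" using False p mult_left_mono[of "exp t" 1 p] by simp
    have "(1 - p) * exp t \<le> (1 - p) * 1" using False p by (intro mult_left_mono) auto
    then have 2: "exp t \<le> 1 - p + p * exp t" by (simp add: algebra_simps)
    have "exp t / 1\<^sup>2 \<le> g" unfolding g_def using 1 D by (intro divide_left_mono power_mono) auto
    moreover have "g \<le> exp t / (exp t)\<^sup>2" unfolding g_def using 2 D by (intro divide_left_mono power_mono) auto
    moreover have "exp t / (exp t)\<^sup>2 = exp (- t)" by (simp add: power2_eq_square exp_minus field_simps)
    ultimately show ?thesis using False by simp
  qed
  moreover have "exp (- \<bar>x\<bar>) \<le> exp (- \<bar>t\<bar>)" "exp \<bar>t\<bar> \<le> exp \<bar>x\<bar>" using t(1) by auto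
  ultimately have g: "exp (- \<bar>x\<bar>) \<le> g" "g \<le> exp \<bar>x\<bar>" by linarith+
  show "p * (1 - p) * exp (- \<bar>x\<bar>) * x\<^sup>2 / 2 \<le> log_mix p x - p * x"
    unfolding eq using g p by (intro divide_right_mono mult_right_mono mult_left_mono) auto
  show "log_mix p x - p * x \<le> p * (1 - p) * exp \<bar>x\<bar> * x\<^sup>2 / 2"
    unfolding eq using g p by (intro divide_right_mono mult_right_mono mult_left_mono) auto
qed

lemma convex_log_mix: "0 < p \<Longrightarrow> p < 1 \<Longrightarrow> convex_on UNIV (log_mix p)"
  by (rule f''_ge0_imp_convex[OF _ DERIV_log_mix]) auto

text \<open>
  Minus the logarithm of the density of the ratio of radii in the variable \<open>y\<close> given by
  \<open>s\<^sup>2 = (p / (1 - p)) exp (2 \<eta> y)\<close>; convexity gives a bound that does not depend on the dimensions.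
\<close>
definition log_weight :: "nat \<Rightarrow> real \<Rightarrow> real \<Rightarrow> real \<Rightarrow> real" where
  "log_weight n p \<eta> y = real n / 2 * (log_mix p (2 * \<eta> * y) - p * (2 * \<eta> * y))"

text \<open>The relation between \<open>\<eta>\<close>, \<open>n\<close> and \<open>p\<close>
  normalizes the quadratic coefficient to 1/2, so both bounds tend to the Gaussian exponent as
  \<open>\<eta>\<close> tends to 0.\<close>

lemma log_weight_bounds:
  assumes p: "0 < p" "p < 1" and \<eta>: "0 < \<eta>" "2 * real n * p * (1 - p) * \<eta>\<^sup>2 = 1"
  shows "exp (- (2 * \<eta> * \<bar>y\<bar>)) * y\<^sup>2 / 2 \<le> log_weight n p \<eta> y"
    and "log_weight n p \<eta> y \<le> exp (2 * \<eta> * \<bar>y\<bar>) * y\<^sup>2 / 2"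
proof -
  have e: "real n / 2 * (p * (1 - p) * c * (2 * \<eta> * y)\<^sup>2 / 2) = c * y\<^sup>2 / 2" for c
  proof -
    have "real n / 2 * (p * (1 - p) * c * (2 * \<eta> * y)\<^sup>2 / 2) = (2 * real n * p * (1 - p) * \<eta>\<^sup>2) * c * y\<^sup>2 / 2"
      by (simp add: power2_eq_square algebra_simps)
    then show ?thesis using \<eta> by simp
  qed
  have a: "\<bar>2 * \<eta> * y\<bar> = 2 * \<eta> * \<bar>y\<bar>" using \<eta> by (simp add: abs_mult)
  show "exp (- (2 * \<eta> * \<bar>y\<bar>)) * y\<^sup>2 / 2 \<le> log_weight n p \<eta> y"
    unfolding log_weight_def e[symmetric] a[symmetric] by (intro mult_left_mono log_mix_bounds p) auto
  show "log_weight n p \<eta> y \<le> exp (2 * \<eta> * \<bar>y\<bar>) * y\<^sup>2 / 2"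
    unfolding log_weight_def e[symmetric] a[symmetric] by (intro mult_left_mono log_mix_bounds p) auto
qed

text \<open>A convex function that vanishes at 0 grows at least linearly beyond the points 1 and -1.
  Its value there is at least 1/6, since the lower bound is \<open>exp (- 2 * \<eta>) / 2\<close>
  with \<open>\<eta> \<le> 1/2\<close> and \<open>exp 1 \<le> 3\<close>.\<close>

lemma log_weight_ge_linear:
  assumes p: "0 < p" "p < 1" and \<eta>: "0 < \<eta>" "2 * real n * p * (1 - p) * \<eta>\<^sup>2 = 1" "\<eta> \<le> 1/2" and y: "1 \<le> \<bar>y\<bar>"
  shows "\<bar>y\<bar> / 6 \<le> log_weight n p \<eta> y"
proof -
  define e where "e = sgn y"
  have y': "y = \<bar>y\<bar> * e" "\<bar>e\<bar> = 1" using y by (auto simp: e_def sgn_mult_abs mult.commute sgn_if)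
  have "1/6 \<le> log_weight n p \<eta> e"
  proof -
    have "1/3 \<le> exp (-1::real)" using exp_le by (simp add: exp_minus field_simps)
    also have "\<dots> \<le> exp (- (2 * \<eta> * \<bar>e\<bar>))" using \<eta> y' by simp
    finally have "1/3 * e\<^sup>2 / 2 \<le> exp (- (2 * \<eta> * \<bar>e\<bar>)) * e\<^sup>2 / 2" by (intro divide_right_mono mult_right_mono) auto
    moreover have "e\<^sup>2 = 1" using y'(2) by (metis one_power2 power2_abs)
    ultimately show ?thesis using log_weight_bounds(1)[OF p \<eta>(1,2), of e] by simp
  qed
  moreover have "log_weight n p \<eta> e \<le> (1 / \<bar>y\<bar>) * log_weight n p \<eta> y"
  proof -
    have "log_mix p ((1 - 1 / \<bar>y\<bar>) *\<^sub>R 0 + (1 / \<bar>y\<bar>) *\<^sub>R (2 * \<eta> * y)) \<le> (1 - 1 / \<bar>y\<bar>) * log_mix p 0 + (1 / \<bar>y\<bar>) * log_mix p (2 * \<eta> * y)"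
      using y by (intro convex_onD[OF convex_log_mix[OF p]]) auto
    moreover have "(1 / \<bar>y\<bar>) * (2 * \<eta> * y) = 2 * \<eta> * e"
    proof -
      have "(1 / \<bar>y\<bar>) * y = e" using y by (subst (2) y'(1)) auto
      then show ?thesis by (metis mult.left_commute)
    qed
    moreover have "log_mix p 0 = 0" by (simp add: log_mix_def)
    ultimately have 1: "log_mix p (2 * \<eta> * e) \<le> (1 / \<bar>y\<bar>) * log_mix p (2 * \<eta> * y)"
      and 2: "(1 / \<bar>y\<bar>) * (2 * \<eta> * y) = 2 * \<eta> * e" by simp_all
    have "(1 / \<bar>y\<bar>) * (log_mix p (2 * \<eta> * y) - p * (2 * \<eta> * y)) =
        (1 / \<bar>y\<bar>) * log_mix p (2 * \<eta> * y) - p * ((1 / \<bar>y\<bar>) * (2 * \<eta> * y))"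
      by (simp only: right_diff_distrib mult.left_commute)
    then have "log_mix p (2 * \<eta> * e) - p * (2 * \<eta> * e) \<le> (1 / \<bar>y\<bar>) * (log_mix p (2 * \<eta> * y) - p * (2 * \<eta> * y))"
      using 1 unfolding 2 by simp
    then have "real n / 2 * (log_mix p (2 * \<eta> * e) - p * (2 * \<eta> * e)) \<le> real n / 2 * ((1 / \<bar>y\<bar>) * (log_mix p (2 * \<eta> * y) - p * (2 * \<eta> * y)))"
      by (intro mult_left_mono) auto
    then show ?thesis unfolding log_weight_def by (simp add: mult_ac)
  qed
  ultimately have "1/6 \<le> (1 / \<bar>y\<bar>) * log_weight n p \<eta> y" by linarith
  then show ?thesis using y by (simp add: field_simps)
qed

lemma integrable_inverse_1_plus_sq: "integrable lborel (\<lambda>y::real. inverse (1 + y\<^sup>2))"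
  using integrable_inverse_1_plus_square by (simp add: set_integrable_def)

text \<open>An integrable majorant free of the parameters. The quadratic Taylor bound of
  \<open>exp\<close> at \<open>\<bar>y\<bar> / 6\<close> gives \<open>y\<^sup>2 / 72\<close>, and
  \<open>1 + y\<^sup>2 \<le> 2 * y\<^sup>2\<close> doubles 72 to 144.\<close>

lemma exp_minus_log_weight_le:
  assumes p: "0 < p" "p < 1" and \<eta>: "0 < \<eta>" "2 * real n * p * (1 - p) * \<eta>\<^sup>2 = 1" "\<eta> \<le> 1/2"
  shows "exp (- log_weight n p \<eta> y) \<le> 144 * inverse (1 + y\<^sup>2)"
proof (cases "1 \<le> \<bar>y\<bar>")
  case True
  have y2: "1 \<le> y\<^sup>2" using True by (metis one_le_power power2_abs)
  have "y\<^sup>2 / 72 \<le> exp (\<bar>y\<bar> / 6)"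
    using exp_lower_Taylor_quadratic[of "\<bar>y\<bar> / 6"] by (simp add: power_divide)
  also have "\<dots> \<le> exp (log_weight n p \<eta> y)" using log_weight_ge_linear[OF assms True] by simp
  finally have "y\<^sup>2 / 72 \<le> exp (log_weight n p \<eta> y)" .
  moreover have "(1 + y\<^sup>2) / 144 \<le> y\<^sup>2 / 72" using y2 by simp
  ultimately have "(1 + y\<^sup>2) / 144 \<le> exp (log_weight n p \<eta> y)" by linarith
  then have "inverse (exp (log_weight n p \<eta> y)) \<le> inverse ((1 + y\<^sup>2) / 144)"
    by (intro le_imp_inverse_le) (auto simp: add_pos_nonneg)
  then show ?thesis by (simp add: exp_minus field_simps)
next
  case False
  then have "y\<^sup>2 \<le> 1" by (simp add: abs_square_le_1)
  then have "(1 + y\<^sup>2) / 144 \<le> 1" by simp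
  then have "1 \<le> 144 * inverse (1 + y\<^sup>2)" by (simp add: field_simps add_pos_nonneg)
  moreover have "0 \<le> log_weight n p \<eta> y"
    by (rule order_trans[OF _ log_weight_bounds(1)[OF p \<eta>(1,2)]]) simp
  ultimately show ?thesis by (meson exp_le_one_iff neg_le_0_iff_le order_trans)
qed

lemma ratio_mass_alt:
  assumes "W \<in> sets borel"
  shows "ratio_mass n k W = (\<integral>s. s ^ (k - 1) * (1 + s\<^sup>2) powr (- real n / 2) * indicator (W \<inter> {0<..}) s \<partial>lborel)"
proof -
  have [measurable]: "W \<inter> {0<..} \<in> sets borel" using assms by simp
  have "(\<integral>s. s ^ (k - 1) * (1 + s\<^sup>2) powr (- real n / 2) * indicator (W \<inter> {0<..}) s \<partial>lborel)
     = enn2real (\<integral>\<^sup>+s. ennreal (s ^ (k - 1) * (1 + s\<^sup>2) powr (- real n / 2) * indicator (W \<inter> {0<..}) s) \<partial>lborel)"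
    by (rule integral_eq_nn_integral) (measurable, simp add: indicator_def)
  also have "(\<lambda>s. ennreal (s ^ (k - 1) * (1 + s\<^sup>2) powr (- real n / 2) * indicator (W \<inter> {0<..}) s)) =
      (\<lambda>s. ennreal (s ^ (k - 1) * (1 + s\<^sup>2) powr (- real n / 2)) * indicator (W \<inter> {0<..}) s)"
    by (auto simp: fun_eq_iff indicator_def)
  finally show ?thesis by (simp add: ratio_mass_def)
qed

lemma ratio_mass_log_weight:
  fixes k l n :: nat
  assumes kl: "1 \<le> k" "1 \<le> l" and n: "n = k + l"
  defines "p \<equiv> real k / real n" and "\<eta> \<equiv> 1 / sqrt (2 * real n * (real k / real n) * (1 - real k / real n))"
  shows "\<exists>C>0. \<forall>W \<in> sets borel. ratio_mass n k W =
    C * (\<integral>y. exp (- log_weight n p \<eta> y) * indicator {y. sqrt (p / (1 - p)) * exp (\<eta> * y) \<in> W} y \<partial>lborel)"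
proof -
  have n0: "0 < real n" using kl n by simp
  have p: "0 < p" "p < 1" using kl n by (auto simp: p_def)
  have \<eta>: "0 < \<eta>" unfolding \<eta>_def p_def[symmetric] using p n0 by simp
  \<comment> \<open>The mode of the weight in the variable \<open>t = ln s\<close>; \<open>y\<close>
    is the distance from it in units of \<open>\<eta>\<close>.\<close>
  define b where "b = ln (sqrt (p / (1 - p)))"
  have eb: "exp b = sqrt (p / (1 - p))" "exp (2 * b) = p / (1 - p)"
    using p by (simp_all add: b_def exp_double)
  define C where "C = \<eta> * (exp (real k * b) * (1 - p) powr (real n / 2))"
  show ?thesis
  proof (intro exI conjI ballI)
    show "0 < C" using \<eta> p by (simp add: C_def)
    fix W :: "real set" assume W [measurable]: "W \<in> sets borel"
    define f where "f s = s ^ (k - 1) * (1 + s\<^sup>2) powr (- real n / 2) * indicator W s" for s :: real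
    have f_meas [measurable]: "f \<in> borel_measurable borel" unfolding f_def by measurable
    have f0: "0 \<le> f (exp t) * exp t" for t by (simp add: f_def)
    have "ratio_mass n k W = enn2real (\<integral>\<^sup>+s. ennreal (f s) * indicator {0<..} s \<partial>lborel)"
      unfolding ratio_mass_def f_def
      by (intro arg_cong[where f = enn2real] nn_integral_cong) (auto simp: indicator_def)
    also have "\<dots> = enn2real (\<integral>\<^sup>+t. ennreal (f (exp t) * exp t) \<partial>lborel)"
      by (simp add: nn_integral_exp_substitution)
    also have "\<dots> = (\<integral>t. f (exp t) * exp t \<partial>lborel)"
      by (rule integral_eq_nn_integral[symmetric]) (auto simp: f0)
    also have "\<dots> = \<eta> * (\<integral>y. f (exp (b + \<eta> * y)) * exp (b + \<eta> * y) \<partial>lborel)"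
      using lborel_integral_real_affine[of \<eta> "\<lambda>t. f (exp t) * exp t" b] \<eta> by simp
    also have "(\<lambda>y. f (exp (b + \<eta> * y)) * exp (b + \<eta> * y)) =
        (\<lambda>y. (exp (real k * b) * (1 - p) powr (real n / 2)) *
          (exp (- log_weight n p \<eta> y) * indicator {y. sqrt (p / (1 - p)) * exp (\<eta> * y) \<in> W} y))"
    proof
      have alg: "a * b * i * c = d * (e * i)" if "a * c * b = d * e" for a b c d e i :: real
      proof -
        have "a * b * i * c = (a * c * b) * i" by simp
        then show ?thesis using that by simp
      qed
      fix y :: real
      define D where "D = 1 - p + p * exp (2 * \<eta> * y)"
      have D: "0 < D" unfolding D_def by (rule log_mix_pos[OF p])
      have s: "exp (b + \<eta> * y) = sqrt (p / (1 - p)) * exp (\<eta> * y)" by (simp add: exp_add eb)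
      have "(exp (b + \<eta> * y))\<^sup>2 = exp (2 * b) * exp (2 * \<eta> * y)"
        by (simp add: power2_eq_square algebra_simps flip: exp_add)
      then have "1 + (exp (b + \<eta> * y))\<^sup>2 = D / (1 - p)"
        unfolding eb D_def using p by (simp add: field_simps)
      then have "(1 + (exp (b + \<eta> * y))\<^sup>2) powr (- real n / 2) = D powr (- real n / 2) * (1 - p) powr (real n / 2)"
        using D p by (simp add: powr_divide powr_minus_divide)
      moreover have "exp (b + \<eta> * y) ^ (k - 1) * exp (b + \<eta> * y) = exp (real k * (b + \<eta> * y))"
        using kl by (simp add: exp_of_nat_mult flip: power_Suc2)
      moreover have "real k = real n * p" using n0 by (simp add: p_def)
      then have "real k * (\<eta> * y) - real n / 2 * ln D = - log_weight n p \<eta> y"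
        by (simp add: log_weight_def log_mix_def D_def algebra_simps)
      then have "exp (real k * (b + \<eta> * y)) * D powr (- real n / 2) = exp (real k * b) * exp (- log_weight n p \<eta> y)"
        using D by (simp add: powr_def algebra_simps flip: exp_add)
      ultimately have "exp (b + \<eta> * y) ^ (k - 1) * exp (b + \<eta> * y) * (1 + (exp (b + \<eta> * y))\<^sup>2) powr (- real n / 2)
          = (exp (real k * b) * (1 - p) powr (real n / 2)) * exp (- log_weight n p \<eta> y)"
        by (simp only: mult.assoc[symmetric]) (simp only: mult_ac)
      moreover have "indicator W (exp (b + \<eta> * y)) = (indicator {y. sqrt (p / (1 - p)) * exp (\<eta> * y) \<in> W} y :: real)"
        by (simp add: indicator_def s)
      ultimately show "f (exp (b + \<eta> * y)) * exp (b + \<eta> * y) = (exp (real k * b) * (1 - p) powr (real n / 2)) *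
          (exp (- log_weight n p \<eta> y) * indicator {y. sqrt (p / (1 - p)) * exp (\<eta> * y) \<in> W} y)"
        unfolding f_def using alg by simp
    qed
    finally show "ratio_mass n k W = C * (\<integral>y. exp (- log_weight n p \<eta> y) * indicator {y. sqrt (p / (1 - p)) * exp (\<eta> * y) \<in> W} y \<partial>lborel)"
      by (simp add: C_def)
  qed
qed

definition gauss_mass :: "real set \<Rightarrow> real" where
  "gauss_mass W = (\<integral>y. exp (- y\<^sup>2 / 2) * indicator W y \<partial>lborel)"

lemma gauss_mass_UNIV: "gauss_mass UNIV = sqrt (2 * pi)"
proof -
  have "(\<integral>y. std_normal_density y \<partial>lborel) = 1" by (rule integral_normal_density) simp
  moreover have "std_normal_density = (\<lambda>y. (1 / sqrt (2 * pi)) * exp (- y\<^sup>2 / 2))"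
    by (simp add: fun_eq_iff std_normal_density_def)
  ultimately have "(\<integral>y. (1 / sqrt (2 * pi)) * exp (- y\<^sup>2 / 2) \<partial>lborel) = 1" by (simp only:)
  moreover have "gauss_mass UNIV = (\<integral>y. exp (- y\<^sup>2 / 2) \<partial>lborel)" by (simp add: gauss_mass_def)
  ultimately have eq: "(1 / sqrt (2 * pi)) * gauss_mass UNIV = 1" by (simp only: integral_mult_right_zero)
  have "gauss_mass UNIV = sqrt (2 * pi) * ((1 / sqrt (2 * pi)) * gauss_mass UNIV)" by simp
  then show ?thesis unfolding eq by simp
qed

lemma integrable_gauss: "integrable lborel (\<lambda>y::real. exp (- y\<^sup>2 / 2))"
proof -
  have "integrable lborel (\<lambda>y. sqrt (2 * pi) * std_normal_density y)"
    by (intro integrable_mult_right integrable_normal_density) simp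
  then show ?thesis by (simp add: std_normal_density_def)
qed

section \<open>Dominated convergence to Gaussian masses\<close>

lemma AE_indicator_lessThan_tendsto:
  assumes "Y \<longlonglongrightarrow> (y0::real)"
  shows "AE y in lborel. (\<lambda>i. indicator {..<Y i} y) \<longlonglongrightarrow> (indicator {..<y0} y :: real)"
proof (rule AE_I[of _ _ "{y0}"])
  show "{y \<in> space lborel. \<not> (\<lambda>i. indicator {..<Y i} y) \<longlonglongrightarrow> (indicator {..<y0} y :: real)} \<subseteq> {y0}"
  proof (safe, rule ccontr)
    fix y assume n: "\<not> (\<lambda>i. indicator {..<Y i} y) \<longlonglongrightarrow> (indicator {..<y0} y :: real)" and "y \<noteq> y0"
    then consider "y < y0" | "y0 < y" by linarith
    then have "\<forall>\<^sub>F i in sequentially. indicator {..<Y i} y = (indicator {..<y0} y :: real)"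
    proof cases
      case 1
      with assms have "\<forall>\<^sub>F i in sequentially. y < Y i" by (rule order_tendstoD)
      then show ?thesis by eventually_elim (use 1 in simp)
    next
      case 2
      with assms have "\<forall>\<^sub>F i in sequentially. Y i < y" by (rule order_tendstoD)
      then show ?thesis by eventually_elim (use 2 in simp)
    qed
    then have "(\<lambda>i. indicator {..<Y i} y) \<longlonglongrightarrow> (indicator {..<y0} y :: real)" by (rule tendsto_eventually)
    with n show False by contradiction
  qed
qed simp_all

text \<open>It is enough that \<open>\<eta>\<close> tends to 0, which follows from the growth of
  both blocks; convergence of \<open>p\<close> is not assumed. Then the weight in \<open>y\<close>
  becomes Gaussian and the cut-off tends to \<open>y0\<close>.\<close>

lemma ratio_mass_tendsto:
  fixes k l :: "nat \<Rightarrow> nat" and z w :: "nat \<Rightarrow> real"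
  assumes kl: "\<And>i. 4 \<le> k i" "\<And>i. 4 \<le> l i" and lim: "filterlim k at_top sequentially" "filterlim l at_top sequentially"
    and z: "\<And>i. 0 < z i" "\<And>i. z i < 1" and w: "w \<longlonglongrightarrow> y0"
  defines "p \<equiv> \<lambda>i. real (k i) / real (k i + l i)"
  assumes zw: "\<And>i. z i = p i + sqrt (2 * p i * (1 - p i) / real (k i + l i)) * w i"
  shows "(\<lambda>i. ratio_mass (k i + l i) (k i) {..<sqrt (z i / (1 - z i))} / ratio_mass (k i + l i) (k i) UNIV)
    \<longlonglongrightarrow> gauss_mass {..<y0} / gauss_mass UNIV"
proof -
  define n where "n i = k i + l i" for i
  define q where "q i = 1 - p i" for i
  define \<eta> where "\<eta> i = 1 / sqrt (2 * real (n i) * p i * (1 - p i))" for i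
  have n0: "0 < real (n i)" for i using kl[of i] by (simp add: n_def)
  have q: "q i = real (l i) / real (n i)" for i using n0[of i] by (simp add: q_def p_def n_def field_simps)
  have p: "0 < p i" "p i < 1" "0 < q i" "q i < 1" for i
    using kl(1)[of i] kl(2)[of i] by (simp_all add: p_def q_def)
  have \<eta>2: "2 * real (n i) * p i * (1 - p i) * (\<eta> i)\<^sup>2 = 1" for i
    using p[of i] n0[of i] unfolding \<eta>_def q_def[symmetric] by (simp add: power_divide)
  have \<eta>_eq: "\<eta> i = sqrt ((1 / real (k i) + 1 / real (l i)) / 2)" for i
  proof -
    have "1 / (2 * real (n i) * p i * q i) = (1 / real (k i) + 1 / real (l i)) / 2"
      using kl[of i] n0[of i] unfolding q by (simp add: p_def n_def[symmetric]) (simp add: n_def field_simps)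
    then have "sqrt (1 / (2 * real (n i) * p i * q i)) = sqrt ((1 / real (k i) + 1 / real (l i)) / 2)" by (rule arg_cong)
    then show ?thesis unfolding \<eta>_def q_def[symmetric] by (simp add: real_sqrt_divide)
  qed
  have \<eta>: "0 < \<eta> i" for i using p[of i] n0[of i] unfolding \<eta>_def q_def[symmetric] by simp
  have \<eta>_half: "\<eta> i \<le> 1/2" for i
  proof -
    have "1 / real (k i) \<le> 1/4" "1 / real (l i) \<le> 1/4" using kl[of i] by (simp_all add: field_simps)
    then have "(1 / real (k i) + 1 / real (l i)) / 2 \<le> (1/2)\<^sup>2" by (simp add: power2_eq_square)
    then have "sqrt ((1 / real (k i) + 1 / real (l i)) / 2) \<le> sqrt ((1/2)\<^sup>2)" by (rule real_sqrt_le_mono)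
    then show ?thesis unfolding \<eta>_eq by simp
  qed
  have inv0: "(\<lambda>i. 1 / real (f i)) \<longlonglongrightarrow> 0" if "filterlim f at_top sequentially" for f :: "nat \<Rightarrow> nat"
    by (rule tendsto_divide_0[OF tendsto_const])
       (rule filterlim_at_top_imp_at_infinity, rule filterlim_compose[OF filterlim_real_sequentially that])
  have "\<eta> \<longlonglongrightarrow> sqrt ((0 + 0) / 2)"
    unfolding \<eta>_eq[abs_def] by (intro tendsto_intros inv0 lim) simp
  then have \<eta>_lim: "\<eta> \<longlonglongrightarrow> 0" by simp
  define lw where "lw i = log_weight (n i) (p i) (\<eta> i)" for i
  \<comment> \<open>The cut-off in the variable \<open>y\<close>. The first-order terms of the two
    logarithms add up to \<open>w i\<close>, since \<open>p i + q i = 1\<close>.\<close>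
  define Y where "Y i = (ln (1 + 2 * q i * \<eta> i * w i) - ln (1 - 2 * p i * \<eta> i * w i)) / (2 * \<eta> i)" for i
  have \<sigma>: "sqrt (2 * p i * (1 - p i) / real (n i)) = 2 * p i * q i * \<eta> i" for i
  proof -
    have "(2 * p i * q i * \<eta> i)\<^sup>2 = (2 * p i * q i / n i) * (2 * real (n i) * p i * (1 - p i) * (\<eta> i)\<^sup>2)"
      using n0[of i] unfolding q_def[symmetric] by (simp add: power2_eq_square)
    also have "\<dots> = 2 * p i * q i / n i" unfolding \<eta>2 by simp
    finally have "sqrt ((2 * p i * q i * \<eta> i)\<^sup>2) = sqrt (2 * p i * q i / n i)" by (rule arg_cong)
    then show ?thesis using p[of i] \<eta>[of i] by (simp add: q_def)
  qed
  have set_eq: "{y. sqrt (p i / (1 - p i)) * exp (\<eta> i * y) \<in> {..<sqrt (z i / (1 - z i))}} = {..<Y i}" for i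
  proof -
    have zp: "z i = p i * (1 + 2 * q i * \<eta> i * w i)"
      using zw[of i] unfolding n_def[symmetric] \<sigma> by (simp add: algebra_simps)
    have zq: "1 - z i = q i * (1 - 2 * p i * \<eta> i * w i)"
      using zw[of i] unfolding n_def[symmetric] \<sigma> by (simp add: algebra_simps q_def)
    have "0 < p i * (1 + 2 * q i * \<eta> i * w i)" "0 < q i * (1 - 2 * p i * \<eta> i * w i)"
      using z[of i] unfolding zp[symmetric] zq[symmetric] by simp_all
    then have pos: "0 < 1 + 2 * q i * \<eta> i * w i" "0 < 1 - 2 * p i * \<eta> i * w i"
      using p[of i] by (auto dest: zero_less_mult_pos)
    define a where "a = (1 + 2 * q i * \<eta> i * w i) / (1 - 2 * p i * \<eta> i * w i)"
    have a: "0 < a" using pos by (simp add: a_def)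
    have za: "z i / (1 - z i) = p i / q i * a" unfolding zq unfolding zp a_def using p[of i] pos by simp
    have Ya: "Y i = ln a / (2 * \<eta> i)" unfolding Y_def a_def using pos by (simp add: ln_div)
    have "sqrt (p i / (1 - p i)) * exp (\<eta> i * y) < sqrt (z i / (1 - z i)) \<longleftrightarrow> y < Y i" for y
    proof -
      have s0: "0 < sqrt (p i / q i)" using p[of i] by simp
      have "sqrt (p i / (1 - p i)) * exp (\<eta> i * y) < sqrt (z i / (1 - z i)) \<longleftrightarrow>
          sqrt (p i / q i) * exp (\<eta> i * y) < sqrt (p i / q i) * sqrt a"
        unfolding za q_def[symmetric] real_sqrt_mult ..
      also have "\<dots> \<longleftrightarrow> exp (\<eta> i * y) < sqrt a" using s0 by (rule mult_less_cancel_left_pos)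
      also have "\<dots> \<longleftrightarrow> (exp (\<eta> i * y))\<^sup>2 < a"
        using a by (metis exp_ge_zero real_sqrt_less_iff real_sqrt_abs abs_of_nonneg)
      also have "(exp (\<eta> i * y))\<^sup>2 = exp (2 * \<eta> i * y)" by (simp add: power2_eq_square flip: exp_add)
      also have "exp (2 * \<eta> i * y) < a \<longleftrightarrow> 2 * \<eta> i * y < ln a"
        using a by (metis exp_less_cancel_iff exp_ln)
      also have "\<dots> \<longleftrightarrow> y < Y i" unfolding Ya using \<eta>[of i] by (simp add: field_simps)
      finally show ?thesis .
    qed
    then show ?thesis by auto
  qed
  have Y_lim: "Y \<longlonglongrightarrow> y0"
  proof -
    have "(\<lambda>i. Y i - w i) \<longlonglongrightarrow> 0"
    proof (rule Lim_null_comparison)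
      have "(\<lambda>i. 2 * \<eta> i * w i) \<longlonglongrightarrow> 2 * 0 * y0" by (intro tendsto_intros \<eta>_lim w)
      then have "\<forall>\<^sub>F i in sequentially. norm (2 * \<eta> i * w i) < 1/2"
        by (intro order_tendstoD[OF tendsto_norm_zero]) simp_all
      then show "\<forall>\<^sub>F i in sequentially. norm (Y i - w i) \<le> 8 * \<eta> i * (w i)\<^sup>2"
      proof eventually_elim
        case (elim i)
        define a b where "a = 2 * q i * \<eta> i * w i" and "b = - (2 * p i * \<eta> i * w i)"
        have aq: "a = q i * (2 * \<eta> i * w i)" and bq: "b = - (p i * (2 * \<eta> i * w i))"
          by (simp_all add: a_def b_def)
        have sm: "\<bar>2 * \<eta> i * w i\<bar> \<le> 1/2" using elim by simp
        have ale: "\<bar>a\<bar> \<le> 1 * \<bar>2 * \<eta> i * w i\<bar>" unfolding aq abs_mult[of "q i"] using p[of i] by (intro mult_right_mono) auto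
        have ble: "\<bar>b\<bar> \<le> 1 * \<bar>2 * \<eta> i * w i\<bar>" unfolding bq abs_minus_cancel abs_mult[of "p i"] using p[of i] by (intro mult_right_mono) auto
        have "\<bar>ln (1 + a) - a\<bar> \<le> 2 * a\<^sup>2" "\<bar>ln (1 + b) - b\<bar> \<le> 2 * b\<^sup>2"
          using ale ble sm by (auto intro!: abs_ln_one_plus_x_minus_x_bound)
        moreover have "a\<^sup>2 \<le> (2 * \<eta> i * w i)\<^sup>2" "b\<^sup>2 \<le> (2 * \<eta> i * w i)\<^sup>2"
          using ale ble by (simp_all add: abs_le_square_iff)
        \<comment> \<open>Each logarithm contributes at most twice
          \<open>(2 * \<eta> i * w i)\<^sup>2\<close>; division of the sum by
          \<open>2 * \<eta> i\<close> gives the claimed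
          \<open>8 * \<eta> i * (w i)\<^sup>2\<close>.\<close>
        ultimately have le: "\<bar>(ln (1 + a) - a) - (ln (1 + b) - b)\<bar> \<le> 4 * (2 * \<eta> i * w i)\<^sup>2" by linarith
        have "a - b = 2 * \<eta> i * w i" unfolding a_def b_def q_def by (simp add: algebra_simps)
        then have "Y i - w i = ((ln (1 + a) - a) - (ln (1 + b) - b)) / (2 * \<eta> i)"
          unfolding Y_def using \<eta>[of i] by (simp add: a_def b_def field_simps)
        then have "\<bar>Y i - w i\<bar> = \<bar>(ln (1 + a) - a) - (ln (1 + b) - b)\<bar> / (2 * \<eta> i)"
          using \<eta>[of i] by (simp add: abs_divide)
        also have "\<dots> \<le> 4 * (2 * \<eta> i * w i)\<^sup>2 / (2 * \<eta> i)" using le \<eta>[of i] by (intro divide_right_mono) auto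
        also have "\<dots> = 8 * \<eta> i * (w i)\<^sup>2" using \<eta>[of i] by (simp add: power2_eq_square)
        finally show ?case by simp
      qed
      have "(\<lambda>i. 8 * \<eta> i * (w i)\<^sup>2) \<longlonglongrightarrow> 8 * 0 * y0\<^sup>2" by (intro tendsto_intros \<eta>_lim w)
      then show "(\<lambda>i. 8 * \<eta> i * (w i)\<^sup>2) \<longlonglongrightarrow> 0" by simp
    qed
    from tendsto_add[OF this w] show ?thesis by simp
  qed
  have lw_lim: "(\<lambda>i. exp (- lw i y)) \<longlonglongrightarrow> exp (- y\<^sup>2 / 2)" for y
  proof -
    have "(\<lambda>i. lw i y) \<longlonglongrightarrow> y\<^sup>2 / 2"
    proof (rule tendsto_sandwich)
      show "\<forall>\<^sub>F i in sequentially. exp (- (2 * \<eta> i * \<bar>y\<bar>)) * y\<^sup>2 / 2 \<le> lw i y"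
        "\<forall>\<^sub>F i in sequentially. lw i y \<le> exp (2 * \<eta> i * \<bar>y\<bar>) * y\<^sup>2 / 2"
        unfolding lw_def using log_weight_bounds[OF p(1,2) \<eta> \<eta>2] by (simp_all add: always_eventually)
      have "(\<lambda>i. exp (- (2 * \<eta> i * \<bar>y\<bar>)) * y\<^sup>2 / 2) \<longlonglongrightarrow> exp (- (2 * 0 * \<bar>y\<bar>)) * y\<^sup>2 / 2"
        "(\<lambda>i. exp (2 * \<eta> i * \<bar>y\<bar>) * y\<^sup>2 / 2) \<longlonglongrightarrow> exp (2 * 0 * \<bar>y\<bar>) * y\<^sup>2 / 2"
        by (intro tendsto_intros \<eta>_lim; simp)+
      then show "(\<lambda>i. exp (- (2 * \<eta> i * \<bar>y\<bar>)) * y\<^sup>2 / 2) \<longlonglongrightarrow> y\<^sup>2 / 2"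
        "(\<lambda>i. exp (2 * \<eta> i * \<bar>y\<bar>) * y\<^sup>2 / 2) \<longlonglongrightarrow> y\<^sup>2 / 2" by simp_all
    qed
    from tendsto_exp[OF tendsto_minus[OF this]] show ?thesis by simp
  qed
  have lw_meas [measurable]: "lw i \<in> borel_measurable borel" for i
    unfolding lw_def log_weight_def[abs_def] log_mix_def by measurable
  have dom: "integrable lborel (\<lambda>y::real. 144 * inverse (1 + y\<^sup>2))"
    by (intro integrable_mult_right integrable_inverse_1_plus_sq)
  have bound: "exp (- lw i y) \<le> 144 * inverse (1 + y\<^sup>2)" for i y
    unfolding lw_def by (rule exp_minus_log_weight_le[OF p(1,2) \<eta> \<eta>2 \<eta>_half])
  have 1: "(\<lambda>i. \<integral>y. exp (- lw i y) * indicator {..<Y i} y \<partial>lborel) \<longlonglongrightarrow> gauss_mass {..<y0}"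
    unfolding gauss_mass_def
  proof (rule integral_dominated_convergence[OF _ _ dom])
    show "AE y in lborel. (\<lambda>i. exp (- lw i y) * indicator {..<Y i} y) \<longlonglongrightarrow> exp (- y\<^sup>2 / 2) * indicator {..<y0} y"
      using AE_indicator_lessThan_tendsto[OF Y_lim] by eventually_elim (intro tendsto_mult lw_lim)
    show "AE y in lborel. norm (exp (- lw i y) * indicator {..<Y i} y) \<le> 144 * inverse (1 + y\<^sup>2)" for i
    proof (rule AE_I2)
      fix y :: real
      have "norm (exp (- lw i y) * indicator {..<Y i} y) \<le> exp (- lw i y)" by (simp add: indicator_def)
      then show "norm (exp (- lw i y) * indicator {..<Y i} y) \<le> 144 * inverse (1 + y\<^sup>2)"
        using bound[of i y] by linarith
    qed
  qed measurable
  have 2: "(\<lambda>i. \<integral>y. exp (- lw i y) * indicator UNIV y \<partial>lborel) \<longlonglongrightarrow> gauss_mass UNIV"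
    unfolding gauss_mass_def
  proof (rule integral_dominated_convergence[OF _ _ dom])
    show "AE y in lborel. (\<lambda>i. exp (- lw i y) * indicator UNIV y) \<longlonglongrightarrow> exp (- y\<^sup>2 / 2) * indicator UNIV y"
      using lw_lim by simp
    show "AE y in lborel. norm (exp (- lw i y) * indicator UNIV y) \<le> 144 * inverse (1 + y\<^sup>2)" for i
      using bound by simp
  qed measurable
  have "ratio_mass (k i + l i) (k i) {..<sqrt (z i / (1 - z i))} / ratio_mass (k i + l i) (k i) UNIV
    = (\<integral>y. exp (- lw i y) * indicator {..<Y i} y \<partial>lborel) / (\<integral>y. exp (- lw i y) * indicator UNIV y \<partial>lborel)" for i
  proof -
    have "1 \<le> k i" "1 \<le> l i" using kl[of i] by auto
    note R = ratio_mass_log_weight[OF this n_def[of i]]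
    have pe: "p i = real (k i) / real (n i)" by (simp add: p_def n_def)
    have "\<exists>C>0. \<forall>W\<in>sets borel. ratio_mass (n i) (k i) W =
        C * (\<integral>y. exp (- lw i y) * indicator {y. sqrt (p i / (1 - p i)) * exp (\<eta> i * y) \<in> W} y \<partial>lborel)"
      using R unfolding lw_def \<eta>_def pe .
    then obtain C where C: "C > 0" and all: "\<forall>W\<in>sets borel. ratio_mass (n i) (k i) W =
        C * (\<integral>y. exp (- lw i y) * indicator {y. sqrt (p i / (1 - p i)) * exp (\<eta> i * y) \<in> W} y \<partial>lborel)"
      by (elim exE conjE)
    note * = all[rule_format]
    have "ratio_mass (n i) (k i) {..<sqrt (z i / (1 - z i))} = C * (\<integral>y. exp (- lw i y) * indicator {..<Y i} y \<partial>lborel)"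
      unfolding set_eq[symmetric] by (rule *) simp
    moreover have "ratio_mass (n i) (k i) UNIV = C * (\<integral>y. exp (- lw i y) * indicator UNIV y \<partial>lborel)"
      using *[of UNIV] by simp
    ultimately show ?thesis using C by (simp add: n_def)
  qed
  moreover have "gauss_mass UNIV \<noteq> 0" by (simp add: gauss_mass_UNIV)
  ultimately show ?thesis using tendsto_divide[OF 1 2] by simp
qed

text \<open>Bernoulli's inequality with the exponent \<open>m = n div 2\<close>; the factor 3 comes
  from \<open>3 * m \<ge> n\<close>.\<close>

lemma powr_neg_half_le:
  fixes y :: real
  assumes "2 \<le> n"
  shows "(1 + y\<^sup>2 / real n) powr (- real n / 2) \<le> 3 * inverse (1 + y\<^sup>2)"
proof -
  define m where "m = n div 2"
  have m: "3 * m \<ge> n" "2 * m \<le> n" using assms unfolding m_def by presburger+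
  have x: "0 \<le> y\<^sup>2 / real n" "1 \<le> 1 + y\<^sup>2 / real n" by simp_all
  have "(1 + y\<^sup>2) / 3 \<le> 1 + real m * (y\<^sup>2 / real n)"
  proof -
    have "1/3 \<le> real m / real n" using m assms by (simp add: field_simps)
    then have "1/3 * y\<^sup>2 \<le> real m / real n * y\<^sup>2" by (rule mult_right_mono) simp
    then show ?thesis by simp
  qed
  also have "\<dots> \<le> (1 + y\<^sup>2 / real n) ^ m" using x by (intro Bernoulli_inequality) linarith
  also have "\<dots> = (1 + y\<^sup>2 / real n) powr real m" using x by (intro powr_realpow[symmetric]) linarith
  also have "\<dots> \<le> (1 + y\<^sup>2 / real n) powr (real n / 2)"
    using m x by (intro powr_mono) auto
  finally have "inverse ((1 + y\<^sup>2 / real n) powr (real n / 2)) \<le> inverse ((1 + y\<^sup>2) / 3)"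
    by (intro le_imp_inverse_le) (auto simp: add_pos_nonneg)
  moreover have "(1 + y\<^sup>2 / real n) powr (- real n / 2) = inverse ((1 + y\<^sup>2 / real n) powr (real n / 2))"
    unfolding minus_divide_left[symmetric] by (rule powr_minus)
  moreover have "inverse (a / 3) = 3 * inverse a" for a :: real by (simp add: inverse_eq_divide)
  then have "inverse ((1 + y\<^sup>2) / 3) = 3 * inverse (1 + y\<^sup>2)" .
  ultimately show ?thesis by (simp only:)
qed

text \<open>With \<open>s = y / sqrt n\<close> the weight becomes
  \<open>(1 + y\<^sup>2 / n) powr (- n / 2)\<close>, which tends to the Gaussian.\<close>

lemma ratio_mass_one_tendsto:
  fixes z :: "nat \<Rightarrow> real"
  assumes z: "\<forall>\<^sub>F n in sequentially. 0 < z n \<and> z n < 1" and lim: "(\<lambda>n. real n * z n) \<longlonglongrightarrow> a"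
  shows "(\<lambda>n. ratio_mass n 1 {..<sqrt (z n / (1 - z n))} / ratio_mass n 1 UNIV)
    \<longlonglongrightarrow> gauss_mass {0<..<sqrt a} / gauss_mass {0<..}"
proof -
  define Y where "Y n = sqrt (real n * z n / (1 - z n))" for n
  define g where "g n y = (1 + y\<^sup>2 / real n) powr (- real n / 2)" for n :: nat and y :: real
  define f where "f n y = (if 2 \<le> n then g n y else 0)" for n :: nat and y :: real
  have z_lim: "z \<longlonglongrightarrow> 0"
  proof -
    have "(\<lambda>n. (real n * z n) * inverse (real n)) \<longlonglongrightarrow> a * 0"
      by (intro tendsto_mult lim tendsto_inverse_0_at_top filterlim_real_sequentially)
    moreover have "\<forall>\<^sub>F n in sequentially. (real n * z n) * inverse (real n) = z n"
      using eventually_gt_at_top[of 0] by eventually_elim simp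
    ultimately show ?thesis by (simp add: Lim_transform_eventually)
  qed
  have Y_lim: "Y \<longlonglongrightarrow> sqrt a"
  proof -
    have "Y \<longlonglongrightarrow> sqrt (a / (1 - 0))" unfolding Y_def[abs_def] by (intro tendsto_intros lim z_lim) simp
    then show ?thesis by simp
  qed
  have g_meas [measurable]: "f n \<in> borel_measurable borel" for n unfolding f_def g_def by measurable
  have dom: "integrable lborel (\<lambda>y::real. 3 * inverse (1 + y\<^sup>2))"
    by (intro integrable_mult_right integrable_inverse_1_plus_sq)
  have bound: "norm (f n y * indicator W y) \<le> 3 * inverse (1 + y\<^sup>2)" for n y W
    using powr_neg_half_le[of n y] by (auto simp: f_def g_def indicator_def add_nonneg_nonneg)
  have f_lim: "(\<lambda>n. f n y) \<longlonglongrightarrow> exp (- y\<^sup>2 / 2)" for y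
  proof -
    have "(\<lambda>n. (1 + y\<^sup>2 / real n) ^ n) \<longlonglongrightarrow> exp (y\<^sup>2)" by (rule tendsto_exp_limit_sequentially)
    then have "(\<lambda>n. ((1 + y\<^sup>2 / real n) ^ n) powr (- (1/2))) \<longlonglongrightarrow> exp (y\<^sup>2) powr (- (1/2))"
      by (intro tendsto_powr tendsto_const) auto
    moreover have "\<forall>\<^sub>F n in sequentially. ((1 + y\<^sup>2 / real n) ^ n) powr (- (1/2)) = f n y"
      using eventually_ge_at_top[of 2]
    proof eventually_elim
      case (elim n)
      have "0 < 1 + y\<^sup>2 / real n" by (simp add: add_pos_nonneg)
      then have "((1 + y\<^sup>2 / real n) ^ n) powr (- (1/2)) = ((1 + y\<^sup>2 / real n) powr real n) powr (- (1/2))"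
        by (simp add: powr_realpow)
      then show ?case using elim by (simp add: f_def g_def powr_powr)
    qed
    moreover have "exp (y\<^sup>2) powr (- (1/2)) = exp (- y\<^sup>2 / 2)" by (simp add: powr_def)
    ultimately show ?thesis by (simp add: Lim_transform_eventually)
  qed
  have 1: "(\<lambda>n. \<integral>y. f n y * indicator {0<..<Y n} y \<partial>lborel) \<longlonglongrightarrow> gauss_mass {0<..<sqrt a}"
    unfolding gauss_mass_def
  proof (rule integral_dominated_convergence[OF _ _ dom])
    show "AE y in lborel. (\<lambda>n. f n y * indicator {0<..<Y n} y) \<longlonglongrightarrow> exp (- y\<^sup>2 / 2) * indicator {0<..<sqrt a} y"
      using AE_indicator_lessThan_tendsto[OF Y_lim]
    proof eventually_elim
      case (elim y)
      have split: "indicator {0<..<b} y = indicator {0<..} y * (indicator {..<b} y :: real)" for b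
        by (auto simp: indicator_def)
      show ?case unfolding split by (intro tendsto_mult f_lim tendsto_const elim)
    qed
    show "AE y in lborel. norm (f n y * indicator {0<..<Y n} y) \<le> 3 * inverse (1 + y\<^sup>2)" for n
      using bound by simp
  qed measurable
  have 2: "(\<lambda>n. \<integral>y. f n y * indicator {0<..} y \<partial>lborel) \<longlonglongrightarrow> gauss_mass {0<..}"
    unfolding gauss_mass_def
  proof (rule integral_dominated_convergence[OF _ _ dom])
    show "AE y in lborel. (\<lambda>n. f n y * indicator {0<..} y) \<longlonglongrightarrow> exp (- y\<^sup>2 / 2) * indicator {0<..} y"
      by (intro AE_I2 tendsto_mult f_lim tendsto_const)
    show "AE y in lborel. norm (f n y * indicator {0<..} y) \<le> 3 * inverse (1 + y\<^sup>2)" for n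
      using bound by simp
  qed measurable
  have rm: "ratio_mass n 1 W = (1 / sqrt n) * (\<integral>y. f n y * indicator {y. y / sqrt n \<in> W \<inter> {0<..}} y \<partial>lborel)"
    if n: "2 \<le> n" and W: "W \<in> sets borel" for n W
  proof -
    have n0: "0 < real n" using n by simp
    have "ratio_mass n 1 W = (1 / sqrt n) * (\<integral>y. (1 + (0 + (1 / sqrt n) * y)\<^sup>2) powr (- real n / 2) * indicator (W \<inter> {0<..}) (0 + (1 / sqrt n) * y) \<partial>lborel)"
      unfolding ratio_mass_alt[OF W]
      using lborel_integral_real_affine[of "1 / sqrt n" "\<lambda>s. (1 + s\<^sup>2) powr (- real n / 2) * indicator (W \<inter> {0<..}) s" 0] n0 by simp
    also have "(\<lambda>y. (1 + (0 + (1 / sqrt n) * y)\<^sup>2) powr (- real n / 2) * indicator (W \<inter> {0<..}) (0 + (1 / sqrt n) * y))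
       = (\<lambda>y. f n y * indicator {y. y / sqrt n \<in> W \<inter> {0<..}} y)"
      using n n0 by (auto simp: fun_eq_iff f_def g_def indicator_def power_divide)
    finally show ?thesis .
  qed
  have ev: "\<forall>\<^sub>F n in sequentially. (\<integral>y. f n y * indicator {0<..<Y n} y \<partial>lborel) / (\<integral>y. f n y * indicator {0<..} y \<partial>lborel)
     = ratio_mass n 1 {..<sqrt (z n / (1 - z n))} / ratio_mass n 1 UNIV"
    using eventually_ge_at_top[of 2] z
  proof eventually_elim
    case (elim n)
    have n0: "0 < sqrt n" using elim by simp
    have iff: "y / sqrt n < sqrt (z n / (1 - z n)) \<longleftrightarrow> y < Y n" for y
    proof -
      have "Y n = sqrt n * sqrt (z n / (1 - z n))"
        unfolding Y_def times_divide_eq_right[symmetric] by (rule real_sqrt_mult)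
      then show ?thesis using n0 by (simp add: field_simps)
    qed
    have pos: "0 < y / sqrt n \<longleftrightarrow> 0 < y" for y using n0 by (simp add: zero_less_divide_iff)
    have 3: "{y. y / sqrt n \<in> {..<sqrt (z n / (1 - z n))} \<inter> {0<..}} = {0<..<Y n}"
      by (rule set_eqI) (simp only: mem_Collect_eq Int_iff lessThan_iff greaterThan_iff greaterThanLessThan_iff iff pos conj_commute)
    have 4: "{y. y / sqrt n \<in> UNIV \<inter> {0<..}} = {0<..}"
      by (rule set_eqI) (simp only: mem_Collect_eq Int_iff UNIV_I greaterThan_iff pos simp_thms)
    have 5: "{..<sqrt (z n / (1 - z n))} \<in> sets borel" "UNIV \<in> sets (borel :: real measure)" by simp_all
    show ?case unfolding rm[OF elim(1) 5(1)] rm[OF elim(1) 5(2)] 3 4 using n0 by simp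
  qed
  have nz: "gauss_mass {0<..} \<noteq> 0"
  proof -
    have "(\<integral>y. indicator {0<..1::real} y * exp (- 1/2) \<partial>lborel) \<le> gauss_mass {0<..}"
      unfolding gauss_mass_def
    proof (rule integral_mono)
      show "integrable lborel (\<lambda>y::real. exp (- y\<^sup>2 / 2) * indicator {0<..} y)"
        by (rule integrable_real_mult_indicator[OF _ integrable_gauss]) simp
      fix y :: real
      show "indicator {0<..1} y * exp (- 1/2) \<le> exp (- y\<^sup>2 / 2) * indicator {0<..} y"
      proof (cases "y \<in> {0<..1}")
        case True
        then have "y\<^sup>2 \<le> 1" by (simp add: abs_square_le_1)
        then have "exp (- 1/2) \<le> exp (- y\<^sup>2 / 2)" by simp
        then show ?thesis using True by simp
      qed simp
    qed simp
    moreover have "(\<integral>y. indicator {0<..1::real} y * exp (- 1/2) \<partial>lborel) = exp (- 1/2 :: real)" by simp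
    ultimately have "exp (- 1/2) \<le> gauss_mass {0<..}" by simp
    then show ?thesis using exp_gt_zero[of "- 1/2 :: real"] by linarith
  qed
  show ?thesis by (rule Lim_transform_eventually[OF tendsto_divide[OF 1 2 nz] ev])
qed

section \<open>Numerical bounds\<close>

lemma exp_minus_between:
  fixes u :: real
  assumes "0 \<le> u"
  shows "even N \<Longrightarrow> (\<Sum>i<N. (- u) ^ i / fact i) \<le> exp (- u)" "odd N \<Longrightarrow> exp (- u) \<le> (\<Sum>i<N. (- u) ^ i / fact i)"
proof -
  obtain t where t: "exp (- u) = (\<Sum>i<N. (- u) ^ i / fact i) + exp t / fact N * (- u) ^ N"
    using Maclaurin_exp_le[of "- u" N] by blast
  show "(\<Sum>i<N. (- u) ^ i / fact i) \<le> exp (- u)" if "even N" using that assms by (simp add: t)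
  show "exp (- u) \<le> (\<Sum>i<N. (- u) ^ i / fact i)" if "odd N"
    using that assms by (simp add: t zero_le_mult_iff power_minus_odd)
qed

definition gauss_int :: "real \<Rightarrow> real" where
  "gauss_int y = (\<integral>s. exp (- s\<^sup>2 / 2) * indicator {0..y} s \<partial>lborel)"

text \<open>The Taylor polynomial of \<open>exp (- s\<^sup>2 / 2)\<close> with \<open>N\<close>
  terms, integrated from 0 to \<open>y\<close>.\<close>

definition gauss_poly :: "nat \<Rightarrow> real \<Rightarrow> real" where
  "gauss_poly N y = (\<Sum>i<N. (- 1) ^ i / (2 ^ i * fact i * (2 * real i + 1)) * y ^ (2 * i + 1))"

lemma integral_gauss_taylor:
  assumes "0 \<le> y"
  shows "has_bochner_integral lborel (\<lambda>s. (\<Sum>i<N. (- (s\<^sup>2 / 2)) ^ i / fact i) * indicator {0..y} s) (gauss_poly N y)"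
proof -
  have "has_bochner_integral lborel (\<lambda>s. indicator {0..y} s *\<^sub>R (\<Sum>i<N. (- (s\<^sup>2 / 2)) ^ i / fact i)) (gauss_poly N y - gauss_poly N 0)"
  proof (rule has_bochner_integral_FTC_Icc[OF assms])
    show "continuous_on {0..y} (\<lambda>s. \<Sum>i<N. (- (s\<^sup>2 / 2)) ^ i / fact i)" by (intro continuous_intros) auto
    fix s :: real
    have "((\<lambda>s. (- 1) ^ i / (2 ^ i * fact i * (2 * real i + 1)) * s ^ (2 * i + 1)) has_real_derivative
        (- (s\<^sup>2 / 2)) ^ i / fact i) (at s)" for i :: nat
    proof -
      have "((\<lambda>s. (- 1) ^ i / (2 ^ i * fact i * (2 * real i + 1)) * s ^ (2 * i + 1)) has_real_derivative
        (- 1) ^ i / (2 ^ i * fact i * (2 * real i + 1)) * ((2 * real i + 1) * s ^ (2 * i))) (at s)"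
      proof (rule DERIV_cmult)
        have "((\<lambda>s. s ^ (2 * i + 1)) has_real_derivative real (2 * i + 1) * s ^ (2 * i)) (at s)"
          using DERIV_pow[of "2 * i + 1" s] by simp
        then show "((\<lambda>s. s ^ (2 * i + 1)) has_real_derivative (2 * real i + 1) * s ^ (2 * i)) (at s)" by (simp add: add.commute)
      qed
      moreover have "(2 * real i + 1) \<noteq> 0" by simp
      then have "(- 1) ^ i / (2 ^ i * fact i * (2 * real i + 1)) * ((2 * real i + 1) * s ^ (2 * i)) = (- 1) ^ i * s ^ (2 * i) / (2 ^ i * fact i)"
        by simp
      also have "\<dots> = (- (s\<^sup>2 / 2)) ^ i / fact i"
        by (simp add: power_minus[of "s\<^sup>2 / 2"] power_divide power_mult)
      ultimately show ?thesis by simp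
    qed
    then have "(gauss_poly N has_real_derivative (\<Sum>i<N. (- (s\<^sup>2 / 2)) ^ i / fact i)) (at s)"
      unfolding gauss_poly_def[abs_def] by (rule DERIV_sum)
    then show "(gauss_poly N has_vector_derivative (\<Sum>i<N. (- (s\<^sup>2 / 2)) ^ i / fact i)) (at s within {0..y})"
      by (simp add: has_real_derivative_iff_has_vector_derivative has_vector_derivative_at_within)
  qed
  moreover have "gauss_poly N 0 = 0" by (simp add: gauss_poly_def)
  ultimately show ?thesis by (simp add: mult.commute)
qed

lemma gauss_int_bounds:
  assumes y: "0 \<le> y"
  shows "even N \<Longrightarrow> gauss_poly N y \<le> gauss_int y" "odd N \<Longrightarrow> gauss_int y \<le> gauss_poly N y"
proof -
  have int: "integrable lborel (\<lambda>s::real. exp (- s\<^sup>2 / 2) * indicator {0..y} s)"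
  proof -
    have "integrable lborel (\<lambda>s. sqrt (2 * pi) * std_normal_density s)"
      by (intro integrable_mult_right integrable_normal_density) simp
    then have "integrable lborel (\<lambda>s::real. exp (- s\<^sup>2 / 2))" by (simp add: std_normal_density_def)
    then show ?thesis by (rule integrable_real_mult_indicator[rotated]) simp
  qed
  have poly: "integrable lborel (\<lambda>s. (\<Sum>i<N. (- (s\<^sup>2 / 2)) ^ i / fact i) * indicator {0..y} s)"
    "(\<integral>s. (\<Sum>i<N. (- (s\<^sup>2 / 2)) ^ i / fact i) * indicator {0..y} s \<partial>lborel) = gauss_poly N y"
    using integral_gauss_taylor[OF y, of N] by (auto simp: has_bochner_integral_iff)
  show "gauss_poly N y \<le> gauss_int y" if "even N"
    unfolding poly(2)[symmetric] gauss_int_def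
    by (rule integral_mono[OF poly(1) int])
       (use exp_minus_between(1)[of "_\<^sup>2 / 2" N] that in \<open>auto simp: indicator_def\<close>)
  show "gauss_int y \<le> gauss_poly N y" if "odd N"
    unfolding poly(2)[symmetric] gauss_int_def
    by (rule integral_mono[OF int poly(1)])
       (use exp_minus_between(2)[of "_\<^sup>2 / 2" N] that in \<open>auto simp: indicator_def\<close>)
qed

lemma gauss_int_mono: "0 \<le> x \<Longrightarrow> x \<le> y \<Longrightarrow> gauss_int x \<le> gauss_int y"
proof -
  assume "0 \<le> x" "x \<le> y"
  have "integrable lborel (\<lambda>s. sqrt (2 * pi) * std_normal_density s)"
    by (intro integrable_mult_right integrable_normal_density) simp
  then have i: "integrable lborel (\<lambda>s::real. exp (- s\<^sup>2 / 2))" by (simp add: std_normal_density_def)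
  show ?thesis unfolding gauss_int_def
    by (rule integral_mono; (rule integrable_real_mult_indicator[OF _ i])?) (use \<open>x \<le> y\<close> in \<open>auto simp: indicator_def\<close>)
qed

text \<open>The zero of \<open>hermite_half\<close> depends on the moments at 0 only through
  \<open>psi_ratio 0\<close>, in closed form \<open>sqrt 2 * Gamma (3/4) / Gamma (1/4)\<close>. The
  recurrence encloses it without reference to the Gamma function.\<close>

definition psi_ratio :: "nat \<Rightarrow> real" where
  "psi_ratio j = psi (Suc j) 0 / psi j 0"

section \<open>Enclosure of the ratio of the first two moments\<close>

lemma psi_ratio_pos: "0 < psi_ratio j"
  by (simp add: psi_ratio_def psi_pos)

lemma psi_ratio_mult: "psi_ratio j * psi_ratio (Suc j) = real j + 1/2"
  using psi_recurrence[of j 0] psi_pos[of j 0] psi_pos[of "Suc j" 0] by (simp add: psi_ratio_def)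

text \<open>Log-convexity of the moments: the square inequality with \<open>t\<close> equal to the
  ratio itself.\<close>

lemma psi_ratio_mono: "psi_ratio j \<le> psi_ratio (Suc j)"
proof -
  have p: "0 < psi j 0" "0 < psi (Suc j) 0" by (rule psi_pos)+
  have "0 \<le> psi (Suc (Suc j)) 0 - 2 * psi_ratio j * psi (Suc j) 0 + (psi_ratio j)\<^sup>2 * psi j 0"
    by (rule psi_square_nonneg)
  also have "(psi_ratio j)\<^sup>2 * psi j 0 = psi_ratio j * psi (Suc j) 0"
    using p by (simp add: psi_ratio_def power2_eq_square)
  finally have "psi_ratio j * psi (Suc j) 0 \<le> psi (Suc (Suc j)) 0" by simp
  then show ?thesis unfolding psi_ratio_def[of "Suc j"] using p by (simp add: pos_le_divide_eq)
qed

lemma psi_ratio_square_bounds: "(psi_ratio j)\<^sup>2 \<le> real j + 1/2" "real j + 1/2 \<le> (psi_ratio (Suc j))\<^sup>2"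
  unfolding psi_ratio_mult[symmetric] power2_eq_square
  using psi_ratio_mono[of j] psi_ratio_pos[of j] psi_ratio_pos[of "Suc j"] by (auto intro!: mult_mono)

text \<open>
  The asymptotic expansion of the ratio of consecutive moments suggests comparing its fourth power
  with \<open>j\<^sup>2 + 1/4\<close>: the quotient \<open>Q\<close> then satisfies \<open>Q j * Q (j + 1) = 1 - O(j\<^sup>-\<^sup>4)\<close>.
\<close>
lemma psi_ratio_quartic_bounds:
  assumes j: "1 \<le> j"
  shows "(psi_ratio j) ^ 4 \<le> (real j)\<^sup>2 + 1/4"
    and "(1 - 1 / (4 * (real j + 1/2) ^ 4 + 1)) * ((real j)\<^sup>2 + 1/4) \<le> (psi_ratio j) ^ 4"
proof -
  define Q where "Q j = (psi_ratio j) ^ 4 / ((real j)\<^sup>2 + 1/4)" for j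
  define a where "a j = 1 - 1 / (4 * (real j + 1/2) ^ 4 + 1)" for j :: nat
  have d: "0 < (real j)\<^sup>2 + 1/4" for j :: nat by (simp add: add_nonneg_pos)
  have Q0: "0 < Q j" for j unfolding Q_def using d[of j] psi_ratio_pos[of j] by simp
  have QQ: "Q j * Q (Suc j) = a j" for j
  proof -
    have "Q j * Q (Suc j) = (psi_ratio j * psi_ratio (Suc j)) ^ 4 / (((real j)\<^sup>2 + 1/4) * ((real (Suc j))\<^sup>2 + 1/4))"
      by (simp add: Q_def power_mult_distrib)
    also have "\<dots> = (real j + 1/2) ^ 4 / (((real j)\<^sup>2 + 1/4) * ((real (Suc j))\<^sup>2 + 1/4))"
      unfolding psi_ratio_mult ..
    \<comment> \<open>Sophie Germain's identity, which makes the product of neighbouring quotients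
      explicit.\<close>
    also have "((real j)\<^sup>2 + 1/4) * ((real (Suc j))\<^sup>2 + 1/4) = (real j + 1/2) ^ 4 + 1/4"
      by (simp add: power2_eq_square power4_eq_xxxx field_simps)
    also have "(real j + 1/2) ^ 4 / ((real j + 1/2) ^ 4 + 1/4) = a j"
    proof -
      have "0 \<le> (real j + 1/2) ^ 4" by simp
      then show ?thesis unfolding a_def by (simp add: field_simps add_nonneg_eq_0_iff)
    qed
    finally show ?thesis .
  qed
  have a_mono: "a j \<le> a (Suc j)" for j
    unfolding a_def by (intro diff_left_mono divide_left_mono add_right_mono mult_left_mono power_mono) (auto intro!: mult_pos_pos add_nonneg_pos)
  \<comment> \<open>The products of neighbouring quotients increase, so every second quotient
    increases; the limit 1 is therefore an upper bound.\<close>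
  have step: "Q j \<le> Q (Suc (Suc j))" for j
  proof -
    have "Q (Suc j) * Q j \<le> Q (Suc j) * Q (Suc (Suc j))"
      using QQ[of j] QQ[of "Suc j"] a_mono[of j] by (simp add: mult.commute)
    then show ?thesis using Q0[of "Suc j"] by simp
  qed
  have Q_le1: "Q j \<le> 1" for j
  proof -
    have "incseq (\<lambda>i. Q (j + 2 * i))" by (intro incseq_SucI) (use step in auto)
    moreover have "(\<lambda>i. Q (j + 2 * i)) \<longlonglongrightarrow> 1"
    proof (rule tendsto_sandwich)
      have up: "Q m \<le> (real m + 1/2)\<^sup>2 / ((real m)\<^sup>2 + 1/4)" for m
      proof -
        have "((psi_ratio m)\<^sup>2)\<^sup>2 \<le> (real m + 1/2)\<^sup>2" by (intro power_mono psi_ratio_square_bounds) simp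
        then show ?thesis unfolding Q_def using d[of m] by (intro divide_right_mono) auto
      qed
      have lo: "(real m - 1/2)\<^sup>2 / ((real m)\<^sup>2 + 1/4) \<le> Q m" if m1: "1 \<le> m" for m
      proof -
        obtain m' where m': "m = Suc m'" using m1 by (cases m) auto
        have "(real m' + 1/2)\<^sup>2 \<le> ((psi_ratio m)\<^sup>2)\<^sup>2" unfolding m' by (intro power_mono psi_ratio_square_bounds) simp
        moreover have "real m' + 1/2 = real m - 1/2" by (simp add: m')
        ultimately have "(real m - 1/2)\<^sup>2 \<le> psi_ratio m ^ 4" by simp
        then show ?thesis unfolding Q_def using d[of m] by (intro divide_right_mono) auto
      qed
      show "\<forall>\<^sub>F i in sequentially. (real (j + 2 * i) - 1/2)\<^sup>2 / ((real (j + 2 * i))\<^sup>2 + 1/4) \<le> Q (j + 2 * i)"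
        using eventually_ge_at_top[of 1] by eventually_elim (intro lo, simp)
      show "\<forall>\<^sub>F i in sequentially. Q (j + 2 * i) \<le> (real (j + 2 * i) + 1/2)\<^sup>2 / ((real (j + 2 * i))\<^sup>2 + 1/4)"
        by (intro always_eventually allI up)
      show "(\<lambda>i. (real (j + 2 * i) - 1/2)\<^sup>2 / ((real (j + 2 * i))\<^sup>2 + 1/4)) \<longlonglongrightarrow> 1"
        "(\<lambda>i. (real (j + 2 * i) + 1/2)\<^sup>2 / ((real (j + 2 * i))\<^sup>2 + 1/4)) \<longlonglongrightarrow> 1"
        unfolding of_nat_add of_nat_mult of_nat_numeral by real_asymp+
    qed
    ultimately show ?thesis using incseq_le[of "\<lambda>i. Q (j + 2 * i)" 1 0] by simp
  qed
  show "(psi_ratio j) ^ 4 \<le> (real j)\<^sup>2 + 1/4"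
    using Q_le1[of j] d[of j] by (simp add: Q_def divide_le_eq)
  \<comment> \<open>The lower bound results from inserting the upper bound for the next index into
    the product.\<close>
  have "a j = Q j * Q (Suc j)" by (simp add: QQ)
  also have "\<dots> \<le> Q j * 1" using Q0[of j] Q_le1[of "Suc j"] by (intro mult_left_mono) auto
  finally have "a j \<le> Q j" by simp
  then show "(1 - 1 / (4 * (real j + 1/2) ^ 4 + 1)) * ((real j)\<^sup>2 + 1/4) \<le> (psi_ratio j) ^ 4"
    unfolding a_def Q_def using d[of j] by (simp only: pos_le_divide_eq)
qed

text \<open>Steps of length two have exact rational factors, so the ratio at 0 is \<open>P\<close>
  times the ratio at 16, whose fourth power is enclosed with a relative error below
  \<open>4 / 10 ^ 6\<close>.\<close>

lemma psi_ratio_0_bounds: "477988 / 1000000 \<le> psi_ratio 0" "psi_ratio 0 \<le> 4779895 / 10000000"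
proof -
  have step: "psi_ratio j = (real j + 1/2) / (real j + 3/2) * psi_ratio (Suc (Suc j))" for j
  proof -
    have "psi_ratio j = (real j + 1/2) / psi_ratio (Suc j)"
      using psi_ratio_mult[of j] psi_ratio_pos[of "Suc j"] by (simp add: field_simps)
    moreover have "psi_ratio (Suc (Suc j)) = (real (Suc j) + 1/2) / psi_ratio (Suc j)"
      using psi_ratio_mult[of "Suc j"] psi_ratio_pos[of "Suc j"] by (simp add: field_simps)
    moreover have "real (Suc j) + 1/2 = real j + 3/2" "real j + 3/2 \<noteq> 0" by simp_all
    ultimately show ?thesis by (simp only: times_divide_times_eq) simp
  qed
  have e: "psi_ratio 0 = 1/3 * (5/7 * (9/11 * (13/15 * (17/19 * (21/23 * (25/27 * (29/31 * psi_ratio 16)))))))"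
    using step[of 0] step[of 2] step[of 4] step[of 6] step[of 8] step[of 10] step[of 12] step[of 14]
    by (simp add: numeral_eq_Suc)
  define P :: real where "P = 1/3 * (5/7 * (9/11 * (13/15 * (17/19 * (21/23 * (25/27 * (29/31)))))))"
  have e': "psi_ratio 0 = P * psi_ratio 16" unfolding e P_def by simp
  have "(psi_ratio 0) ^ 4 \<le> P ^ 4 * (16\<^sup>2 + 1/4)"
    unfolding e' power_mult_distrib using psi_ratio_quartic_bounds(1)[of 16] by (intro mult_left_mono) (auto simp: P_def)
  also have "\<dots> \<le> (4779895 / 10000000) ^ 4" by (simp add: P_def power_divide)
  finally show "psi_ratio 0 \<le> 4779895 / 10000000" by (rule power_le_imp_le_base[of _ 3, simplified]) simp
  have "(477988 / 1000000) ^ 4 \<le> P ^ 4 * ((1 - 1 / (4 * (16 + 1/2) ^ 4 + 1)) * (16\<^sup>2 + 1/4))"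
    by (simp add: P_def power_divide)
  also have "\<dots> \<le> (psi_ratio 0) ^ 4"
    unfolding e' power_mult_distrib using psi_ratio_quartic_bounds(2)[of 16] by (intro mult_left_mono) (auto simp: P_def)
  finally show "477988 / 1000000 \<le> psi_ratio 0"
    by (rule power_le_imp_le_base[of _ 3, simplified]) (use psi_ratio_pos[of 0] in simp)
qed

text \<open>The square inequality with \<open>t = 4\<close> gives
  \<open>psi 15 \<le> 5 * psi 14\<close> on the unit interval, so the growth there is at most
  \<open>exp 5 \<le> 3 ^ 5 = 243\<close>. This controls the Taylor remainder of
  \<open>hermite_half\<close>.\<close>

lemma psi_14_le:
  assumes "0 \<le> y" "y \<le> 1"
  shows "psi 14 y \<le> 243 * psi 14 0"
proof -
  have growth: "psi 15 t \<le> 5 * psi 14 t" if "0 \<le> t" "t \<le> 1" for t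
  proof -
    have rec: "psi 16 t = t * psi 15 t + 29/2 * psi 14 t" using psi_recurrence[of 14 t] by (simp add: numeral_eq_Suc)
    have pos: "0 < psi 14 t" "0 < psi 15 t" by (rule psi_pos)+
    have "0 \<le> psi 16 t - 8 * psi 15 t + 16 * psi 14 t"
      using psi_square_nonneg[of 14 t 4] by (simp add: numeral_eq_Suc)
    then have "(8 - t) * psi 15 t \<le> 61/2 * psi 14 t" unfolding rec by (simp add: algebra_simps)
    moreover have "7 * psi 15 t \<le> (8 - t) * psi 15 t" using that pos by (intro mult_right_mono) auto
    ultimately show ?thesis using pos by linarith
  qed
  have "psi 14 y * exp (- 5 * y) \<le> psi 14 0 * exp (- 5 * 0)"
  proof (rule DERIV_nonpos_imp_nonincreasing[OF assms(1)])
    fix t assume t: "0 \<le> t" "t \<le> y"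
    have d14: "(psi 14 has_real_derivative psi 15 t) (at t)" using DERIV_psi[of 14 t] by simp
    have de: "((\<lambda>y. exp (- 5 * y)) has_real_derivative exp (- 5 * t) * (- 5)) (at t)"
      by (auto intro!: derivative_eq_intros)
    note DERIV_mult[OF d14 de]
    moreover have "psi 15 t * exp (- 5 * t) + exp (- 5 * t) * (- 5) * psi 14 t = exp (- 5 * t) * (psi 15 t - 5 * psi 14 t)"
      by (simp add: algebra_simps)
    moreover have "\<dots> \<le> 0" using growth[of t] t assms by (simp add: mult_le_0_iff)
    ultimately show "\<exists>d. ((\<lambda>y. psi 14 y * exp (- 5 * y)) has_real_derivative d) (at t) \<and> d \<le> 0" by auto
  qed
  then have "psi 14 y \<le> psi 14 0 * exp (5 * y)" by (simp add: exp_minus field_simps)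
  also have "\<dots> \<le> psi 14 0 * 243"
  proof (rule mult_left_mono)
    have "exp (5 * y) \<le> exp (5::real)" using assms by simp
    also have "\<dots> = exp 1 ^ 5" by (simp flip: exp_of_nat_mult)
    also have "\<dots> \<le> (3::real) ^ 5" using exp_le by (intro power_mono) auto
    finally show "exp (5 * y) \<le> 243" by simp
  qed (simp add: psi_pos less_imp_le)
  finally show ?thesis by simp
qed

text \<open>From the first on, the derivatives are the negated moments. The remainder is thus
  negative, which makes the truncated series an upper bound, and \<open>psi_14_le\<close> limits
  what has to be subtracted for the lower one.\<close>

lemma hermite_half_taylor:
  assumes y: "0 < y" "y \<le> 1"
  defines "S \<equiv> 2 * psi 1 0 - (\<Sum>j<14. psi j 0 * y ^ Suc j / fact (Suc j))"
  shows "hermite_half y \<le> S" "S - 243 * psi 14 0 * y ^ 15 / fact 15 \<le> hermite_half y"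
proof -
  define diff where "diff m = (case m of 0 \<Rightarrow> hermite_half | Suc j \<Rightarrow> (\<lambda>y. - psi j y))" for m
  have "\<exists>t. 0 < t \<and> t < y \<and> hermite_half y = (\<Sum>m<15. diff m 0 / fact m * y ^ m) + diff 15 t / fact 15 * y ^ 15"
  proof (rule Maclaurin[OF y(1)])
    show "\<forall>m t. m < 15 \<and> 0 \<le> t \<and> t \<le> y \<longrightarrow> (diff m has_real_derivative diff (Suc m) t) (at t)"
      using DERIV_hermite_half DERIV_minus[OF DERIV_psi] by (auto simp: diff_def split: nat.splits)
  qed (auto simp: diff_def)
  then obtain t where t: "0 < t" "t < y" "hermite_half y = (\<Sum>m<15. diff m 0 / fact m * y ^ m) + diff 15 t / fact 15 * y ^ 15" by blast
  have "(\<Sum>m<15. diff m 0 / fact m * y ^ m) = diff 0 0 + (\<Sum>j<14. diff (Suc j) 0 / fact (Suc j) * y ^ Suc j)"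
    using sum.lessThan_Suc_shift[of "\<lambda>m. diff m 0 / fact m * y ^ m" 14] by simp
  also have "\<dots> = S" by (simp add: S_def diff_def hermite_half_def sum_negf)
  finally have eq: "hermite_half y = S - psi 14 t / fact 15 * y ^ 15" using t(3) by (simp add: diff_def)
  have "0 \<le> psi 14 t / fact 15 * y ^ 15" using y psi_pos[of 14 t] by simp
  then show "hermite_half y \<le> S" unfolding eq by linarith
  have "psi 14 t / fact 15 * y ^ 15 \<le> 243 * psi 14 0 / fact 15 * y ^ 15"
    using psi_14_le[of t] t y by (intro mult_right_mono divide_right_mono) auto
  then show "S - 243 * psi 14 0 * y ^ 15 / fact 15 \<le> hermite_half y" unfolding eq by (simp add: mult.commute)
qed

section \<open>Sign change of the Hermite function of degree one half\<close>

lemma psi_at_0: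
  "psi 2 0 = 1/2 * psi 0 0" "psi 3 0 = 3/2 * psi 1 0" "psi 4 0 = 5/4 * psi 0 0" "psi 5 0 = 21/4 * psi 1 0"
  "psi 6 0 = 45/8 * psi 0 0" "psi 7 0 = 231/8 * psi 1 0" "psi 8 0 = 585/16 * psi 0 0" "psi 9 0 = 3465/16 * psi 1 0"
  "psi 10 0 = 9945/32 * psi 0 0" "psi 11 0 = 65835/32 * psi 1 0" "psi 12 0 = 208845/64 * psi 0 0"
  "psi 13 0 = 1514205/64 * psi 1 0" "psi 14 0 = 5221125/128 * psi 0 0"
proof -
  have r: "psi (Suc (Suc j)) 0 = (real j + 1/2) * psi j 0" for j using psi_recurrence[of j 0] by simp
  show 2: "psi 2 0 = 1/2 * psi 0 0" using r[of 0] by (simp add: numeral_eq_Suc)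
  show 3: "psi 3 0 = 3/2 * psi 1 0" using r[of 1] by (simp add: numeral_eq_Suc)
  show 4: "psi 4 0 = 5/4 * psi 0 0" using r[of 2] 2 by (simp add: numeral_eq_Suc)
  show 5: "psi 5 0 = 21/4 * psi 1 0" using r[of 3] 3 by (simp add: numeral_eq_Suc)
  show 6: "psi 6 0 = 45/8 * psi 0 0" using r[of 4] 4 by (simp add: numeral_eq_Suc)
  show 7: "psi 7 0 = 231/8 * psi 1 0" using r[of 5] 5 by (simp add: numeral_eq_Suc)
  show 8: "psi 8 0 = 585/16 * psi 0 0" using r[of 6] 6 by (simp add: numeral_eq_Suc)
  show 9: "psi 9 0 = 3465/16 * psi 1 0" using r[of 7] 7 by (simp add: numeral_eq_Suc)
  show 10: "psi 10 0 = 9945/32 * psi 0 0" using r[of 8] 8 by (simp add: numeral_eq_Suc)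
  show 11: "psi 11 0 = 65835/32 * psi 1 0" using r[of 9] 9 by (simp add: numeral_eq_Suc)
  show 12: "psi 12 0 = 208845/64 * psi 0 0" using r[of 10] 10 by (simp add: numeral_eq_Suc)
  show 13: "psi 13 0 = 1514205/64 * psi 1 0" using r[of 11] 11 by (simp add: numeral_eq_Suc)
  show "psi 14 0 = 5221125/128 * psi 0 0" using r[of 12] 12 by (simp add: numeral_eq_Suc)
qed

text \<open>"Even" refers to the index of the moment: these moments are multiples of
  \<open>psi 0 0\<close> and belong to the odd powers of \<open>y\<close>. The moments of odd index,
  multiples of \<open>psi 1 0\<close>, go into \<open>taylor_odd\<close>.\<close>

definition taylor_even :: "real \<Rightarrow> real" where
  "taylor_even y = y + y ^ 3 / 12 + y ^ 5 / 96 + y ^ 7 / 896 + 13 / 129024 * y ^ 9 + 221 / 28385280 * y ^ 11 + 17 / 32440320 * y ^ 13"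

definition taylor_odd :: "real \<Rightarrow> real" where
  "taylor_odd y = y\<^sup>2 / 2 + y ^ 4 / 16 + 7 / 960 * y ^ 6 + 11 / 15360 * y ^ 8 + 11 / 184320 * y ^ 10 + 19 / 4423680 * y ^ 12 + 437 / 1610219520 * y ^ 14"

lemma taylor_sum_eq:
  "(\<Sum>j<14. psi j 0 * y ^ Suc j / fact (Suc j)) = psi 0 0 * taylor_even y + psi 1 0 * taylor_odd y"
proof -
  have sum: "(\<Sum>j<14. f j) = f 0 + f 1 + f 2 + f 3 + f 4 + f 5 + f 6 + f 7 + f 8 + f 9 + f 10 + f 11 + f 12 + f 13"
    for f :: "nat \<Rightarrow> real" by (simp add: eval_nat_numeral)
  have "(\<Sum>j<14. psi j 0 * y ^ Suc j / fact (Suc j)) = psi 0 0 * y ^ 1 / fact 1 + psi 1 0 * y ^ 2 / fact 2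
    + psi 2 0 * y ^ 3 / fact 3 + psi 3 0 * y ^ 4 / fact 4 + psi 4 0 * y ^ 5 / fact 5 + psi 5 0 * y ^ 6 / fact 6
    + psi 6 0 * y ^ 7 / fact 7 + psi 7 0 * y ^ 8 / fact 8 + psi 8 0 * y ^ 9 / fact 9 + psi 9 0 * y ^ 10 / fact 10
    + psi 10 0 * y ^ 11 / fact 11 + psi 11 0 * y ^ 12 / fact 12 + psi 12 0 * y ^ 13 / fact 13 + psi 13 0 * y ^ 14 / fact 14"
    unfolding sum by (simp only: Suc_numeral add_num_simps One_nat_def[symmetric] Suc_1)
  also have "\<dots> = psi 0 0 * taylor_even y + psi 1 0 * taylor_odd y"
    unfolding psi_at_0 taylor_even_def taylor_odd_def by (simp add: fact_numeral distrib_left)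
  finally show ?thesis .
qed

text \<open>The Taylor polynomials are rounded in the safe direction. What remains is linear in
  \<open>psi 0 0\<close> and \<open>psi 1 0\<close>, and the enclosure of their ratio decides the
  sign. A bracket of length \<open>10 ^ -5\<close> is narrow enough for five decimals of the
  density.\<close>

lemma hermite_half_signs: "0 < hermite_half (764946 / 1000000)" "hermite_half (764956 / 1000000) < 0"
proof -
  define c where "c = psi 0 0"
  have c: "0 < c" by (simp add: c_def psi_pos)
  have R: "477988 / 1000000 * c \<le> psi 1 0" "psi 1 0 \<le> 4779895 / 10000000 * c"
    using psi_ratio_0_bounds c by (simp_all add: psi_ratio_def c_def pos_le_divide_eq pos_divide_le_eq)
  show "0 < hermite_half (764946 / 1000000)"
  proof (rule less_le_trans[OF _ hermite_half_taylor(2)])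
    define e o' r where "e = taylor_even (764946 / 1000000)" and "o' = taylor_odd (764946 / 1000000)"
      and "r = 243 * psi 14 0 * (764946 / 1000000) ^ 15 / fact 15"
    have e: "e \<le> 805155 / 1000000" unfolding e_def taylor_even_def by (simp add: power_divide)
    have o: "o' \<le> 3155198 / 10000000" unfolding o'_def taylor_odd_def by (simp add: power_divide)
    have r: "r \<le> 14 / 100000000 * c"
    proof -
      have "r = c * (243 * (5221125 / 128) * (764946 / 1000000) ^ 15 / fact 15)" by (simp add: r_def psi_at_0 c_def)
      also have "\<dots> \<le> c * (14 / 100000000)" using c by (intro mult_left_mono) (simp_all add: fact_numeral power_divide)
      finally show ?thesis by simp
    qed
    have "c * e \<le> c * (805155 / 1000000)" using e c by (intro mult_left_mono) auto
    moreover have "psi 1 0 * o' \<le> psi 1 0 * (3155198 / 10000000)" using o psi_pos[of 1 0] by (intro mult_left_mono) auto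
    ultimately have "0 < 2 * psi 1 0 - (c * e + psi 1 0 * o') - r" using R r c by linarith
    then show "0 < 2 * psi 1 0 - (\<Sum>j<14. psi j 0 * (764946 / 1000000) ^ Suc j / fact (Suc j)) - 243 * psi 14 0 * (764946 / 1000000) ^ 15 / fact 15"
      unfolding taylor_sum_eq e_def o'_def r_def c_def .
  qed simp_all
  show "hermite_half (764956 / 1000000) < 0"
  proof (rule le_less_trans[OF hermite_half_taylor(1)])
    define e o' where "e = taylor_even (764956 / 1000000)" and "o' = taylor_odd (764956 / 1000000)"
    have e: "805166 / 1000000 \<le> e" unfolding e_def taylor_even_def by (simp add: power_divide)
    have o: "3155286 / 10000000 \<le> o'" unfolding o'_def taylor_odd_def by (simp add: power_divide)
    have "c * (805166 / 1000000) \<le> c * e" using e c by (intro mult_left_mono) auto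
    moreover have "psi 1 0 * (3155286 / 10000000) \<le> psi 1 0 * o'" using o psi_pos[of 1 0] by (intro mult_left_mono) auto
    ultimately have "2 * psi 1 0 - (c * e + psi 1 0 * o') < 0" using R c by linarith
    then show "2 * psi 1 0 - (\<Sum>j<14. psi j 0 * (764956 / 1000000) ^ Suc j / fact (Suc j)) < 0"
      unfolding taylor_sum_eq e_def o'_def c_def .
  qed simp_all
qed

text \<open>Horner's scheme for the series of \<open>gauss_poly\<close> in
  \<open>u = y\<^sup>2\<close>, with \<open>N\<close> terms from index \<open>k\<close> on.
  Evaluated from the inside, it allows rounding after every step.\<close>

primrec gauss_horner :: "nat \<Rightarrow> nat \<Rightarrow> real \<Rightarrow> real" where
  "gauss_horner 0 k u = 0"
| "gauss_horner (Suc N) k u = 1 / (2 ^ k * fact k * (2 * real k + 1)) - u * gauss_horner N (Suc k) u"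

lemma gauss_horner_eq: "(\<Sum>i<N. (- 1) ^ i / (2 ^ (k + i) * fact (k + i) * (2 * real (k + i) + 1)) * u ^ i) = gauss_horner N k u"
proof (induction N arbitrary: k)
  case (Suc N)
  show ?case
    unfolding sum.lessThan_Suc_shift gauss_horner.simps Suc.IH[of "Suc k", symmetric] sum_distrib_left
    by (simp add: mult_ac flip: sum_negf)
qed simp

lemma gauss_poly_horner: "gauss_poly N y = y * gauss_horner N 0 (y\<^sup>2)"
  unfolding gauss_horner_eq[symmetric] gauss_poly_def sum_distrib_left
  by (intro sum.cong) (simp_all add: power_mult[symmetric])

text \<open>One step of interval arithmetic with outward rounding: all enclosures are nonnegative,
  so the product is monotone in both factors.\<close>

lemma gauss_horner_step:
  assumes "l \<le> gauss_horner N k' u" "gauss_horner N k' u \<le> m" "0 \<le> l" "lo \<le> u" "u \<le> hi" "0 \<le> lo"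
    and "N' = Suc N" "k' = Suc k"
  shows "L \<le> 1 / (2 ^ k * fact k * (2 * real k + 1)) - hi * m \<Longrightarrow> L \<le> gauss_horner N' k u"
    and "1 / (2 ^ k * fact k * (2 * real k + 1)) - lo * l \<le> M \<Longrightarrow> gauss_horner N' k u \<le> M"
proof -
  have "lo * l \<le> u * gauss_horner N k' u" "u * gauss_horner N k' u \<le> hi * m"
    using assms by (auto intro!: mult_mono)
  then show "L \<le> 1 / (2 ^ k * fact k * (2 * real k + 1)) - hi * m \<Longrightarrow> L \<le> gauss_horner N' k u"
    "1 / (2 ^ k * fact k * (2 * real k + 1)) - lo * l \<le> M \<Longrightarrow> gauss_horner N' k u \<le> M"
    using assms(7,8) by auto
qed

text \<open>An even number of terms bounds \<open>gauss_int\<close> from below, an odd number from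
  above; hence 8 and 10 terms at the lower ends of the brackets, 9 and 11 at the upper ends.
  Intermediate values are rounded to ten decimals.\<close>

lemma gauss_poly_value_1: "6964619 / 10000000 \<le> gauss_poly 8 (764946 / 1000000)"
proof -
  define u :: real where "u = (764946 / 1000000)\<^sup>2"
  have u: "585142382 / 1000000000 \<le> u" "u \<le> 585142383 / 1000000000" by (simp_all add: u_def power_divide)
  have h0: "0 \<le> gauss_horner 0 8 u" "gauss_horner 0 8 u \<le> 0" by simp_all
  have h1: "1033 / 10000000000 \<le> gauss_horner 1 7 u" "gauss_horner 1 7 u \<le> 1034 / 10000000000"
    by (rule gauss_horner_step[OF h0 _ u]; simp add: fact_numeral)+
  have h2: "16088 / 10000000000 \<le> gauss_horner 2 6 u" "gauss_horner 2 6 u \<le> 16089 / 10000000000"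
    by (rule gauss_horner_step[OF h1 _ u]; simp add: fact_numeral)+
  have h3: "227328 / 10000000000 \<le> gauss_horner 3 5 u" "gauss_horner 3 5 u \<le> 227329 / 10000000000"
    by (rule gauss_horner_step[OF h2 _ u]; simp add: fact_numeral)+
  have h4: "2760498 / 10000000000 \<le> gauss_horner 4 4 u" "gauss_horner 4 4 u \<le> 2760500 / 10000000000"
    by (rule gauss_horner_step[OF h3 _ u]; simp add: fact_numeral)+
  have h5: "28146619 / 10000000000 \<le> gauss_horner 5 3 u" "gauss_horner 5 3 u \<le> 28146621 / 10000000000"
    by (rule gauss_horner_step[OF h4 _ u]; simp add: fact_numeral)+
  have h6: "233530219 / 10000000000 \<le> gauss_horner 6 2 u" "gauss_horner 6 2 u \<le> 233530221 / 10000000000"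
    by (rule gauss_horner_step[OF h5 _ u]; simp add: fact_numeral)+
  have h7: "1530018236 / 10000000000 \<le> gauss_horner 7 1 u" "gauss_horner 7 1 u \<le> 1530018239 / 10000000000"
    by (rule gauss_horner_step[OF h6 _ u]; simp add: fact_numeral)+
  have h8: "9104721481 / 10000000000 \<le> gauss_horner 8 0 u" "gauss_horner 8 0 u \<le> 9104721485 / 10000000000"
    by (rule gauss_horner_step[OF h7 _ u]; simp add: fact_numeral)+
  show ?thesis unfolding gauss_poly_horner u_def[symmetric] using h8 by linarith
qed

lemma gauss_poly_value_2: "gauss_poly 9 (764956 / 1000000) \<le> 6964696 / 10000000"
proof -
  define u :: real where "u = (764956 / 1000000)\<^sup>2"
  have u: "585157681 / 1000000000 \<le> u" "u \<le> 585157682 / 1000000000" by (simp_all add: u_def power_divide)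
  have h0: "0 \<le> gauss_horner 0 9 u" "gauss_horner 0 9 u \<le> 0" by simp_all
  have h1: "56 / 10000000000 \<le> gauss_horner 1 8 u" "gauss_horner 1 8 u \<le> 57 / 10000000000"
    by (rule gauss_horner_step[OF h0 _ u]; simp add: fact_numeral)+
  have h2: "1000 / 10000000000 \<le> gauss_horner 2 7 u" "gauss_horner 2 7 u \<le> 1001 / 10000000000"
    by (rule gauss_horner_step[OF h1 _ u]; simp add: fact_numeral)+
  have h3: "16107 / 10000000000 \<le> gauss_horner 3 6 u" "gauss_horner 3 6 u \<le> 16109 / 10000000000"
    by (rule gauss_horner_step[OF h2 _ u]; simp add: fact_numeral)+
  have h4: "227316 / 10000000000 \<le> gauss_horner 4 5 u" "gauss_horner 4 5 u \<le> 227318 / 10000000000"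
    by (rule gauss_horner_step[OF h3 _ u]; simp add: fact_numeral)+
  have h5: "2760501 / 10000000000 \<le> gauss_horner 5 4 u" "gauss_horner 5 4 u \<le> 2760503 / 10000000000"
    by (rule gauss_horner_step[OF h4 _ u]; simp add: fact_numeral)+
  have h6: "28146575 / 10000000000 \<le> gauss_horner 6 3 u" "gauss_horner 6 3 u \<le> 28146577 / 10000000000"
    by (rule gauss_horner_step[OF h5 _ u]; simp add: fact_numeral)+
  have h7: "233529814 / 10000000000 \<le> gauss_horner 7 2 u" "gauss_horner 7 2 u \<le> 233529816 / 10000000000"
    by (rule gauss_horner_step[OF h6 _ u]; simp add: fact_numeral)+
  have h8: "1530014900 / 10000000000 \<le> gauss_horner 8 1 u" "gauss_horner 8 1 u \<le> 1530014903 / 10000000000"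
    by (rule gauss_horner_step[OF h7 _ u]; simp add: fact_numeral)+
  have h9: "9104700025 / 10000000000 \<le> gauss_horner 9 0 u" "gauss_horner 9 0 u \<le> 9104700030 / 10000000000"
    by (rule gauss_horner_step[OF h8 _ u]; simp add: fact_numeral)+
  show ?thesis unfolding gauss_poly_horner u_def[symmetric] using h9 by linarith
qed

lemma gauss_poly_value_3: "10136342 / 10000000 \<le> gauss_poly 10 (1306929 / 1000000)"
proof -
  define u :: real where "u = (1306929 / 1000000)\<^sup>2"
  have u: "1708063411 / 1000000000 \<le> u" "u \<le> 1708063412 / 1000000000" by (simp_all add: u_def power_divide)
  have h0: "0 \<le> gauss_horner 0 10 u" "gauss_horner 0 10 u \<le> 0" by simp_all
  have h1: "2 / 10000000000 \<le> gauss_horner 1 9 u" "gauss_horner 1 9 u \<le> 3 / 10000000000"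
    by (rule gauss_horner_step[OF h0 _ u]; simp add: fact_numeral)+
  have h2: "51 / 10000000000 \<le> gauss_horner 2 8 u" "gauss_horner 2 8 u \<le> 54 / 10000000000"
    by (rule gauss_horner_step[OF h1 _ u]; simp add: fact_numeral)+
  have h3: "941 / 10000000000 \<le> gauss_horner 3 7 u" "gauss_horner 3 7 u \<le> 947 / 10000000000"
    by (rule gauss_horner_step[OF h2 _ u]; simp add: fact_numeral)+
  have h4: "15075 / 10000000000 \<le> gauss_horner 4 6 u" "gauss_horner 4 6 u \<le> 15087 / 10000000000"
    by (rule gauss_horner_step[OF h3 _ u]; simp add: fact_numeral)+
  have h5: "210972 / 10000000000 \<le> gauss_horner 5 5 u" "gauss_horner 5 5 u \<le> 210994 / 10000000000"
    by (rule gauss_horner_step[OF h4 _ u]; simp add: fact_numeral)+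
  have h6: "2533127 / 10000000000 \<le> gauss_horner 6 4 u" "gauss_horner 6 4 u \<le> 2533165 / 10000000000"
    by (rule gauss_horner_step[OF h5 _ u]; simp add: fact_numeral)+
  have h7: "25435098 / 10000000000 \<le> gauss_horner 7 3 u" "gauss_horner 7 3 u \<le> 25435164 / 10000000000"
    by (rule gauss_horner_step[OF h6 _ u]; simp add: fact_numeral)+
  have h8: "206555126 / 10000000000 \<le> gauss_horner 8 2 u" "gauss_horner 8 2 u \<le> 206555240 / 10000000000"
    by (rule gauss_horner_step[OF h7 _ u]; simp add: fact_numeral)+
  have h9: "1313857218 / 10000000000 \<le> gauss_horner 9 1 u" "gauss_horner 9 1 u \<le> 1313857414 / 10000000000"
    by (rule gauss_horner_step[OF h8 _ u]; simp add: fact_numeral)+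
  have h10: "7755848222 / 10000000000 \<le> gauss_horner 10 0 u" "gauss_horner 10 0 u \<le> 7755848559 / 10000000000"
    by (rule gauss_horner_step[OF h9 _ u]; simp add: fact_numeral)+
  show ?thesis unfolding gauss_poly_horner u_def[symmetric] using h10 by linarith
qed

lemma gauss_poly_value_4: "gauss_poly 11 (1306931 / 1000000) \<le> 10136353 / 10000000"
proof -
  define u :: real where "u = (1306931 / 1000000)\<^sup>2"
  have u: "1708068638 / 1000000000 \<le> u" "u \<le> 1708068639 / 1000000000" by (simp_all add: u_def power_divide)
  have h0: "0 \<le> gauss_horner 0 11 u" "gauss_horner 0 11 u \<le> 0" by simp_all
  have h1: "0 / 10000000000 \<le> gauss_horner 1 10 u" "gauss_horner 1 10 u \<le> 1 / 10000000000"
    by (rule gauss_horner_step[OF h0 _ u]; simp add: fact_numeral)+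
  have h2: "1 / 10000000000 \<le> gauss_horner 2 9 u" "gauss_horner 2 9 u \<le> 3 / 10000000000"
    by (rule gauss_horner_step[OF h1 _ u]; simp add: fact_numeral)+
  have h3: "51 / 10000000000 \<le> gauss_horner 3 8 u" "gauss_horner 3 8 u \<le> 56 / 10000000000"
    by (rule gauss_horner_step[OF h2 _ u]; simp add: fact_numeral)+
  have h4: "937 / 10000000000 \<le> gauss_horner 4 7 u" "gauss_horner 4 7 u \<le> 947 / 10000000000"
    by (rule gauss_horner_step[OF h3 _ u]; simp add: fact_numeral)+
  have h5: "15075 / 10000000000 \<le> gauss_horner 5 6 u" "gauss_horner 5 6 u \<le> 15093 / 10000000000"
    by (rule gauss_horner_step[OF h4 _ u]; simp add: fact_numeral)+
  have h6: "210962 / 10000000000 \<le> gauss_horner 6 5 u" "gauss_horner 6 5 u \<le> 210994 / 10000000000"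
    by (rule gauss_horner_step[OF h5 _ u]; simp add: fact_numeral)+
  have h7: "2533126 / 10000000000 \<le> gauss_horner 7 4 u" "gauss_horner 7 4 u \<le> 2533181 / 10000000000"
    by (rule gauss_horner_step[OF h6 _ u]; simp add: fact_numeral)+
  have h8: "25435057 / 10000000000 \<le> gauss_horner 8 3 u" "gauss_horner 8 3 u \<le> 25435152 / 10000000000"
    by (rule gauss_horner_step[OF h7 _ u]; simp add: fact_numeral)+
  have h9: "206555014 / 10000000000 \<le> gauss_horner 9 2 u" "gauss_horner 9 2 u \<le> 206555177 / 10000000000"
    by (rule gauss_horner_step[OF h8 _ u]; simp add: fact_numeral)+
  have h10: "1313856246 / 10000000000 \<le> gauss_horner 10 1 u" "gauss_horner 10 1 u \<le> 1313856526 / 10000000000"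
    by (rule gauss_horner_step[OF h9 _ u]; simp add: fact_numeral)+
  have h11: "7755842871 / 10000000000 \<le> gauss_horner 11 0 u" "gauss_horner 11 0 u \<le> 7755843352 / 10000000000"
    by (rule gauss_horner_step[OF h10 _ u]; simp add: fact_numeral)+
  show ?thesis unfolding gauss_poly_horner u_def[symmetric] using h11 by linarith
qed

lemmas gauss_poly_values = gauss_poly_value_1 gauss_poly_value_2 gauss_poly_value_3 gauss_poly_value_4

section \<open>The zero of the profile when one block is a line\<close>

text \<open>The value is -1 for \<open>j = 0\<close> and positive afterwards, so the series starts
  at -1 and increases for nonnegative arguments.\<close>

definition kummer_coeff :: "nat \<Rightarrow> real" where
  "kummer_coeff j = 1 / ((2 * real j - 1) * fact j)"

text \<open>Up to sign, the confluent limit \<open>1F1(-1/2; 1/2; x)\<close> of the hypergeometric function.\<close>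
definition kummer_neg :: "real \<Rightarrow> real" where
  "kummer_neg x = (\<Sum>j. kummer_coeff j * x ^ j)"

lemma kummer_coeff_pos: "1 \<le> j \<Longrightarrow> 0 < kummer_coeff j"
  by (simp add: kummer_coeff_def)

lemma two_j_minus_1_nz: "2 * real j - 1 \<noteq> 0"
proof
  assume "2 * real j - 1 = 0"
  then have "real (2 * j) = real 1" by simp
  then have "2 * j = 1" by (simp only: of_nat_eq_iff)
  then show False by presburger
qed

lemma summable_kummer: "summable (\<lambda>j. kummer_coeff j * x ^ j)"
proof (rule summable_comparison_test'[where N = 0])
  show "summable (\<lambda>j. \<bar>x\<bar> ^ j / fact j)" using summable_exp[of "\<bar>x\<bar>"] by (simp add: field_simps)
  fix j :: nat
  have "1 \<le> \<bar>2 * real j - 1\<bar>" by (cases j) auto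
  then have "1 / (\<bar>2 * real j - 1\<bar> * fact j) \<le> 1 / (1 * fact j)"
    by (intro divide_left_mono mult_right_mono mult_pos_pos) auto
  then have "\<bar>kummer_coeff j\<bar> \<le> 1 / fact j" by (simp add: kummer_coeff_def abs_mult)
  then have "\<bar>kummer_coeff j\<bar> * \<bar>x\<bar> ^ j \<le> 1 / fact j * \<bar>x\<bar> ^ j" by (intro mult_right_mono) auto
  then show "norm (kummer_coeff j * x ^ j) \<le> \<bar>x\<bar> ^ j / fact j" by (simp add: abs_mult power_abs)
qed

text \<open>After the constant term all coefficients are positive, and the linear term, with
  coefficient 1, already contributes \<open>y - x\<close>.\<close>

lemma kummer_neg_strict_mono:
  assumes "0 \<le> x" "x < y"
  shows "kummer_neg x < kummer_neg y"
proof -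
  have "0 < y - x" using assms by simp
  also have "\<dots> = (\<Sum>j<2. kummer_coeff j * y ^ j - kummer_coeff j * x ^ j)"
    by (simp add: kummer_coeff_def numeral_2_eq_2)
  also have "\<dots> \<le> (\<Sum>j. kummer_coeff j * y ^ j - kummer_coeff j * x ^ j)"
  proof (rule sum_le_suminf)
    show "summable (\<lambda>j. kummer_coeff j * y ^ j - kummer_coeff j * x ^ j)"
      by (intro summable_diff summable_kummer)
    fix j :: nat assume "j \<in> - {..<2}"
    then have "0 < kummer_coeff j" "x ^ j \<le> y ^ j" using assms by (auto intro!: kummer_coeff_pos power_mono)
    then show "0 \<le> kummer_coeff j * y ^ j - kummer_coeff j * x ^ j" by simp
  qed simp
  also have "\<dots> = kummer_neg y - kummer_neg x"
    unfolding kummer_neg_def by (rule suminf_diff[symmetric]) (rule summable_kummer)+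
  finally show ?thesis by simp
qed

lemma isCont_kummer_neg: "isCont kummer_neg x"
  unfolding kummer_neg_def[abs_def]
  by (rule isCont_powser[OF summable_kummer[of "\<bar>x\<bar> + 1"]]) simp

text \<open>Ten terms decide both signs. At the upper point the omitted terms are positive; at the
  lower one the tail is bounded by a geometric series, as
  \<open>fact (j + 10) \<ge> fact 10 * 2 ^ j\<close> and the argument is below 1.\<close>

lemma kummer_neg_signs: "kummer_neg (854032 / 1000000) < 0" "0 < kummer_neg (854033 / 1000000)"
proof -
  have sum: "(\<Sum>j<10. f j) = f 0 + f 1 + f 2 + f 3 + f 4 + f 5 + f 6 + f 7 + f 8 + f 9" for f :: "nat \<Rightarrow> real"
    by (simp add: eval_nat_numeral)
  show "0 < kummer_neg (854033 / 1000000)"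
  proof (rule less_le_trans)
    show "0 < (\<Sum>j<10. kummer_coeff j * (854033 / 1000000) ^ j)"
      unfolding sum by (simp add: kummer_coeff_def fact_numeral power_divide)
    show "(\<Sum>j<10. kummer_coeff j * (854033 / 1000000) ^ j) \<le> kummer_neg (854033 / 1000000)"
      unfolding kummer_neg_def
      by (rule sum_le_suminf[OF summable_kummer]) (auto intro!: mult_nonneg_nonneg less_imp_le[OF kummer_coeff_pos])
  qed
  let ?x = "854032 / 1000000 :: real"
  have split: "kummer_neg ?x = (\<Sum>j. kummer_coeff (j + 10) * ?x ^ (j + 10)) + (\<Sum>j<10. kummer_coeff j * ?x ^ j)"
    unfolding kummer_neg_def by (rule suminf_split_initial_segment[OF summable_kummer])
  have "(\<Sum>j. kummer_coeff (j + 10) * ?x ^ (j + 10)) \<le> (\<Sum>j. 1 / (19 * fact 10) * (1/2) ^ j)"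
  proof (rule suminf_le)
    show "summable (\<lambda>j. kummer_coeff (j + 10) * ?x ^ (j + 10))"
      using summable_kummer[of ?x] by (subst summable_iff_shift)
    show "summable (\<lambda>j. 1 / (19 * fact 10) * (1/2 :: real) ^ j)" by (intro summable_mult summable_geometric) simp
    fix j :: nat
    have fact_ge: "fact 10 * 2 ^ j \<le> (fact (j + 10) :: real)"
    proof (induction j)
      case (Suc j)
      have "fact 10 * 2 ^ Suc j = 2 * (fact 10 * 2 ^ j :: real)" by simp
      also have "\<dots> \<le> real (Suc (j + 10)) * fact (j + 10)" using Suc by (intro mult_mono) auto
      also have "\<dots> = fact (Suc j + 10)" by (simp only: add_Suc fact_Suc)
      finally show ?case .
    qed simp
    have "19 * (fact 10 * 2 ^ j) \<le> (2 * real (j + 10) - 1) * fact (j + 10)"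
      using fact_ge by (intro mult_mono) auto
    then have "kummer_coeff (j + 10) \<le> 1 / (19 * (fact 10 * 2 ^ j))"
      unfolding kummer_coeff_def by (intro divide_left_mono mult_pos_pos) auto
    then have "kummer_coeff (j + 10) * ?x ^ (j + 10) \<le> 1 / (19 * (fact 10 * 2 ^ j)) * 1"
      by (intro mult_mono power_le_one) auto
    then show "kummer_coeff (j + 10) * ?x ^ (j + 10) \<le> 1 / (19 * fact 10) * (1/2) ^ j"
      by (simp add: power_divide)
  qed
  also have "(\<Sum>j. 1 / (19 * fact 10) * (1/2 :: real) ^ j) = 1 / (19 * fact 10) * 2"
    by (subst suminf_mult) (simp_all add: suminf_geometric summable_geometric)
  finally have tail: "(\<Sum>j. kummer_coeff (j + 10) * ?x ^ (j + 10)) \<le> 1 / (19 * fact 10) * 2" .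
  have "1 / (19 * fact 10) * 2 + (\<Sum>j<10. kummer_coeff j * ?x ^ j) < 0"
    unfolding sum by (simp add: kummer_coeff_def fact_numeral power_divide)
  with tail show "kummer_neg ?x < 0" unfolding split by linarith
qed

text \<open>Confluence: the parameter \<open>(n - 1) / 2\<close> is asymptotic to
  \<open>n / 2\<close> and the argument is scaled by \<open>2 / n\<close>, so the recursion of the
  coefficients tends to that of the Kummer series.\<close>

lemma hyp_fps_one_scaled_tendsto:
  "(\<lambda>n. fps_nth (hyp_fps n 1) j * (2 / real n) ^ j) \<longlonglongrightarrow> - kummer_coeff j"
proof (induction j)
  case 0
  then show ?case by (simp add: kummer_coeff_def)
next
  case (Suc j)
  define c where "c = (real j - 1/2) / ((real j + 1) * (real j + 1/2))"
  have nz: "(real j + 1) * (real j + 1/2) \<noteq> 0" by (simp add: add_nonneg_eq_0_iff)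
  have lim: "(\<lambda>n. ((real n - 1 + 2 * real j) / real n) * c * (fps_nth (hyp_fps n 1) j * (2 / real n) ^ j)) \<longlonglongrightarrow> 1 * c * (- kummer_coeff j)"
    by (intro tendsto_mult Suc tendsto_const) real_asymp
  have ev: "\<forall>\<^sub>F n in sequentially. ((real n - 1 + 2 * real j) / real n) * c * (fps_nth (hyp_fps n 1) j * (2 / real n) ^ j)
      = fps_nth (hyp_fps n 1) (Suc j) * (2 / real n) ^ Suc j"
    using eventually_gt_at_top[of 0]
  proof eventually_elim
    case (elim n)
    have "(real j + 1) * (real j + 1/2) * fps_nth (hyp_fps n 1) (Suc j) = ((real n - 1) / 2 + real j) * (real j - 1/2) * fps_nth (hyp_fps n 1) j"
      using hyp_fps_Suc[of 1 j n] by (simp add: add.commute)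
    then have "fps_nth (hyp_fps n 1) (Suc j) = ((real n - 1) / 2 + real j) * c * fps_nth (hyp_fps n 1) j"
      unfolding c_def using nz by (simp add: field_simps)
    moreover have "((real n - 1) / 2 + real j) * (2 / real n) = (real n - 1 + 2 * real j) / real n" using elim by (simp add: field_simps)
    ultimately show ?case by (simp add: mult_ac)
  qed
  have eq: "1 * c * (- kummer_coeff j) = - kummer_coeff (Suc j)"
  proof -
    have "c = (2 * (real j - 1/2)) / (2 * ((real j + 1) * (real j + 1/2)))"
      unfolding c_def by (rule mult_divide_mult_cancel_left[symmetric]) simp
    also have "2 * (real j - 1/2) = 2 * real j - 1" by simp
    also have "2 * ((real j + 1) * (real j + 1/2)) = (2 * real j + 1) * (real j + 1)" by (simp add: algebra_simps)
    finally have "c * kummer_coeff j = 1 / (((2 * real j + 1) * (real j + 1)) * fact j)"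
      unfolding kummer_coeff_def using two_j_minus_1_nz[of j] by simp
    also have "\<dots> = kummer_coeff (Suc j)" by (simp add: kummer_coeff_def algebra_simps)
    finally show ?thesis by simp
  qed
  show ?case by (rule Lim_transform_eventually[OF lim[unfolded eq] ev])
qed

text \<open>Majorant for Tannery's theorem. For \<open>n \<ge> 4\<close> the quotient of successive
  terms is at most \<open>(1 + j / 2) / (j + 1)\<close>, exactly the quotient for
  \<open>(j + 1) / 2 ^ j\<close>.\<close>

lemma hyp_fps_one_scaled_bound:
  assumes n: "4 \<le> n"
  shows "\<bar>fps_nth (hyp_fps n 1) j * (2 / real n) ^ j\<bar> \<le> (real j + 1) * (1/2) ^ j"
proof (induction j)
  case (Suc j)
  define d where "d j = fps_nth (hyp_fps n 1) j * (2 / real n) ^ j" for j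
  have nz: "0 < (real j + 1) * (real j + 1/2)" by (simp add: add_nonneg_pos)
  have "(real j + 1) * (real j + 1/2) * fps_nth (hyp_fps n 1) (Suc j) = ((real n - 1) / 2 + real j) * (real j - 1/2) * fps_nth (hyp_fps n 1) j"
    using hyp_fps_Suc[of 1 j n] by (simp add: add.commute)
  then have "(real j + 1) * (real j + 1/2) * d (Suc j) = ((real n - 1) / 2 + real j) * (2 / real n) * (real j - 1/2) * d j"
    unfolding d_def by (simp add: mult_ac)
  also have "((real n - 1) / 2 + real j) * (2 / real n) = 1 + (2 * real j - 1) / real n" using n by (simp add: field_simps)
  finally have "(real j + 1) * (real j + 1/2) * d (Suc j) = (1 + (2 * real j - 1) / real n) * (real j - 1/2) * d j" .
  then have "\<bar>(real j + 1) * (real j + 1/2) * d (Suc j)\<bar> = \<bar>(1 + (2 * real j - 1) / real n) * (real j - 1/2) * d j\<bar>"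
    by (rule arg_cong)
  then have "(real j + 1) * (real j + 1/2) * \<bar>d (Suc j)\<bar> = \<bar>1 + (2 * real j - 1) / real n\<bar> * \<bar>real j - 1/2\<bar> * \<bar>d j\<bar>"
    using nz by (simp only: abs_mult) (simp add: add_nonneg_pos)
  also have "\<dots> \<le> (1 + real j / 2) * (real j + 1/2) * ((real j + 1) * (1/2) ^ j)"
  proof (intro mult_mono)
    have "(2 * real j - 1) / real n \<le> 2 * real j / real n" by (simp add: divide_right_mono)
    also have "\<dots> \<le> 2 * real j / 4" using n by (intro divide_left_mono) auto
    finally have "1 + (2 * real j - 1) / real n \<le> 1 + real j / 2" by simp
    moreover have "- 1 \<le> (2 * real j - 1) / real n" using n by (simp add: field_simps)
    ultimately show "\<bar>1 + (2 * real j - 1) / real n\<bar> \<le> 1 + real j / 2" by simp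
    show "\<bar>d j\<bar> \<le> (real j + 1) * (1/2) ^ j" using Suc by (simp add: d_def)
  qed auto
  also have "\<dots> = (real j + 1) * (real j + 1/2) * ((real (Suc j) + 1) * (1/2) ^ Suc j)" by (simp add: field_simps)
  finally show ?case using nz unfolding d_def by (simp only: mult_le_cancel_left_pos)
qed simp

text \<open>Tannery's theorem; the majorant is summable for \<open>x < 2\<close>, which covers a
  neighbourhood of the zero near 0.854.\<close>

lemma hypG_one_tendsto:
  assumes x: "0 \<le> x" "x < 2"
  shows "(\<lambda>n. hypG n 1 (2 * x / real n)) \<longlonglongrightarrow> - kummer_neg x"
proof -
  define a where "a j n = fps_nth (hyp_fps n 1) j * (2 / real n) ^ j * x ^ j" for j n :: nat
  have "((\<lambda>n. \<Sum>j. a j n) \<longlongrightarrow> (\<Sum>j. - kummer_coeff j * x ^ j)) sequentially"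
  proof (rule tannerys_theorem[THEN conjunct2, THEN conjunct2])
    show "(\<lambda>n. a j n) \<longlonglongrightarrow> - kummer_coeff j * x ^ j" for j
      unfolding a_def by (intro tendsto_mult tendsto_const hyp_fps_one_scaled_tendsto)
    have "\<bar>a j n\<bar> \<le> real (Suc j) * (x / 2) ^ j" if "4 \<le> n" for j n
    proof -
      have "\<bar>a j n\<bar> = \<bar>fps_nth (hyp_fps n 1) j * (2 / real n) ^ j\<bar> * x ^ j" using x by (simp add: a_def abs_mult)
      also have "\<dots> \<le> (real j + 1) * (1/2) ^ j * x ^ j"
        using x by (intro mult_right_mono hyp_fps_one_scaled_bound that) auto
      also have "\<dots> = real (Suc j) * (x / 2) ^ j" by (simp add: power_divide power_mult_distrib add.commute)
      finally show ?thesis .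
    qed
    then show "\<forall>\<^sub>F (j, n) in at_top \<times>\<^sub>F sequentially. norm (a j n) \<le> real (Suc j) * (x / 2) ^ j"
      unfolding eventually_prod_sequentially by (intro exI[of _ 4]) auto
    show "summable (\<lambda>j. real (Suc j) * (x / 2) ^ j)"
      using geometric_deriv_sums[of "x / 2"] x by (auto simp: sums_iff)
  qed simp
  moreover have "(\<Sum>j. - kummer_coeff j * x ^ j) = - kummer_neg x"
    unfolding kummer_neg_def using suminf_minus[OF summable_kummer[of x]] by simp
  moreover have "(\<Sum>j. a j n) = hypG n 1 (2 * x / real n)" for n
    by (simp add: hypG_def eval_fps_def a_def power_mult_distrib power_divide mult_ac)
  ultimately show ?thesis by simp
qed

lemma kummer_root:
  obtains x0 where "854032 / 1000000 < x0" "x0 < 854033 / 1000000" "kummer_neg x0 = 0"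
proof -
  have "\<exists>x\<ge>854032 / 1000000. x \<le> 854033 / 1000000 \<and> kummer_neg x = 0"
    by (rule IVT) (use kummer_neg_signs isCont_kummer_neg in auto)
  then obtain x where "854032 / 1000000 \<le> x" "x \<le> 854033 / 1000000" "kummer_neg x = 0" by blast
  with kummer_neg_signs that[of x] show ?thesis by (metis less_irrefl order_le_less)
qed

text \<open>The scaled profiles converge pointwise, and the limit changes sign at \<open>x0\<close>
  only; by monotonicity the zero is trapped between points \<open>2 * x / n\<close> with
  \<open>x\<close> on either side of \<open>x0\<close>.\<close>

lemma hypG_one_zero_tendsto:
  assumes x0: "0 < x0" "x0 < 2" "kummer_neg x0 = 0"
  shows "\<exists>z. (\<forall>\<^sub>F n in sequentially. 0 < z n \<and> z n < 1 \<and> hypG n 1 (z n) = 0 \<and> (\<forall>x. 0 \<le> x \<and> x < z n \<longrightarrow> 0 < hypG n 1 x) \<and>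
     (\<forall>x. 0 < x \<and> x < 1 \<and> hypG n 1 x = 0 \<longrightarrow> x = z n)) \<and> (\<lambda>n. real n * z n) \<longlonglongrightarrow> 2 * x0"
proof -
  let ?Z = "\<lambda>n z. 0 < z \<and> z < 1 \<and> hypG n 1 z = 0 \<and> (\<forall>x. 0 \<le> x \<and> x < z \<longrightarrow> 0 < hypG n 1 x) \<and>
     (\<forall>x. 0 < x \<and> x < 1 \<and> hypG n 1 x = 0 \<longrightarrow> x = z)"
  \<comment> \<open>For small \<open>n\<close> the choice may be arbitrary, as existence of a zero
    is known only eventually; no more is claimed.\<close>
  define z where "z n = (SOME z. ?Z n z)" for n
  have upper: "\<forall>\<^sub>F n in sequentially. ?Z n (z n) \<and> z n \<le> 2 * x / real n" if x: "x0 < x" "x < 2" for x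
  proof -
    have "(\<lambda>n. hypG n 1 (2 * x / real n)) \<longlonglongrightarrow> - kummer_neg x" using x x0 by (intro hypG_one_tendsto) auto
    moreover have "- kummer_neg x < 0" using kummer_neg_strict_mono[of x0 x] x x0 by simp
    ultimately have "\<forall>\<^sub>F n in sequentially. hypG n 1 (2 * x / real n) < 0" by (rule order_tendstoD)
    then show ?thesis using eventually_ge_at_top[of 5]
    proof eventually_elim
      case (elim n)
      have z1: "0 < 2 * x / real n" "2 * x / real n < 1" using x x0 elim by simp_all
      obtain y where y: "y \<le> 2 * x / real n" "?Z n y"
        using hypG_unique_zero[of n 1 "2 * x / real n"] elim z1 by fastforce
      have "?Z n (z n)" unfolding z_def by (rule someI[of "?Z n"]) (rule y(2))
      then have "z n = y" using y(2) by blast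
      with y(1) \<open>?Z n (z n)\<close> show ?case by blast
    qed
  qed
  have mid: "x0 < (x0 + 2) / 2" "(x0 + 2) / 2 < 2" using x0 by simp_all
  have lower: "\<forall>\<^sub>F n in sequentially. 2 * x / real n < z n" if x: "0 < x" "x < x0" for x
  proof -
    have "(\<lambda>n. hypG n 1 (2 * x / real n)) \<longlonglongrightarrow> - kummer_neg x" using x x0 by (intro hypG_one_tendsto) auto
    moreover have "0 < - kummer_neg x" using kummer_neg_strict_mono[of x x0] x x0 by simp
    ultimately have "\<forall>\<^sub>F n in sequentially. 0 < hypG n 1 (2 * x / real n)" by (rule order_tendstoD)
    then show ?thesis using eventually_ge_at_top[of 5] upper[OF mid]
    proof eventually_elim
      case (elim n)
      have z1: "0 < 2 * x / real n" "2 * x / real n < 1" using x x0 elim by simp_all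
      have zn: "?Z n (z n)" using elim x0 by simp
      show ?case
      proof (rule ccontr)
        assume "\<not> 2 * x / real n < z n"
        then consider "z n = 2 * x / real n" | "z n < 2 * x / real n" by linarith
        then have "hypG n 1 (2 * x / real n) \<le> 0"
        proof cases
          case 2
          then show ?thesis using hypG_strict_antimono[of n 1 "z n" "2 * x / real n"] zn z1 elim by simp
        qed (use zn in simp)
        with elim show False by simp
      qed
    qed
  qed
  have "(\<lambda>n. real n * z n) \<longlonglongrightarrow> 2 * x0"
  proof (rule order_tendstoI)
    fix a assume "a < 2 * x0"
    define x where "x = (max 0 (a / 2) + x0) / 2"
    have x: "0 < x" "x < x0" "a < 2 * x" using \<open>a < 2 * x0\<close> x0 by (auto simp: x_def max_def)
    show "\<forall>\<^sub>F n in sequentially. a < real n * z n"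
      using lower[OF x(1,2)] eventually_gt_at_top[of 0]
    proof eventually_elim
      case (elim n)
      then have "2 * x < real n * z n" by (simp add: field_simps)
      then show ?case using x by simp
    qed
  next
    fix a assume "2 * x0 < a"
    define x where "x = (x0 + min (a / 2) 2) / 2"
    have x: "x0 < x" "x < 2" "2 * x < a" using \<open>2 * x0 < a\<close> x0 by (auto simp: x_def min_def)
    show "\<forall>\<^sub>F n in sequentially. real n * z n < a"
      using upper[OF x(1,2)] eventually_gt_at_top[of 0]
    proof eventually_elim
      case (elim n)
      then have "real n * z n \<le> 2 * x" by (simp add: field_simps)
      then show ?case using x by simp
    qed
  qed
  moreover have "\<forall>\<^sub>F n in sequentially. ?Z n (z n)"
    using upper[OF mid] by (rule eventually_mono) simp
  ultimately show ?thesis by (intro exI[of _ z]) simp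
qed

section \<open>The densities and their limits\<close>

lemma gauss_mass_finite_additive:
  assumes "A \<in> sets borel" "B \<in> sets borel" "A \<inter> B = {}"
  shows "gauss_mass (A \<union> B) = gauss_mass A + gauss_mass B"
proof -
  have i: "integrable lborel (\<lambda>y::real. exp (- y\<^sup>2 / 2) * indicator W y)" if "W \<in> sets borel" for W
    using that by (intro integrable_real_mult_indicator integrable_gauss) simp
  have "gauss_mass (A \<union> B) = (\<integral>y. exp (- y\<^sup>2 / 2) * indicator A y + exp (- y\<^sup>2 / 2) * indicator B y \<partial>lborel)"
    unfolding gauss_mass_def using assms(3)
    by (intro Bochner_Integration.integral_cong) (auto simp: indicator_def)
  also have "\<dots> = gauss_mass A + gauss_mass B"
    unfolding gauss_mass_def by (intro Bochner_Integration.integral_add i assms)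
  finally show ?thesis .
qed

lemma gauss_mass_singleton: "gauss_mass {a} = 0"
proof -
  have "gauss_mass {a} = (\<integral>y. 0 \<partial>(lborel :: real measure))"
    unfolding gauss_mass_def
    by (rule integral_cong_AE) (auto intro!: AE_I[of _ _ "{a}"] simp: indicator_def)
  then show ?thesis by simp
qed

lemma gauss_mass_half: "gauss_mass {..<0} = sqrt (2 * pi) / 2" "gauss_mass {0<..} = sqrt (2 * pi) / 2"
proof -
  have "gauss_mass {..<0} = (\<integral>y. exp (- (- y)\<^sup>2 / 2) * indicator {..<0} (- y) \<partial>lborel)"
    unfolding gauss_mass_def
    using lborel_integral_real_affine[of "-1" "\<lambda>y. exp (- y\<^sup>2 / 2) * indicator {..<0} y" 0] by simp
  also have "\<dots> = gauss_mass {0<..}"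
    unfolding gauss_mass_def by (intro Bochner_Integration.integral_cong) (auto simp: indicator_def)
  finally have eq: "gauss_mass {..<0} = gauss_mass {0<..}" .
  have "gauss_mass UNIV = gauss_mass ({..<0} \<union> ({0} \<union> {0<..}))"
    by (intro arg_cong[where f = gauss_mass]) auto
  also have "\<dots> = gauss_mass {..<0} + (gauss_mass {0} + gauss_mass {0<..})"
    by (subst gauss_mass_finite_additive, simp, simp, force, subst gauss_mass_finite_additive) auto
  finally have "sqrt (2 * pi) = 2 * gauss_mass {0<..}" by (simp add: gauss_mass_UNIV gauss_mass_singleton eq)
  then show "gauss_mass {..<0} = sqrt (2 * pi) / 2" "gauss_mass {0<..} = sqrt (2 * pi) / 2" by (simp_all add: eq)
qed

lemma gauss_mass_interval:
  assumes "0 < y"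
  shows "gauss_mass {0<..<y} = gauss_int y"
  unfolding gauss_mass_def gauss_int_def
  by (rule integral_cong_AE) (auto intro!: AE_I[of _ _ "{0, y}"] simp: indicator_def emeasure_lborel_countable)

lemma gauss_mass_lessThan:
  assumes "0 < y"
  shows "gauss_mass {..<y} = sqrt (2 * pi) / 2 + gauss_int y"
proof -
  have "gauss_mass {..<y} = gauss_mass ({..<0} \<union> ({0} \<union> {0<..<y}))"
    using assms by (intro arg_cong[where f = gauss_mass]) auto
  also have "\<dots> = gauss_mass {..<0} + (gauss_mass {0} + gauss_mass {0<..<y})"
    by (subst gauss_mass_finite_additive, simp, simp, force, subst gauss_mass_finite_additive) auto
  finally show ?thesis using assms by (simp add: gauss_mass_singleton gauss_mass_half gauss_mass_interval)
qed

lemma sqrt_2pi_bounds: "25066282 / 10000000 \<le> sqrt (2 * pi)" "sqrt (2 * pi) \<le> 25066283 / 10000000"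
proof -
  have "(25066282 / 10000000)\<^sup>2 \<le> 2 * (3.141592653588 :: real)" by (simp add: power_divide)
  also have "\<dots> \<le> 2 * pi" using pi_approx(1) by simp
  finally show "25066282 / 10000000 \<le> sqrt (2 * pi)" by (rule real_le_rsqrt)
  have "2 * pi \<le> 2 * 3.1415926535899" using pi_approx(2) by simp
  also have "\<dots> \<le> (25066283 / 10000000)\<^sup>2" by (simp add: power_divide)
  finally show "sqrt (2 * pi) \<le> 25066283 / 10000000" by (intro real_le_lsqrt) auto
qed

lemma round_decimals_eqI:
  assumes "real_of_int m - 1/2 \<le> 10 ^ k * x" "10 ^ k * x < real_of_int m + 1/2"
  shows "round_decimals k x = real_of_int m / 10 ^ k"
proof -
  have "round (10 ^ k * x) = m" unfolding round_def by (rule floor_unique) (use assms in auto)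
  then show ?thesis by (simp add: round_decimals_def)
qed

text \<open>The limit is \<open>1/2 + gauss_int y / sqrt (2 * pi)\<close> and has to stay within
  \<open>5 / 10 ^ 6\<close> of 0.77785. The cruder bound 79/100 is meant for the comparison with
  8/10 on the other side.\<close>

lemma limit_value_typeI:
  assumes "764946 / 1000000 \<le> y" "y \<le> 764956 / 1000000"
  shows "round_decimals 5 (gauss_mass {..<y} / gauss_mass UNIV) = 0.77785"
    and "gauss_mass {..<y} / gauss_mass UNIV < 79 / 100"
proof -
  define s where "s = sqrt (2 * pi)"
  define v where "v = gauss_mass {..<y} / gauss_mass UNIV"
  have s: "25066282 / 10000000 \<le> s" "s \<le> 25066283 / 10000000" using sqrt_2pi_bounds by (simp_all add: s_def)
  have "gauss_poly 8 (764946 / 1000000) \<le> gauss_int (764946 / 1000000)" by (rule gauss_int_bounds) simp_all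
  also have "\<dots> \<le> gauss_int y" using assms by (intro gauss_int_mono) auto
  finally have lo: "6964619 / 10000000 \<le> gauss_int y" using gauss_poly_values(1) by linarith
  have "gauss_int y \<le> gauss_int (764956 / 1000000)" using assms by (intro gauss_int_mono) auto
  also have "\<dots> \<le> gauss_poly 9 (764956 / 1000000)" by (rule gauss_int_bounds) simp_all
  finally have hi: "gauss_int y \<le> 6964696 / 10000000" using gauss_poly_values(2) by linarith
  have "v * s = s / 2 + gauss_int y"
    using s assms by (simp add: v_def gauss_mass_UNIV gauss_mass_lessThan s_def[symmetric])
  then have vs: "(v - 1/2) * s = gauss_int y" by (simp add: algebra_simps)
  have "0.277845 * s \<le> (v - 1/2) * s" unfolding vs using lo s by simp
  then have 1: "0.277845 \<le> v - 1/2" by (rule mult_right_le_imp_le) (use s in linarith)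
  have "(v - 1/2) * s < 0.277855 * s" unfolding vs using hi s by simp
  then have 2: "v - 1/2 < 0.277855" by (rule mult_right_less_imp_less) (use s in linarith)
  have "round_decimals 5 v = real_of_int 77785 / 10 ^ 5"
    by (rule round_decimals_eqI) (use 1 2 in simp_all)
  then show "round_decimals 5 (gauss_mass {..<y} / gauss_mass UNIV) = 0.77785" by (simp add: v_def)
  show "gauss_mass {..<y} / gauss_mass UNIV < 79 / 100" unfolding v_def[symmetric] using 2 by simp
qed

lemma limit_value_DSJ:
  assumes "1306929 / 1000000 \<le> y" "y \<le> 1306931 / 1000000"
  shows "round_decimals 5 (gauss_mass {0<..<y} / gauss_mass {0<..}) = 0.80876"
    and "8 / 10 < gauss_mass {0<..<y} / gauss_mass {0<..}"
proof -
  define s where "s = sqrt (2 * pi)"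
  define v where "v = gauss_mass {0<..<y} / gauss_mass {0<..}"
  have s: "25066282 / 10000000 \<le> s" "s \<le> 25066283 / 10000000" using sqrt_2pi_bounds by (simp_all add: s_def)
  have "gauss_poly 10 (1306929 / 1000000) \<le> gauss_int (1306929 / 1000000)" by (rule gauss_int_bounds) simp_all
  also have "\<dots> \<le> gauss_int y" using assms by (intro gauss_int_mono) auto
  finally have lo: "10136342 / 10000000 \<le> gauss_int y" using gauss_poly_values(3) by linarith
  have "gauss_int y \<le> gauss_int (1306931 / 1000000)" using assms by (intro gauss_int_mono) auto
  also have "\<dots> \<le> gauss_poly 11 (1306931 / 1000000)" by (rule gauss_int_bounds) simp_all
  finally have hi: "gauss_int y \<le> 10136353 / 10000000" using gauss_poly_values(4) by linarith
  have vs: "v * s = 2 * gauss_int y"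
    using s assms by (simp add: v_def gauss_mass_half gauss_mass_interval s_def[symmetric])
  have "0.808755 * s \<le> v * s" unfolding vs using lo s by simp
  then have 1: "0.808755 \<le> v" by (rule mult_right_le_imp_le) (use s in linarith)
  have "v * s < 0.808765 * s" unfolding vs using hi s by simp
  then have 2: "v < 0.808765" by (rule mult_right_less_imp_less) (use s in linarith)
  have "round_decimals 5 v = real_of_int 80876 / 10 ^ 5"
    by (rule round_decimals_eqI) (use 1 2 in simp_all)
  then show "round_decimals 5 (gauss_mass {0<..<y} / gauss_mass {0<..}) = 0.80876" by (simp add: v_def)
  show "8 / 10 < gauss_mass {0<..<y} / gauss_mass {0<..}" unfolding v_def[symmetric] using 1 by simp
qed

section \<open>Densities as quotients of beta integrals\<close>

context homogeneous_cone
begin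

text \<open>The norm of the block is 1-Lipschitz, so the positivity set is relatively open in the
  sphere, with \<open>sqrt z - L2_set x I\<close> as admissible radius at \<open>x\<close>.\<close>

lemma sphere_density_U:
  assumes c: "0 < c"
  shows "sphere_density n (U c) = ratio_mass n (card I) {..<sqrt (z / (1 - z))} / ratio_mass n (card I) UNIV"
proof -
  have n2: "2 \<le> n"
  proof -
    obtain i j where "i \<in> I" "i < n" "j \<notin> I" "j < n" using I IN by auto
    then show ?thesis by (cases "i = j") auto
  qed
  define S where "S = {y \<in> unit_sphere n. (L2_set y I)\<^sup>2 < z}"
  have "positive_set n (U c) \<inter> unit_sphere n = S"
    unfolding positive_set_U[OF c] P_def S_def A_eq[symmetric] B_eq[symmetric]
    by (auto simp: unit_sphere_def)
  moreover have "S \<in> sets borel"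
  proof -
    have "(\<lambda>x :: nat \<Rightarrow> real. L2_set x I) \<in> borel_measurable borel"
      unfolding L2_set_def using borel_measurable_component by measurable
    then have "{y \<in> space borel. y \<in> unit_sphere n \<and> (L2_set y I)\<^sup>2 < z} \<in> sets borel"
      using unit_sphere_borel by measurable
    then show ?thesis by (simp add: S_def)
  qed
  moreover have "\<exists>r>0. \<forall>y\<in>unit_sphere n. vnorm n (\<lambda>i. x i - y i) < r \<longrightarrow> y \<in> S" if x: "x \<in> S" for x
  proof (intro exI conjI ballI impI)
    have "L2_set x I < sqrt z" using x by (auto simp: S_def intro: real_less_rsqrt)
    then show "0 < sqrt z - L2_set x I" by simp
    fix y assume y: "y \<in> unit_sphere n" "vnorm n (\<lambda>i. x i - y i) < sqrt z - L2_set x I"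
    have "L2_set y I = L2_set (\<lambda>i. x i + (y i - x i)) I" by simp
    also have "\<dots> \<le> L2_set x I + L2_set (\<lambda>i. y i - x i) I" by (rule L2_set_triangle_ineq)
    also have "L2_set (\<lambda>i. y i - x i) I \<le> vnorm n (\<lambda>i. y i - x i)"
      unfolding vnorm_def L2_set_def using I by (intro real_sqrt_le_mono sum_mono2) auto
    also have "\<dots> < sqrt z - L2_set x I" using y(2) by (simp add: vnorm_minus_commute[of n y x])
    finally have "L2_set y I < sqrt z" by simp
    then have "(L2_set y I)\<^sup>2 < (sqrt z)\<^sup>2" by (intro power_strict_mono) auto
    then show "y \<in> S" using y z by (simp add: S_def)
  qed
  moreover have "S \<subseteq> unit_sphere n" by (auto simp: S_def)
  ultimately have "sphere_density n (U c) = measure (cone_measure n) S / measure (cone_measure n) (unit_sphere n)"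
    unfolding sphere_density_def using hausdorff_sphere_ratio[OF n2, of S] by simp
  then show ?thesis unfolding S_def using cone_measure_ratio[OF I z] by simp
qed

lemma sphere_density_normalized:
  "sphere_density n (U (THE c. 0 < c \<and> unit_gradient_on_free_boundary n (U c))) =
     ratio_mass n (card I) {..<sqrt (z / (1 - z))} / ratio_mass n (card I) UNIV"
  by (rule sphere_density_U) (rule theI'[OF ex1_unit_gradient, THEN conjunct1])

end

text \<open>What the comparison arguments deliver about the zero: uniqueness evaluates the definite
  description in the cones, positivity to the left of it is demanded by the locale.\<close>

definition profile_zero :: "nat \<Rightarrow> nat \<Rightarrow> real \<Rightarrow> bool" where
  "profile_zero n k z \<longleftrightarrow> 0 < z \<and> z < 1 \<and> hypG n k z = 0 \<and> (\<forall>x. 0 \<le> x \<and> x < z \<longrightarrow> 0 < hypG n k x) \<and>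
     (\<forall>x. 0 < x \<and> x < 1 \<and> hypG n k x = 0 \<longrightarrow> x = z)"

lemma the_profile_zero:
  assumes "profile_zero n k z"
  shows "(THE t. 0 < t \<and> t < 1 \<and> hypG n k (t\<^sup>2) = 0) = sqrt z"
proof (rule the_equality)
  show "0 < sqrt z \<and> sqrt z < 1 \<and> hypG n k ((sqrt z)\<^sup>2) = 0" using assms by (simp add: profile_zero_def)
  fix t assume t: "0 < t \<and> t < 1 \<and> hypG n k (t\<^sup>2) = 0"
  then have "t\<^sup>2 < 1" by (simp add: power_less_one_iff)
  then have "t\<^sup>2 = z" using assms t by (simp add: profile_zero_def)
  then show "t = sqrt z" using t by (metis less_imp_le real_sqrt_unique)
qed

lemma homogeneous_cone_profile:
  assumes "2 \<le> n" "1 \<le> card I" "I \<subset> {..<n}" and z: "profile_zero n (card I) z"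
    and "\<And>c x. x \<in> mspace (Rn n) \<Longrightarrow> U c x =
      (if (L2_set x I)\<^sup>2 < z * (vnorm n x)\<^sup>2 then c * vnorm n x * hypG n (card I) ((L2_set x I)\<^sup>2 / (vnorm n x)\<^sup>2) else 0)"
  shows "homogeneous_cone n I z (hypG n (card I)) (hypG' n (card I)) U"
proof
  show "I \<noteq> {}" using assms(2) by auto
  show "isCont (hypG' n (card I)) z"
    using z by (intro DERIV_isCont[OF DERIV_hypG'[OF assms(1,2)]]) (simp add: profile_zero_def)
  show "(hypG n (card I) has_real_derivative hypG' n (card I) x) (at x)" if "0 \<le> x" "x < 1" for x
    using that by (intro DERIV_hypG[OF assms(1,2)]) simp
  show "hypG' n (card I) z < 0" using z by (intro hypG'_neg[OF assms(1,2)]) (simp_all add: profile_zero_def)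
qed (use assms in \<open>simp_all add: profile_zero_def\<close>)

lemma DSJ_F_eq: "DSJ_F n t = hypG n 1 (t\<^sup>2)"
  by (simp add: DSJ_F_def hyp2f1_def hypG_def hyp_fps_def)

lemma DSJ_density_eq:
  assumes n: "2 \<le> n" and z: "profile_zero n 1 z"
  shows "DSJ_density n = ratio_mass n 1 {..<sqrt (z / (1 - z))} / ratio_mass n 1 UNIV"
proof -
  let ?I = "{n - 1}"
  have z01: "0 < z" using z by (simp add: profile_zero_def)
  have t: "DSJ_zero n = sqrt z" unfolding DSJ_zero_def DSJ_F_eq by (rule the_profile_zero[OF z])
  have sq: "(L2_set x ?I)\<^sup>2 = (x (n - 1))\<^sup>2" for x :: "nat \<Rightarrow> real" by (simp add: L2_set_def)
  interpret homogeneous_cone n ?I z "hypG n (card ?I)" "hypG' n (card ?I)" "DSJ_scaled n"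
  proof (rule homogeneous_cone_profile)
    fix c and x :: "nat \<Rightarrow> real"
    have "\<bar>x (n - 1)\<bar> < sqrt z * vnorm n x \<longleftrightarrow> (x (n - 1))\<^sup>2 < z * (vnorm n x)\<^sup>2"
    proof -
      have "(x (n - 1))\<^sup>2 < z * (vnorm n x)\<^sup>2 \<longleftrightarrow> sqrt ((x (n - 1))\<^sup>2) < sqrt (z * (vnorm n x)\<^sup>2)" by (simp only: real_sqrt_less_iff)
      then show ?thesis by (simp add: real_sqrt_mult)
    qed
    then show "DSJ_scaled n c x = (if (L2_set x ?I)\<^sup>2 < z * (vnorm n x)\<^sup>2 then c * vnorm n x * hypG n (card ?I) ((L2_set x ?I)\<^sup>2 / (vnorm n x)\<^sup>2) else 0)"
      unfolding sq DSJ_scaled_def t DSJ_F_eq by (simp add: power_divide)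
    show "?I \<subset> {..<n}"
    proof (rule psubsetI)
      show "?I \<noteq> {..<n}" using n by (intro notI) (drule arg_cong[of _ _ card], simp)
    qed (use n in simp)
  qed (use n z in simp_all)
  show ?thesis
    using sphere_density_normalized by (simp add: DSJ_density_def DSJ_cone_def DSJ_const_def)
qed

lemma typeI_f_eq: "typeI_f m1 m2 t = hypG (m1 + m2 + 2) (m1 + 1) (t\<^sup>2)"
  by (simp add: typeI_f_def hyp2f1_def hypG_def hyp_fps_def add_ac)

text \<open>Two nonnegative numbers whose squares add up to 1 are sine and cosine of exactly one
  angle in the first quadrant, the arcsine of the first.\<close>

lemma sin_leaf_param:
  assumes "L2_set y {..<m1 + 1} = a" "L2_set y {m1 + 1..<m1 + m2 + 2} = b" "a\<^sup>2 + b\<^sup>2 = 1"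
  shows "sin (leaf_param m1 m2 y) = a"
proof -
  have ab: "0 \<le> a" "0 \<le> b" using assms(1,2) L2_set_nonneg by metis+
  have "a\<^sup>2 \<le> 1" using assms(3) zero_le_power2[of b] by linarith
  then have a1: "a \<le> 1" using ab by (simp add: abs_square_le_1)
  have "b = sqrt (1 - a\<^sup>2)" using assms(3) ab by (metis add_diff_cancel_left' real_sqrt_unique)
  then have cos: "cos (arcsin a) = b" using ab a1 by (simp add: cos_arcsin)
  have "leaf_param m1 m2 y = arcsin a"
    unfolding leaf_param_def assms(1,2)
  proof (rule the_equality)
    show "0 \<le> arcsin a \<and> arcsin a \<le> pi / 2 \<and> a = sin (arcsin a) \<and> b = cos (arcsin a)"
      using ab a1 cos arcsin_bounded[of a] arcsin_le_arcsin[of 0 a] by simp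
    fix s assume "0 \<le> s \<and> s \<le> pi / 2 \<and> a = sin s \<and> b = cos s"
    then show "s = arcsin a" using arcsin_sin[of s] pi_ge_zero by auto
  qed
  then show ?thesis using ab a1 by simp
qed

lemma typeI_density_eq:
  assumes z: "profile_zero (m1 + m2 + 2) (m1 + 1) z"
  shows "typeI_density m1 m2 = ratio_mass (m1 + m2 + 2) (m1 + 1) {..<sqrt (z / (1 - z))} / ratio_mass (m1 + m2 + 2) (m1 + 1) UNIV"
proof -
  let ?I = "{..<m1 + 1}"
  let ?J = "{m1 + 1..<m1 + m2 + 2}"
  define n where "n = m1 + m2 + 2"
  have z01: "0 < z" using z by (simp add: profile_zero_def)
  have t: "typeI_zero m1 m2 = sqrt z" unfolding typeI_zero_def typeI_f_eq by (rule the_profile_zero[OF z])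
  have split: "(vnorm n x)\<^sup>2 = (L2_set x ?I)\<^sup>2 + (L2_set x ?J)\<^sup>2" for x
  proof -
    have "{..<n} = ?I \<union> ?J" by (auto simp: n_def)
    moreover have "(\<Sum>i\<in>?I \<union> ?J. (x i)\<^sup>2) = (\<Sum>i\<in>?I. (x i)\<^sup>2) + (\<Sum>i\<in>?J. (x i)\<^sup>2)"
      by (rule sum.union_disjoint) auto
    ultimately show ?thesis by (simp only: vnorm_sq) (simp add: L2_set_def sum_nonneg)
  qed
  interpret homogeneous_cone n ?I z "hypG n (card ?I)" "hypG' n (card ?I)" "typeI_scaled m1 m2"
  proof (rule homogeneous_cone_profile)
    fix c and x :: "nat \<Rightarrow> real"
    define r where "r = vnorm n x"
    show "typeI_scaled m1 m2 c x = (if (L2_set x ?I)\<^sup>2 < z * (vnorm n x)\<^sup>2 then c * vnorm n x * hypG n (card ?I) ((L2_set x ?I)\<^sup>2 / (vnorm n x)\<^sup>2) else 0)"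
    proof (cases "r = 0")
      \<comment> \<open>At the origin both sides vanish, whatever angle \<open>leaf_param\<close>
        returns.\<close>
      case True
      then show ?thesis by (simp add: typeI_scaled_def Let_def r_def n_def)
    next
      case False
      then have r: "0 < r" by (simp add: r_def less_le)
      have scale: "L2_set (\<lambda>i. x i / r) K = L2_set x K / r" for K
        using L2_set_right_distrib[of "1 / r" x K] r by simp
      have "(L2_set x ?I / r)\<^sup>2 + (L2_set x ?J / r)\<^sup>2 = ((L2_set x ?I)\<^sup>2 + (L2_set x ?J)\<^sup>2) / r\<^sup>2"
        by (simp add: power_divide add_divide_distrib)
      also have "\<dots> = 1" unfolding split[symmetric] r_def[symmetric] using r by simp
      finally have "(L2_set x ?I / r)\<^sup>2 + (L2_set x ?J / r)\<^sup>2 = 1" .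
      then have "sin (leaf_param m1 m2 (\<lambda>i. x i / r)) = L2_set x ?I / r"
        by (intro sin_leaf_param[OF scale scale])
      moreover have "L2_set x ?I / r < sqrt z \<longleftrightarrow> (L2_set x ?I)\<^sup>2 < z * r\<^sup>2"
      proof -
        have "(L2_set x ?I)\<^sup>2 < z * r\<^sup>2 \<longleftrightarrow> sqrt ((L2_set x ?I)\<^sup>2) < sqrt (z * r\<^sup>2)" by (simp only: real_sqrt_less_iff)
        also have "\<dots> \<longleftrightarrow> L2_set x ?I < sqrt z * r" using r by (simp add: real_sqrt_mult)
        finally show ?thesis using r by (simp add: pos_divide_less_eq)
      qed
      ultimately show ?thesis
        unfolding typeI_scaled_def Let_def n_def[symmetric] r_def[symmetric] t typeI_f_eq by (simp add: power_divide)
    qed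
  qed (use z in \<open>auto simp: n_def\<close>)
  show ?thesis
    using sphere_density_normalized by (simp add: typeI_density_def typeI_cone_def typeI_const_def n_def)
qed

section \<open>The two limits\<close>

lemma DSJ_density_tendsto:
  assumes x0: "0 < x0" "x0 < 2" "kummer_neg x0 = 0"
  shows "DSJ_density \<longlonglongrightarrow> gauss_mass {0<..<sqrt (2 * x0)} / gauss_mass {0<..}"
proof -
  obtain z where z: "\<forall>\<^sub>F n in sequentially. profile_zero n 1 (z n)" "(\<lambda>n. real n * z n) \<longlonglongrightarrow> 2 * x0"
    using hypG_one_zero_tendsto[OF x0] unfolding profile_zero_def by (elim exE conjE)
  have "\<forall>\<^sub>F n in sequentially. 0 < z n \<and> z n < 1"
    using z(1) by (rule eventually_mono) (simp add: profile_zero_def)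
  from ratio_mass_one_tendsto[OF this z(2)]
  have lim: "(\<lambda>n. ratio_mass n 1 {..<sqrt (z n / (1 - z n))} / ratio_mass n 1 UNIV) \<longlonglongrightarrow> gauss_mass {0<..<sqrt (2 * x0)} / gauss_mass {0<..}" .
  have "\<forall>\<^sub>F n in sequentially. ratio_mass n 1 {..<sqrt (z n / (1 - z n))} / ratio_mass n 1 UNIV = DSJ_density n"
    using z(1) eventually_ge_at_top[of 2] by eventually_elim (simp add: DSJ_density_eq)
  then show ?thesis by (rule Lim_transform_eventually[OF lim])
qed

text \<open>One \<open>w\<close> serves all admissible \<open>h\<close>: the zero is unique, while
  the location estimate can be invoked for each \<open>h\<close> separately.\<close>

lemma profile_zero_location:
  fixes k l :: nat and y0 :: real
  assumes kl: "300 \<le> k" "300 \<le> l" and y0: "hermite_half y0 = 0" "0 \<le> y0" "y0 \<le> 1"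
  defines "p \<equiv> real k / real (k + l)" and "\<rho> \<equiv> sqrt (2 * (1 / real k + 1 / real l))"
  defines "\<sigma> \<equiv> sqrt (2 * p * (1 - p) / real (k + l))"
  shows "\<exists>z w. profile_zero (k + l) k z \<and> z = p + \<sigma> * w \<and> (\<forall>h. 8 * \<rho> < h \<and> h \<le> 1 \<longrightarrow> \<bar>w - y0\<bar> \<le> h)"
proof -
  have kl1: "1 \<le> k" "1 \<le> l" using kl by auto
  have n2: "2 \<le> k + l" using kl by simp
  note loc = hypG_zero_location[OF kl1 refl y0, folded p_def \<rho>_def, folded \<sigma>_def]
  \<comment> \<open>Blocks of size at least 300 give \<open>\<rho> \<le> 12/100\<close>, so that
    \<open>h = 1\<close> is admissible and the zero exists.\<close>
  have \<rho>: "0 \<le> \<rho>" "8 * \<rho> < 1"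
  proof -
    have "1 / real k \<le> 1 / 300" "1 / real l \<le> 1 / 300" using kl by (simp_all add: field_simps)
    then have "2 * (1 / real k + 1 / real l) \<le> (12/100)\<^sup>2" by (simp add: power_divide)
    then have "\<rho> \<le> 12/100" unfolding \<rho>_def by (intro real_le_lsqrt) auto
    then show "8 * \<rho> < 1" by simp
  qed (simp add: \<rho>_def)
  have p: "0 < p" "p < 1" using kl by (auto simp: p_def)
  have \<sigma>: "0 < \<sigma>" using p kl by (simp add: \<sigma>_def)
  from loc(3)[of 1] obtain z1 where z1: "0 < z1" "z1 \<le> p + \<sigma> * (y0 + 1)" "hypG (k + l) k z1 \<le> 0" using \<rho> by auto
  have z1_less: "z1 < 1" using z1(2) loc(2)[of 1] \<rho> by simp
  obtain z where zz: "0 < z \<and> z \<le> z1 \<and> hypG (k + l) k z = 0 \<and> (\<forall>x. 0 \<le> x \<and> x < z \<longrightarrow> 0 < hypG (k + l) k x) \<and>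
     (\<forall>x. 0 < x \<and> x < 1 \<and> hypG (k + l) k x = 0 \<longrightarrow> x = z)"
    by (rule exE[OF hypG_unique_zero[OF n2 kl1(1) z1(1) z1_less z1(3)]])
  have "z < 1" using zz z1_less by (elim conjE) (rule le_less_trans)
  then have z: "profile_zero (k + l) k z" using zz unfolding profile_zero_def by (intro conjI; elim conjE)
  define w where "w = (z - p) / \<sigma>"
  have zw: "z = p + \<sigma> * w" using \<sigma> by (simp add: w_def)
  have "\<bar>w - y0\<bar> \<le> h" if h: "8 * \<rho> < h" "h \<le> 1" for h
  proof -
    have h0: "0 < h" using h \<rho> by linarith
    from loc(3)[OF h0 h(2) h(1)] obtain z2 where z2: "0 < z2" "z2 \<le> p + \<sigma> * (y0 + h)" "hypG (k + l) k z2 \<le> 0" by auto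
    have "z \<le> z2"
    proof (rule ccontr)
      assume "\<not> z \<le> z2"
      then have "0 < hypG (k + l) k z2" using z z2(1) unfolding profile_zero_def by simp
      with z2(3) show False by simp
    qed
    then have "\<sigma> * w \<le> \<sigma> * (y0 + h)" using z2(2) zw by linarith
    then have up: "w \<le> y0 + h" using \<sigma> by simp
    have "p + \<sigma> * (y0 - h) \<le> z"
      by (rule loc(4)[OF h0 h(2) h(1)]) (use z in \<open>auto simp: profile_zero_def\<close>)
    then have "\<sigma> * (y0 - h) \<le> \<sigma> * w" using zw by linarith
    then have "y0 - h \<le> w" using \<sigma> by simp
    with up show ?thesis by (simp add: abs_le_iff)
  qed
  then show ?thesis using z zw by blast
qed

text \<open>Dominated convergence works along sequences, so the limit along the product filter is
  proved by contradiction: a failure yields a sequence of pairs, both entries tending to infinity,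
  whose densities stay away from the limit.\<close>

lemma typeI_density_tendsto:
  assumes y0: "hermite_half y0 = 0" "0 \<le> y0" "y0 \<le> 1"
  shows "((\<lambda>(m1, m2). typeI_density m1 m2) \<longlongrightarrow> gauss_mass {..<y0} / gauss_mass UNIV) (at_top \<times>\<^sub>F at_top)"
    (is "(?F \<longlongrightarrow> ?L) _")
proof (rule ccontr)
  assume "\<not> (?F \<longlongrightarrow> ?L) (at_top \<times>\<^sub>F at_top)"
  then obtain e where e: "0 < e" "\<not> (\<forall>\<^sub>F x in sequentially \<times>\<^sub>F sequentially. dist (?F x) ?L < e)"
    unfolding tendsto_iff by auto
  \<comment> \<open>Entries of at least \<open>i + 300\<close> tend to infinity with
    \<open>i\<close> and meet the size condition of \<open>profile_zero_location\<close> for every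
    \<open>i\<close>.\<close>
  have "\<exists>a b. i + 300 \<le> a \<and> i + 300 \<le> b \<and> e \<le> dist (typeI_density a b) ?L" for i
  proof -
    have "\<not> (\<forall>m\<ge>i + 300. \<forall>n\<ge>i + 300. dist (typeI_density n m) ?L < e)"
      using e(2) unfolding eventually_prod_sequentially by auto
    then show ?thesis by (auto simp: not_less)
  qed
  then obtain m1 m2 where m: "\<And>i. i + 300 \<le> m1 i" "\<And>i. i + 300 \<le> m2 i" "\<And>i. e \<le> dist (typeI_density (m1 i) (m2 i)) ?L"
    by metis
  define k l where "k i = m1 i + 1" and "l i = m2 i + 1" for i
  have kl: "300 \<le> k i" "300 \<le> l i" "i \<le> k i" "i \<le> l i" for i
    using m(1)[of i] m(2)[of i] by (auto simp: k_def l_def)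
  define p where "p i = real (k i) / real (k i + l i)" for i
  define \<rho> where "\<rho> i = sqrt (2 * (1 / real (k i) + 1 / real (l i)))" for i
  have "\<exists>z w. profile_zero (k i + l i) (k i) z \<and> z = p i + sqrt (2 * p i * (1 - p i) / real (k i + l i)) * w \<and>
      (\<forall>h. 8 * \<rho> i < h \<and> h \<le> 1 \<longrightarrow> \<bar>w - y0\<bar> \<le> h)" for i
    unfolding p_def \<rho>_def by (rule profile_zero_location[OF kl(1,2) y0])
  then obtain z w where z: "\<And>i. profile_zero (k i + l i) (k i) (z i)"
    and zw: "\<And>i. z i = p i + sqrt (2 * p i * (1 - p i) / real (k i + l i)) * w i"
    and w: "\<And>i h. 8 * \<rho> i < h \<Longrightarrow> h \<le> 1 \<Longrightarrow> \<bar>w i - y0\<bar> \<le> h" by metis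
  have lim: "filterlim k at_top sequentially" "filterlim l at_top sequentially"
    using kl(3,4) by (auto intro!: filterlim_at_top_mono[OF filterlim_ident])
  have inv0: "(\<lambda>i. 1 / real (f i)) \<longlonglongrightarrow> 0" if "filterlim f at_top sequentially" for f :: "nat \<Rightarrow> nat"
    by (rule tendsto_divide_0[OF tendsto_const])
       (rule filterlim_at_top_imp_at_infinity, rule filterlim_compose[OF filterlim_real_sequentially that])
  have "(\<lambda>i. 8 * \<rho> i) \<longlonglongrightarrow> 8 * sqrt (2 * (0 + 0))"
    unfolding \<rho>_def by (intro tendsto_intros inv0 lim)
  then have \<rho>_lim: "(\<lambda>i. 8 * \<rho> i) \<longlonglongrightarrow> 0" by simp
  have w_lim: "w \<longlonglongrightarrow> y0"
    unfolding tendsto_iff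
  proof (intro allI impI)
    fix d :: real assume d: "0 < d"
    define h where "h = min 1 (d / 2)"
    have h: "0 < h" "h \<le> 1" "h < d" using d by (auto simp: h_def min_def)
    from \<rho>_lim h(1) have "\<forall>\<^sub>F i in sequentially. 8 * \<rho> i < h" by (rule order_tendstoD)
    then show "\<forall>\<^sub>F i in sequentially. dist (w i) y0 < d"
    proof eventually_elim
      case (elim i)
      then show ?case using w[OF elim h(2)] h(3) by (simp add: dist_real_def)
    qed
  qed
  have "(\<lambda>i. ratio_mass (k i + l i) (k i) {..<sqrt (z i / (1 - z i))} / ratio_mass (k i + l i) (k i) UNIV) \<longlonglongrightarrow> ?L"
  proof (rule ratio_mass_tendsto[OF _ _ lim _ _ w_lim])
    show "4 \<le> k i" "4 \<le> l i" for i using kl[of i] by auto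
    show "0 < z i" "z i < 1" for i using z[of i] by (auto simp: profile_zero_def)
    show "z i = real (k i) / real (k i + l i) + sqrt (2 * (real (k i) / real (k i + l i)) * (1 - real (k i) / real (k i + l i)) / real (k i + l i)) * w i" for i
      using zw[of i] unfolding p_def .
  qed
  moreover have "ratio_mass (k i + l i) (k i) {..<sqrt (z i / (1 - z i))} / ratio_mass (k i + l i) (k i) UNIV = typeI_density (m1 i) (m2 i)" for i
  proof -
    have n: "k i + l i = m1 i + m2 i + 2" by (simp add: k_def l_def)
    show ?thesis using typeI_density_eq[of "m1 i" "m2 i" "z i"] z[of i] unfolding n unfolding k_def by simp
  qed
  ultimately have "(\<lambda>i. typeI_density (m1 i) (m2 i)) \<longlonglongrightarrow> ?L" by simp
  then have "\<forall>\<^sub>F i in sequentially. dist (typeI_density (m1 i) (m2 i)) ?L < e"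
    using e(1) by (rule tendstoD)
  then obtain i where "dist (typeI_density (m1 i) (m2 i)) ?L < e" by (auto simp: eventually_sequentially)
  with m(3)[of i] show False by simp
qed

lemma hermite_half_root:
  obtains y0 where "764946 / 1000000 \<le> y0" "y0 \<le> 764956 / 1000000" "hermite_half y0 = 0"
proof -
  have "\<exists>y\<ge>764946 / 1000000. y \<le> 764956 / 1000000 \<and> hermite_half y = 0"
    by (rule IVT2) (use hermite_half_signs DERIV_isCont[OF DERIV_hermite_half] in auto)
  then show ?thesis using that by blast
qed

theorem proposition1p3:
  shows "\<exists>L\<^sub>2 L\<^sub>1 :: real.
           ((\<lambda>(m1, m2). typeI_density m1 m2) \<longlongrightarrow> L\<^sub>2) (at_top \<times>\<^sub>F at_top) \<and>
           DSJ_density \<longlonglongrightarrow> L\<^sub>1 \<and>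
           round_decimals 5 L\<^sub>2 = 0.77785 \<and>
           round_decimals 5 L\<^sub>1 = 0.80876 \<and>
           L\<^sub>2 < L\<^sub>1"
proof -
  obtain y0 where y0: "764946 / 1000000 \<le> y0" "y0 \<le> 764956 / 1000000" "hermite_half y0 = 0"
    by (rule hermite_half_root)
  obtain x0 where x0: "854032 / 1000000 < x0" "x0 < 854033 / 1000000" "kummer_neg x0 = 0"
    by (rule kummer_root)
  \<comment> \<open>The cut-off of the Gaussian is the square root of the limit
    \<open>2 * x0\<close> of \<open>n * z n\<close>; its bracket must fit the window for which the
    Gaussian integral has been evaluated.\<close>
  have Y: "1306929 / 1000000 \<le> sqrt (2 * x0)" "sqrt (2 * x0) \<le> 1306931 / 1000000"
  proof -
    have "(1306929 / 1000000)\<^sup>2 \<le> (2 * (854032 / 1000000) :: real)" by (simp add: power_divide)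
    also have "\<dots> \<le> 2 * x0" using x0 by simp
    finally show "1306929 / 1000000 \<le> sqrt (2 * x0)" by (rule real_le_rsqrt)
    have "2 * x0 \<le> 2 * (854033 / 1000000)" using x0 by simp
    also have "\<dots> \<le> (1306931 / 1000000)\<^sup>2" by (simp add: power_divide)
    finally show "sqrt (2 * x0) \<le> 1306931 / 1000000" using x0 by (intro real_le_lsqrt) auto
  qed
  let ?L2 = "gauss_mass {..<y0} / gauss_mass UNIV"
  let ?L1 = "gauss_mass {0<..<sqrt (2 * x0)} / gauss_mass {0<..}"
  have "((\<lambda>(m1, m2). typeI_density m1 m2) \<longlongrightarrow> ?L2) (at_top \<times>\<^sub>F at_top)"
    using y0 by (intro typeI_density_tendsto) auto
  moreover have "DSJ_density \<longlonglongrightarrow> ?L1"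
    using x0 by (intro DSJ_density_tendsto) auto
  moreover have "?L2 < ?L1" using limit_value_typeI(2)[OF y0(1,2)] limit_value_DSJ(2)[OF Y] by linarith
  ultimately show ?thesis using limit_value_typeI(1)[OF y0(1,2)] limit_value_DSJ(1)[OF Y] by blast
qed

end
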